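(* Let $T>0$, $\nu>0$, let $s\ge 2$ and $q>s$ be integers, and let $f:\mathbb{R}\to\mathbb{R}$, $u_0$, $u$ be the flux, initial datum and exact solution of the advection–diffusion problem described in the context. Suppose that the interpolation operators $\mathcal{I}_h$ satisfy the properties (P1), (P2), (P3) listed in the context for $s$ and $q$. Let $C_{\Delta 2}>0$ and $\varepsilon>0$ be constants. Then there exist $(h_0,\Delta t_0)\in(0,1)^2$ and $C_e>0$, with $C_e$ depending on $\|u\|_{W^{1,\infty}(0,T;H^{s+2}(\mathbb{T}))}$, $\|u\|_{L^\infty(0,T;H^{s+4}(\mathbb{T}))}$ and $\|u\|_{L^\infty(0,T;H^{q}(\mathbb{T}))}$ (and $h_0,\Delta t_0,C_e$ independent of $h$, $\Delta t$ and $n$), such that, whenever $(h,\Delta t)\in(0,h_0)\times(0,\Delta t_0)$ satisfies $$\frac{h^{2s}}{\Delta t}\le C_{\Delta 2}\quad\text{and}\quad \frac{h^{2(q-s)}}{\Delta t^{1+\varepsilon}}\le C_{\Delta 2},$$ the numerical solution $(u_h^n)_{n=0}^{N_t}$ of the fully semi-Lagrangian scheme is well-defined and $$\|u^n-u_h^n\|_{s,2,\ast}\le C_e\left(\Delta t+\frac{h^{q-s}}{\Delta t^{1/2}}+\frac{h^q}{\Delta t}\right)\qquad\text{for all } n\in\{0,\ldots,N_t\},$$ where $u^n=u(\cdot,t_n)$.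
   Context: $\mathbb{T}=\mathbb{R}/\mathbb{Z}$. Norms: $|v|_{s,2}=\|\partial_x^s v\|_{L^2(\mathbb{T})}$, $\|v\|_{0,2}=\|v\|_{L^2(\mathbb{T})}$, and $\|v\|_{s,2,\ast}=(\|v\|_{0,2}^2+|v|_{s,2}^2)^{1/2}$. Problem: $f:\mathbb{R}\to\mathbb{R}$ satisfies $c_f\le |f'|\le C_f$ for some positive constants $c_f,C_f$. The problem is $\partial_t u+f(u)\,\partial_x u-\nu\,\partial_x^2 u=0$ in $\mathbb{T}\times[0,T]$, $u(0)=u_0$ in $\mathbb{T}$. The functions $f$ and $u_0$ are assumed sufficiently smooth so that the problem has a unique, sufficiently smooth solution $u$; concretely, $f\in C^{s+1}(\mathbb{R})$ and $u\in W^{2,\infty}(0,T;H^s(\mathbb{T}))\cap W^{1,\infty}(0,T;H^{s+2}(\mathbb{T}))\cap L^\infty(0,T;H^{s+4}(\mathbb{T}))\cap L^\infty(0,T;H^q(\mathbb{T}))$. Discretization: $N_t,N_x\in\mathbb{N}$, $\Delta t=T/N_t$, $t_n=n\Delta t$; $0=x_0<x_1<\cdots<x_{N_x}=1$ is a grid on $\mathbb{T}$ with mesh size $h=\max_m|x_m-x_{m-1}|$. Interpolation: for each grid, $\mathcal{I}_h:H^s(\mathbb{T})\to H^s(\mathbb{T})$ is an interpolation operator, i.e. a linear operator with $\mathcal{I}_h\mathcal{I}_h=\mathcal{I}_h$ and $(\mathcal{I}_h v)(x_m)=v(x_m)$ for all $m$. With $I$ the identity operator, the properties are (with constants $C_s,C_q$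 independent of the grid): (P1) $|(I-\mathcal{I}_h)v-\mathcal{I}_h w|_{s,2}^2=|(I-\mathcal{I}_h)v|_{s,2}^2+|\mathcal{I}_h w|_{s,2}^2$ for all $v,w\in H^s(\mathbb{T})$; (P2) there is $C_s>0$ with $\|(I-\mathcal{I}_h)v\|_{0,2}\le C_s h^s|v|_{s,2}$ for all $v\in H^s(\mathbb{T})$; (P3) for the integer $q>s$ there is $C_q>0$ with $|(I-\mathcal{I}_h)v|_{s,2}\le C_q h^{q-s}|v|_{q,2}$ for all $v\in H^q(\mathbb{T})$. Scheme: for $a:\mathbb{T}\to\mathbb{R}$ let $X^1_{\Delta t}[a]:\mathbb{T}\to\mathbb{T}$, $X^1_{\Delta t}[a](x)=x-a(x)\Delta t$. Let $\delta=(\nu\Delta t)^{1/2}$ and $\mathcal{S}^{\mathrm{V}}_{\Delta t}(v)(x)=\tfrac12\big(v(x-\sqrt2\,\delta)+v(x+\sqrt2\,\delta)\big)$. For $v\in H^s(\mathbb{T})$, $\mathcal{S}^{\mathrm{A}}_{\Delta t}(v)$ denotes the unique $w\in H^s(\mathbb{T})$ with $w=v\circ X^1_{\Delta t}[f\circ w]$ (it exists uniquely when $\Delta t$ is sufficiently small relative to $v$ and $f$). The numerical solution is $u_h^0=\mathcal{I}_h u_0$ and $u_h^n=\mathcal{I}_h\big[\mathcal{S}^{\mathrm{A}}_{\Delta t}(\mathcal{S}^{\mathrm{V}}_{\Delta t}u_h^{n-1})\big]$ for $n=1,\ldots,N_t$. *)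

theory Defs
  imports "HOL-Probability.Essential_Supremum" "HOL-Library.Periodic_Fun"
begin

section \<open>Differentiability classes on the real line\<close>

definition Ck :: "nat \<Rightarrow> (real \<Rightarrow> real) \<Rightarrow> bool" where
  "Ck k g \<longleftrightarrow> (\<forall>j<k. (deriv ^^ j) g differentiable_on UNIV) \<and> continuous_on UNIV ((deriv ^^ k) g)"

definition smooth :: "(real \<Rightarrow> real) \<Rightarrow> bool" where
  "smooth g \<longleftrightarrow> (\<forall>k. Ck k g)"


section \<open>Sobolev spaces on the torus\<close>

text \<open>Functions on the torus are rendered as functions on the real line of period 1
  (the library predicate \<^const>\<open>periodic_fun_simple'\<close>); integrals over the torus are integrals
  over a fundamental domain.\<close>

abbreviation torus :: "real measure" where
  "torus \<equiv> lebesgue_on {0..<1}"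

definition L2 :: "(real \<Rightarrow> real) set" where
  "L2 = {v. periodic_fun_simple' v \<and> v \<in> borel_measurable torus \<and> integrable torus (\<lambda>x. (v x)\<^sup>2)}"

definition L2norm :: "(real \<Rightarrow> real) \<Rightarrow> real" where
  "L2norm v = sqrt (\<integral>x. (v x)\<^sup>2 \<partial>torus)"

definition has_weak_deriv :: "nat \<Rightarrow> (real \<Rightarrow> real) \<Rightarrow> (real \<Rightarrow> real) \<Rightarrow> bool" where
  "has_weak_deriv k v g \<longleftrightarrow> g \<in> L2 \<and>
     (\<forall>\<phi>. periodic_fun_simple' \<phi> \<and> smooth \<phi> \<longrightarrow>
        (\<integral>x. v x * (deriv ^^ k) \<phi> x \<partial>torus) = (-1) ^ k * (\<integral>x. g x * \<phi> x \<partial>torus))"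

text \<open>Weak derivatives are determined up to null sets, so the seminorm does not depend on the
  choice.\<close>

definition weak_deriv :: "nat \<Rightarrow> (real \<Rightarrow> real) \<Rightarrow> real \<Rightarrow> real" where
  "weak_deriv k v = (SOME g. has_weak_deriv k v g)"

text \<open>For positive order, an element of the Sobolev space is represented by its continuous
  representative, so that point values are meaningful and equality of elements is equality of
  functions.\<close>

definition Hsob :: "nat \<Rightarrow> (real \<Rightarrow> real) set" where
  "Hsob s = {v \<in> L2. (s > 0 \<longrightarrow> continuous_on UNIV v) \<and> (\<forall>k\<le>s. \<exists>g. has_weak_deriv k v g)}"

definition Hsemi :: "nat \<Rightarrow> (real \<Rightarrow> real) \<Rightarrow> real" where
  "Hsemi s v = L2norm (weak_deriv s v)"

definition Hnorm :: "nat \<Rightarrow> (real \<Rightarrow> real) \<Rightarrow> real" where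
  "Hnorm s v = sqrt (\<Sum>k\<le>s. (Hsemi k v)\<^sup>2)"

definition Hnorm_star :: "nat \<Rightarrow> (real \<Rightarrow> real) \<Rightarrow> real" where
  "Hnorm_star s v = sqrt ((L2norm v)\<^sup>2 + (Hsemi s v)\<^sup>2)"


section \<open>Bochner spaces on a time interval\<close>

text \<open>A space-time function is written \<open>u t x\<close>, time first.\<close>

definition strongly_measurable :: "real \<Rightarrow> nat \<Rightarrow> (real \<Rightarrow> real \<Rightarrow> real) \<Rightarrow> bool" where
  "strongly_measurable T m u \<longleftrightarrow>
     (\<exists>S :: nat \<Rightarrow> real \<Rightarrow> real \<Rightarrow> real.
        (\<forall>n. simple_function (lebesgue_on {0<..<T}) (S n) \<and> (\<forall>t\<in>{0<..<T}. S n t \<in> Hsob m)) \<and>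
        (AE t in lebesgue_on {0<..<T}. (\<lambda>n. Hnorm m (\<lambda>x. S n t x - u t x)) \<longlonglongrightarrow> 0))"

definition Linf_esssup :: "real \<Rightarrow> nat \<Rightarrow> (real \<Rightarrow> real \<Rightarrow> real) \<Rightarrow> ereal" where
  "Linf_esssup T m u = esssup (lebesgue_on {0<..<T}) (\<lambda>t. ereal (Hnorm m (u t)))"

definition Linf :: "real \<Rightarrow> nat \<Rightarrow> (real \<Rightarrow> real \<Rightarrow> real) set" where
  "Linf T m = {u. strongly_measurable T m u \<and> (AE t in lebesgue_on {0<..<T}. u t \<in> Hsob m) \<and>
                  Linf_esssup T m u < \<infinity>}"

definition Linf_norm :: "real \<Rightarrow> nat \<Rightarrow> (real \<Rightarrow> real \<Rightarrow> real) \<Rightarrow> real" where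
  "Linf_norm T m u = real_of_ereal (Linf_esssup T m u)"

text \<open>The defining identity of the weak time derivative is an equality of Bochner integrals with
  values in the Sobolev space of order \<open>m\<close>. It is written at each point \<open>x\<close>: for \<open>m > 0\<close>, the only
  case used, point evaluations are continuous linear functionals, hence commute with the Bochner
  integral, and they separate points.\<close>

definition has_weak_time_deriv ::
    "real \<Rightarrow> nat \<Rightarrow> nat \<Rightarrow> (real \<Rightarrow> real \<Rightarrow> real) \<Rightarrow> (real \<Rightarrow> real \<Rightarrow> real) \<Rightarrow> bool" where
  "has_weak_time_deriv T m j u g \<longleftrightarrow> g \<in> Linf T m \<and>
     (\<forall>\<phi>. smooth \<phi> \<and> closure {t. \<phi> t \<noteq> 0} \<subseteq> {0<..<T} \<longrightarrow>
        (\<forall>x. (\<integral>t. (deriv ^^ j) \<phi> t * u t x \<partial>lebesgue_on {0<..<T})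
               = (-1) ^ j * (\<integral>t. \<phi> t * g t x \<partial>lebesgue_on {0<..<T})))"

definition weak_time_deriv ::
    "real \<Rightarrow> nat \<Rightarrow> nat \<Rightarrow> (real \<Rightarrow> real \<Rightarrow> real) \<Rightarrow> real \<Rightarrow> real \<Rightarrow> real" where
  "weak_time_deriv T m j u = (SOME g. has_weak_time_deriv T m j u g)"

text \<open>The space of functions whose weak time derivatives up to order \<open>k\<close> are essentially bounded
  with values in the Sobolev space of order \<open>m\<close>.\<close>

definition Winf :: "nat \<Rightarrow> real \<Rightarrow> nat \<Rightarrow> (real \<Rightarrow> real \<Rightarrow> real) set" where
  "Winf k T m = {u \<in> Linf T m. \<forall>j\<le>k. \<exists>g. has_weak_time_deriv T m j u g}"

definition Winf_norm :: "nat \<Rightarrow> real \<Rightarrow> nat \<Rightarrow> (real \<Rightarrow> real \<Rightarrow> real) \<Rightarrow> real" where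
  "Winf_norm k T m u = (MAX j\<in>{..k}. Linf_norm T m (weak_time_deriv T m j u))"


section \<open>The advection-diffusion problem\<close>

definition solves_problem ::
    "(real \<Rightarrow> real) \<Rightarrow> real \<Rightarrow> real \<Rightarrow> (real \<Rightarrow> real) \<Rightarrow> (real \<Rightarrow> real \<Rightarrow> real) \<Rightarrow> bool" where
  "solves_problem f \<nu> T u0 u \<longleftrightarrow>
     u 0 = u0 \<and>
     (\<forall>t\<in>{0..T}. periodic_fun_simple' (u t) \<and>
        (\<forall>x. u t differentiable (at x) \<and> deriv (u t) differentiable (at x) \<and>
           (\<exists>ut. ((\<lambda>r. u r x) has_real_derivative ut) (at t within {0..T}) \<and>
                 ut + f (u t x) * deriv (u t) x - \<nu> * deriv (deriv (u t)) x = 0)))"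

definition smooth_solution ::
    "nat \<Rightarrow> nat \<Rightarrow> (real \<Rightarrow> real) \<Rightarrow> real \<Rightarrow> real \<Rightarrow> (real \<Rightarrow> real) \<Rightarrow> (real \<Rightarrow> real \<Rightarrow> real) \<Rightarrow> bool" where
  "smooth_solution s q f \<nu> T u0 u \<longleftrightarrow>
     solves_problem f \<nu> T u0 u \<and>
     u \<in> Winf 2 T s \<inter> Winf 1 T (s + 2) \<inter> Linf T (s + 4) \<inter> Linf T q"

definition unique_smooth_solution ::
    "nat \<Rightarrow> nat \<Rightarrow> (real \<Rightarrow> real) \<Rightarrow> real \<Rightarrow> real \<Rightarrow> (real \<Rightarrow> real) \<Rightarrow> (real \<Rightarrow> real \<Rightarrow> real) \<Rightarrow> bool" where
  "unique_smooth_solution s q f \<nu> T u0 u \<longleftrightarrow>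
     smooth_solution s q f \<nu> T u0 u \<and>
     (\<forall>v. smooth_solution s q f \<nu> T u0 v \<longrightarrow> (\<forall>t\<in>{0..T}. v t = u t))"


section \<open>Grids and interpolation operators\<close>

text \<open>The grid with nodes \<open>x\<^sub>0 < \<dots> < x\<^sub>N\<close> is the list of its nodes, of length \<open>N + 1\<close>.\<close>

definition is_grid :: "real list \<Rightarrow> bool" where
  "is_grid xs \<longleftrightarrow> length xs \<ge> 2 \<and> sorted_wrt (<) xs \<and> hd xs = 0 \<and> last xs = 1"

definition mesh :: "real list \<Rightarrow> real" where
  "mesh xs = (MAX m\<in>{1..<length xs}. \<bar>xs ! m - xs ! (m - 1)\<bar>)"

definition interpolation_operator ::
    "nat \<Rightarrow> real list \<Rightarrow> ((real \<Rightarrow> real) \<Rightarrow> real \<Rightarrow> real) \<Rightarrow> bool" where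
  "interpolation_operator s xs I \<longleftrightarrow>
     (\<forall>v\<in>Hsob s. I v \<in> Hsob s \<and> I (I v) = I v \<and> (\<forall>m<length xs. I v (xs ! m) = v (xs ! m))) \<and>
     (\<forall>v\<in>Hsob s. \<forall>w\<in>Hsob s. I (\<lambda>x. v x + w x) = (\<lambda>x. I v x + I w x)) \<and>
     (\<forall>a. \<forall>v\<in>Hsob s. I (\<lambda>x. a * v x) = (\<lambda>x. a * I v x))"

definition P1 :: "nat \<Rightarrow> ((real \<Rightarrow> real) \<Rightarrow> real \<Rightarrow> real) \<Rightarrow> bool" where
  "P1 s I \<longleftrightarrow> (\<forall>v\<in>Hsob s. \<forall>w\<in>Hsob s.
     (Hsemi s (\<lambda>x. (v x - I v x) - I w x))\<^sup>2
       = (Hsemi s (\<lambda>x. v x - I v x))\<^sup>2 + (Hsemi s (I w))\<^sup>2)"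

definition P2 :: "nat \<Rightarrow> real \<Rightarrow> real \<Rightarrow> ((real \<Rightarrow> real) \<Rightarrow> real \<Rightarrow> real) \<Rightarrow> bool" where
  "P2 s Cs h I \<longleftrightarrow> (\<forall>v\<in>Hsob s. L2norm (\<lambda>x. v x - I v x) \<le> Cs * h ^ s * Hsemi s v)"

definition P3 :: "nat \<Rightarrow> nat \<Rightarrow> real \<Rightarrow> real \<Rightarrow> ((real \<Rightarrow> real) \<Rightarrow> real \<Rightarrow> real) \<Rightarrow> bool" where
  "P3 s q Cq h I \<longleftrightarrow> (\<forall>v\<in>Hsob q. Hsemi s (\<lambda>x. v x - I v x) \<le> Cq * h ^ (q - s) * Hsemi q v)"


section \<open>The fully semi-Lagrangian scheme\<close>

definition X1 :: "real \<Rightarrow> (real \<Rightarrow> real) \<Rightarrow> real \<Rightarrow> real" where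
  "X1 dt a x = x - a x * dt"

definition SV :: "real \<Rightarrow> real \<Rightarrow> (real \<Rightarrow> real) \<Rightarrow> real \<Rightarrow> real" where
  "SV \<nu> dt v x = (let \<delta> = sqrt (\<nu> * dt) in (v (x - sqrt 2 * \<delta>) + v (x + sqrt 2 * \<delta>)) / 2)"

definition is_SA :: "nat \<Rightarrow> (real \<Rightarrow> real) \<Rightarrow> real \<Rightarrow> (real \<Rightarrow> real) \<Rightarrow> (real \<Rightarrow> real) \<Rightarrow> bool" where
  "is_SA s f dt v w \<longleftrightarrow> w \<in> Hsob s \<and> w = v \<circ> X1 dt (f \<circ> w)"

definition SA :: "nat \<Rightarrow> (real \<Rightarrow> real) \<Rightarrow> real \<Rightarrow> (real \<Rightarrow> real) \<Rightarrow> real \<Rightarrow> real" where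
  "SA s f dt v = (THE w. is_SA s f dt v w)"

text \<open>The value at \<open>n\<close> is meaningful only if the scheme is well-defined up to step \<open>n\<close> in the sense
  of \<open>scheme_well_defined\<close> below.\<close>

primrec num_sol ::
    "nat \<Rightarrow> (real \<Rightarrow> real) \<Rightarrow> real \<Rightarrow> real \<Rightarrow> ((real \<Rightarrow> real) \<Rightarrow> real \<Rightarrow> real) \<Rightarrow> (real \<Rightarrow> real)
       \<Rightarrow> nat \<Rightarrow> real \<Rightarrow> real" where
  "num_sol s f \<nu> dt I u0 0 = I u0"
| "num_sol s f \<nu> dt I u0 (Suc n) = I (SA s f dt (SV \<nu> dt (num_sol s f \<nu> dt I u0 n)))"

definition scheme_well_defined ::
    "nat \<Rightarrow> (real \<Rightarrow> real) \<Rightarrow> real \<Rightarrow> real \<Rightarrow> ((real \<Rightarrow> real) \<Rightarrow> real \<Rightarrow> real) \<Rightarrow> (real \<Rightarrow> real)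
       \<Rightarrow> nat \<Rightarrow> bool" where
  "scheme_well_defined s f \<nu> dt I u0 Nt \<longleftrightarrow>
     (\<forall>n<Nt. \<exists>!w. is_SA s f dt (SV \<nu> dt (num_sol s f \<nu> dt I u0 n)) w)"

end

theory Submission
  imports Defs "HOL-Probability.Probability_Measure" "HOL-Computational_Algebra.Polynomial"
begin

text \<open>
  Let \<open>U n\<close> be the exact solution at time \<open>n dt\<close>, let \<open>u_h n\<close> be the numerical one, and let
  \<open>e n = I (U n) - u_h n\<close>. The proof is a discrete Gronwall argument for the energy
  \<open>|e|\<^sub>0\<^sup>2 + \<mu> |e|\<^sub>s\<^sup>2\<close> of \<open>e n\<close>, which requires that one step, started from the
  discrete error, multiplies the energy by at most \<open>1 + O(dt)\<close> up to a small inhomogeneity. Everything rests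
  on keeping the leading constant equal to one in each of the three parts of a step.

  Interpolation (\<open>energy_interpolation\<close>). By (P1) the seminorm satisfies
  \<open>|I z|\<^sub>s\<^sup>2 = |z|\<^sub>s\<^sup>2 - |z - I z|\<^sub>s\<^sup>2\<close>, and (P2) applied to \<open>z - I z\<close>, whose interpolant vanishes,
  bounds the \<open>L\<^sup>2\<close> norm of \<open>z - I z\<close> by a multiple of \<open>h^s |z - I z|\<^sub>s\<close>. The \<open>L\<^sup>2\<close> norm may therefore grow, but
  Young's inequality with weight \<open>dt\<close> turns the growth into \<open>(h^(2s) / dt) |z - I z|\<^sub>s\<^sup>2\<close>, which the gain in
  the seminorm pays for once \<open>\<mu>\<close> is large compared with \<open>h^(2s) / dt\<close>, a quantity that the first mesh
  condition bounds. The splitting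
  \<open>U n - u_h n = (U n - I (U n)) + e n\<close> is orthogonal for the same reason, so that the interpolation error of
  the exact solution enters as \<open>h^(2(q-s)) + h^(2q) / dt\<close> per step; \<open>T / dt\<close> steps give the rate.

  Transport and averaging (\<open>scheme_step\<close>). Composition with \<open>x \<mapsto> x - a(x) dt\<close> changes an \<open>L\<^sup>2\<close>
  norm by a factor \<open>1 + O(dt)\<close> (change of variables) and commutes with derivatives up to \<open>O(dt)\<close>, and
  averaging two translates does not increase any seminorm. The implicit advection \<open>w = b(x - f(w) dt)\<close> is solved
  explicitly: \<open>w = b \<circ> X\<close> with \<open>X\<close> the inverse of \<open>y \<mapsto> y + f(b(y)) dt\<close> (\<open>SA_wellposed\<close>). The
  two velocities \<open>f(u)\<close> and \<open>f(w)\<close> differ by no more than a multiple of the error, and this difference is made to act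
  on the averaged exact solution, which has derivatives to spare. Consistency is \<open>O(dt\<^sup>2)\<close> by Taylor
  expansion (\<open>truncation_error\<close>).

  These constants depend on a bound for \<open>u_h n\<close>. It is propagated together with the error estimate: the
  second mesh condition makes the right-hand side of that estimate tend to zero with \<open>dt\<close>
  (\<open>error_small\<close>), hence the numerical solution stays within distance one of the exact solution.

  The nonlinear estimates are proved for periodic \<open>C\<^sup>k\<close> functions, by induction on the number of
  derivatives, and are carried over to Sobolev spaces by two facts: mollification does not increase
  seminorms (\<open>mollify_Hsemi\<close>), and seminorm bounds survive pointwise limits, as weak derivatives have weak
  limits in \<open>L\<^sup>2\<close> (\<open>Hsob_lsc\<close>). The second fact also replaces integration of functions with values in a Sobolev
  space: a Riemann sum, or the integral of a simple function, is a finite linear combination. In this way the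
  regularity in time is reduced to bounds and Lipschitz estimates valid at every time
  (\<open>smooth_solution_regular\<close>).
\<close>

section \<open>Square integrable functions on the torus\<close>

lemma torus_prob: "prob_space torus"
proof
  have "emeasure torus (space torus) = emeasure lebesgue {0..<1::real}"
    by (subst emeasure_restrict_space) auto
  then show "emeasure torus (space torus) = 1" by simp
qed

interpretation torus: prob_space torus by (rule torus_prob)

lemma measure_torus [simp]: "measure torus {0..<1} = 1"
  using torus.prob_space by simp

lemma L2I:
  assumes "\<And>x. v (x + 1) = v x" "v \<in> borel_measurable torus" "integrable torus (\<lambda>x. (v x)\<^sup>2)"
  shows "v \<in> L2"
  using assms by (simp add: L2_def periodic_fun_simple'_def)

lemma L2D:
  assumes "v \<in> L2"
  shows "v (x + 1) = v x" "v \<in> borel_measurable torus" "integrable torus (\<lambda>x. (v x)\<^sup>2)"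
  using assms by (auto simp add: L2_def periodic_fun_simple'_def)

lemma L2_integrable_mult:
  assumes "v \<in> L2" "w \<in> L2"
  shows "integrable torus (\<lambda>x. v x * w x)"
proof (rule Bochner_Integration.integrable_bound)
  show "integrable torus (\<lambda>x. (v x)\<^sup>2 + (w x)\<^sup>2)"
    using L2D(3)[OF assms(1)] L2D(3)[OF assms(2)] by simp
  show "(\<lambda>x. v x * w x) \<in> borel_measurable torus"
    using L2D(2)[OF assms(1)] L2D(2)[OF assms(2)] by simp
  have "\<bar>a * b\<bar> \<le> a\<^sup>2 + b\<^sup>2" for a b :: real
  proof -
    have "0 \<le> (\<bar>a\<bar> - \<bar>b\<bar>)\<^sup>2" by simp
    also have "\<dots> = a\<^sup>2 + b\<^sup>2 - 2 * \<bar>a * b\<bar>" by (simp add: power2_diff abs_mult)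
    finally show ?thesis using abs_ge_zero[of "a*b"] by linarith
  qed
  then show "AE x in torus. norm (v x * w x) \<le> norm ((v x)\<^sup>2 + (w x)\<^sup>2)"
    by (intro AE_I2) (smt (verit, best) real_norm_def)
qed

lemma L2_const [simp]: "(\<lambda>x. c) \<in> L2"
  by (intro L2I) auto

lemma L2_integrable: "v \<in> L2 \<Longrightarrow> integrable torus v"
  using L2_integrable_mult[of v "\<lambda>x. 1"] by simp

lemma L2_add [intro]:
  assumes "v \<in> L2" "w \<in> L2"
  shows "(\<lambda>x. v x + w x) \<in> L2"
proof (rule L2I)
  have "integrable torus (\<lambda>x. (v x)\<^sup>2 + (w x)\<^sup>2 + 2 * (v x * w x))"
    using L2D(3)[OF assms(1)] L2D(3)[OF assms(2)] L2_integrable_mult[OF assms] by simp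
  then show "integrable torus (\<lambda>x. (v x + w x)\<^sup>2)" by (simp add: power2_sum mult.assoc)
qed (use L2D[OF assms(1)] L2D[OF assms(2)] in auto)

lemma L2_cmult [intro]:
  assumes "v \<in> L2" shows "(\<lambda>x. c * v x) \<in> L2"
  by (rule L2I) (use L2D[OF assms] in \<open>auto simp: power_mult_distrib\<close>)

lemma L2_uminus [intro]: "v \<in> L2 \<Longrightarrow> (\<lambda>x. - v x) \<in> L2"
  using L2_cmult[of v "-1"] by simp

lemma L2_diff [intro]: "v \<in> L2 \<Longrightarrow> w \<in> L2 \<Longrightarrow> (\<lambda>x. v x - w x) \<in> L2"
  using L2_add[of v "\<lambda>x. - w x"] L2_uminus[of w] by simp

lemma L2_sum [intro]:
  "finite A \<Longrightarrow> (\<And>i. i \<in> A \<Longrightarrow> v i \<in> L2) \<Longrightarrow> (\<lambda>x. \<Sum>i\<in>A. v i x) \<in> L2"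
  by (induction A rule: finite_induct) auto

lemma L2_bounded:
  assumes "\<And>x. v (x + 1) = v x" "v \<in> borel_measurable torus" "\<And>x. \<bar>v x\<bar> \<le> B"
  shows "v \<in> L2"
proof (rule L2I)
  show "integrable torus (\<lambda>x. (v x)\<^sup>2)"
  proof (rule torus.integrable_const_bound)
    show "AE x in torus. norm ((v x)\<^sup>2) \<le> B\<^sup>2"
    proof (rule AE_I2)
      fix x have "\<bar>v x\<bar>\<^sup>2 \<le> B\<^sup>2" using assms(3)[of x] by (intro power_mono) auto
      then show "norm ((v x)\<^sup>2) \<le> B\<^sup>2" by simp
    qed
  qed (use assms in auto)
qed (use assms in auto)

lemma cont_measurable_torus: "continuous_on UNIV v \<Longrightarrow> (v::real\<Rightarrow>real) \<in> borel_measurable torus"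
  by (intro measurable_restrict_space1 measurable_completion) (simp add: borel_measurable_continuous_onI)

lemma periodic_int_shift:
  assumes "\<And>x::real. v (x + 1) = (v x :: 'b)"
  shows "v (x + of_int k) = v x"
proof -
  interpret periodic_fun_simple' v using assms by unfold_locales auto
  show ?thesis by (simp add: plus_of_int)
qed

lemma periodic_frac: 
  assumes "\<And>x::real. v (x + 1) = (v x :: 'b)"
  shows "v (frac x) = v x"
  using periodic_int_shift[of v "frac x" "\<lfloor>x\<rfloor>"] assms by (simp add: frac_def)

lemma cont_periodic_bounded:
  assumes "\<And>x. v (x + 1) = v x" "continuous_on UNIV (v::real\<Rightarrow>real)"
  obtains B where "\<And>x. \<bar>v x\<bar> \<le> B" "B \<ge> 0"
proof -
  have "compact (v ` {0..1})"
    by (rule compact_continuous_image[OF continuous_on_subset[OF assms(2)]]) auto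
  then obtain B where B: "\<forall>x\<in>{0..1}. norm (v x) \<le> B"
    by (metis bounded_iff compact_imp_bounded image_eqI)
  have "\<bar>v x\<bar> \<le> B" for x
  proof -
    have "frac x \<in> {0..1}" using frac_lt_1[of x] frac_ge_0[of x] by auto
    then have "\<bar>v (frac x)\<bar> \<le> B" using B by auto
    then show ?thesis by (simp add: periodic_frac[of v, OF assms(1)])
  qed
  moreover from this[of 0] have "B \<ge> 0" by linarith
  ultimately show ?thesis using that[of B] by blast
qed

lemma L2_cont:
  assumes "\<And>x. v (x + 1) = v x" "continuous_on UNIV (v::real\<Rightarrow>real)"
  shows "v \<in> L2"
proof -
  obtain B where "\<And>x. \<bar>v x\<bar> \<le> B" using cont_periodic_bounded[OF assms] by blast
  then show ?thesis using L2_bounded[OF assms(1) cont_measurable_torus[OF assms(2)]] by blast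
qed

lemma torus_integral_cont:
  assumes "continuous_on UNIV (v::real\<Rightarrow>real)"
  shows "integrable torus v" "(\<integral>x. v x \<partial>torus) = integral {0..1} v"
proof -
  have "compact (v ` {0..1})"
    by (rule compact_continuous_image[OF continuous_on_subset[OF assms]]) auto
  then obtain B where B: "\<forall>x\<in>{0..1}. norm (v x) \<le> B"
    by (metis bounded_iff compact_imp_bounded image_eqI)
  show i1: "integrable torus v"
    by (rule torus.integrable_const_bound[of _ B]) (use B cont_measurable_torus[OF assms] in auto)
  have "(\<integral>x. v x \<partial>torus) = integral {0..<1} v"
    by (rule lebesgue_integral_eq_integral[OF i1]) auto
  also have "\<dots> = integral {0..1} v"
  proof (rule integral_subset_negligible)
    have "{0..1} - {0..<1} = {1::real}" by auto
    then show "negligible ({0..1} - {0..<1::real})" by simp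
  qed auto
  finally show "(\<integral>x. v x \<partial>torus) = integral {0..1} v" .
qed

lemma L2norm_nonneg [simp]: "L2norm v \<ge> 0"
  by (simp add: L2norm_def)

lemma L2norm_sq: "(L2norm v)\<^sup>2 = (\<integral>x. (v x)\<^sup>2 \<partial>torus)"
  by (simp add: L2norm_def)

lemma L2norm_le_iff: "B \<ge> 0 \<Longrightarrow> L2norm v \<le> B \<longleftrightarrow> (\<integral>x. (v x)\<^sup>2 \<partial>torus) \<le> B\<^sup>2"
  unfolding L2norm_sq[symmetric] by simp

lemma L2norm_cong_AE:
  assumes "v \<in> borel_measurable torus" "w \<in> borel_measurable torus" "AE x in torus. v x = w x"
  shows "L2norm v = L2norm w"
  unfolding L2norm_def
  by (intro arg_cong[where f=sqrt] integral_cong_AE) (use assms in auto)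

lemma L2norm_cmult: "L2norm (\<lambda>x. c * v x) = \<bar>c\<bar> * L2norm v"
  by (simp add: L2norm_def power_mult_distrib real_sqrt_mult)

lemma L2norm_minus [simp]: "L2norm (\<lambda>x. - v x) = L2norm v"
  by (simp add: L2norm_def)

lemma L2norm_diff_commute: "L2norm (\<lambda>x. v x - w x) = L2norm (\<lambda>x. w x - v x)"
  using L2norm_minus[of "\<lambda>x. v x - w x"] by (simp del: L2norm_minus)

lemma L2norm_const [simp]: "L2norm (\<lambda>x. c) = \<bar>c\<bar>"
  by (simp add: L2norm_def)

lemma L2_Cauchy_Schwarz:
  assumes "v \<in> L2" "w \<in> L2"
  shows "\<bar>\<integral>x. v x * w x \<partial>torus\<bar> \<le> L2norm v * L2norm w"
proof -
  define A where "A = (\<integral>x. (v x)\<^sup>2 \<partial>torus)"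
  define B where "B = (\<integral>x. (w x)\<^sup>2 \<partial>torus)"
  define P where "P = (\<integral>x. v x * w x \<partial>torus)"
  note [simp] = L2D(3)[OF assms(1)] L2D(3)[OF assms(2)] L2_integrable_mult[OF assms]
  have quad: "0 \<le> a\<^sup>2 * A + b\<^sup>2 * B - 2 * a * b * P" for a b
  proof -
    have "0 \<le> (\<integral>x. (a * v x - b * w x)\<^sup>2 \<partial>torus)" by simp
    also have "\<dots> = (\<integral>x. a\<^sup>2 * (v x)\<^sup>2 + b\<^sup>2 * (w x)\<^sup>2 - (2 * a * b) * (v x * w x) \<partial>torus)"
      by (intro arg_cong[where f="integral\<^sup>L torus"] ext) (simp add: power2_diff power_mult_distrib algebra_simps)
    also have "\<dots> = a\<^sup>2 * A + b\<^sup>2 * B - 2 * a * b * P"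
      by (simp add: A_def B_def P_def)
    finally show ?thesis .
  qed
  have "A \<ge> 0" "B \<ge> 0" by (auto simp: A_def B_def)
  \<comment> \<open>The quadratic form is evaluated at its minimiser; for \<open>B = 0\<close> at a vector that would make it negative.\<close>
  have "P\<^sup>2 \<le> A * B"
  proof (cases "B = 0")
    case True
    have "P = 0"
    proof (rule ccontr)
      assume "P \<noteq> 0"
      have "0 \<le> A - 2 * ((A + 1) / (2 * P)) * P"
        using quad[of 1 "(A + 1) / (2 * P)"] True by simp
      then show False using \<open>P \<noteq> 0\<close> by (simp add: field_simps)
    qed
    then show ?thesis using True by simp
  next
    case False
    then have "B > 0" using \<open>B \<ge> 0\<close> by simp
    have "0 \<le> B\<^sup>2 * A + P\<^sup>2 * B - 2 * B * P * P" by (rule quad)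
    then have "0 \<le> B * (A * B - P\<^sup>2)" by (simp add: power2_eq_square algebra_simps)
    then show ?thesis using \<open>B > 0\<close> by (simp add: zero_le_mult_iff)
  qed
  then have "sqrt (P\<^sup>2) \<le> sqrt (A * B)" by (rule real_sqrt_le_mono)
  then show ?thesis by (simp add: P_def A_def B_def L2norm_def real_sqrt_mult)
qed

lemma L2norm_triangle:
  assumes "v \<in> L2" "w \<in> L2"
  shows "L2norm (\<lambda>x. v x + w x) \<le> L2norm v + L2norm w"
proof -
  note [simp] = L2D(3)[OF assms(1)] L2D(3)[OF assms(2)] L2_integrable_mult[OF assms]
  have "(L2norm (\<lambda>x. v x + w x))\<^sup>2 = (\<integral>x. (v x)\<^sup>2 + (w x)\<^sup>2 + 2 * (v x * w x) \<partial>torus)"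
    unfolding L2norm_sq by (simp add: power2_sum mult.assoc)
  also have "\<dots> = (L2norm v)\<^sup>2 + (L2norm w)\<^sup>2 + 2 * (\<integral>x. v x * w x \<partial>torus)"
    by (simp add: L2norm_sq)
  also have "\<dots> \<le> (L2norm v)\<^sup>2 + (L2norm w)\<^sup>2 + 2 * (L2norm v * L2norm w)"
    using L2_Cauchy_Schwarz[OF assms] by linarith
  also have "\<dots> = (L2norm v + L2norm w)\<^sup>2" by (simp add: power2_sum)
  finally show ?thesis by (rule power2_le_imp_le) simp
qed

lemma L2norm_triangle_diff:
  assumes "v \<in> L2" "w \<in> L2"
  shows "L2norm (\<lambda>x. v x - w x) \<le> L2norm v + L2norm w"
  using L2norm_triangle[OF assms(1) L2_uminus[OF assms(2)]] by simp

lemma L2norm_sum: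
  "finite A \<Longrightarrow> (\<And>i. i \<in> A \<Longrightarrow> v i \<in> L2) \<Longrightarrow> L2norm (\<lambda>x. \<Sum>i\<in>A. v i x) \<le> (\<Sum>i\<in>A. L2norm (v i))"
proof (induction A rule: finite_induct)
  case (insert i A)
  then have "L2norm (\<lambda>x. v i x + (\<Sum>i\<in>A. v i x)) \<le> L2norm (v i) + L2norm (\<lambda>x. \<Sum>i\<in>A. v i x)"
    by (intro L2norm_triangle L2_sum) auto
  then show ?case using insert by force
qed simp

lemma L2norm_mono:
  assumes "v \<in> L2" "w \<in> L2" "\<And>x. \<bar>v x\<bar> \<le> \<bar>w x\<bar>"
  shows "L2norm v \<le> L2norm w"
  unfolding L2norm_def
proof (intro real_sqrt_le_mono integral_mono)
  show "(v x)\<^sup>2 \<le> (w x)\<^sup>2" for x using assms(3)[of x] by (simp add: abs_le_square_iff)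
qed (use L2D(3) assms in auto)

lemma L2norm_le_bound:
  assumes "v \<in> L2" "\<And>x. \<bar>v x\<bar> \<le> B"
  shows "L2norm v \<le> B"
proof -
  have B: "B \<ge> 0" using assms(2)[of 0] by linarith
  have "L2norm v \<le> L2norm (\<lambda>x. B)"
    by (rule L2norm_mono[OF assms(1)]) (use assms(2) B in auto)
  then show ?thesis using B by simp
qed

lemma L2norm_mult_bound:
  assumes "v \<in> L2" "(\<lambda>x. a x * v x) \<in> L2" "\<And>x. \<bar>a x\<bar> \<le> B"
  shows "L2norm (\<lambda>x. a x * v x) \<le> B * L2norm v"
proof -
  have B: "B \<ge> 0" using assms(3)[of 0] by linarith
  have "L2norm (\<lambda>x. a x * v x) \<le> L2norm (\<lambda>x. B * v x)"
    by (rule L2norm_mono) (use assms B in \<open>auto simp: abs_mult intro: mult_right_mono\<close>)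
  then show ?thesis using B by (simp add: L2norm_cmult)
qed

text \<open>Fatou for the squares, with the norm bound in place of the lower limit.\<close>

lemma L2_Fatou:
  assumes v: "\<And>n. v n \<in> L2" "\<And>n. L2norm (v n) \<le> M"
    and w: "\<And>x. w (x + 1) = w x" "w \<in> borel_measurable torus"
    and lim: "AE x in torus. (\<lambda>n. v n x) \<longlonglongrightarrow> w x"
  shows "w \<in> L2" "L2norm w \<le> M"
proof -
  have M: "M \<ge> 0" using v(2)[of 0] L2norm_nonneg[of "v 0"] by linarith
  have "(\<integral>\<^sup>+x. ennreal ((w x)\<^sup>2) \<partial>torus) = (\<integral>\<^sup>+x. liminf (\<lambda>n. ennreal ((v n x)\<^sup>2)) \<partial>torus)"
  proof (rule nn_integral_cong_AE)
    show "AE x in torus. ennreal ((w x)\<^sup>2) = liminf (\<lambda>n. ennreal ((v n x)\<^sup>2))"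
      using lim
    proof eventually_elim
      case (elim x)
      have "(\<lambda>n. ennreal ((v n x)\<^sup>2)) \<longlonglongrightarrow> ennreal ((w x)\<^sup>2)"
        by (intro tendsto_ennrealI tendsto_power elim)
      then show ?case by (intro lim_imp_Liminf[symmetric]) simp_all
    qed
  qed
  also have "\<dots> \<le> liminf (\<lambda>n. \<integral>\<^sup>+x. ennreal ((v n x)\<^sup>2) \<partial>torus)"
    by (rule nn_integral_liminf) (use L2D(2)[OF v(1)] in auto)
  also have "\<dots> \<le> ennreal (M\<^sup>2)"
  proof (rule Liminf_le)
    show "\<forall>\<^sub>F n in sequentially. (\<integral>\<^sup>+x. ennreal ((v n x)\<^sup>2) \<partial>torus) \<le> ennreal (M\<^sup>2)"
    proof (rule always_eventually, rule allI)
      fix n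
      have "(\<integral>\<^sup>+x. ennreal ((v n x)\<^sup>2) \<partial>torus) = ennreal ((L2norm (v n))\<^sup>2)"
        unfolding L2norm_sq by (rule nn_integral_eq_integral) (use L2D(3)[OF v(1)] in auto)
      also have "\<dots> \<le> ennreal (M\<^sup>2)" using v(2)[of n] by (intro ennreal_leI power_mono) auto
      finally show "(\<integral>\<^sup>+x. ennreal ((v n x)\<^sup>2) \<partial>torus) \<le> ennreal (M\<^sup>2)" .
    qed
  qed simp
  finally have le: "(\<integral>\<^sup>+x. ennreal ((w x)\<^sup>2) \<partial>torus) \<le> ennreal (M\<^sup>2)" .
  have "integrable torus (\<lambda>x. (w x)\<^sup>2)"
    by (rule integrableI_bounded) (use w le in \<open>auto simp: le_less_trans\<close>)
  then show "w \<in> L2" using w by (intro L2I)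
  have "(\<integral>x. (w x)\<^sup>2 \<partial>torus) \<le> M\<^sup>2"
    using le \<open>integrable torus (\<lambda>x. (w x)\<^sup>2)\<close> by (subst (asm) nn_integral_eq_integral) auto
  then show "L2norm w \<le> M" using M by (simp add: L2norm_le_iff)
qed

text \<open>The increments are summable almost everywhere because their \<open>L\<^sup>1\<close> norms are; the
  geometric rate avoids a passage to subsequences.\<close>

lemma L2_complete:
  assumes w: "\<And>n. w n \<in> L2" "\<And>n. L2norm (\<lambda>x. w (Suc n) x - w n x) \<le> (1/2) ^ n"
  shows "\<exists>g\<in>L2. \<forall>n. L2norm (\<lambda>x. g x - w n x) \<le> 2 * (1/2) ^ n"
proof -
  define d where "d n x = \<bar>w (Suc n) x - w n x\<bar>" for n x
  have d0: "d n x \<ge> 0" for n x by (simp add: d_def)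
  have dL: "d n \<in> L2" for n
  proof (rule L2I)
    show "d n (x + 1) = d n x" for x using L2D(1)[OF w(1)] by (simp add: d_def)
    show "d n \<in> borel_measurable torus" using L2D(2)[OF w(1)] unfolding d_def by measurable
    show "integrable torus (\<lambda>x. (d n x)\<^sup>2)"
      using L2D(3)[OF L2_diff[OF w(1) w(1), of "Suc n" n]] by (simp add: d_def)
  qed
  have dn: "L2norm (d n) \<le> (1/2)^n" for n
    using w(2)[of n] by (simp add: d_def L2norm_def)
  have dint: "(\<integral>x. d n x \<partial>torus) \<le> (1/2)^n" for n
    using L2_Cauchy_Schwarz[OF dL[of n] L2_const[of 1]] dn[of n] by simp
  have "(\<integral>\<^sup>+x. (\<Sum>n. ennreal (d n x)) \<partial>torus) = (\<Sum>n. \<integral>\<^sup>+x. ennreal (d n x) \<partial>torus)"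
    by (rule nn_integral_suminf) (use L2D(2)[OF dL] in auto)
  also have "\<dots> \<le> (\<Sum>n. ennreal ((1/2)^n))"
  proof (rule suminf_le)
    show "(\<integral>\<^sup>+x. ennreal (d n x) \<partial>torus) \<le> ennreal ((1/2)^n)" for n
      using dint[of n] by (subst nn_integral_eq_integral) (auto intro: L2_integrable[OF dL] ennreal_leI simp: d0)
  qed auto
  also have "\<dots> = ennreal (\<Sum>n. (1/2)^n)"
    by (rule suminf_ennreal2) (auto intro: summable_geometric)
  also have "\<dots> < \<infinity>" by simp
  finally have "AE x in torus. (\<Sum>n. ennreal (d n x)) \<noteq> \<infinity>"
    by (intro nn_integral_PInf_AE) (use L2D(2)[OF dL] in auto)
  then have summ: "AE x in torus. summable (\<lambda>n. d n x)"
    by eventually_elim (auto intro!: summable_suminf_not_top simp: d_def)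
  define g where "g x = lim (\<lambda>n. w n x)" for x
  have lim: "AE x in torus. (\<lambda>n. w n x) \<longlonglongrightarrow> g x"
    using summ
  proof eventually_elim
    case (elim x)
    then have "summable (\<lambda>n. w (Suc n) x - w n x)"
      unfolding d_def by (rule summable_rabs_cancel)
    then have "(\<lambda>n. w 0 x + (\<Sum>i<n. w (Suc i) x - w i x)) \<longlonglongrightarrow> w 0 x + (\<Sum>i. w (Suc i) x - w i x)"
      by (intro tendsto_add tendsto_const summable_LIMSEQ)
    then have "(\<lambda>n. w n x) \<longlonglongrightarrow> w 0 x + (\<Sum>i. w (Suc i) x - w i x)"
      by (simp add: sum_lessThan_telescope[of "\<lambda>i. w i x"])
    then show ?case unfolding g_def by (metis limI)
  qed
  have gm: "g (x + 1) = g x" "g \<in> borel_measurable torus" for x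
    using L2D(1,2)[OF w(1)] by (auto simp: g_def[abs_def] intro!: borel_measurable_lim_metric)
  have tail: "L2norm (\<lambda>x. w (n + m) x - w n x) \<le> (\<Sum>i<m. (1/2)^(n+i))" for n m
  proof (induction m)
    case (Suc m)
    have "L2norm (\<lambda>x. (w (n + m) x - w n x) + (w (Suc (n + m)) x - w (n + m) x)) 
       \<le> L2norm (\<lambda>x. w (n + m) x - w n x) + L2norm (\<lambda>x. w (Suc (n + m)) x - w (n + m) x)"
      by (intro L2norm_triangle L2_diff w)
    then show ?case using Suc w(2)[of "n+m"] by simp
  qed simp
  have geo: "(\<Sum>i<m. (1/2::real)^(n+i)) \<le> 2 * (1/2)^n" for n m :: nat
  proof -
    have "(\<Sum>i<m. (1/2::real)^(n+i)) = (1/2)^n * (\<Sum>i<m. (1/2::real)^i)"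
      by (simp add: power_add sum_distrib_left)
    also have "(\<Sum>i<m. (1/2::real)^i) \<le> 2"
      by (subst geometric_sum) auto
    finally show ?thesis by simp
  qed
  have bd: "(\<lambda>x. g x - w n x) \<in> L2 \<and> L2norm (\<lambda>x. g x - w n x) \<le> 2 * (1/2) ^ n" for n
  proof -
    have "AE x in torus. (\<lambda>m. w (n + m) x - w n x) \<longlonglongrightarrow> g x - w n x"
      using lim
    proof eventually_elim
      case (elim x)
      have "(\<lambda>m. w (n + m) x) \<longlonglongrightarrow> g x"
        using LIMSEQ_ignore_initial_segment[OF elim, of n] by (simp add: add.commute)
      then show ?case by (intro tendsto_diff tendsto_const)
    qed
    then show ?thesis
      using L2_Fatou[of "\<lambda>m x. w (n + m) x - w n x" "2 * (1/2)^n" "\<lambda>x. g x - w n x"]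
        order_trans[OF tail geo] gm L2D(1,2)[OF w(1)] L2_diff[OF w(1) w(1)] by auto
  qed
  have "(\<lambda>x. (g x - w 0 x) + w 0 x) \<in> L2" by (intro L2_add w) (use bd in auto)
  then have "g \<in> L2" by simp
  then show ?thesis using bd by blast
qed

lemma L2norm_parallelogram:
  assumes "v \<in> L2" "w \<in> L2"
  shows "(L2norm (\<lambda>x. v x - w x))\<^sup>2 = 2 * (L2norm v)\<^sup>2 + 2 * (L2norm w)\<^sup>2 - 4 * (L2norm (\<lambda>x. (v x + w x) / 2))\<^sup>2"
proof -
  note [simp] = L2D(3)[OF assms(1)] L2D(3)[OF assms(2)] L2_integrable_mult[OF assms]
    L2D(3)[OF L2_add[OF assms]]
  have "(\<integral>x. (v x - w x)\<^sup>2 \<partial>torus) = (\<integral>x. 2 * (v x)\<^sup>2 + 2 * (w x)\<^sup>2 - (v x + w x)\<^sup>2 \<partial>torus)"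
    by (intro arg_cong[where f="integral\<^sup>L torus"] ext) (simp add: power2_sum power2_diff)
  also have "\<dots> = 2 * (L2norm v)\<^sup>2 + 2 * (L2norm w)\<^sup>2 - (\<integral>x. (v x + w x)\<^sup>2 \<partial>torus)"
    by (simp add: L2norm_sq)
  also have "(\<integral>x. (v x + w x)\<^sup>2 \<partial>torus) = 4 * (L2norm (\<lambda>x. (v x + w x) / 2))\<^sup>2"
    by (simp add: L2norm_sq power_divide)
  finally show ?thesis by (simp add: L2norm_sq)
qed

text \<open>Closing under midpoints is enough for the parallelogram argument and spares finite convex combinations.\<close>

inductive_set midhull :: "(real \<Rightarrow> real) set \<Rightarrow> (real \<Rightarrow> real) set" for S where
  base: "v \<in> S \<Longrightarrow> v \<in> midhull S"
| mid: "v \<in> midhull S \<Longrightarrow> w \<in> midhull S \<Longrightarrow> (\<lambda>x. (v x + w x) / 2) \<in> midhull S"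

lemma midhull_mono: "v \<in> midhull S \<Longrightarrow> S \<subseteq> S' \<Longrightarrow> v \<in> midhull S'"
  by (induction rule: midhull.induct) (auto intro: midhull.intros)

lemma midhull_L2:
  assumes "v \<in> midhull S" "\<And>w. w \<in> S \<Longrightarrow> w \<in> L2 \<and> L2norm w \<le> M"
  shows "v \<in> L2 \<and> L2norm v \<le> M"
  using assms(1)
proof (induction rule: midhull.induct)
  case (mid v w)
  have m: "(\<lambda>x. (1/2) * (v x + w x)) \<in> L2" using mid by (intro L2_cmult L2_add) auto
  have "L2norm (\<lambda>x. (1/2) * (v x + w x)) = (1/2) * L2norm (\<lambda>x. v x + w x)"
    unfolding L2norm_cmult by simp
  also have "\<dots> \<le> M" using L2norm_triangle[of v w] mid by simp
  finally show ?case using m by simp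
qed (use assms in auto)

lemma midhull_test:
  assumes "v \<in> midhull S" "S \<subseteq> L2" "\<phi> \<in> L2"
    "\<And>w. w \<in> S \<Longrightarrow> \<bar>(\<integral>x. w x * \<phi> x \<partial>torus) - l\<bar> \<le> e"
  shows "v \<in> L2 \<and> \<bar>(\<integral>x. v x * \<phi> x \<partial>torus) - l\<bar> \<le> e"
  using assms(1)
proof (induction rule: midhull.induct)
  case (mid v w)
  have m: "(\<lambda>x. (1/2) * (v x + w x)) \<in> L2" using mid by (intro L2_cmult L2_add) auto
  have "(\<integral>x. (v x + w x) / 2 * \<phi> x \<partial>torus) = (\<integral>x. (v x * \<phi> x + w x * \<phi> x) / 2 \<partial>torus)"
    by (simp add: algebra_simps)
  also have "\<dots> = ((\<integral>x. v x * \<phi> x \<partial>torus) + (\<integral>x. w x * \<phi> x \<partial>torus)) / 2"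
    using L2_integrable_mult assms(3) mid by simp
  finally show ?case using m mid by (simp add: abs_if field_simps split: if_splits)
qed (use assms in auto)

text \<open>Weak compactness without a countable dense set: elements of nearly minimal norm in the midpoint hulls of
  the tails form a Cauchy sequence by the parallelogram identity. Their limit tests every function as the sequence
  does, provided the sequence of tests converges, since each hull element inherits the bounds of its tail.\<close>

lemma L2_weak_limit:
  assumes g: "\<And>n. g n \<in> L2" "\<And>n. L2norm (g n) \<le> M"
  shows "\<exists>G\<in>L2. L2norm G \<le> M \<and>
    (\<forall>\<phi>\<in>L2. \<forall>l. (\<lambda>n. \<integral>x. g n x * \<phi> x \<partial>torus) \<longlonglongrightarrow> l \<longrightarrow> (\<integral>x. G x * \<phi> x \<partial>torus) = l)"
proof -
  have M: "M \<ge> 0" using g(2)[of 0] L2norm_nonneg[of "g 0"] by linarith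
  define H where "H n = midhull (g ` {n..})" for n
  have HL: "v \<in> L2" "L2norm v \<le> M" if "v \<in> H n" for v n
    using midhull_L2[of v _ M] that g unfolding H_def by blast+
  have Hmono: "H m \<subseteq> H n" if "n \<le> m" for n m
    unfolding H_def using that by (auto intro: midhull_mono)
  have Hne: "H n \<noteq> {}" for n unfolding H_def using midhull.base[of "g n" "g ` {n..}"] by auto
  define d where "d n = Inf ((\<lambda>v. (L2norm v)\<^sup>2) ` H n)" for n
  have bb: "bdd_below ((\<lambda>v. (L2norm v)\<^sup>2) ` H n)" for n by (rule bdd_belowI[of _ 0]) auto
  have d_le: "d n \<le> (L2norm v)\<^sup>2" if "v \<in> H n" for v n
    unfolding d_def by (rule cInf_lower[OF _ bb]) (use that in auto)
  have dM: "d n \<le> M\<^sup>2" for n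
  proof -
    obtain v where v: "v \<in> H n" using Hne by blast
    have "(L2norm v)\<^sup>2 \<le> M\<^sup>2" using HL[OF v] by (intro power_mono) auto
    then show ?thesis using d_le[OF v] by linarith
  qed
  have dinc: "d n \<le> d m" if "n \<le> m" for n m
    unfolding d_def by (rule cInf_superset_mono[OF _ bb]) (use Hne Hmono[OF that] in auto)
  define D where "D = (SUP n. d n)"
  have bdd: "bdd_above (range d)" using dM by (intro bdd_aboveI[of _ "M\<^sup>2"]) auto
  have dD: "d n \<le> D" for n unfolding D_def by (rule cSUP_upper[OF _ bdd]) simp
  \<comment> \<open>Tolerances for which the parallelogram identity yields increments of norm at most \<open>2^(-k)\<close>.\<close>
  define e where "e k = (1/4::real)^k / 8" for k :: nat
  have e: "e k > 0" for k by (simp add: e_def)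
  have "\<exists>n v. n \<ge> k \<and> D - e k < d n \<and> v \<in> H n \<and> (L2norm v)\<^sup>2 < D + e k" for k
  proof -
    have "D - e k < D" using e[of k] by simp
    then obtain n0 where "D - e k < d n0" unfolding D_def using less_cSUP_iff[OF _ bdd] by auto
    then have n: "D - e k < d (max k n0)" using dinc[of n0 "max k n0"] by simp
    have "Inf ((\<lambda>v. (L2norm v)\<^sup>2) ` H (max k n0)) < D + e k"
      using dD[of "max k n0"] e[of k] unfolding d_def by linarith
    then obtain v where "v \<in> H (max k n0)" "(L2norm v)\<^sup>2 < D + e k"
      using cInf_less_iff[OF _ bb[of "max k n0"]] Hne by auto
    with n show ?thesis by (intro exI[of _ "max k n0"] exI[of _ v]) auto
  qed
  then obtain N v where N: "\<And>k. N k \<ge> k" "\<And>k. D - e k < d (N k)"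
    and v: "\<And>k. v k \<in> H (N k)" "\<And>k. (L2norm (v k))\<^sup>2 < D + e k" by metis
  have step: "L2norm (\<lambda>x. v (Suc k) x - v k x) \<le> (1/2)^k" for k
  proof -
    define n where "n = min (N k) (N (Suc k))"
    have es: "e (Suc k) \<le> e k" by (simp add: e_def)
    have "v k \<in> H n" "v (Suc k) \<in> H n" using v(1) Hmono unfolding n_def by (meson min.cobounded1 min.cobounded2 subsetD)+
    then have "(\<lambda>x. (v (Suc k) x + v k x) / 2) \<in> H n" unfolding H_def by (intro midhull.mid)
    then have "d n \<le> (L2norm (\<lambda>x. (v (Suc k) x + v k x) / 2))\<^sup>2" by (rule d_le)
    moreover have "D - e k < d n" using N(2)[of k] N(2)[of "Suc k"] es unfolding n_def by (auto simp: min_def)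
    ultimately have "(L2norm (\<lambda>x. v (Suc k) x - v k x))\<^sup>2 \<le> 8 * e k"
      using L2norm_parallelogram[OF HL(1)[OF v(1)[of "Suc k"]] HL(1)[OF v(1)[of k]]] v(2)[of k] v(2)[of "Suc k"] es
      by linarith
    also have "\<dots> = ((1/2)^k)\<^sup>2" by (simp add: e_def power2_eq_square power_mult_distrib[symmetric])
    finally show ?thesis by (rule power2_le_imp_le) simp
  qed
  have vL: "v k \<in> L2" "L2norm (v k) \<le> M" for k using HL v(1) by blast+
  obtain G where G: "G \<in> L2" "\<And>k. L2norm (\<lambda>x. G x - v k x) \<le> 2 * (1/2)^k"
    using L2_complete[OF vL(1) step] by blast
  have lim0: "(\<lambda>k. 2 * (1/2::real)^k) \<longlonglongrightarrow> 0"
    by (rule tendsto_mult_right_zero[OF LIMSEQ_realpow_zero]) auto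
  have "L2norm G \<le> M + 2 * (1/2)^k" for k
  proof -
    have "L2norm (\<lambda>x. (G x - v k x) + v k x) \<le> L2norm (\<lambda>x. G x - v k x) + L2norm (v k)"
      by (intro L2norm_triangle L2_diff G vL)
    then show ?thesis using G(2)[of k] vL(2)[of k] by simp
  qed
  then have GM: "L2norm G \<le> M"
    using LIMSEQ_le_const[OF tendsto_add[OF tendsto_const[of M] lim0]] by force
  have test: "(\<integral>x. G x * \<phi> x \<partial>torus) = l"
    if \<phi>: "\<phi> \<in> L2" and l: "(\<lambda>n. \<integral>x. g n x * \<phi> x \<partial>torus) \<longlonglongrightarrow> l" for \<phi> l
  proof -
    have "(\<lambda>k. (\<integral>x. v k x * \<phi> x \<partial>torus)) \<longlonglongrightarrow> l"
    proof (rule LIMSEQ_I)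
      fix r :: real assume "r > 0"
      then have "\<exists>n0. \<forall>n\<ge>n0. norm ((\<integral>x. g n x * \<phi> x \<partial>torus) - l) < r / 2"
        by (intro LIMSEQ_D[OF l]) simp
      then obtain n0 where n0: "\<And>n. n \<ge> n0 \<Longrightarrow> \<bar>(\<integral>x. g n x * \<phi> x \<partial>torus) - l\<bar> \<le> r / 2"
        by (metis less_imp_le real_norm_def)
      have "\<bar>(\<integral>x. v k x * \<phi> x \<partial>torus) - l\<bar> \<le> r / 2" if "k \<ge> n0" for k
        using midhull_test[of "v k" "g ` {N k..}" \<phi> l "r/2"] v(1)[of k] g \<phi> n0 N(1)[of k] that
        unfolding H_def by force
      then show "\<exists>no. \<forall>n\<ge>no. norm ((\<integral>x. v n x * \<phi> x \<partial>torus) - l) < r"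
        using \<open>r > 0\<close> by (intro exI[of _ n0]) force
    qed
    moreover have "(\<lambda>k. (\<integral>x. v k x * \<phi> x \<partial>torus)) \<longlonglongrightarrow> (\<integral>x. G x * \<phi> x \<partial>torus)"
    proof (rule Lim_null_comparison[THEN LIM_zero_cancel])
      show "\<forall>\<^sub>F k in sequentially. norm ((\<integral>x. v k x * \<phi> x \<partial>torus) - (\<integral>x. G x * \<phi> x \<partial>torus)) \<le> (2 * (1/2)^k) * L2norm \<phi>"
      proof (rule always_eventually, rule allI)
        fix k
        have "(\<integral>x. v k x * \<phi> x \<partial>torus) - (\<integral>x. G x * \<phi> x \<partial>torus) = (\<integral>x. (v k x - G x) * \<phi> x \<partial>torus)"
          using L2_integrable_mult[OF vL(1) \<phi>] L2_integrable_mult[OF G(1) \<phi>]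
          by (simp add: left_diff_distrib)
        also have "\<bar>\<dots>\<bar> \<le> L2norm (\<lambda>x. v k x - G x) * L2norm \<phi>"
          by (intro L2_Cauchy_Schwarz L2_diff vL G \<phi>)
        also have "\<dots> \<le> (2 * (1/2)^k) * L2norm \<phi>"
          using G(2)[of k] by (intro mult_right_mono) (auto simp: L2norm_diff_commute[of "v k"])
        finally show "norm ((\<integral>x. v k x * \<phi> x \<partial>torus) - (\<integral>x. G x * \<phi> x \<partial>torus)) \<le> (2 * (1/2)^k) * L2norm \<phi>"
          by simp
      qed
      show "(\<lambda>k. (2 * (1/2)^k) * L2norm \<phi>) \<longlonglongrightarrow> 0" by (rule tendsto_mult_left_zero[OF lim0])
    qed
    ultimately show ?thesis by (rule LIMSEQ_unique[symmetric])
  qed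
  show ?thesis using G(1) GM test by blast
qed

section \<open>Calculus of k times continuously differentiable functions\<close>

lemma Ck_0 [simp]: "Ck 0 g \<longleftrightarrow> continuous_on UNIV g"
  by (simp add: Ck_def)

lemma deriv_funpow_Suc: "(deriv ^^ Suc j) g = (deriv ^^ j) (deriv g)"
  by (simp add: funpow_Suc_right del: funpow.simps)

lemma Ck_Suc: "Ck (Suc k) g \<longleftrightarrow> g differentiable_on UNIV \<and> Ck k (deriv g)"
  unfolding Ck_def All_less_Suc2 deriv_funpow_Suc by simp

lemma Ck_SucI:
  assumes "\<And>x. (g has_real_derivative g' x) (at x)" "Ck k g'"
  shows "Ck (Suc k) g"
proof -
  have "deriv g = g'" using assms(1) by (intro ext DERIV_imp_deriv)
  moreover have "g differentiable_on UNIV"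
    using assms(1) by (meson differentiable_on_eq_differentiable_at open_UNIV real_differentiable_def)
  ultimately show ?thesis using assms(2) by (simp add: Ck_Suc)
qed

lemma Ck_DERIV: "Ck (Suc k) g \<Longrightarrow> (g has_real_derivative deriv g x) (at x)"
  unfolding Ck_Suc by (metis DERIV_deriv_iff_real_differentiable UNIV_I differentiable_on_def)

lemma Ck_deriv: "Ck (Suc k) g \<Longrightarrow> Ck k (deriv g)"
  by (simp add: Ck_Suc)

lemma Ck_SucD: "Ck (Suc k) g \<Longrightarrow> Ck k g"
proof (induction k arbitrary: g)
  case 0
  then show ?case by (simp add: Ck_Suc differentiable_imp_continuous_on)
next
  case (Suc k)
  then show ?case by (metis Ck_Suc)
qed

lemma Ck_mono: "Ck k g \<Longrightarrow> j \<le> k \<Longrightarrow> Ck j g"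
  by (induction k) (auto simp: le_Suc_eq dest: Ck_SucD)

lemma Ck_cont: "Ck k g \<Longrightarrow> continuous_on UNIV g"
  using Ck_mono[of k g 0] by simp

lemma Ck_const [simp]: "Ck k (\<lambda>x. c)"
proof (induction k arbitrary: c)
  case (Suc k)
  show ?case by (rule Ck_SucI[where g'="\<lambda>x. 0"]) (use Suc in auto)
qed simp

lemma Ck_ident [simp]: "Ck k (\<lambda>x. x)"
proof (cases k)
  case (Suc k)
  show ?thesis unfolding Suc by (rule Ck_SucI[where g'="\<lambda>x. 1"]) auto
qed simp

lemma Ck_add: "Ck k g \<Longrightarrow> Ck k h \<Longrightarrow> Ck k (\<lambda>x. g x + h x)"
proof (induction k arbitrary: g h)
  case (Suc k)
  show ?case
    by (rule Ck_SucI[where g'="\<lambda>x. deriv g x + deriv h x"])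
       (use Suc in \<open>auto intro!: derivative_eq_intros dest: Ck_DERIV Ck_deriv\<close>)
qed (auto intro: continuous_intros)

lemma Ck_mult: "Ck k g \<Longrightarrow> Ck k h \<Longrightarrow> Ck k (\<lambda>x. g x * h x)"
proof (induction k arbitrary: g h)
  case (Suc k)
  show ?case
    by (rule Ck_SucI[where g'="\<lambda>x. deriv g x * h x + deriv h x * g x"])
       (use Suc in \<open>auto intro!: derivative_eq_intros Ck_add dest: Ck_DERIV Ck_deriv Ck_SucD\<close>)
qed (auto intro: continuous_intros)

lemma Ck_cmult: "Ck k g \<Longrightarrow> Ck k (\<lambda>x. c * g x)"
  by (intro Ck_mult) auto

lemma Ck_minus: "Ck k g \<Longrightarrow> Ck k (\<lambda>x. - g x)"
  using Ck_cmult[of k g "-1"] by simp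

lemma Ck_diff: "Ck k g \<Longrightarrow> Ck k h \<Longrightarrow> Ck k (\<lambda>x. g x - h x)"
  using Ck_add[of k g "\<lambda>x. - h x"] Ck_minus[of k h] by simp

lemma Ck_compose: "Ck k g \<Longrightarrow> Ck k h \<Longrightarrow> Ck k (\<lambda>x. g (h x))"
proof (induction k arbitrary: g h)
  case 0
  then show ?case by (auto intro: continuous_on_compose2)
next
  case (Suc k)
  show ?case
  proof (rule Ck_SucI[where g'="\<lambda>x. deriv g (h x) * deriv h x"])
    show "((\<lambda>x. g (h x)) has_real_derivative deriv g (h x) * deriv h x) (at x)" for x
      by (rule DERIV_chain2[OF Ck_DERIV[OF Suc.prems(1)] Ck_DERIV[OF Suc.prems(2)]])
    show "Ck k (\<lambda>x. deriv g (h x) * deriv h x)"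
      by (intro Ck_mult Suc.IH[OF Ck_deriv[OF Suc.prems(1)] Ck_SucD[OF Suc.prems(2)]] Ck_deriv[OF Suc.prems(2)])
  qed
qed

lemma Ck_inverse: "Ck k g \<Longrightarrow> (\<And>x. g x \<noteq> 0) \<Longrightarrow> Ck k (\<lambda>x. inverse (g x))"
proof (induction k arbitrary: g)
  case (Suc k)
  show ?case
  proof (rule Ck_SucI)
    show "((\<lambda>x. inverse (g x)) has_real_derivative - (deriv g x * (inverse (g x) * inverse (g x)))) (at x)" for x
      using DERIV_inverse_fun[OF Ck_DERIV[OF Suc.prems(1)] Suc.prems(2), of x]
      by (simp add: mult.commute mult.left_commute)
    show "Ck k (\<lambda>x. - (deriv g x * (inverse (g x) * inverse (g x))))"
      using Suc Ck_SucD by (intro Ck_minus Ck_mult Suc.IH) (auto dest: Ck_deriv)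
  qed
qed (auto intro!: continuous_intros)

lemma Ck_funpow_deriv: "Ck (j + k) g \<Longrightarrow> Ck k ((deriv ^^ j) g)"
proof (induction j arbitrary: g)
  case (Suc j)
  then show ?case by (simp add: deriv_funpow_Suc Ck_Suc del: funpow.simps)
qed simp

lemma Ck_deriv_lincomb:
  assumes "Ck (Suc 0) g" "Ck (Suc 0) h"
  shows "deriv (\<lambda>x. a * g x + b * h x) = (\<lambda>x. a * deriv g x + b * deriv h x)"
  by (rule ext, rule DERIV_imp_deriv)
     (use Ck_DERIV assms in \<open>auto intro!: derivative_eq_intros\<close>)

lemma Ck_funpow_lincomb:
  "Ck j g \<Longrightarrow> Ck j h \<Longrightarrow>
   (deriv ^^ j) (\<lambda>x. a * g x + b * h x) = (\<lambda>x. a * (deriv ^^ j) g x + b * (deriv ^^ j) h x)"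
proof (induction j arbitrary: g h)
  case (Suc j)
  have "deriv (\<lambda>x. a * g x + b * h x) = (\<lambda>x. a * deriv g x + b * deriv h x)"
    by (rule Ck_deriv_lincomb) (use Suc.prems Ck_mono[of "Suc j" _ "Suc 0"] in auto)
  then show ?case using Suc by (simp add: deriv_funpow_Suc Ck_Suc del: funpow.simps)
qed simp

lemma Ck_funpow_diff:
  "Ck j g \<Longrightarrow> Ck j h \<Longrightarrow> (deriv ^^ j) (\<lambda>x. g x - h x) = (\<lambda>x. (deriv ^^ j) g x - (deriv ^^ j) h x)"
  using Ck_funpow_lincomb[of j g h 1 "-1"] by simp

lemma Ck_funpow_cmult:
  "Ck j g \<Longrightarrow> (deriv ^^ j) (\<lambda>x. a * g x) = (\<lambda>x. a * (deriv ^^ j) g x)"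
  using Ck_funpow_lincomb[of j g g a 0] by simp

lemma deriv_shift_scale:
  assumes "Ck (Suc 0) g"
  shows "deriv (\<lambda>x. g (c * x + d)) = (\<lambda>x. c * deriv g (c * x + d))"
proof (rule ext, rule DERIV_imp_deriv)
  fix x
  have "((\<lambda>x. g (c * x + d)) has_real_derivative deriv g (c * x + d) * c) (at x)"
    by (rule DERIV_chain2[OF Ck_DERIV[OF assms]]) (auto intro!: derivative_eq_intros)
  then show "((\<lambda>x. g (c * x + d)) has_real_derivative c * deriv g (c * x + d)) (at x)"
    by (simp add: mult.commute)
qed

lemma funpow_deriv_affine:
  "Ck j g \<Longrightarrow> (deriv ^^ j) (\<lambda>x. g (c * x + d)) = (\<lambda>x. c ^ j * (deriv ^^ j) g (c * x + d))"
proof (induction j arbitrary: g)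
  case (Suc j)
  have "(deriv ^^ Suc j) (\<lambda>x. g (c * x + d)) = (deriv ^^ j) (\<lambda>x. c * deriv g (c * x + d))"
    unfolding deriv_funpow_Suc
    by (subst deriv_shift_scale) (use Suc.prems Ck_mono[of "Suc j" _ "Suc 0"] in auto)
  also have "\<dots> = (\<lambda>x. c * (deriv ^^ j) (\<lambda>x. deriv g (c * x + d)) x)"
    by (rule Ck_funpow_cmult)
       (use Suc.prems in \<open>auto intro!: Ck_compose[of _ "deriv g"] Ck_add Ck_cmult simp: Ck_Suc\<close>)
  also have "\<dots> = (\<lambda>x. c ^ Suc j * (deriv ^^ Suc j) g (c * x + d))"
    using Suc by (simp add: deriv_funpow_Suc Ck_Suc mult.assoc del: funpow.simps)
  finally show ?case .
qed simp

lemma deriv_periodic: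
  assumes "\<And>x::real. g (x + 1) = (g x::real)" shows "deriv g (x + 1) = deriv g x"
proof -
  have "(g has_field_derivative D) (at (x + 1)) \<longleftrightarrow> (g has_field_derivative D) (at x)" for D
    using DERIV_shift[of g D x 1] assms by simp
  then show ?thesis unfolding deriv_def by simp
qed

lemma funpow_deriv_periodic:
  assumes "\<And>x::real. g (x + 1) = (g x::real)" shows "(deriv ^^ j) g (x + 1) = (deriv ^^ j) g x"
  using assms by (induction j arbitrary: x) (auto intro: deriv_periodic)

section \<open>A smooth bump function\<close>

text \<open>The functions \<open>p(1/t) exp(-1/t)\<close>, extended by zero: this family is closed under derivatives,
  which makes all of its members smooth at once.\<close>

definition flat :: "real poly \<Rightarrow> real \<Rightarrow> real" where
  "flat p t = (if t > 0 then poly p (1 / t) * exp (- 1 / t) else 0)"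

lemma poly_exp_tendsto_0: "((\<lambda>y. y ^ k * poly p y * exp (- y)) \<longlongrightarrow> (0::real)) at_top"
proof (induction p arbitrary: k)
  case (pCons a p)
  have "((\<lambda>y::real. a * (y ^ k / exp y) + y ^ Suc k * poly p y * exp (- y)) \<longlongrightarrow> a * 0 + 0) at_top"
    by (intro tendsto_add tendsto_mult tendsto_const tendsto_power_div_exp_0 pCons.IH)
  then show ?case by (simp add: algebra_simps exp_minus divide_inverse)
qed simp

text \<open>At the origin the difference quotient is \<open>y p(y) exp(-y)\<close> with \<open>y = 1/t\<close>; away
  from it this is the chain rule.\<close>

lemma flat_DERIV: "(flat p has_real_derivative flat ([:0, 0, 1:] * (p - pderiv p)) t) (at t)"
proof -
  consider "t > 0" | "t < 0" | "t = 0" by linarith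
  then show ?thesis
  proof cases
    case 1
    have "((\<lambda>t. poly p (1 / t) * exp (- 1 / t)) has_real_derivative
        poly p (1 / t) * (exp (- 1 / t) * (1 / t^2)) + (poly (pderiv p) (1 / t) * (- 1 / t^2)) * exp (- 1 / t)) (at t)"
      by (rule derivative_eq_intros DERIV_chain2[OF poly_DERIV] refl
          | use 1 in \<open>force simp: field_simps power2_eq_square\<close>)+
    moreover have "\<forall>\<^sub>F x in nhds t. poly p (1 / x) * exp (- 1 / x) = flat p x"
      using eventually_nhds_in_open[of "{0<..}" t] 1 by (auto elim!: eventually_mono simp: flat_def)
    ultimately show ?thesis
      using 1 by (simp add: DERIV_cong_ev[OF refl _ refl, symmetric] flat_def algebra_simps power2_eq_square divide_simps)
  next
    case 2
    have "\<forall>\<^sub>F x in nhds t. 0 = flat p x"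
      using eventually_nhds_in_open[of "{..<0}" t] 2 by (auto elim!: eventually_mono simp: flat_def)
    then have "(flat p has_real_derivative 0) (at t)"
      using DERIV_cong_ev[OF refl _ refl, of "\<lambda>x. 0" "flat p" t 0] by simp
    then show ?thesis using 2 by (simp add: flat_def)
  next
    case 3
    have "((\<lambda>h. flat p h / h) \<longlongrightarrow> 0) (at_right 0)"
    proof -
      have "((\<lambda>h. (inverse h) ^ 1 * poly p (inverse h) * exp (- inverse h)) \<longlongrightarrow> 0) (at_right (0::real))"
        by (rule filterlim_compose[OF poly_exp_tendsto_0 filterlim_inverse_at_top_right])
      moreover have "\<forall>\<^sub>F h in at_right 0. (inverse h) ^ 1 * poly p (inverse h) * exp (- inverse h) = flat p h / h"
        unfolding eventually_at_filter by (auto simp: flat_def field_simps)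
      ultimately show ?thesis by (rule Lim_transform_eventually)
    qed
    moreover have "((\<lambda>h. flat p h / h) \<longlongrightarrow> 0) (at_left 0)"
      by (rule Lim_transform_eventually[OF tendsto_const]) (auto simp: eventually_at_filter flat_def)
    ultimately have "((\<lambda>h. flat p h / h) \<longlongrightarrow> 0) (at 0)" by (simp add: filterlim_split_at)
    then show ?thesis using 3 by (simp add: DERIV_def flat_def)
  qed
qed

lemma flat_Ck: "Ck k (flat p)"
proof (induction k arbitrary: p)
  case 0
  then show ?case using flat_DERIV by (auto intro!: DERIV_isCont continuous_at_imp_continuous_on)
next
  case (Suc k)
  then show ?case by (intro Ck_SucI[OF flat_DERIV])
qed

definition bump :: "real \<Rightarrow> real" where
  "bump t = flat 1 t"

lemma bump_Ck: "Ck k bump"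
  unfolding bump_def[abs_def] by (rule flat_Ck)

lemma bump_nonneg: "bump t \<ge> 0"
  by (simp add: bump_def flat_def)

lemma bump_pos_iff: "bump t > 0 \<longleftrightarrow> t > 0"
  by (simp add: bump_def flat_def)

lemma bump_eq_0_iff: "bump t = 0 \<longleftrightarrow> t \<le> 0"
  by (simp add: bump_def flat_def)

section \<open>Mollification on the torus\<close>

text \<open>The argument of \<open>sin\<close> makes the kernel 1-periodic; its support lies where
  \<open>|sin (\<pi> x)| < 1 / (n + 1)\<close>, that is, near the integers.\<close>

definition prekernel :: "nat \<Rightarrow> real \<Rightarrow> real" where
  "prekernel n x = bump (1 - (real (Suc n) * sin (pi * x))\<^sup>2)"

definition tkernel :: "nat \<Rightarrow> real \<Rightarrow> real" where
  "tkernel n x = prekernel n x / integral {0..1} (prekernel n)"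

lemma Ck_sin_cos: "Ck k (sin :: real \<Rightarrow> real) \<and> Ck k (cos :: real \<Rightarrow> real)"
proof (induction k)
  case (Suc k)
  have "Ck (Suc k) (sin::real\<Rightarrow>real)" by (rule Ck_SucI[where g'=cos]) (use Suc in auto)
  moreover have "Ck (Suc k) (cos::real\<Rightarrow>real)"
    by (rule Ck_SucI[where g'="\<lambda>x. - sin x"]) (use Suc Ck_minus in \<open>auto intro!: derivative_eq_intros\<close>)
  ultimately show ?case by simp
qed (auto intro: continuous_intros)

lemma prekernel_Ck: "Ck k (prekernel n)"
proof -
  have "Ck k (\<lambda>x. sin (pi * x))"
    by (rule Ck_compose[where g=sin and h="\<lambda>x. pi * x"]) (simp_all add: Ck_sin_cos Ck_cmult)
  then show ?thesis unfolding prekernel_def[abs_def] power2_eq_square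
    by (intro Ck_compose[OF bump_Ck] Ck_diff Ck_mult Ck_const)
qed

lemma prekernel_int_pos: "integral {0..1} (prekernel n) > 0"
proof -
  have c: "continuous_on {0..1} (prekernel n)" using Ck_cont[OF prekernel_Ck] continuous_on_subset by blast
  have nn: "prekernel n x \<ge> 0" for x by (simp add: prekernel_def bump_nonneg)
  have "integral {0..1} (prekernel n) \<noteq> 0"
  proof
    assume "integral {0..1} (prekernel n) = 0"
    then have "prekernel n 0 = 0"
      using integral_eq_0_iff[OF c] nn by force
    then show False by (simp add: prekernel_def bump_eq_0_iff)
  qed
  moreover have "integral {0..1} (prekernel n) \<ge> 0"
    by (rule integral_nonneg[OF integrable_continuous_real[OF c]]) (simp add: nn)
  ultimately show ?thesis by linarith
qed

lemma kernel_Ck: "Ck k (tkernel n)"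
  unfolding tkernel_def[abs_def] divide_inverse by (intro Ck_mult prekernel_Ck Ck_const)

lemma kernel_cont: "continuous_on UNIV (tkernel n)"
  using Ck_cont[OF kernel_Ck] .

lemma kernel_nonneg: "tkernel n x \<ge> 0"
  using prekernel_int_pos[of n] by (simp add: tkernel_def prekernel_def bump_nonneg)

lemma kernel_abs_diff: "\<bar>tkernel n z * a - tkernel n z * b\<bar> = tkernel n z * \<bar>a - b\<bar>"
  by (metis abs_mult abs_of_nonneg kernel_nonneg right_diff_distrib)

lemma kernel_periodic: "tkernel n (x + 1) = tkernel n x"
proof -
  have "sin (pi * (x + 1)) = - sin (pi * x)" by (simp add: distrib_left sin_add)
  then show ?thesis by (simp add: tkernel_def prekernel_def)
qed

lemma kernel_even: "tkernel n (- x) = tkernel n x"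
  by (simp add: tkernel_def prekernel_def)

lemma antiderivative_ex:
  assumes "continuous_on UNIV (v::real\<Rightarrow>real)"
  shows "\<exists>A. \<forall>x. (A has_real_derivative v x) (at x)"
proof (intro exI allI)
  fix x :: real
  define a b where "a = min 0 x - 1" and "b = max 0 x + 1"
  have "((\<lambda>u. LBINT y=ereal 0..ereal u. v y) has_vector_derivative v x) (at x within {a..b})"
    by (rule interval_integral_FTC2) (auto simp: a_def b_def continuous_on_subset[OF assms])
  moreover have "at x within {a..b} = at x"
    by (rule at_within_interior) (auto simp: a_def b_def)
  ultimately show "((\<lambda>u. LBINT y=ereal 0..ereal u. v y) has_real_derivative v x) (at x)"
    by (simp add: has_real_derivative_iff_has_vector_derivative)
qed

text \<open>The increment of an antiderivative over one period does not depend on the starting point, since its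
  derivative vanishes.\<close>

lemma cont_periodic_integral_shift:
  assumes "\<And>x. v (x + 1) = v x" "continuous_on UNIV (v::real\<Rightarrow>real)"
  shows "integral {0..1} (\<lambda>x. v (x + d)) = integral {0..1} v"
proof -
  obtain A where A: "\<And>x. (A has_real_derivative v x) (at x)"
    using antiderivative_ex[OF assms(2)] by blast
  have I: "integral {0..1} (\<lambda>x. v (x + e)) = A (1 + e) - A e" for e
  proof -
    have "((\<lambda>x. v (x + e)) has_integral A (1 + e) - A (0 + e)) {0..1}"
    proof (rule fundamental_theorem_of_calculus)
      fix x :: real
      have "((\<lambda>x. A (x + e)) has_real_derivative v (x + e)) (at x)"
        using A DERIV_shift by blast
      then show "((\<lambda>x. A (x + e)) has_vector_derivative v (x + e)) (at x within {0..1})"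
        by (simp add: has_real_derivative_iff_has_vector_derivative has_vector_derivative_at_within)
    qed simp
    then show ?thesis by (simp add: integral_unique)
  qed
  have "((\<lambda>e. A (1 + e) - A e) has_real_derivative 0) (at e)" for e
  proof -
    have "((\<lambda>e. A (e + 1)) has_real_derivative v (e + 1)) (at e)" using A DERIV_shift by blast
    then have "((\<lambda>e. A (e + 1) - A e) has_real_derivative v (e + 1) - v e) (at e)"
      by (intro DERIV_diff A)
    then show ?thesis using assms(1)[of e] by (simp add: add.commute)
  qed
  then have "A (1 + d) - A d = A (1 + 0) - A 0" 
    using DERIV_isconst_all[of "\<lambda>e. A (1 + e) - A e" d 0] by blast
  then show ?thesis using I[of d] I[of 0] by simp
qed

lemma kernel_integral_one: "(\<integral>y. tkernel n (x - y) \<partial>torus) = 1"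
proof -
  have c: "continuous_on UNIV (\<lambda>y. tkernel n (y + e))" for e
    by (rule continuous_on_compose2[OF kernel_cont]) (auto intro!: continuous_intros)
  have "(\<integral>y. tkernel n (x - y) \<partial>torus) = (\<integral>y. tkernel n (y + (- x)) \<partial>torus)"
    using kernel_even[of n "x - y" for y] by (simp add: algebra_simps)
  also have "\<dots> = integral {0..1} (\<lambda>y. tkernel n (y + (- x)))"
    by (rule torus_integral_cont(2)[OF c])
  also have "\<dots> = integral {0..1} (tkernel n)"
    by (rule cont_periodic_integral_shift[OF kernel_periodic kernel_cont])
  also have "\<dots> = 1" unfolding tkernel_def[abs_def] using prekernel_int_pos[of n] by simp
  finally show ?thesis .
qed

lemma kernel_integral_one': "(\<integral>x. tkernel n (x - y) \<partial>torus) = 1"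
  using kernel_integral_one[of n y] kernel_even[of n "x - y" for x] by simp

lemma kernel_concentrates:
  assumes "0 < d" "d \<le> 1/2"
  shows "\<exists>n0. \<forall>n\<ge>n0. \<forall>z. tkernel n z \<noteq> 0 \<longrightarrow> (\<exists>m::int. \<bar>z - m\<bar> < d)"
proof -
  have s: "sin (pi * d) > 0" using assms by (intro sin_gt_zero) (auto simp: pi_gt_zero)
  obtain n0 :: nat where n0: "1 / sin (pi * d) < real n0" using reals_Archimedean2 by blast
  show ?thesis
  proof (intro exI[of _ n0] allI impI)
    fix n z assume n: "n \<ge> n0" and K: "tkernel n z \<noteq> 0"
    define m where "m = round z"
    define r where "r = z - m"
    have r: "\<bar>r\<bar> \<le> 1/2" unfolding r_def m_def using of_int_round_abs_le[of z] by (simp add: abs_minus_commute)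
    have "tkernel n z = tkernel n r"
      using periodic_int_shift[of "tkernel n" r m] kernel_periodic by (simp add: r_def)
    then have "tkernel n \<bar>r\<bar> \<noteq> 0" using K by (simp add: abs_if kernel_even)
    then have lt: "(real (Suc n) * sin (pi * \<bar>r\<bar>))\<^sup>2 < 1"
      by (auto simp: tkernel_def prekernel_def bump_eq_0_iff)
    have "\<bar>r\<bar> < d"
    proof (rule ccontr)
      assume "\<not> \<bar>r\<bar> < d"
      then have le: "sin (pi * d) \<le> sin (pi * \<bar>r\<bar>)"
        using assms r by (intro sin_monotone_2pi_le) (auto intro: order_trans[of _ 0])
      have "1 < real n0 * sin (pi * d)" using n0 s by (simp add: field_simps)
      also have "\<dots> \<le> real (Suc n) * sin (pi * \<bar>r\<bar>)" using n le s by (intro mult_mono) auto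
      finally have "1 < (real (Suc n) * sin (pi * \<bar>r\<bar>))\<^sup>2" by (simp add: one_less_power)
      then show False using lt by simp
    qed
    then show "\<exists>m::int. \<bar>z - m\<bar> < d" unfolding r_def by blast
  qed
qed

lemma cont_periodic_uniform:
  assumes "\<And>x. v (x + 1) = v x" "continuous_on UNIV (v::real\<Rightarrow>real)" "e > 0"
  shows "\<exists>d>0. \<forall>x y. \<bar>x - y\<bar> < d \<longrightarrow> \<bar>v x - v y\<bar> < e"
proof -
  have "uniformly_continuous_on {-1..2} v"
    by (rule compact_uniformly_continuous[OF continuous_on_subset[OF assms(2)]]) auto
  then obtain d where d: "d > 0" "\<And>x y. x \<in> {-1..2} \<Longrightarrow> y \<in> {-1..2} \<Longrightarrow> dist y x < d \<Longrightarrow> dist (v y) (v x) < e"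
    using assms(3) unfolding uniformly_continuous_on_def by metis
  show ?thesis
  proof (intro exI[of _ "min d 1"] conjI allI impI)
    fix x y :: real assume xy: "\<bar>x - y\<bar> < min d 1"
    define k where "k = \<lfloor>x\<rfloor>"
    have kx: "0 \<le> x - k" "x - k < 1" unfolding k_def by linarith+
    have "dist (v (x - k)) (v (y - k)) < e"
      by (rule d(2)) (use kx xy in \<open>auto simp: dist_real_def abs_if split: if_splits\<close>)
    moreover have "v (x - k) = v x" "v (y - k) = v y"
      using periodic_int_shift[of v "x - k" k, OF assms(1)] periodic_int_shift[of v "y - k" k, OF assms(1)] by auto
    ultimately show "\<bar>v x - v y\<bar> < e" by (simp add: dist_real_def)
  qed (use d in auto)
qed

text \<open>The convolution over one period; only kernels of period one are inserted.\<close>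

definition conv :: "(real \<Rightarrow> real) \<Rightarrow> (real \<Rightarrow> real) \<Rightarrow> real \<Rightarrow> real" where
  "conv K v x = (\<integral>y. K (x - y) * v y \<partial>torus)"

definition mollify :: "nat \<Rightarrow> (real \<Rightarrow> real) \<Rightarrow> real \<Rightarrow> real" where
  "mollify n v = conv (tkernel n) v"

lemma conv_cont_eq:
  assumes "continuous_on UNIV K" "continuous_on UNIV (v::real\<Rightarrow>real)"
  shows "conv K v x = integral {0..1} (\<lambda>y. K (x - y) * v y)"
  unfolding conv_def
  by (rule torus_integral_cont(2))
     (auto intro!: continuous_intros assms continuous_on_compose2[OF assms(1)])

lemma conv_DERIV:
  assumes "Ck (Suc 0) K" "continuous_on UNIV (v::real\<Rightarrow>real)"
  shows "(conv K v has_real_derivative conv (deriv K) v x) (at x)"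
proof -
  have c: "continuous_on UNIV K" "continuous_on UNIV (deriv K)"
    using assms(1) Ck_cont Ck_deriv by blast+
  have "((\<lambda>x. integral (cbox 0 1) (\<lambda>y. K (x - y) * v y)) has_real_derivative
      integral (cbox 0 1) (\<lambda>y. deriv K (x - y) * v y)) (at x within UNIV)"
  proof (rule leibniz_rule_field_derivative)
    fix x y :: real
    have "((\<lambda>x. K (x - y)) has_real_derivative deriv K (x - y) * 1) (at x)"
      by (rule DERIV_chain2[OF Ck_DERIV[OF assms(1)]]) (auto intro!: derivative_eq_intros)
    then show "((\<lambda>x. K (x - y) * v y) has_real_derivative deriv K (x - y) * v y) (at x within UNIV)"
      by (auto intro!: derivative_eq_intros)
    show "(\<lambda>y. K (x - y) * v y) integrable_on cbox 0 1"
      by (rule integrable_continuous)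
         (auto intro!: continuous_intros continuous_on_compose2[OF c(1)] continuous_on_subset[OF assms(2)])
  next
    show "continuous_on (UNIV \<times> cbox 0 1) (\<lambda>(x, y). deriv K (x - y) * v y)"
      unfolding case_prod_beta
      by (auto intro!: continuous_intros continuous_on_compose2[OF c(2)] continuous_on_compose2[OF assms(2)])
  qed auto
  moreover have "conv K v = (\<lambda>x. integral (cbox 0 1) (\<lambda>y. K (x - y) * v y))"
    by (rule ext) (simp add: conv_cont_eq[OF c(1) assms(2)])
  ultimately show ?thesis by (simp add: conv_cont_eq[OF c(2) assms(2)])
qed

lemma conv_Ck:
  "(\<And>k. Ck k K) \<Longrightarrow> continuous_on UNIV v \<Longrightarrow> Ck k (conv K v)"
proof (induction k arbitrary: K)
  case 0
  show ?case using conv_DERIV[OF 0(1,2)] by (auto intro!: DERIV_isCont continuous_at_imp_continuous_on)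
next
  case (Suc k)
  show ?case by (rule Ck_SucI[OF conv_DERIV]) (use Suc in \<open>auto intro: Ck_deriv\<close>)
qed

text \<open>Derivatives fall on the kernel, so a convolution is as smooth as its kernel.\<close>

lemma conv_funpow_deriv:
  assumes "\<And>k. Ck k K" "continuous_on UNIV v"
  shows "(deriv ^^ j) (conv K v) = conv ((deriv ^^ j) K) v"
proof (induction j)
  case (Suc j)
  have "deriv (conv ((deriv ^^ j) K) v) = conv (deriv ((deriv ^^ j) K)) v"
    by (intro ext DERIV_imp_deriv conv_DERIV Ck_funpow_deriv assms)
  then show ?case using Suc by simp
qed simp

lemma conv_periodic: "(\<And>x. K (x + 1) = K x) \<Longrightarrow> conv K v (x + 1) = conv K v x"
proof -
  assume p: "\<And>x. K (x + 1) = K x"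
  have "K (x + 1 - y) = K (x - y)" for y using p[of "x - y"] by (simp add: algebra_simps)
  then show ?thesis by (simp add: conv_def)
qed

lemma kernel_shift_L2:
  assumes "\<And>x. K (x + 1) = K x" "continuous_on UNIV (K::real\<Rightarrow>real)"
  shows "(\<lambda>y. K (x - y)) \<in> L2"
proof (rule L2_cont)
  show "K (x - (y + 1)) = K (x - y)" for y using assms(1)[of "x - (y + 1)"] by (simp add: algebra_simps)
qed (auto intro!: continuous_intros continuous_on_compose2[OF assms(2)])

lemma mollify_Ck: "continuous_on UNIV v \<Longrightarrow> Ck k (mollify n v)"
  unfolding mollify_def by (intro conv_Ck kernel_Ck)

lemma mollify_periodic: "mollify n v (x + 1) = mollify n v x"
  unfolding mollify_def by (intro conv_periodic kernel_periodic)

lemma mollify_lincomb: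
  assumes "v \<in> L2" "w \<in> L2"
  shows "mollify n (\<lambda>x. a * v x + b * w x) x = a * mollify n v x + b * mollify n w x"
proof -
  note K = kernel_shift_L2[OF kernel_periodic kernel_cont, of n x]
  have "mollify n (\<lambda>x. a * v x + b * w x) x = (\<integral>y. a * (tkernel n (x - y) * v y) + b * (tkernel n (x - y) * w y) \<partial>torus)"
    by (simp add: mollify_def conv_def algebra_simps)
  then show ?thesis
    using L2_integrable_mult[OF K assms(1)] L2_integrable_mult[OF K assms(2)] by (simp add: mollify_def conv_def)
qed

lemma mollify_uniform:
  assumes "\<And>x. v (x + 1) = v x" "continuous_on UNIV (v::real\<Rightarrow>real)" "e > 0"
  shows "\<exists>n0. \<forall>n\<ge>n0. \<forall>x. \<bar>mollify n v x - v x\<bar> \<le> e"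
proof -
  obtain d where d: "d > 0" "\<And>x y. \<bar>x - y\<bar> < d \<Longrightarrow> \<bar>v x - v y\<bar> < e"
    using cont_periodic_uniform[OF assms] by blast
  obtain n0 where n0: "\<And>n z. n \<ge> n0 \<Longrightarrow> tkernel n z \<noteq> 0 \<Longrightarrow> \<exists>m::int. \<bar>z - m\<bar> < min d (1/2)"
    using kernel_concentrates[of "min d (1/2)"] d(1) by (metis half_gt_zero_iff min.cobounded2 min_less_iff_conj zero_less_one)
  have "\<bar>mollify n v x - v x\<bar> \<le> e" if nn0: "n \<ge> n0" for n x
  proof -
    note K = kernel_shift_L2[OF kernel_periodic kernel_cont, of n x]
    have vL: "v \<in> L2" by (rule L2_cont[OF assms(1,2)])
    have "mollify n v x - v x = (\<integral>y. tkernel n (x - y) * v y \<partial>torus) - (\<integral>y. tkernel n (x - y) \<partial>torus) * v x"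
      by (simp add: mollify_def conv_def kernel_integral_one)
    also have "\<dots> = (\<integral>y. tkernel n (x - y) * v y - tkernel n (x - y) * v x \<partial>torus)"
      using L2_integrable_mult[OF K vL] L2_integrable[OF K] by simp
    also have "\<bar>\<dots>\<bar> \<le> (\<integral>y. \<bar>tkernel n (x - y) * v y - tkernel n (x - y) * v x\<bar> \<partial>torus)"
      by (rule integral_abs_bound)
    also have "\<dots> \<le> (\<integral>y. e * tkernel n (x - y) \<partial>torus)"
    proof (rule integral_mono)
      fix y
      show "\<bar>tkernel n (x - y) * v y - tkernel n (x - y) * v x\<bar> \<le> e * tkernel n (x - y)"
      proof (cases "tkernel n (x - y) = 0")
        case False
        then obtain m :: int where m: "\<bar>x - y - m\<bar> < d" using n0[OF nn0 False] by auto
        have "\<bar>v (y + m) - v x\<bar> < e" by (rule d(2)) (use m in linarith)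
        then have "\<bar>v y - v x\<bar> \<le> e" using periodic_int_shift[of v y m, OF assms(1)] by simp
        then have "tkernel n (x - y) * \<bar>v y - v x\<bar> \<le> tkernel n (x - y) * e"
          using kernel_nonneg by (intro mult_left_mono)
        then show ?thesis unfolding kernel_abs_diff by (simp only: mult.commute)
      qed simp
    qed (use L2_integrable_mult[OF K vL] L2_integrable[OF K] in auto)
    also have "\<dots> = e" by (simp add: kernel_integral_one)
    finally show ?thesis .
  qed
  then show ?thesis by blast
qed

lemma mollify_tendsto:
  assumes "\<And>x. v (x + 1) = v x" "continuous_on UNIV (v::real\<Rightarrow>real)"
  shows "(\<lambda>n. mollify n v x) \<longlonglongrightarrow> v x"
proof (rule LIMSEQ_I)
  fix r :: real assume "r > 0"
  then have "r / 2 > 0" by simp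
  from mollify_uniform[OF assms this] obtain n0 where "\<forall>n\<ge>n0. \<bar>mollify n v x - v x\<bar> \<le> r / 2" by blast
  then show "\<exists>no. \<forall>n\<ge>no. norm (mollify n v x - v x) < r"
    using \<open>r > 0\<close> by (intro exI[of _ n0]) force
qed

text \<open>Young's inequality for a probability kernel. Cauchy-Schwarz with the kernel split into two square roots
  gives the pointwise bound by the average of \<open>g\<^sup>2\<close>; Fubini and the unit mass of the kernel in its
  other variable do the rest.\<close>

lemma kernel_Jensen:
  assumes g: "g \<in> L2" and c: "conv (tkernel n) g \<in> borel_measurable torus"
  shows "conv (tkernel n) g \<in> L2" "L2norm (conv (tkernel n) g) \<le> L2norm g"
proof -
  interpret P: pair_sigma_finite torus torus ..
  define K where "K x y = tkernel n (x - y) * (g y)\<^sup>2" for x y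
  obtain B where B: "\<And>x. \<bar>tkernel n x\<bar> \<le> B" "B \<ge> 0"
    using cont_periodic_bounded[of "tkernel n"] kernel_periodic kernel_cont by blast
  have km: "(\<lambda>y. tkernel n (x - y)) \<in> borel_measurable torus" for x
    using L2D(2)[OF kernel_shift_L2[OF kernel_periodic kernel_cont]] .
  have Kint: "integrable torus (\<lambda>y. K x y)" for x
    unfolding K_def
  proof (rule Bochner_Integration.integrable_bound)
    show "integrable torus (\<lambda>y. B * (g y)\<^sup>2)" using L2D(3)[OF g] by simp
    show "(\<lambda>y. tkernel n (x - y) * (g y)\<^sup>2) \<in> borel_measurable torus" using km L2D(2)[OF g] by measurable
    show "AE y in torus. norm (tkernel n (x - y) * (g y)\<^sup>2) \<le> norm (B * (g y)\<^sup>2)"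
      using B by (auto simp: abs_mult intro!: mult_right_mono)
  qed
  have pw: "(conv (tkernel n) g x)\<^sup>2 \<le> (\<integral>y. K x y \<partial>torus)" for x
  proof -
    have a: "(\<lambda>y. sqrt (tkernel n (x - y))) \<in> L2"
    proof (rule L2_cont)
      show "sqrt (tkernel n (x - (y + 1))) = sqrt (tkernel n (x - y))" for y
        using kernel_periodic[of n "x - (y + 1)"] by (simp add: algebra_simps)
    qed (auto intro!: continuous_intros continuous_on_compose2[OF kernel_cont])
    have b: "(\<lambda>y. sqrt (tkernel n (x - y)) * g y) \<in> L2"
    proof (rule L2I)
      show "integrable torus (\<lambda>y. (sqrt (tkernel n (x - y)) * g y)\<^sup>2)"
        using Kint[of x] by (simp add: K_def power_mult_distrib kernel_nonneg)
    qed (use L2D(1,2)[OF a] L2D(1,2)[OF g] in auto)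
    have "\<bar>\<integral>y. sqrt (tkernel n (x - y)) * (sqrt (tkernel n (x - y)) * g y) \<partial>torus\<bar>
       \<le> L2norm (\<lambda>y. sqrt (tkernel n (x - y))) * L2norm (\<lambda>y. sqrt (tkernel n (x - y)) * g y)"
      by (rule L2_Cauchy_Schwarz[OF a b])
    then have "\<bar>conv (tkernel n) g x\<bar> \<le> sqrt (\<integral>y. tkernel n (x - y) \<partial>torus) * sqrt (\<integral>y. K x y \<partial>torus)"
      by (simp add: L2norm_def K_def power_mult_distrib kernel_nonneg conv_def mult.assoc[symmetric])
    then have "\<bar>conv (tkernel n) g x\<bar> \<le> sqrt (\<integral>y. K x y \<partial>torus)" by (simp add: kernel_integral_one)
    then have "\<bar>conv (tkernel n) g x\<bar>\<^sup>2 \<le> (sqrt (\<integral>y. K x y \<partial>torus))\<^sup>2" by (intro power_mono) auto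
    also have "\<dots> = (\<integral>y. K x y \<partial>torus)"
      by (simp add: K_def kernel_nonneg integral_nonneg_AE)
    finally show ?thesis by simp
  qed
  have Bk: "tkernel n x \<le> B" for x using B(1)[of x] by linarith
  have pw': "norm ((conv (tkernel n) g x)\<^sup>2) \<le> norm (\<integral>y. K x y \<partial>torus)" for x
    using pw[of x] abs_ge_self[of "\<integral>y. K x y \<partial>torus"] by simp
  have Kle: "(\<integral>y. K x y \<partial>torus) \<le> B * (L2norm g)\<^sup>2" for x
  proof -
    have "(\<integral>y. K x y \<partial>torus) \<le> (\<integral>y. B * (g y)\<^sup>2 \<partial>torus)"
      by (rule integral_mono[OF Kint])
         (use L2D(3)[OF g] Bk in \<open>auto simp: K_def intro!: mult_right_mono\<close>)
    then show ?thesis by (simp add: L2norm_sq)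
  qed
  have idb: "(\<lambda>x. x) \<in> borel_measurable torus" using id_borel_measurable_lebesgue_on[of "{0..<1::real}"] by (simp add: id_def)
  have diffm: "(\<lambda>p. fst p - snd p) \<in> borel_measurable (torus \<Otimes>\<^sub>M torus)"
    by (intro borel_measurable_diff measurable_compose[OF measurable_fst idb] measurable_compose[OF measurable_snd idb])
  have kb: "tkernel n \<in> borel_measurable borel" by (rule borel_measurable_continuous_onI[OF kernel_cont])
  have Km: "(\<lambda>p. K (fst p) (snd p)) \<in> borel_measurable (torus \<Otimes>\<^sub>M torus)"
    unfolding K_def
    by (intro borel_measurable_times borel_measurable_power measurable_compose[OF diffm kb] measurable_compose[OF measurable_snd L2D(2)[OF g]])
  have Knn: "norm (K x y) = K x y" for x y by (simp add: K_def kernel_nonneg)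
  have Im: "(\<lambda>x. \<integral>y. K x y \<partial>torus) \<in> borel_measurable torus"
    using Km by (intro torus.borel_measurable_lebesgue_integral) (simp add: case_prod_beta)
  have Iint: "integrable torus (\<lambda>x. \<integral>y. K x y \<partial>torus)"
    by (rule torus.integrable_const_bound[of _ "B * (L2norm g)\<^sup>2"])
       (use Kle Im in \<open>auto simp: K_def kernel_nonneg integral_nonneg_AE\<close>)
  have int2: "integrable (torus \<Otimes>\<^sub>M torus) (case_prod K)"
    by (rule P.Fubini_integrable) (use Km Iint Kint Knn in \<open>auto simp: case_prod_beta\<close>)
  have sq: "integrable torus (\<lambda>x. (conv (tkernel n) g x)\<^sup>2)"
    by (rule Bochner_Integration.integrable_bound[OF Iint])
       (use c pw' in auto)
  then show L: "conv (tkernel n) g \<in> L2" by (intro L2I c conv_periodic kernel_periodic)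
  have "(\<integral>x. (conv (tkernel n) g x)\<^sup>2 \<partial>torus) \<le> (\<integral>x. (\<integral>y. K x y \<partial>torus) \<partial>torus)"
    by (rule integral_mono[OF sq Iint]) (rule pw)
  also have "\<dots> = (\<integral>y. (\<integral>x. K x y \<partial>torus) \<partial>torus)"
    by (rule P.Fubini_integral[OF int2, symmetric])
  also have "\<dots> = (\<integral>y. (g y)\<^sup>2 \<partial>torus)"
    by (simp add: K_def kernel_integral_one')
  finally show "L2norm (conv (tkernel n) g) \<le> L2norm g" unfolding L2norm_def by (rule real_sqrt_le_mono)
qed

section \<open>Weak derivatives and Sobolev seminorms\<close>

lemma smooth_Ck: "smooth \<phi> \<Longrightarrow> Ck k \<phi>"
  by (simp add: smooth_def)

lemma smooth_mollify: "continuous_on UNIV v \<Longrightarrow> smooth (mollify n v)"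
  by (simp add: smooth_def mollify_Ck)

lemma periodic'_iff: "periodic_fun_simple' v \<longleftrightarrow> (\<forall>x. v (x + 1) = v x)"
  by (auto simp: periodic_fun_simple'_def)

lemma kernel_reflected_Ck: "Ck k (\<lambda>y. tkernel n (x - y))"
  by (rule Ck_compose[OF kernel_Ck]) (intro Ck_diff Ck_const Ck_ident)

lemma kernel_reflected_smooth: "smooth (\<lambda>y. tkernel n (x - y))"
  by (simp add: smooth_def kernel_reflected_Ck)

lemma kernel_reflected_periodic: "tkernel n (x - (y + 1)) = tkernel n (x - y)"
  using kernel_periodic[of n "x - (y + 1)"] by (simp add: algebra_simps)

lemma kernel_reflected_deriv:
  "(deriv ^^ j) (\<lambda>y. tkernel n (x - y)) = (\<lambda>y. (- 1) ^ j * (deriv ^^ j) (tkernel n) (x - y))"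
  using funpow_deriv_affine[of j "tkernel n" "-1" x] kernel_Ck by (simp add: algebra_simps)

lemma smooth_deriv_L2:
  assumes "smooth \<phi>" "\<And>x. \<phi> (x + 1) = \<phi> x"
  shows "(deriv ^^ j) \<phi> \<in> L2"
proof (rule L2_cont)
  show "(deriv ^^ j) \<phi> (x + 1) = (deriv ^^ j) \<phi> x" for x
    by (rule funpow_deriv_periodic) (rule assms(2))
  show "continuous_on UNIV ((deriv ^^ j) \<phi>)"
    by (rule Ck_cont[OF Ck_funpow_deriv[of j 0]]) (simp add: smooth_Ck assms)
qed

lemma mollify_bound:
  assumes "continuous_on UNIV (c::real\<Rightarrow>real)" "\<And>y. y \<in> {0..<1} \<Longrightarrow> \<bar>c y\<bar> \<le> B"
  shows "\<bar>mollify n c x\<bar> \<le> B"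
proof -
  have i: "integrable torus (\<lambda>y. tkernel n (x - y) * c y)"
    by (rule torus_integral_cont)
       (auto intro!: continuous_intros assms continuous_on_compose2[OF kernel_cont])
  have k: "integrable torus (\<lambda>y. tkernel n (x - y))"
    by (rule torus_integral_cont)
       (auto intro!: continuous_intros continuous_on_compose2[OF kernel_cont])
  have "\<bar>mollify n c x\<bar> \<le> (\<integral>y. \<bar>tkernel n (x - y) * c y\<bar> \<partial>torus)"
    unfolding mollify_def conv_def by (rule integral_abs_bound)
  also have "\<dots> \<le> (\<integral>y. B * tkernel n (x - y) \<partial>torus)"
  proof (rule integral_mono)
    fix y assume "y \<in> space torus"
    then have "\<bar>tkernel n (x - y)\<bar> * \<bar>c y\<bar> \<le> tkernel n (x - y) * B"
      using assms(2)[of y] kernel_nonneg[of n "x - y"] by (auto intro!: mult_left_mono)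
    then show "\<bar>tkernel n (x - y) * c y\<bar> \<le> B * tkernel n (x - y)" by (simp add: abs_mult mult.commute)
  qed (use i k in auto)
  also have "\<dots> = B" by (simp add: kernel_integral_one)
  finally show ?thesis .
qed

text \<open>A function that is continuous but not periodic jumps at the integers; its mollifications still converge
  at interior points.\<close>

lemma mollify_tendsto_interior:
  assumes "continuous_on UNIV (c::real\<Rightarrow>real)" "0 < x" "x < 1"
  shows "(\<lambda>n. mollify n c x) \<longlonglongrightarrow> c x"
proof (rule LIMSEQ_I)
  fix r :: real assume r: "r > 0"
  have "isCont c x" using assms(1) by (simp add: continuous_on_eq_continuous_at)
  then obtain d where d: "d > 0" "\<And>y. \<bar>y - x\<bar> < d \<Longrightarrow> \<bar>c y - c x\<bar> < r / 2"
    using r unfolding continuous_at_eps_delta by (metis dist_real_def half_gt_zero)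
  define d' where "d' = min d (min (x/2) ((1 - x)/2))"
  have d': "0 < d'" "d' \<le> 1/2" "d' \<le> d" "d' \<le> x/2" "d' \<le> (1-x)/2"
    using d assms unfolding d'_def min_def by (auto split: if_splits)
  obtain n0 where n0: "\<And>n z. n \<ge> n0 \<Longrightarrow> tkernel n z \<noteq> 0 \<Longrightarrow> \<exists>m::int. \<bar>z - m\<bar> < d'"
    using kernel_concentrates[OF d'(1,2)] by metis
  have "norm (mollify n c x - c x) < r" if nn0: "n \<ge> n0" for n
  proof -
    have i: "integrable torus (\<lambda>y. tkernel n (x - y) * c y)"
      by (rule torus_integral_cont)
         (auto intro!: continuous_intros assms continuous_on_compose2[OF kernel_cont])
    have k: "integrable torus (\<lambda>y. tkernel n (x - y))"
      by (rule torus_integral_cont)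
         (auto intro!: continuous_intros continuous_on_compose2[OF kernel_cont])
    have "mollify n c x - c x = (\<integral>y. tkernel n (x - y) * c y \<partial>torus) - (\<integral>y. tkernel n (x - y) \<partial>torus) * c x"
      by (simp add: mollify_def conv_def kernel_integral_one)
    also have "\<dots> = (\<integral>y. tkernel n (x - y) * c y - tkernel n (x - y) * c x \<partial>torus)"
      using i k by simp
    also have "\<bar>\<dots>\<bar> \<le> (\<integral>y. \<bar>tkernel n (x - y) * c y - tkernel n (x - y) * c x\<bar> \<partial>torus)"
      by (rule integral_abs_bound)
    also have "\<dots> \<le> (\<integral>y. (r / 2) * tkernel n (x - y) \<partial>torus)"
    proof (rule integral_mono)
      fix y assume "y \<in> space torus"
      then have y: "0 \<le> y" "y < 1" by auto
      show "\<bar>tkernel n (x - y) * c y - tkernel n (x - y) * c x\<bar> \<le> (r / 2) * tkernel n (x - y)"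
      proof (cases "tkernel n (x - y) = 0")
        case False
        then obtain m :: int where m: "\<bar>x - y - m\<bar> < d'" using n0[OF nn0 False] by auto
        then have m': "x - y - m < d'" "- d' < x - y - m" by (auto simp: abs_less_iff)
        have "real_of_int m < 1" using m' y d' assms(2,3) by argo
        moreover have "real_of_int m > -1" using m' y d' assms(2,3) by argo
        ultimately have "m = 0" by linarith
        then have "\<bar>c y - c x\<bar> \<le> r / 2" using d(2)[of y] m d' by (simp add: abs_minus_commute)
        then have "tkernel n (x - y) * \<bar>c y - c x\<bar> \<le> tkernel n (x - y) * (r / 2)"
          using kernel_nonneg by (intro mult_left_mono)
        then show ?thesis unfolding kernel_abs_diff by (simp only: mult.commute)
      qed simp
    qed (use i k in auto)
    also have "\<dots> < r" using r by (simp add: kernel_integral_one)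
    finally show ?thesis by simp
  qed
  then show "\<exists>no. \<forall>n\<ge>no. norm (mollify n c x - c x) < r" by blast
qed

lemma AE_torus_interior: "AE x in torus. 0 < x \<and> x < 1"
proof -
  have "{0} \<in> null_sets torus" by simp
  then have "AE x in torus. x \<notin> {0}" by (rule AE_not_in)
  moreover have "AE x in torus. x \<in> space torus" by (rule AE_space)
  ultimately show ?thesis by eventually_elim auto
qed

text \<open>Smooth periodic functions suffice to test against continuous ones: mollifications are bounded and
  converge almost everywhere.\<close>

lemma L2_orthogonal_cont:
  assumes d: "d \<in> L2" and orth: "\<And>\<phi>. smooth \<phi> \<Longrightarrow> (\<And>x. \<phi> (x + 1) = \<phi> x) \<Longrightarrow> (\<integral>x. d x * \<phi> x \<partial>torus) = 0"
    and c: "continuous_on UNIV c" 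
  shows "(\<integral>x. d x * c x \<partial>torus) = 0"
proof -
  have "compact (c ` {0..1})"
    by (rule compact_continuous_image[OF continuous_on_subset[OF c]]) auto
  then obtain B where B: "\<forall>x\<in>{0..1}. norm (c x) \<le> B"
    by (metis bounded_iff compact_imp_bounded image_eqI)
  have "(\<lambda>n. \<integral>x. d x * mollify n c x \<partial>torus) \<longlonglongrightarrow> (\<integral>x. d x * c x \<partial>torus)"
  proof (rule integral_dominated_convergence)
    show "integrable torus (\<lambda>x. B * \<bar>d x\<bar>)" using L2_integrable[OF d] by simp
    show "AE x in torus. (\<lambda>n. d x * mollify n c x) \<longlonglongrightarrow> d x * c x"
      using AE_torus_interior
      by eventually_elim (auto intro!: tendsto_mult mollify_tendsto_interior[OF c])
    show "AE x in torus. norm (d x * mollify n c x) \<le> B * \<bar>d x\<bar>" for n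
    proof (rule AE_I2)
      fix x
      have "\<bar>mollify n c x\<bar> \<le> B" by (rule mollify_bound[OF c]) (use B in auto)
      then have "\<bar>d x\<bar> * \<bar>mollify n c x\<bar> \<le> \<bar>d x\<bar> * B" by (intro mult_left_mono) auto
      then show "norm (d x * mollify n c x) \<le> B * \<bar>d x\<bar>" by (simp add: abs_mult mult.commute)
    qed
    show "(\<lambda>x. d x * c x) \<in> borel_measurable torus"
      using L2D(2)[OF d] cont_measurable_torus[OF c] by simp
    show "(\<lambda>x. d x * mollify n c x) \<in> borel_measurable torus" for n
      using L2D(2)[OF d] cont_measurable_torus[OF Ck_cont[OF mollify_Ck[OF c]]] by simp
  qed
  moreover have "(\<integral>x. d x * mollify n c x \<partial>torus) = 0" for n
    by (rule orth) (auto intro: smooth_mollify c mollify_periodic)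
  ultimately show ?thesis by (simp add: LIMSEQ_const_iff)
qed

text \<open>Fundamental lemma of the calculus of variations. Testing with continuous functions that converge almost
  everywhere to \<open>d / (1 + |d|)\<close> gives a vanishing integral of a nonnegative function; the denominator
  keeps the test functions bounded.\<close>

lemma L2_orthogonal_zero:
  assumes d: "d \<in> L2" and orth: "\<And>\<phi>. smooth \<phi> \<Longrightarrow> (\<And>x. \<phi> (x + 1) = \<phi> x) \<Longrightarrow> (\<integral>x. d x * \<phi> x \<partial>torus) = 0"
  shows "AE x in torus. d x = 0"
proof -
  define u where "u x = (if x \<in> {0..<1} then d x else 0)" for x
  have "u \<in> borel_measurable lebesgue"
    unfolding u_def using L2D(2)[OF d] by (intro borel_measurable_if_I) auto
  then have "u measurable_on UNIV" by (rule lebesgue_measurable_imp_measurable_on_real) simp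
  then obtain N g where N: "negligible N" and g: "\<And>n. continuous_on UNIV (g n)"
    and lim: "\<And>x. x \<notin> N \<Longrightarrow> (\<lambda>n. g n x) \<longlonglongrightarrow> u x"
    unfolding measurable_on_def by auto
  \<comment> \<open>Bounded test functions that converge almost everywhere to \<open>d / (1 + |d|)\<close>.\<close>
  define h where "h n x = g n x / (1 + \<bar>g n x\<bar>)" for n x
  have hc: "continuous_on UNIV (h n)" for n
    unfolding h_def by (intro continuous_intros g) (simp add: add_nonneg_eq_0_iff)
  have "AE x in lebesgue. x \<notin> N" using N by (simp add: AE_not_in negligible_iff_null_sets)
  then have NE: "AE x in torus. x \<notin> N" by (subst AE_restrict_space_iff) auto
  have z: "(\<integral>x. d x * h n x \<partial>torus) = 0" for n by (rule L2_orthogonal_cont[OF d orth hc])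
  have hb: "\<bar>h n x\<bar> \<le> 1" for n x by (simp add: h_def divide_simps)
  have "(\<lambda>n. \<integral>x. d x * h n x \<partial>torus) \<longlonglongrightarrow> (\<integral>x. d x * (d x / (1 + \<bar>d x\<bar>)) \<partial>torus)"
  proof (rule integral_dominated_convergence)
    show "integrable torus (\<lambda>x. \<bar>d x\<bar>)" using L2_integrable[OF d] by simp
    have sp: "AE x in torus. x \<in> space torus" by (rule AE_space)
    show "AE x in torus. (\<lambda>n. d x * h n x) \<longlonglongrightarrow> d x * (d x / (1 + \<bar>d x\<bar>))"
      using NE sp
    proof eventually_elim
      case (elim x)
      then have "(\<lambda>n. g n x) \<longlonglongrightarrow> d x" using lim[of x] by (simp add: u_def)
      then show ?case unfolding h_def by (intro tendsto_intros) (auto simp: add_nonneg_eq_0_iff)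
    qed
    show "AE x in torus. norm (d x * h n x) \<le> \<bar>d x\<bar>" for n
      using hb[of n] by (auto simp: abs_mult mult_left_le intro!: AE_I2)
  qed (use L2D(2)[OF d] cont_measurable_torus[OF hc] in auto)
  then have I0: "(\<integral>x. d x * (d x / (1 + \<bar>d x\<bar>)) \<partial>torus) = 0" using z by (simp add: LIMSEQ_const_iff)
  have nn: "0 \<le> d x * (d x / (1 + \<bar>d x\<bar>))" for x by simp
  have int: "integrable torus (\<lambda>x. d x * (d x / (1 + \<bar>d x\<bar>)))"
  proof (rule Bochner_Integration.integrable_bound)
    show "integrable torus (\<lambda>x. \<bar>d x\<bar>)" using L2_integrable[OF d] by simp
    show "AE x in torus. norm (d x * (d x / (1 + \<bar>d x\<bar>))) \<le> norm \<bar>d x\<bar>"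
    proof (rule AE_I2)
      fix x
      have "\<bar>d x\<bar> * (\<bar>d x\<bar> / (1 + \<bar>d x\<bar>)) \<le> \<bar>d x\<bar> * 1" by (intro mult_left_mono) auto
      then show "norm (d x * (d x / (1 + \<bar>d x\<bar>))) \<le> norm \<bar>d x\<bar>" by (simp add: abs_mult)
    qed
  qed (use L2D(2)[OF d] in auto)
  have "AE x in torus. d x * (d x / (1 + \<bar>d x\<bar>)) = 0"
    using integral_nonneg_eq_0_iff_AE[OF int] I0 nn by simp
  then show ?thesis by eventually_elim (auto simp: add_nonneg_eq_0_iff)
qed

lemma has_weak_derivD:
  assumes "has_weak_deriv k v g"
  shows "g \<in> L2" "smooth \<phi> \<Longrightarrow> (\<And>x. \<phi> (x + 1) = \<phi> x) \<Longrightarrow>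
    (\<integral>x. v x * (deriv ^^ k) \<phi> x \<partial>torus) = (-1) ^ k * (\<integral>x. g x * \<phi> x \<partial>torus)"
  using assms by (auto simp: has_weak_deriv_def periodic'_iff)

lemma has_weak_derivI:
  assumes "g \<in> L2" "\<And>\<phi>. smooth \<phi> \<Longrightarrow> (\<And>x. \<phi> (x + 1) = \<phi> x) \<Longrightarrow>
    (\<integral>x. v x * (deriv ^^ k) \<phi> x \<partial>torus) = (-1) ^ k * (\<integral>x. g x * \<phi> x \<partial>torus)"
  shows "has_weak_deriv k v g"
  using assms by (auto simp: has_weak_deriv_def periodic'_iff)

lemma smooth_L2: "smooth \<phi> \<Longrightarrow> (\<And>x. \<phi> (x + 1) = \<phi> x) \<Longrightarrow> \<phi> \<in> L2"
  using smooth_deriv_L2[of \<phi> 0] by simp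

lemma has_weak_deriv_unique:
  assumes "has_weak_deriv k v g" "has_weak_deriv k v h"
  shows "AE x in torus. g x = h x" "L2norm g = L2norm h"
proof -
  note gh = has_weak_derivD(1)[OF assms(1)] has_weak_derivD(1)[OF assms(2)]
  have "AE x in torus. g x - h x = 0"
  proof (rule L2_orthogonal_zero[OF L2_diff[OF gh]])
    fix \<phi> assume \<phi>: "smooth \<phi>" "\<And>x. \<phi> (x + 1) = \<phi> x"
    have "(\<integral>x. g x * \<phi> x \<partial>torus) = (\<integral>x. h x * \<phi> x \<partial>torus)"
      using has_weak_derivD(2)[OF assms(1) \<phi>] has_weak_derivD(2)[OF assms(2) \<phi>] by simp
    then show "(\<integral>x. (g x - h x) * \<phi> x \<partial>torus) = 0"
      using L2_integrable_mult[OF gh(1) smooth_L2[OF \<phi>]] L2_integrable_mult[OF gh(2) smooth_L2[OF \<phi>]]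
      by (simp add: left_diff_distrib)
  qed
  then show "AE x in torus. g x = h x" by simp
  then show "L2norm g = L2norm h" by (intro L2norm_cong_AE) (use L2D(2) gh in auto)
qed

lemma weak_deriv_spec: "has_weak_deriv k v g \<Longrightarrow> has_weak_deriv k v (weak_deriv k v)"
  using someI[of "has_weak_deriv k v" g] by (simp add: weak_deriv_def)

lemma Hsemi_eq: "has_weak_deriv k v g \<Longrightarrow> Hsemi k v = L2norm g"
  unfolding Hsemi_def using has_weak_deriv_unique(2) weak_deriv_spec by blast

lemma Hsemi_nonneg [simp]: "Hsemi k v \<ge> 0"
  by (simp add: Hsemi_def)

lemma HsobD:
  assumes "v \<in> Hsob k"
  shows "v \<in> L2" "k > 0 \<Longrightarrow> continuous_on UNIV v" "v (x + 1) = v x"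
    "j \<le> k \<Longrightarrow> has_weak_deriv j v (weak_deriv j v)"
  using assms L2D(1)[of v x] weak_deriv_spec by (auto simp: Hsob_def)

lemma Hsob_mono: "v \<in> Hsob k \<Longrightarrow> j \<le> k \<Longrightarrow> v \<in> Hsob j"
  by (auto simp: Hsob_def)

lemma has_weak_deriv_lincomb:
  assumes "v \<in> L2" "w \<in> L2" "has_weak_deriv k v g" "has_weak_deriv k w h"
  shows "has_weak_deriv k (\<lambda>x. a * v x + b * w x) (\<lambda>x. a * g x + b * h x)"
proof (rule has_weak_derivI)
  show "(\<lambda>x. a * g x + b * h x) \<in> L2"
    using has_weak_derivD(1)[OF assms(3)] has_weak_derivD(1)[OF assms(4)] by (intro L2_add L2_cmult)
  fix \<phi> assume \<phi>: "smooth \<phi>" "\<And>x. \<phi> (x + 1) = \<phi> x"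
  note gh = has_weak_derivD(1)[OF assms(3)] has_weak_derivD(1)[OF assms(4)]
  note D = smooth_deriv_L2[OF \<phi>, of k]
  have "(\<integral>x. (a * v x + b * w x) * (deriv ^^ k) \<phi> x \<partial>torus)
    = (\<integral>x. a * (v x * (deriv ^^ k) \<phi> x) + b * (w x * (deriv ^^ k) \<phi> x) \<partial>torus)"
    by (simp add: algebra_simps)
  also have "\<dots> = a * (\<integral>x. v x * (deriv ^^ k) \<phi> x \<partial>torus) + b * (\<integral>x. w x * (deriv ^^ k) \<phi> x \<partial>torus)"
    using L2_integrable_mult[OF assms(1) D] L2_integrable_mult[OF assms(2) D] by simp
  also have "\<dots> = (-1) ^ k * (a * (\<integral>x. g x * \<phi> x \<partial>torus) + b * (\<integral>x. h x * \<phi> x \<partial>torus))"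
    using has_weak_derivD(2)[OF assms(3) \<phi>] has_weak_derivD(2)[OF assms(4) \<phi>] by (simp add: algebra_simps)
  also have "a * (\<integral>x. g x * \<phi> x \<partial>torus) + b * (\<integral>x. h x * \<phi> x \<partial>torus) = (\<integral>x. a * (g x * \<phi> x) + b * (h x * \<phi> x) \<partial>torus)"
    using L2_integrable_mult[OF gh(1) smooth_L2[OF \<phi>]] L2_integrable_mult[OF gh(2) smooth_L2[OF \<phi>]] by simp
  finally show "(\<integral>x. (a * v x + b * w x) * (deriv ^^ k) \<phi> x \<partial>torus) = (-1) ^ k * (\<integral>x. (a * g x + b * h x) * \<phi> x \<partial>torus)"
    by (simp add: algebra_simps)
qed

lemma Hsob_lincomb:
  assumes "v \<in> Hsob k" "w \<in> Hsob k"
  shows "(\<lambda>x. a * v x + b * w x) \<in> Hsob k"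
    "j \<le> k \<Longrightarrow> Hsemi j (\<lambda>x. a * v x + b * w x) \<le> \<bar>a\<bar> * Hsemi j v + \<bar>b\<bar> * Hsemi j w"
proof -
  note L = HsobD(1)[OF assms(1)] HsobD(1)[OF assms(2)]
  have wd: "has_weak_deriv j (\<lambda>x. a * v x + b * w x) (\<lambda>x. a * weak_deriv j v x + b * weak_deriv j w x)" if "j \<le> k" for j
    by (intro has_weak_deriv_lincomb L HsobD(4)[OF assms(1)] HsobD(4)[OF assms(2)] that)
  show "(\<lambda>x. a * v x + b * w x) \<in> Hsob k"
    unfolding Hsob_def
  proof (safe)
    show "(\<lambda>x. a * v x + b * w x) \<in> L2" by (intro L2_add L2_cmult L)
    show "continuous_on UNIV (\<lambda>x. a * v x + b * w x)" if "k > 0"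
      by (intro continuous_intros HsobD(2)[OF assms(1)] HsobD(2)[OF assms(2)] that)
  qed (use wd in blast)
  show "Hsemi j (\<lambda>x. a * v x + b * w x) \<le> \<bar>a\<bar> * Hsemi j v + \<bar>b\<bar> * Hsemi j w" if "j \<le> k"
  proof -
    have l: "weak_deriv j v \<in> L2" "weak_deriv j w \<in> L2"
      using HsobD(4)[OF assms(1) that] HsobD(4)[OF assms(2) that] has_weak_derivD(1) by blast+
    have "Hsemi j (\<lambda>x. a * v x + b * w x) = L2norm (\<lambda>x. a * weak_deriv j v x + b * weak_deriv j w x)"
      by (rule Hsemi_eq[OF wd[OF that]])
    also have "\<dots> \<le> L2norm (\<lambda>x. a * weak_deriv j v x) + L2norm (\<lambda>x. b * weak_deriv j w x)"
      by (intro L2norm_triangle L2_cmult l)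
    finally show ?thesis by (simp add: L2norm_cmult Hsemi_def)
  qed
qed

lemma Hsob_add: "v \<in> Hsob k \<Longrightarrow> w \<in> Hsob k \<Longrightarrow> (\<lambda>x. v x + w x) \<in> Hsob k"
  using Hsob_lincomb(1)[of v k w 1 1] by simp

lemma Hsob_diff: "v \<in> Hsob k \<Longrightarrow> w \<in> Hsob k \<Longrightarrow> (\<lambda>x. v x - w x) \<in> Hsob k"
  using Hsob_lincomb(1)[of v k w 1 "-1"] by simp

lemma Hsob_cmult: "v \<in> Hsob k \<Longrightarrow> (\<lambda>x. a * v x) \<in> Hsob k"
  using Hsob_lincomb(1)[of v k v a 0] by simp

lemma Hsemi_add: "v \<in> Hsob k \<Longrightarrow> w \<in> Hsob k \<Longrightarrow> j \<le> k \<Longrightarrow> Hsemi j (\<lambda>x. v x + w x) \<le> Hsemi j v + Hsemi j w"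
  using Hsob_lincomb(2)[of v k w j 1 1] by simp

lemma Hsemi_cmult_le: "v \<in> Hsob k \<Longrightarrow> j \<le> k \<Longrightarrow> Hsemi j (\<lambda>x. a * v x) \<le> \<bar>a\<bar> * Hsemi j v"
  using Hsob_lincomb(2)[of v k v j a 0] by simp

lemma Hsemi_uminus: "v \<in> Hsob k \<Longrightarrow> j \<le> k \<Longrightarrow> Hsemi j (\<lambda>x. - v x) = Hsemi j v"
  using Hsemi_cmult_le[of v k j "-1"] Hsemi_cmult_le[of "\<lambda>x. - v x" k j "-1"] Hsob_cmult[of v k "-1"] by simp

lemma torus_integral_deriv_zero:
  assumes "Ck (Suc 0) h" "\<And>x. h (x + 1) = h x"
  shows "(\<integral>x. deriv h x \<partial>torus) = 0"
proof -
  have "((deriv h) has_integral (h 1 - h 0)) {0..1}"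
    by (rule fundamental_theorem_of_calculus)
       (auto intro!: has_field_derivative_at_within[OF Ck_DERIV[OF assms(1)]] simp: has_real_derivative_iff_has_vector_derivative[symmetric])
  then have "integral {0..1} (deriv h) = 0" using assms(2)[of 0] by (simp add: integral_unique)
  then show ?thesis using torus_integral_cont(2)[of "deriv h"] Ck_deriv[OF assms(1)] by simp
qed

text \<open>Integration by parts moves one derivative at a time; no boundary terms appear because the product is
  periodic.\<close>

lemma has_weak_deriv_classical:
  assumes "Ck k v" "\<And>x. v (x + 1) = v x"
  shows "has_weak_deriv k v ((deriv ^^ k) v)"
  using assms
proof (induction k arbitrary: v)
  case 0
  then show ?case by (intro has_weak_derivI) (auto intro: L2_cont)
next
  case (Suc k)
  have p: "deriv v (x + 1) = deriv v x" for x using Suc.prems(2) by (rule deriv_periodic)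
  note IH = Suc.IH[OF Ck_deriv[OF Suc.prems(1)] p]
  have v1: "Ck (Suc 0) v" using Ck_mono[OF Suc.prems(1)] by simp
  show ?case
  proof (rule has_weak_derivI)
    show "(deriv ^^ Suc k) v \<in> L2"
      unfolding deriv_funpow_Suc by (rule has_weak_derivD(1)[OF IH])
    fix \<phi> assume \<phi>: "smooth \<phi>" "\<And>x. \<phi> (x + 1) = (\<phi> x :: real)"
    define \<psi> where "\<psi> = (deriv ^^ k) \<phi>"
    have \<psi>: "Ck (Suc 0) \<psi>" unfolding \<psi>_def by (rule Ck_funpow_deriv) (rule smooth_Ck[OF \<phi>(1)])
    have \<psi>p: "\<psi> (x + 1) = \<psi> x" for x unfolding \<psi>_def by (rule funpow_deriv_periodic) (rule \<phi>(2))
    have dm: "deriv (\<lambda>x. v x * \<psi> x) = (\<lambda>x. deriv v x * \<psi> x + v x * deriv \<psi> x)"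
      by (rule ext, rule DERIV_imp_deriv) (auto intro!: derivative_eq_intros Ck_DERIV v1 \<psi>)
    have c: "continuous_on UNIV (deriv v)" "continuous_on UNIV (deriv \<psi>)" "continuous_on UNIV v" "continuous_on UNIV \<psi>"
      using Ck_deriv[OF v1] Ck_deriv[OF \<psi>] Ck_cont[OF v1] Ck_cont[OF \<psi>] by auto
    have "0 = (\<integral>x. deriv v x * \<psi> x + v x * deriv \<psi> x \<partial>torus)"
      using torus_integral_deriv_zero[of "\<lambda>x. v x * \<psi> x"] Ck_mult[OF v1 \<psi>] Suc.prems(2) \<psi>p
      unfolding dm by simp
    also have "\<dots> = (\<integral>x. deriv v x * \<psi> x \<partial>torus) + (\<integral>x. v x * deriv \<psi> x \<partial>torus)"
      by (intro Bochner_Integration.integral_add torus_integral_cont continuous_intros c)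
    finally have "(\<integral>x. v x * deriv \<psi> x \<partial>torus) = - (\<integral>x. deriv v x * \<psi> x \<partial>torus)" by simp
    then show "(\<integral>x. v x * (deriv ^^ Suc k) \<phi> x \<partial>torus) = (- 1) ^ Suc k * (\<integral>x. (deriv ^^ Suc k) v x * \<phi> x \<partial>torus)"
      using has_weak_derivD(2)[OF IH \<phi>] unfolding \<psi>_def deriv_funpow_Suc[of k v] by simp
  qed
qed

lemma Hsob_classical:
  assumes "Ck k v" "\<And>x. v (x + 1) = v x"
  shows "v \<in> Hsob k" "j \<le> k \<Longrightarrow> Hsemi j v = L2norm ((deriv ^^ j) v)"
proof -
  have w: "has_weak_deriv j v ((deriv ^^ j) v)" if "j \<le> k" for j
    by (rule has_weak_deriv_classical[OF Ck_mono[OF assms(1) that] assms(2)])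
  show "v \<in> Hsob k" unfolding Hsob_def using w L2_cont[OF assms(2) Ck_cont[OF assms(1)]] Ck_cont[OF assms(1)] by blast
  show "j \<le> k \<Longrightarrow> Hsemi j v = L2norm ((deriv ^^ j) v)" using Hsemi_eq w by blast
qed

lemma has_weak_deriv_0: "v \<in> L2 \<Longrightarrow> has_weak_deriv 0 v v"
  by (intro has_weak_derivI) auto

lemma Hsemi_0: "v \<in> L2 \<Longrightarrow> Hsemi 0 v = L2norm v"
  by (rule Hsemi_eq[OF has_weak_deriv_0])

text \<open>The derivative falls on the reflected kernel, which is a legitimate test function; hence the derivative
  of the mollification is the mollification of the weak derivative.\<close>

lemma mollify_Hsemi:
  assumes "v \<in> Hsob k" "k > 0" "j \<le> k"
  shows "L2norm ((deriv ^^ j) (mollify n v)) \<le> Hsemi j v"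
proof -
  note w = HsobD(4)[OF assms(1,3)]
  note c = HsobD(2)[OF assms(1,2)]
  have eq: "(deriv ^^ j) (mollify n v) = conv (tkernel n) (weak_deriv j v)"
  proof
    fix x
    have "(deriv ^^ j) (mollify n v) x = (\<integral>y. (deriv ^^ j) (tkernel n) (x - y) * v y \<partial>torus)"
      unfolding mollify_def conv_funpow_deriv[OF kernel_Ck c] by (simp add: conv_def)
    also have "\<dots> = (- 1) ^ j * (\<integral>y. v y * (deriv ^^ j) (\<lambda>y. tkernel n (x - y)) y \<partial>torus)"
      unfolding kernel_reflected_deriv
      by (subst integral_mult_right_zero[symmetric])
         (simp add: algebra_simps power_mult_distrib[symmetric] flip: mult.assoc)
    also have "\<dots> = (- 1) ^ j * ((- 1) ^ j * (\<integral>y. weak_deriv j v y * tkernel n (x - y) \<partial>torus))"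
      by (subst has_weak_derivD(2)[OF w]) (auto intro: kernel_reflected_smooth kernel_reflected_periodic)
    also have "\<dots> = conv (tkernel n) (weak_deriv j v) x"
      by (simp add: conv_def mult.commute power_mult_distrib[symmetric] flip: mult.assoc)
    finally show "(deriv ^^ j) (mollify n v) x = conv (tkernel n) (weak_deriv j v) x" .
  qed
  have "continuous_on UNIV ((deriv ^^ j) (mollify n v))"
    using Ck_cont[OF Ck_funpow_deriv[of j 0]] mollify_Ck[OF c] by blast
  then have "conv (tkernel n) (weak_deriv j v) \<in> borel_measurable torus"
    unfolding eq by (rule cont_measurable_torus)
  then show ?thesis unfolding eq Hsemi_def
    by (rule kernel_Jensen(2)[OF has_weak_derivD(1)[OF w]])
qed

text \<open>Closure of Sobolev balls under bounded pointwise convergence: the weak derivatives have a weak limit, and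
  the defining identity passes to the limit on both sides. The nonlinear estimates for Sobolev functions are obtained
  through this lemma.\<close>

lemma Hsob_lsc:
  assumes v: "\<And>n. v n \<in> Hsob k" and lim: "\<And>x. (\<lambda>n. v n x) \<longlonglongrightarrow> w x"
    and c: "continuous_on UNIV w" and B: "\<And>n x. \<bar>v n x\<bar> \<le> B"
    and M: "\<And>n j. j \<le> k \<Longrightarrow> Hsemi j (v n) \<le> M j"
  shows "w \<in> Hsob k" "j \<le> k \<Longrightarrow> Hsemi j w \<le> M j"
proof -
  have per: "w (x + 1) = w x" for x
    using lim[of "x + 1"] lim[of x] HsobD(3)[OF v] by (simp add: LIMSEQ_unique)
  have wL: "w \<in> L2" by (rule L2_cont[OF per c])
  have ex: "\<exists>G. has_weak_deriv j w G \<and> L2norm G \<le> M j" if "j \<le> k" for j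
  proof -
    note wd = HsobD(4)[OF v that]
    have "\<exists>G\<in>L2. L2norm G \<le> M j \<and> (\<forall>\<phi>\<in>L2. \<forall>l. (\<lambda>n. \<integral>x. weak_deriv j (v n) x * \<phi> x \<partial>torus) \<longlonglongrightarrow> l \<longrightarrow> (\<integral>x. G x * \<phi> x \<partial>torus) = l)"
      by (rule L2_weak_limit[OF has_weak_derivD(1)[OF wd]]) (rule M[OF that, unfolded Hsemi_def])
    then obtain G where G: "G \<in> L2" "L2norm G \<le> M j"
      "\<And>\<phi> l. \<phi> \<in> L2 \<Longrightarrow> (\<lambda>n. \<integral>x. weak_deriv j (v n) x * \<phi> x \<partial>torus) \<longlonglongrightarrow> l \<Longrightarrow> (\<integral>x. G x * \<phi> x \<partial>torus) = l"
      by blast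
    have "has_weak_deriv j w G"
    proof (rule has_weak_derivI[OF G(1)])
      fix \<phi> assume \<phi>: "smooth \<phi>" "\<And>x. \<phi> (x + 1) = (\<phi> x :: real)"
      note D = smooth_deriv_L2[OF \<phi>, of j]
      have "(\<lambda>n. \<integral>x. v n x * (deriv ^^ j) \<phi> x \<partial>torus) \<longlonglongrightarrow> (\<integral>x. w x * (deriv ^^ j) \<phi> x \<partial>torus)"
      proof (rule integral_dominated_convergence)
        show "integrable torus (\<lambda>x. B * \<bar>(deriv ^^ j) \<phi> x\<bar>)" using L2_integrable[OF D] by simp
        show "AE x in torus. norm (v n x * (deriv ^^ j) \<phi> x) \<le> B * \<bar>(deriv ^^ j) \<phi> x\<bar>" for n
          using B[of n] by (auto simp: abs_mult intro!: AE_I2 mult_right_mono)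
        show "AE x in torus. (\<lambda>n. v n x * (deriv ^^ j) \<phi> x) \<longlonglongrightarrow> w x * (deriv ^^ j) \<phi> x"
          using lim by (auto intro!: AE_I2 tendsto_intros)
      qed (use L2D(2)[OF D] L2D(2)[OF wL] L2D(2)[OF HsobD(1)[OF v]] in auto)
      then have "(\<lambda>n. (- 1) ^ j * (\<integral>x. weak_deriv j (v n) x * \<phi> x \<partial>torus)) \<longlonglongrightarrow> (\<integral>x. w x * (deriv ^^ j) \<phi> x \<partial>torus)"
        using has_weak_derivD(2)[OF wd \<phi>] by simp
      then have "(\<lambda>n. (- 1) ^ j * ((- 1) ^ j * (\<integral>x. weak_deriv j (v n) x * \<phi> x \<partial>torus))) \<longlonglongrightarrow> (- 1) ^ j * (\<integral>x. w x * (deriv ^^ j) \<phi> x \<partial>torus)"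
        by (intro tendsto_mult_left)
      then have "(\<integral>x. G x * \<phi> x \<partial>torus) = (- 1) ^ j * (\<integral>x. w x * (deriv ^^ j) \<phi> x \<partial>torus)"
        by (intro G(3) smooth_L2[OF \<phi>]) (simp add: power_mult_distrib[symmetric] flip: mult.assoc)
      then show "(\<integral>x. w x * (deriv ^^ j) \<phi> x \<partial>torus) = (- 1) ^ j * (\<integral>x. G x * \<phi> x \<partial>torus)"
        by (simp add: power_mult_distrib[symmetric] flip: mult.assoc)
    qed
    then show ?thesis using G(2) by blast
  qed
  then show "w \<in> Hsob k" unfolding Hsob_def using wL c by blast
  show "j \<le> k \<Longrightarrow> Hsemi j w \<le> M j" using ex Hsemi_eq by metis
qed

section \<open>Classical norms of smooth periodic functions\<close>

definition CP :: "nat \<Rightarrow> (real \<Rightarrow> real) \<Rightarrow> bool" where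
  "CP k v \<longleftrightarrow> Ck k v \<and> (\<forall>x. v (x + 1) = v x)"

text \<open>The classical counterpart of \<open>nr\<close>. Sums of seminorms are used instead of the Euclidean
  combination because they satisfy the recursion \<open>cn_Suc\<close>, on which the inductions over the order are
  based.\<close>

definition cn :: "nat \<Rightarrow> (real \<Rightarrow> real) \<Rightarrow> real" where
  "cn k v = (\<Sum>j\<le>k. L2norm ((deriv ^^ j) v))"

definition nr :: "nat \<Rightarrow> (real \<Rightarrow> real) \<Rightarrow> real" where
  "nr k v = (\<Sum>j\<le>k. Hsemi j v)"

lemma CPI: "Ck k v \<Longrightarrow> (\<And>x. v (x + 1) = v x) \<Longrightarrow> CP k v"
  by (simp add: CP_def)

lemma CPD: "CP k v \<Longrightarrow> Ck k v" "CP k v \<Longrightarrow> v (x + 1) = v x"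
  by (auto simp: CP_def)

lemma CP_mono: "CP k v \<Longrightarrow> j \<le> k \<Longrightarrow> CP j v"
  by (auto simp: CP_def intro: Ck_mono)

lemma CP_SucD: "CP (Suc k) v \<Longrightarrow> CP k v"
  by (rule CP_mono) auto

lemma CP_cont: "CP k v \<Longrightarrow> continuous_on UNIV v"
  using CPD(1) Ck_cont by blast

lemma CP_L2: "CP k v \<Longrightarrow> v \<in> L2"
  by (rule L2_cont) (auto intro: CP_cont CPD)

lemma CP_deriv: "CP (Suc k) v \<Longrightarrow> CP k (deriv v)"
  by (auto simp: CP_def intro: Ck_deriv deriv_periodic)

lemma CP_funpow: "CP (j + k) v \<Longrightarrow> CP k ((deriv ^^ j) v)"
  by (auto simp: CP_def intro: Ck_funpow_deriv funpow_deriv_periodic)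

lemma CP_funpow_L2: "CP k v \<Longrightarrow> j \<le> k \<Longrightarrow> (deriv ^^ j) v \<in> L2"
  using CP_L2[OF CP_funpow[of j 0 v]] CP_mono by auto

lemma CP_add: "CP k v \<Longrightarrow> CP k w \<Longrightarrow> CP k (\<lambda>x. v x + w x)"
  by (auto simp: CP_def intro: Ck_add)

lemma CP_diff: "CP k v \<Longrightarrow> CP k w \<Longrightarrow> CP k (\<lambda>x. v x - w x)"
  by (auto simp: CP_def intro: Ck_diff)

lemma CP_mult: "CP k v \<Longrightarrow> CP k w \<Longrightarrow> CP k (\<lambda>x. v x * w x)"
  by (auto simp: CP_def intro: Ck_mult)

lemma CP_const [simp]: "CP k (\<lambda>x. c)"
  by (auto simp: CP_def)

lemma CP_cmult: "CP k v \<Longrightarrow> CP k (\<lambda>x. c * v x)"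
  by (auto simp: CP_def intro: Ck_cmult)

lemma CP_compose_left: "Ck k F \<Longrightarrow> CP k v \<Longrightarrow> CP k (\<lambda>x. F (v x))"
  by (auto simp: CP_def intro: Ck_compose)

lemma CP_DERIV: "CP (Suc k) v \<Longrightarrow> (v has_real_derivative deriv v x) (at x)"
  using CPD(1) Ck_DERIV by blast

lemma nr_nonneg [simp]: "nr k v \<ge> 0"
  by (simp add: nr_def sum_nonneg)

lemma cn_nonneg [simp]: "cn k v \<ge> 0"
  by (simp add: cn_def sum_nonneg)

lemma nr_classical: "CP k v \<Longrightarrow> nr k v = cn k v"
  unfolding nr_def cn_def by (rule sum.cong) (auto simp: Hsob_classical(2) CP_def)

lemma CP_Hsob: "CP k v \<Longrightarrow> v \<in> Hsob k"
  by (rule Hsob_classical(1)) (auto simp: CP_def)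

lemma cn_0: "cn 0 v = L2norm v"
  by (simp add: cn_def)

lemma cn_Suc: "cn (Suc k) v = L2norm v + cn k (deriv v)"
  unfolding cn_def sum.atMost_Suc_shift by (simp add: deriv_funpow_Suc del: funpow.simps(2))

lemma cn_mono: "j \<le> k \<Longrightarrow> cn j v \<le> cn k v"
  unfolding cn_def by (rule sum_mono2) auto

lemma nr_mono: "j \<le> k \<Longrightarrow> nr j v \<le> nr k v"
  unfolding nr_def by (rule sum_mono2) auto

lemma Hsemi_le_nr: "j \<le> k \<Longrightarrow> Hsemi j v \<le> nr k v"
  unfolding nr_def by (rule member_le_sum) auto

lemma L2norm_le_cn: "j \<le> k \<Longrightarrow> L2norm ((deriv ^^ j) v) \<le> cn k v"
  unfolding cn_def by (rule member_le_sum[of j "{..k}" "\<lambda>j. L2norm ((deriv ^^ j) v)"]) auto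

lemma cn_deriv_le: "cn k (deriv v) \<le> cn (Suc k) v"
  by (simp add: cn_Suc)

lemma L2norm_le_cn0: "L2norm v \<le> cn k v"
  using L2norm_le_cn[of 0 k v] by simp

lemma nr_lincomb:
  assumes "v \<in> Hsob k" "w \<in> Hsob k"
  shows "nr k (\<lambda>x. a * v x + b * w x) \<le> \<bar>a\<bar> * nr k v + \<bar>b\<bar> * nr k w"
  unfolding nr_def sum_distrib_left sum.distrib[symmetric]
  by (rule sum_mono) (use Hsob_lincomb(2)[OF assms] in auto)

lemma nr_add: "v \<in> Hsob k \<Longrightarrow> w \<in> Hsob k \<Longrightarrow> nr k (\<lambda>x. v x + w x) \<le> nr k v + nr k w"
  using nr_lincomb[of v k w 1 1] by simp

lemma nr_diff: "v \<in> Hsob k \<Longrightarrow> w \<in> Hsob k \<Longrightarrow> nr k (\<lambda>x. v x - w x) \<le> nr k v + nr k w"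
  using nr_lincomb[of v k w 1 "-1"] by simp

lemma nr_cmult: "v \<in> Hsob k \<Longrightarrow> nr k (\<lambda>x. a * v x) \<le> \<bar>a\<bar> * nr k v"
  using nr_lincomb[of v k v a 0] by simp

lemma cn_add: "CP k v \<Longrightarrow> CP k w \<Longrightarrow> cn k (\<lambda>x. v x + w x) \<le> cn k v + cn k w"
  using nr_add[OF CP_Hsob CP_Hsob] by (simp add: nr_classical CP_add)

lemma cn_diff: "CP k v \<Longrightarrow> CP k w \<Longrightarrow> cn k (\<lambda>x. v x - w x) \<le> cn k v + cn k w"
  using nr_diff[OF CP_Hsob CP_Hsob] by (simp add: nr_classical CP_diff)

lemma cn_cmult: "CP k v \<Longrightarrow> cn k (\<lambda>x. a * v x) \<le> \<bar>a\<bar> * cn k v"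
  using nr_cmult[OF CP_Hsob] by (simp add: nr_classical CP_cmult)

lemma periodic_antiderivative:
  assumes "\<And>x. v (x + 1) = v x" "continuous_on UNIV v" "\<And>x. (A has_real_derivative v x) (at x)"
  shows "A (e + 1) - A e = integral {0..1} v"
proof -
  have "((\<lambda>x. v (x + e)) has_integral A (1 + e) - A (0 + e)) {0..1}"
  proof (rule fundamental_theorem_of_calculus)
    fix x :: real
    have "((\<lambda>x. A (x + e)) has_real_derivative v (x + e)) (at x)"
      using assms(3) DERIV_shift by blast
    then show "((\<lambda>x. A (x + e)) has_vector_derivative v (x + e)) (at x within {0..1})"
      by (simp add: has_real_derivative_iff_has_vector_derivative has_vector_derivative_at_within)
  qed simp
  then have "integral {0..1} (\<lambda>x. v (x + e)) = A (1 + e) - A e" by (simp add: integral_unique)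
  then show ?thesis using cont_periodic_integral_shift[OF assms(1,2), of e] by (simp add: add.commute)
qed

text \<open>Both points may be moved into one period, where the fundamental theorem bounds the difference by the
  \<open>L\<^sup>1\<close> norm of the derivative.\<close>

lemma CP_oscillation:
  assumes "CP (Suc 0) v" shows "\<bar>v x - v y\<bar> \<le> L2norm (deriv v)"
proof -
  have c: "continuous_on UNIV (deriv v)" by (rule CP_cont[OF CP_deriv[OF assms]])
  have *: "\<bar>v b - v a\<bar> \<le> L2norm (deriv v)" if "0 \<le> a" "a \<le> b" "b \<le> 1" for a b
  proof -
    have "((deriv v) has_integral (v b - v a)) {a..b}"
      by (rule fundamental_theorem_of_calculus[OF that(2)])
         (auto intro!: has_field_derivative_at_within[OF CP_DERIV[OF assms]] simp: has_real_derivative_iff_has_vector_derivative[symmetric])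
    then have "\<bar>v b - v a\<bar> = norm (integral {a..b} (deriv v))" by (simp add: integral_unique)
    also have "\<dots> \<le> integral {a..b} (\<lambda>x. \<bar>deriv v x\<bar>)"
      by (rule integral_norm_bound_integral)
         (auto intro!: integrable_continuous_real continuous_intros continuous_on_subset[OF c])
    also have "\<dots> \<le> integral {0..1} (\<lambda>x. \<bar>deriv v x\<bar>)"
      by (rule integral_subset_le)
         (use that in \<open>auto intro!: integrable_continuous_real continuous_intros continuous_on_subset[OF c]\<close>)
    also have "\<dots> = (\<integral>x. \<bar>deriv v x\<bar> * 1 \<partial>torus)"
      by (simp add: torus_integral_cont(2) continuous_intros c)
    also have "\<dots> \<le> L2norm (\<lambda>x. \<bar>deriv v x\<bar>) * L2norm (\<lambda>x. 1)"
      by (rule order_trans[OF abs_ge_self L2_Cauchy_Schwarz])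
         (use CPD(2)[OF CP_deriv[OF assms]] in \<open>auto intro!: L2_cont continuous_intros c\<close>)
    also have "\<dots> = L2norm (deriv v)" by (simp add: L2norm_def)
    finally show ?thesis .
  qed
  have fr: "frac z \<in> {0..1}" for z :: real using frac_lt_1[of z] frac_ge_0[of z] by auto
  have "\<bar>v (frac x) - v (frac y)\<bar> \<le> L2norm (deriv v)"
    using *[of "frac x" "frac y"] *[of "frac y" "frac x"] fr[of x] fr[of y]
    by (cases "frac x \<le> frac y") (auto simp: abs_minus_commute)
  then show ?thesis using periodic_frac[of v, OF CPD(2)[OF assms]] by simp
qed

text \<open>The one-dimensional Sobolev embedding: the mean of \<open>v\<close> is bounded by its
  \<open>L\<^sup>2\<close> norm and the oscillation by the derivative.\<close>

lemma CP_sup: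
  assumes "CP (Suc 0) v" shows "\<bar>v x\<bar> \<le> cn 1 v"
proof -
  have "\<bar>v x\<bar> = \<bar>(\<integral>y. (v x - v y) + v y \<partial>torus)\<bar>" by simp
  also have "\<dots> = \<bar>(\<integral>y. (v x - v y) \<partial>torus) + (\<integral>y. v y * 1 \<partial>torus)\<bar>"
    using L2_integrable[OF CP_L2[OF assms]] by (subst Bochner_Integration.integral_add) auto
  also have "\<dots> \<le> \<bar>\<integral>y. (v x - v y) \<partial>torus\<bar> + \<bar>\<integral>y. v y * 1 \<partial>torus\<bar>" by (rule abs_triangle_ineq)
  also have "\<bar>\<integral>y. v y * 1 \<partial>torus\<bar> \<le> L2norm v * L2norm (\<lambda>x. 1)"
    by (rule L2_Cauchy_Schwarz[OF CP_L2[OF assms] L2_const])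
  also have "\<bar>\<integral>y. (v x - v y) \<partial>torus\<bar> \<le> (\<integral>y. \<bar>v x - v y\<bar> \<partial>torus)" by (rule integral_abs_bound)
  also have "\<dots> \<le> (\<integral>y. L2norm (deriv v) \<partial>torus)"
    by (rule integral_mono) (use L2_integrable[OF CP_L2[OF assms]] CP_oscillation[OF assms] in auto)
  finally show ?thesis by (simp add: cn_Suc cn_0)
qed

lemma CP_sup': "CP (Suc k) v \<Longrightarrow> \<bar>v x\<bar> \<le> cn (Suc k) v"
  using CP_sup[of v x] CP_mono[of "Suc k" v "Suc 0"] cn_mono[of 1 "Suc k" v] by simp

text \<open>The derivative of a periodic function has a zero by Rolle, hence is bounded by its oscillation.\<close>

lemma CP_Poincare:
  assumes "CP (Suc (Suc 0)) v" shows "L2norm (deriv v) \<le> L2norm (deriv (deriv v))"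
proof -
  have "\<exists>z>0. z < 1 \<and> (v has_real_derivative 0) (at z)"
  proof -
    have "\<exists>z>0::real. z < 1 \<and> (\<lambda>h. deriv v z * h) = (\<lambda>h. 0)"
    proof (rule Rolle_deriv[of 0 1 v])
      show "v 0 = v 1" using CPD(2)[OF assms, of 0] by simp
      show "continuous_on {0..1} v" using CP_cont[OF assms] continuous_on_subset by blast
      show "(v has_derivative (\<lambda>h. deriv v x * h)) (at x)" for x
        using CP_DERIV[OF assms, of x] by (simp add: has_field_derivative_def mult.commute[of _ "deriv v x"])
    qed auto
    then obtain z where z: "z > 0" "z < 1" "(\<lambda>h. deriv v z * h) = (\<lambda>h. 0)" by blast
    from fun_cong[OF z(3), of 1] have "deriv v z = 0" by simp
    then show ?thesis using z CP_DERIV[OF assms, of z] by auto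
  qed
  then obtain z where "deriv v z = 0" using DERIV_imp_deriv by blast
  then have "\<bar>deriv v x\<bar> \<le> L2norm (deriv (deriv v))" for x
    using CP_oscillation[OF CP_deriv[OF assms], of x z] by simp
  then show ?thesis by (intro L2norm_le_bound CP_L2[OF CP_deriv[OF assms]])
qed

section \<open>Approximation in Sobolev spaces\<close>

lemma mollify_CP: "v \<in> Hsob k \<Longrightarrow> k > 0 \<Longrightarrow> CP m (mollify n v)"
  by (auto simp: CP_def intro: mollify_Ck mollify_periodic HsobD)

lemma mollify_lim: "v \<in> Hsob k \<Longrightarrow> k > 0 \<Longrightarrow> (\<lambda>n. mollify n v x) \<longlonglongrightarrow> v x"
  by (auto intro: mollify_tendsto HsobD)

lemma mollify_cn: "v \<in> Hsob k \<Longrightarrow> k > 0 \<Longrightarrow> j \<le> k \<Longrightarrow> cn j (mollify n v) \<le> nr j v"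
  unfolding cn_def nr_def by (rule sum_mono) (auto intro: mollify_Hsemi)

lemma Hsob_sup:
  assumes "v \<in> Hsob (Suc k)" shows "\<bar>v x\<bar> \<le> nr 1 v"
proof (rule LIMSEQ_le_const2[OF tendsto_rabs[OF mollify_lim[OF assms]]])
  have "\<bar>mollify n v x\<bar> \<le> nr 1 v" for n
    using CP_sup[OF mollify_CP[OF assms zero_less_Suc], of n x] mollify_cn[OF assms zero_less_Suc, of 1 n] by simp
  then show "\<exists>N. \<forall>n\<ge>N. \<bar>mollify n v x\<bar> \<le> nr 1 v" by blast
qed simp

lemma Hsob_sup': "v \<in> Hsob (Suc k) \<Longrightarrow> \<bar>v x\<bar> \<le> nr (Suc k) v"
  using Hsob_sup[of v k x] nr_mono[of 1 "Suc k" v] by simp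

text \<open>For classical approximations the uniform bound is a consequence of the norm bound; the factor counts the
  seminorms in \<open>nr\<close>.\<close>

lemma Hsob_lsc_cn:
  assumes v: "\<And>n. CP (Suc k) (v n)" and lim: "\<And>x. (\<lambda>n. v n x) \<longlonglongrightarrow> w x"
    and c: "continuous_on UNIV w" and M: "\<And>n. cn (Suc k) (v n) \<le> M"
  shows "w \<in> Hsob (Suc k)" "nr (Suc k) w \<le> (real k + 2) * M"
proof -
  have B: "\<bar>v n x\<bar> \<le> M" for n x using CP_sup'[OF v[of n], of x] M[of n] by linarith
  have S: "Hsemi j (v n) \<le> M" if "j \<le> Suc k" for n j
    using Hsemi_le_nr[OF that, of "v n"] nr_classical[OF v[of n]] M[of n] by simp
  show "w \<in> Hsob (Suc k)" by (rule Hsob_lsc[OF CP_Hsob[OF v] lim c B S])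
  have "Hsemi j w \<le> M" if "j \<le> Suc k" for j
    by (rule Hsob_lsc(2)[OF CP_Hsob[OF v] lim c B S that])
  then have "nr (Suc k) w \<le> (\<Sum>j\<le>Suc k. M)" unfolding nr_def by (intro sum_mono) auto
  then show "nr (Suc k) w \<le> (real k + 2) * M" by (simp add: algebra_simps)
qed

lemma Hsob_Poincare:
  assumes "v \<in> Hsob (Suc (Suc k))" shows "Hsemi (Suc k) v \<le> Hsemi (Suc (Suc k)) v"
proof -
  define M where "M j = (if j = Suc k then Hsemi (Suc (Suc k)) v else Hsemi j v)" for j
  have CPm: "CP m (mollify n v)" for m n by (rule mollify_CP[OF assms]) simp
  have "Hsemi (Suc k) v \<le> M (Suc k)"
  proof (rule Hsob_lsc(2)[of "\<lambda>n. mollify n v" "Suc k" v "nr 1 v" M])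
    show "mollify n v \<in> Hsob (Suc k)" for n by (rule CP_Hsob[OF CPm])
    show "(\<lambda>n. mollify n v x) \<longlonglongrightarrow> v x" for x by (rule mollify_lim[OF assms]) simp
    show "continuous_on UNIV v" by (rule HsobD(2)[OF assms]) simp
    show "\<bar>mollify n v x\<bar> \<le> nr 1 v" for n x
      using CP_sup[OF CPm, of n x] mollify_cn[OF assms, of 1 n] by simp
    show "Hsemi j (mollify n v) \<le> M j" if "j \<le> Suc k" for n j
    proof -
      have eq: "Hsemi i (mollify n v) = L2norm ((deriv ^^ i) (mollify n v))" for i
        by (rule Hsob_classical(2)[of i]) (use CPm CP_def in auto)
      have "L2norm ((deriv ^^ Suc k) (mollify n v)) \<le> L2norm ((deriv ^^ Suc (Suc k)) (mollify n v))"
        using CP_Poincare[OF CP_funpow[of k, OF CPm]] by simp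
      also have "\<dots> \<le> Hsemi (Suc (Suc k)) v" by (rule mollify_Hsemi[OF assms]) auto
      finally show ?thesis unfolding M_def eq
        using mollify_Hsemi[OF assms, of j n] that by auto
    qed
  qed simp
  then show ?thesis by (simp add: M_def)
qed

text \<open>Iterated Poincare inequality; this is why the norm of order zero together with the top seminorm controls
  all orders.\<close>

lemma Hsemi_le_top:
  assumes "v \<in> Hsob s" "0 < j" "j \<le> s" shows "Hsemi j v \<le> Hsemi s v"
  using assms(3,1,2)
proof (induction s rule: dec_induct)
  case (step n)
  then obtain m where m: "n = Suc m" by (cases n) auto
  have "Hsemi j v \<le> Hsemi n v" using step Hsob_mono[of v "Suc n" n] by simp
  also have "\<dots> \<le> Hsemi (Suc n) v" using Hsob_Poincare[of v m] step m by simp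
  finally show ?case .
qed simp

lemma nr_le_star:
  assumes "v \<in> Hsob s" shows "nr s v \<le> (real s + 1) * (L2norm v + Hsemi s v)"
proof -
  have "Hsemi j v \<le> L2norm v + Hsemi s v" if "j \<le> s" for j
    using Hsemi_le_top[OF assms, of j] that Hsemi_0[OF HsobD(1)[OF assms]] by (cases "j = 0") (auto simp: add_increasing)
  then have "nr s v \<le> (\<Sum>j\<le>s. L2norm v + Hsemi s v)" unfolding nr_def by (intro sum_mono) auto
  then show ?thesis by (simp add: algebra_simps)
qed

lemma Hsob_Lipschitz:
  assumes "v \<in> Hsob (Suc (Suc k))" shows "\<bar>v x - v y\<bar> \<le> nr 2 v * \<bar>x - y\<bar>"
proof (rule LIMSEQ_le_const2[OF tendsto_rabs[OF tendsto_diff[OF mollify_lim[OF assms] mollify_lim[OF assms]]]])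
  have "\<bar>mollify n v x - mollify n v y\<bar> \<le> nr 2 v * \<bar>x - y\<bar>" for n
  proof -
    have C: "CP m (mollify n v)" for m by (rule mollify_CP[OF assms]) simp
    have "\<bar>deriv (mollify n v) z\<bar> \<le> nr 2 v" for z
    proof -
      have "\<bar>deriv (mollify n v) z\<bar> \<le> cn 1 (deriv (mollify n v))" by (rule CP_sup[OF CP_deriv[OF C]])
      also have "\<dots> \<le> cn 2 (mollify n v)" using cn_deriv_le[of 1 "mollify n v"] by (simp add: numeral_2_eq_2)
      also have "\<dots> \<le> nr 2 v" by (rule mollify_cn[OF assms]) auto
      finally show ?thesis .
    qed
    then have "norm (mollify n v x - mollify n v y) \<le> nr 2 v * norm (x - y)"
      by (intro field_differentiable_bound[of UNIV "mollify n v" "deriv (mollify n v)"]) (auto intro: CP_DERIV[OF C])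
    then show ?thesis by simp
  qed
  then show "\<exists>N. \<forall>n\<ge>N. \<bar>mollify n v x - mollify n v y\<bar> \<le> nr 2 v * \<bar>x - y\<bar>" by blast
qed auto

lemma CP_Taylor:
  assumes "CP (Suc (Suc 0)) v" "\<And>x. \<bar>deriv (deriv v) x\<bar> \<le> M"
  shows "\<bar>v (x + h) - v x - h * deriv v x\<bar> \<le> M * h\<^sup>2"
proof -
  have lip: "\<bar>deriv v y - deriv v z\<bar> \<le> M * \<bar>y - z\<bar>" for y z
    using field_differentiable_bound[of UNIV "deriv v" "deriv (deriv v)" M y z] CP_DERIV[OF CP_deriv[OF assms(1)]] assms(2) by auto
  have D: "((\<lambda>t. v t - t * deriv v x) has_real_derivative (deriv v t - deriv v x)) (at t)" for t
    by (auto intro!: derivative_eq_intros CP_DERIV[OF assms(1)])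
  have M: "M \<ge> 0" using assms(2)[of 0] by linarith
  have "norm ((v (x + h) - (x + h) * deriv v x) - (v x - x * deriv v x)) \<le> (M * \<bar>h\<bar>) * norm ((x + h) - x)"
  proof (rule field_differentiable_bound[of "cball x \<bar>h\<bar>" _ "\<lambda>t. deriv v t - deriv v x"])
    fix t assume t: "t \<in> cball x \<bar>h\<bar>"
    show "((\<lambda>t. v t - t * deriv v x) has_real_derivative (deriv v t - deriv v x)) (at t within cball x \<bar>h\<bar>)"
      by (rule has_field_derivative_at_within[OF D])
    have "\<bar>deriv v t - deriv v x\<bar> \<le> M * \<bar>t - x\<bar>" by (rule lip)
    also have "\<dots> \<le> M * \<bar>h\<bar>" using t M by (intro mult_left_mono) (auto simp: dist_real_def)
    finally show "norm (deriv v t - deriv v x) \<le> M * \<bar>h\<bar>" by simp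
  qed (auto simp: dist_real_def)
  then show ?thesis by (simp add: algebra_simps power2_eq_square)
qed

text \<open>Sobolev functions of order at least three are continuously differentiable. Their mollifications have
  uniformly bounded second derivatives, so the derivatives converge along with the functions, and the limit satisfies
  the first-order Taylor bound that identifies it as the derivative.\<close>

lemma Hsob_deriv:
  assumes "v \<in> Hsob (Suc k)" "k \<ge> 2"
  shows "(v has_real_derivative deriv v x) (at x)" "deriv v \<in> Hsob k"
    "j \<le> k \<Longrightarrow> Hsemi j (deriv v) \<le> Hsemi (Suc j) v"
proof -
  define M where "M = nr 3 v"
  have M0: "M \<ge> 0" by (simp add: M_def)
  have CPm: "CP m (mollify n v)" for m n by (rule mollify_CP[OF assms(1)]) simp
  have d2: "\<bar>deriv (deriv (mollify n v)) z\<bar> \<le> M" for n z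
  proof -
    have "\<bar>deriv (deriv (mollify n v)) z\<bar> \<le> cn 1 (deriv (deriv (mollify n v)))"
      by (rule CP_sup[OF CP_deriv[OF CP_deriv[OF CPm]]])
    also have "\<dots> \<le> cn 3 (mollify n v)"
      using cn_deriv_le[of 1 "deriv (mollify n v)"] cn_deriv_le[of 2 "mollify n v"] by (simp add: numeral_2_eq_2 numeral_3_eq_3)
    also have "\<dots> \<le> M" unfolding M_def by (rule mollify_cn[OF assms(1)]) (use assms in auto)
    finally show ?thesis .
  qed
  have d1: "\<bar>deriv (mollify n v) z\<bar> \<le> M" for n z
  proof -
    have "\<bar>deriv (mollify n v) z\<bar> \<le> cn 1 (deriv (mollify n v))" by (rule CP_sup[OF CP_deriv[OF CPm]])
    also have "\<dots> \<le> cn 3 (mollify n v)"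
      using cn_deriv_le[of 1 "mollify n v"] cn_mono[of 2 3 "mollify n v"] by (simp add: numeral_2_eq_2)
    also have "\<dots> \<le> M" unfolding M_def by (rule mollify_cn[OF assms(1)]) (use assms in auto)
    finally show ?thesis .
  qed
  note lim = mollify_lim[OF assms(1) zero_less_Suc]
  note T = CP_Taylor[OF CPm d2]
  have conv: "convergent (\<lambda>n. deriv (mollify n v) x)" for x
  proof (rule real_Cauchy_convergent, rule metric_CauchyI)
    fix e :: real assume e: "e > 0"
    \<comment> \<open>A step so small that difference quotients approximate all the derivatives up to \<open>e/4\<close>, uniformly in \<open>n\<close>.\<close>
    define h where "h = e / (4 * (M + 1))"
    have h: "h > 0" using e M0 by (simp add: h_def)
    have Mh: "M * h \<le> e / 4" using e M0 by (simp add: h_def field_simps)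
    have "Cauchy (\<lambda>n. (mollify n v (x + h) - mollify n v x) / h)"
      by (intro LIMSEQ_imp_Cauchy) (rule tendsto_divide[OF tendsto_diff[OF lim lim] tendsto_const], use h in simp)
    from metric_CauchyD[OF this, of "e/4"] e obtain N where N: "\<And>m n. m \<ge> N \<Longrightarrow> n \<ge> N \<Longrightarrow>
        dist ((mollify m v (x + h) - mollify m v x) / h) ((mollify n v (x + h) - mollify n v x) / h) < e / 4"
      by auto
    have q: "\<bar>(mollify n v (x + h) - mollify n v x) / h - deriv (mollify n v) x\<bar> \<le> e / 4" for n
    proof -
      have "\<bar>(mollify n v (x + h) - mollify n v x - h * deriv (mollify n v) x) / h\<bar> \<le> M * h\<^sup>2 / h"
        using T[of n x h] h by (simp add: abs_divide divide_right_mono)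
      also have "\<dots> \<le> e / 4" using Mh h by (simp add: power2_eq_square)
      finally show ?thesis using h by (simp add: diff_divide_distrib)
    qed
    show "\<exists>N. \<forall>m\<ge>N. \<forall>n\<ge>N. dist (deriv (mollify m v) x) (deriv (mollify n v) x) < e"
    proof (intro exI[of _ N] allI impI)
      fix m n assume "m \<ge> N" "n \<ge> N"
      from N[OF this] q[of m] q[of n] e
      show "dist (deriv (mollify m v) x) (deriv (mollify n v) x) < e" unfolding dist_real_def by linarith
    qed
  qed
  define p where "p x = lim (\<lambda>n. deriv (mollify n v) x)" for x
  have plim: "(\<lambda>n. deriv (mollify n v) x) \<longlonglongrightarrow> p x" for x
    unfolding p_def using conv by (simp add: convergent_LIMSEQ_iff)
  have TT: "\<bar>v (x + h) - v x - h * p x\<bar> \<le> M * h\<^sup>2" for x h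
    by (rule LIMSEQ_le_const2[of "\<lambda>n. \<bar>mollify n v (x + h) - mollify n v x - h * deriv (mollify n v) x\<bar>"])
       (use T lim plim in \<open>auto intro!: tendsto_intros\<close>)
  have D: "(v has_real_derivative p x) (at x)" for x
    unfolding DERIV_def
  proof (rule LIM_zero_cancel, rule Lim_null_comparison)
    show "\<forall>\<^sub>F h in at 0. norm ((v (x + h) - v x) / h - p x) \<le> M * \<bar>h\<bar>"
      unfolding eventually_at_filter
    proof (intro always_eventually allI impI)
      fix h :: real assume h: "h \<noteq> 0"
      have "\<bar>(v (x + h) - v x - h * p x) / h\<bar> \<le> M * h\<^sup>2 / \<bar>h\<bar>"
        unfolding abs_divide by (intro divide_right_mono TT) auto
      then show "norm ((v (x + h) - v x) / h - p x) \<le> M * \<bar>h\<bar>"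
        using h by (simp add: diff_divide_distrib power2_eq_square abs_if split: if_splits)
    qed
    show "((\<lambda>h. M * \<bar>h\<bar>) \<longlongrightarrow> 0) (at 0)" by (auto intro!: tendsto_eq_intros)
  qed
  then have dp: "deriv v = p" by (intro ext DERIV_imp_deriv)
  show "(v has_real_derivative deriv v x) (at x)" using D dp by simp
  have "\<bar>p x - p y\<bar> \<le> M * \<bar>x - y\<bar>" for x y
  proof (rule LIMSEQ_le_const2[OF tendsto_rabs[OF tendsto_diff[OF plim plim]]])
    have "\<bar>deriv (mollify n v) x - deriv (mollify n v) y\<bar> \<le> M * \<bar>x - y\<bar>" for n
      using field_differentiable_bound[of UNIV "deriv (mollify n v)" "deriv (deriv (mollify n v))" M x y]
        CP_DERIV[OF CP_deriv[OF CPm]] d2 by auto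
    then show "\<exists>N. \<forall>n\<ge>N. \<bar>deriv (mollify n v) x - deriv (mollify n v) y\<bar> \<le> M * \<bar>x - y\<bar>" by blast
  qed
  then have "M-lipschitz_on UNIV p" using M0 by (intro lipschitz_onI) (auto simp: dist_real_def)
  then have pc: "continuous_on UNIV p" by (rule lipschitz_on_continuous_on)
  have S: "Hsemi j (deriv (mollify n v)) \<le> Hsemi (Suc j) v" if "j \<le> k" for j n
  proof -
    have "Hsemi j (deriv (mollify n v)) = L2norm ((deriv ^^ j) (deriv (mollify n v)))"
      by (rule Hsob_classical(2)[of j]) (use CPm CP_deriv CP_def in \<open>blast+\<close>)
    also have "\<dots> = L2norm ((deriv ^^ Suc j) (mollify n v))" by (simp only: deriv_funpow_Suc)
    also have "\<dots> \<le> Hsemi (Suc j) v" by (rule mollify_Hsemi[OF assms(1)]) (use that in auto)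
    finally show ?thesis .
  qed
  note lsc = Hsob_lsc[of "\<lambda>n. deriv (mollify n v)" k p M "\<lambda>j. Hsemi (Suc j) v", OF CP_Hsob[OF CP_deriv[OF CPm]] plim pc d1 S]
  show "deriv v \<in> Hsob k" unfolding dp by (rule lsc(1))
  show "j \<le> k \<Longrightarrow> Hsemi j (deriv v) \<le> Hsemi (Suc j) v" unfolding dp by (rule lsc(2))
qed

lemma nr_deriv:
  assumes "v \<in> Hsob (Suc k)" "k \<ge> 2" shows "nr k (deriv v) \<le> nr (Suc k) v"
proof -
  have "nr k (deriv v) \<le> (\<Sum>j\<le>k. Hsemi (Suc j) v)"
    unfolding nr_def by (rule sum_mono) (use Hsob_deriv(3)[OF assms] in auto)
  also have "\<dots> \<le> nr (Suc k) v" unfolding nr_def sum.atMost_Suc_shift by simp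
  finally show ?thesis .
qed

section \<open>Products and composition with smooth functions\<close>

lemma CP_deriv_mult:
  assumes "CP (Suc 0) v" "CP (Suc 0) w"
  shows "deriv (\<lambda>x. v x * w x) = (\<lambda>x. deriv v x * w x + v x * deriv w x)"
  by (rule ext, rule DERIV_imp_deriv) (auto intro!: derivative_eq_intros CP_DERIV assms)

text \<open>The constant of the algebra property; the recursion is that of the Leibniz rule, where one derivative
  produces two products of one order less.\<close>

primrec alg :: "nat \<Rightarrow> real" where
  "alg 0 = 3"
| "alg (Suc k) = 1 + 2 * alg k"

lemma alg_pos: "alg k \<ge> 3"
  by (induction k) auto

lemma L2norm_mult_sup:
  assumes "CP (Suc k) v" "w \<in> L2" "(\<lambda>x. v x * w x) \<in> L2"
  shows "L2norm (\<lambda>x. v x * w x) \<le> cn (Suc k) v * L2norm w"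
  by (rule L2norm_mult_bound) (use assms CP_sup' in auto)

lemma CP_mult_L2: "CP k v \<Longrightarrow> CP j w \<Longrightarrow> (\<lambda>x. v x * w x) \<in> L2"
  by (intro CP_L2[of 0] CP_mult) (auto intro: CP_mono)

text \<open>In each product one factor is estimated uniformly, at the price of one derivative, which is available for
  positive order.\<close>

lemma cn_mult: "CP (Suc k) v \<Longrightarrow> CP (Suc k) w \<Longrightarrow>
    cn (Suc k) (\<lambda>x. v x * w x) \<le> alg k * cn (Suc k) v * cn (Suc k) w"
proof (induction k arbitrary: v w)
  case 0
  note v = 0(1) and w = 0(2)
  have 1: "L2norm (\<lambda>x. v x * w x) \<le> cn 1 v * cn 1 w"
    using L2norm_mult_sup[OF v CP_L2[OF w] CP_mult_L2[OF v w]] mult_left_mono[OF L2norm_le_cn0[of w 1] cn_nonneg[of 1 v]]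
    by simp
  have 2: "L2norm (\<lambda>x. v x * deriv w x) \<le> cn 1 v * cn 1 w"
    using L2norm_mult_sup[OF v CP_L2[OF CP_deriv[OF w]] CP_mult_L2[OF v CP_deriv[OF w]]]
      mult_left_mono[OF cn_deriv_le[of 0 w] cn_nonneg[of 1 v]]
    by (simp add: cn_0)
  have 3: "L2norm (\<lambda>x. w x * deriv v x) \<le> cn 1 w * cn 1 v"
    using L2norm_mult_sup[OF w CP_L2[OF CP_deriv[OF v]] CP_mult_L2[OF w CP_deriv[OF v]]]
      mult_left_mono[OF cn_deriv_le[of 0 v] cn_nonneg[of 1 w]]
    by (simp add: cn_0)
  have "L2norm (\<lambda>x. w x * deriv v x + v x * deriv w x) \<le> L2norm (\<lambda>x. w x * deriv v x) + L2norm (\<lambda>x. v x * deriv w x)"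
    by (intro L2norm_triangle CP_mult_L2[OF w CP_deriv[OF v]] CP_mult_L2[OF v CP_deriv[OF w]])
  moreover have "cn (Suc 0) (\<lambda>x. v x * w x) = L2norm (\<lambda>x. v x * w x) + L2norm (\<lambda>x. w x * deriv v x + v x * deriv w x)"
    by (simp add: cn_Suc[of 0 "\<lambda>x. v x * w x"] cn_0 CP_deriv_mult[OF v w] mult.commute)
  moreover have "alg 0 * cn (Suc 0) v * cn (Suc 0) w = 3 * (cn 1 v * cn 1 w)" "cn 1 w * cn 1 v = cn 1 v * cn 1 w"
    by simp_all
  ultimately show ?case using 1 2 3 by linarith
next
  case (Suc k)
  note v = Suc.prems(1) and w = Suc.prems(2)
  note v' = CP_deriv[OF v] and w' = CP_deriv[OF w] and v0 = CP_SucD[OF v] and w0 = CP_SucD[OF w]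
  have m: "cn (Suc k) a \<le> cn (Suc (Suc k)) a" for a by (rule cn_mono) simp
  note nn = cn_nonneg alg_pos[of k]
  have 1: "L2norm (\<lambda>x. v x * w x) \<le> cn (Suc (Suc k)) v * cn (Suc (Suc k)) w"
    using L2norm_mult_sup[OF v CP_L2[OF w] CP_mult_L2[OF v w]] mult_left_mono[OF L2norm_le_cn0[of w] cn_nonneg]
    by (rule order_trans)
  have 2: "cn (Suc k) (\<lambda>x. deriv v x * w x) \<le> alg k * cn (Suc (Suc k)) v * cn (Suc (Suc k)) w"
    using Suc.IH[OF v' w0]
    by (rule order_trans) (intro mult_mono m cn_deriv_le mult_nonneg_nonneg, use alg_pos[of k] in auto)
  have 3: "cn (Suc k) (\<lambda>x. v x * deriv w x) \<le> alg k * cn (Suc (Suc k)) v * cn (Suc (Suc k)) w"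
    using Suc.IH[OF v0 w']
    by (rule order_trans) (intro mult_mono m cn_deriv_le mult_nonneg_nonneg, use alg_pos[of k] in auto)
  have "deriv (\<lambda>x. v x * w x) = (\<lambda>x. deriv v x * w x + v x * deriv w x)"
    by (rule CP_deriv_mult) (use v w CP_mono in auto)
  then have "cn (Suc (Suc k)) (\<lambda>x. v x * w x) \<le> L2norm (\<lambda>x. v x * w x) + (cn (Suc k) (\<lambda>x. deriv v x * w x) + cn (Suc k) (\<lambda>x. v x * deriv w x))"
    using cn_add[OF CP_mult[OF v' w0] CP_mult[OF v0 w']] by (simp add: cn_Suc)
  then show ?case using 1 2 3 by (simp add: algebra_simps)
qed

lemma C1_bounds:
  assumes "Ck (Suc 0) F"
  shows "\<exists>L\<ge>0. (\<forall>a. \<bar>a\<bar> \<le> R \<longrightarrow> \<bar>F a\<bar> \<le> L) \<and> (\<forall>a b. \<bar>a\<bar> \<le> R \<longrightarrow> \<bar>b\<bar> \<le> R \<longrightarrow> \<bar>F a - F b\<bar> \<le> L * \<bar>a - b\<bar>)"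
proof -
  have bd: "\<exists>B. \<forall>x\<in>{-R..R}. norm (g x) \<le> B" if "continuous_on UNIV g" for g :: "real \<Rightarrow> real"
  proof -
    have "compact (g ` {-R..R})"
      by (rule compact_continuous_image[OF continuous_on_subset[OF that]]) auto
    then show ?thesis by (metis bounded_iff compact_imp_bounded image_eqI)
  qed
  obtain B1 where B1: "\<forall>x\<in>{-R..R}. norm (F x) \<le> B1" using bd[OF Ck_cont[OF assms]] by blast
  obtain B2 where B2: "\<forall>x\<in>{-R..R}. norm (deriv F x) \<le> B2" using bd[OF Ck_cont[OF Ck_deriv[OF assms]]] by blast
  have lip: "\<bar>F a - F b\<bar> \<le> B2 * \<bar>a - b\<bar>" if "\<bar>a\<bar> \<le> R" "\<bar>b\<bar> \<le> R" for a b
  proof -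
    have "norm (F a - F b) \<le> B2 * norm (a - b)"
      by (rule field_differentiable_bound[of "{-R..R}" F "deriv F"])
         (use that B2 in \<open>auto intro!: has_field_derivative_at_within[OF Ck_DERIV[OF assms]]\<close>)
    then show ?thesis by simp
  qed
  show ?thesis
  proof (intro exI[of _ "max 0 (max B1 B2)"] conjI allI impI)
    fix a assume "\<bar>a\<bar> \<le> R" then show "\<bar>F a\<bar> \<le> max 0 (max B1 B2)" using B1 by (auto simp: abs_le_iff le_max_iff_disj)
  next
    fix a b assume "\<bar>a\<bar> \<le> R" "\<bar>b\<bar> \<le> R"
    from lip[OF this] show "\<bar>F a - F b\<bar> \<le> max 0 (max B1 B2) * \<bar>a - b\<bar>"
      by (rule order_trans) (auto intro: mult_right_mono)
  qed auto
qed

lemma CP_deriv_comp: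
  assumes "Ck (Suc 0) F" "CP (Suc 0) v"
  shows "deriv (\<lambda>x. F (v x)) = (\<lambda>x. deriv F (v x) * deriv v x)"
  by (rule ext, rule DERIV_imp_deriv, rule DERIV_chain2[OF Ck_DERIV[OF assms(1)] CP_DERIV[OF assms(2)]])

lemma CP_deriv_diff:
  assumes "CP (Suc 0) v" "CP (Suc 0) w"
  shows "deriv (\<lambda>x. v x - w x) = (\<lambda>x. deriv v x - deriv w x)"
  by (rule ext, rule DERIV_imp_deriv) (auto intro!: derivative_eq_intros CP_DERIV assms)

text \<open>Induction over the order by means of \<open>(F(v) - F(w))' = (F'(v) - F'(w)) v' + F'(w) (v - w)'\<close>,
  with the induction hypothesis applied to \<open>F\<close> and to \<open>F'\<close>. Lipschitz dependence costs one
  derivative of \<open>F\<close> more than the order of the norm.\<close>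

lemma cn_compose_diff:
  "Ck (Suc (Suc k)) F \<Longrightarrow> \<exists>C\<ge>0. \<forall>v w. CP (Suc k) v \<longrightarrow> CP (Suc k) w \<longrightarrow> cn (Suc k) v \<le> R \<longrightarrow> cn (Suc k) w \<le> R \<longrightarrow>
      cn (Suc k) (\<lambda>x. F (v x) - F (w x)) \<le> C * cn (Suc k) (\<lambda>x. v x - w x)"
proof (induction k arbitrary: F)
  case 0
  have F1: "Ck (Suc 0) F" using Ck_SucD[OF 0] .
  have F2: "Ck (Suc 0) (deriv F)" using Ck_deriv[OF 0] .
  obtain L where L: "L \<ge> 0" "\<And>a b. \<bar>a\<bar> \<le> R \<Longrightarrow> \<bar>b\<bar> \<le> R \<Longrightarrow> \<bar>F a - F b\<bar> \<le> L * \<bar>a - b\<bar>"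
    using C1_bounds[OF F1, of R] by blast
  obtain L' where L': "L' \<ge> 0" "\<And>a. \<bar>a\<bar> \<le> R \<Longrightarrow> \<bar>deriv F a\<bar> \<le> L'"
     "\<And>a b. \<bar>a\<bar> \<le> R \<Longrightarrow> \<bar>b\<bar> \<le> R \<Longrightarrow> \<bar>deriv F a - deriv F b\<bar> \<le> L' * \<bar>a - b\<bar>"
    using C1_bounds[OF F2, of R] by blast
  show ?case
  proof (intro exI[of _ "L + L' * \<bar>R\<bar> + L'"] conjI allI impI)
    fix v w assume v: "CP (Suc 0) v" and w: "CP (Suc 0) w" and R: "cn (Suc 0) v \<le> R" "cn (Suc 0) w \<le> R"
    define z where "z x = v x - w x" for x
    have z: "CP (Suc 0) z" unfolding z_def[abs_def] by (rule CP_diff[OF v w])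
    have vR: "\<bar>v x\<bar> \<le> R" "\<bar>w x\<bar> \<le> R" for x using CP_sup[OF v, of x] CP_sup[OF w, of x] R by auto
    have zs: "\<bar>z x\<bar> \<le> cn 1 z" for x by (rule CP_sup[OF z])
    note c = CP_compose_left[OF F1 v] CP_compose_left[OF F1 w]
    note c' = CP_compose_left[OF Ck_SucD[OF F2] CP_SucD[OF v]] CP_compose_left[OF Ck_SucD[OF F2] CP_SucD[OF w]]
    have 1: "L2norm (\<lambda>x. F (v x) - F (w x)) \<le> L * cn 1 z"
      by (rule L2norm_le_bound[OF CP_L2[OF CP_diff[OF c]]])
         (rule order_trans[OF L(2)[OF vR]], use L(1) zs in \<open>auto simp: z_def intro!: mult_left_mono\<close>)
    have 2: "L2norm (\<lambda>x. (deriv F (v x) - deriv F (w x)) * deriv v x) \<le> (L' * cn 1 z) * L2norm (deriv v)"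
      by (rule L2norm_mult_bound[OF CP_L2[OF CP_deriv[OF v]] CP_mult_L2[OF CP_diff[OF c'] CP_deriv[OF v]]])
         (rule order_trans[OF L'(3)[OF vR]], use L'(1) zs in \<open>auto simp: z_def intro!: mult_left_mono\<close>)
    have 3: "L2norm (\<lambda>x. deriv F (w x) * deriv z x) \<le> L' * L2norm (deriv z)"
      by (rule L2norm_mult_bound[OF CP_L2[OF CP_deriv[OF z]] CP_mult_L2[OF c'(2) CP_deriv[OF z]] L'(2)[OF vR(2)]])
    have dz: "deriv z = (\<lambda>x. deriv v x - deriv w x)" unfolding z_def[abs_def] by (rule CP_deriv_diff[OF v w])
    have "deriv (\<lambda>x. F (v x) - F (w x)) = (\<lambda>x. deriv F (v x) * deriv v x - deriv F (w x) * deriv w x)"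
      by (simp add: CP_deriv_diff[OF c] CP_deriv_comp[OF F1 v] CP_deriv_comp[OF F1 w])
    also have "\<dots> = (\<lambda>x. (deriv F (v x) - deriv F (w x)) * deriv v x + deriv F (w x) * deriv z x)"
      by (simp add: dz algebra_simps)
    finally have "L2norm (deriv (\<lambda>x. F (v x) - F (w x))) \<le> L2norm (\<lambda>x. (deriv F (v x) - deriv F (w x)) * deriv v x) + L2norm (\<lambda>x. deriv F (w x) * deriv z x)"
      using L2norm_triangle[OF CP_mult_L2[OF CP_diff[OF c'] CP_deriv[OF v]] CP_mult_L2[OF c'(2) CP_deriv[OF z]]] by simp
    moreover have "(L' * cn 1 z) * L2norm (deriv v) \<le> (L' * cn 1 z) * \<bar>R\<bar>"
      using cn_deriv_le[of 0 v] R by (intro mult_left_mono mult_nonneg_nonneg L') (auto simp: cn_0)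
    moreover have "L' * L2norm (deriv z) \<le> L' * cn 1 z"
      using cn_deriv_le[of 0 z] L' by (intro mult_left_mono) (auto simp: cn_0)
    ultimately have "cn (Suc 0) (\<lambda>x. F (v x) - F (w x)) \<le> (L + L' * \<bar>R\<bar> + L') * cn (Suc 0) z"
      using 1 2 3 by (simp add: cn_Suc[of 0 "\<lambda>x. F (v x) - F (w x)"] cn_0 algebra_simps)
    then show "cn (Suc 0) (\<lambda>x. F (v x) - F (w x)) \<le> (L + L' * \<bar>R\<bar> + L') * cn (Suc 0) (\<lambda>x. v x - w x)"
      by (simp add: z_def[abs_def])
  qed (use L L' in auto)
next
  case (Suc k)
  have F1: "Ck (Suc (Suc k)) F" using Ck_SucD[OF Suc.prems] .
  have F2: "Ck (Suc (Suc k)) (deriv F)" using Ck_deriv[OF Suc.prems] .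
  obtain C1 where C1: "C1 \<ge> 0" "\<And>v w. CP (Suc k) v \<Longrightarrow> CP (Suc k) w \<Longrightarrow> cn (Suc k) v \<le> R \<Longrightarrow> cn (Suc k) w \<le> R \<Longrightarrow>
      cn (Suc k) (\<lambda>x. F (v x) - F (w x)) \<le> C1 * cn (Suc k) (\<lambda>x. v x - w x)"
    using Suc.IH[OF F1] by blast
  obtain C2 where C2: "C2 \<ge> 0" "\<And>v w. CP (Suc k) v \<Longrightarrow> CP (Suc k) w \<Longrightarrow> cn (Suc k) v \<le> R \<Longrightarrow> cn (Suc k) w \<le> R \<Longrightarrow>
      cn (Suc k) (\<lambda>x. deriv F (v x) - deriv F (w x)) \<le> C2 * cn (Suc k) (\<lambda>x. v x - w x)"
    using Suc.IH[OF F2] by blast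
  define K where "K = C2 * \<bar>R\<bar> + \<bar>deriv F 0\<bar>"
  have K: "K \<ge> 0" using C2 by (simp add: K_def)
  define C where "C = C1 + alg k * C2 * \<bar>R\<bar> + alg k * K"
  note a = alg_pos[of k]
  have C: "C \<ge> 0" using C1 C2 K a by (simp add: C_def)
  show ?case
  proof (intro exI[of _ C] conjI allI impI C)
    fix v w assume v: "CP (Suc (Suc k)) v" and w: "CP (Suc (Suc k)) w"
      and R: "cn (Suc (Suc k)) v \<le> R" "cn (Suc (Suc k)) w \<le> R"
    define z where "z x = v x - w x" for x
    have z: "CP (Suc (Suc k)) z" unfolding z_def[abs_def] by (rule CP_diff[OF v w])
    note v0 = CP_SucD[OF v] and w0 = CP_SucD[OF w] and v' = CP_deriv[OF v] and w' = CP_deriv[OF w] and z' = CP_deriv[OF z]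
    have m: "cn (Suc k) x \<le> cn (Suc (Suc k)) x" for x by (rule cn_mono) simp
    have R0: "cn (Suc k) v \<le> R" "cn (Suc k) w \<le> R" using m R order_trans by blast+
    define S where "S = cn (Suc (Suc k)) z"
    have S: "S \<ge> 0" "cn (Suc k) z \<le> S" "cn (Suc k) (deriv z) \<le> S" using m cn_deriv_le by (auto simp: S_def)
    have c0: "CP (Suc k) (\<lambda>x. F (v x))" "CP (Suc k) (\<lambda>x. F (w x))"
      using CP_compose_left[OF Ck_SucD[OF F1]] v0 w0 by auto
    have c': "CP (Suc k) (\<lambda>x. deriv F (v x))" "CP (Suc k) (\<lambda>x. deriv F (w x))"
      using CP_compose_left[OF Ck_SucD[OF F2]] v0 w0 by auto
    have 1: "cn (Suc k) (\<lambda>x. F (v x) - F (w x)) \<le> C1 * S"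
      using C1(2)[OF v0 w0 R0] mult_left_mono[OF S(2) C1(1)] by (simp add: z_def[abs_def])
    have 2: "cn (Suc k) (\<lambda>x. deriv F (v x) - deriv F (w x)) \<le> C2 * S"
      using C2(2)[OF v0 w0 R0] mult_left_mono[OF S(2) C2(1)] by (simp add: z_def[abs_def])
    have 3: "cn (Suc k) (\<lambda>x. deriv F (w x)) \<le> K"
    proof -
      have "cn (Suc k) (\<lambda>x. (deriv F (w x) - deriv F 0) + deriv F 0) \<le> cn (Suc k) (\<lambda>x. deriv F (w x) - deriv F 0) + cn (Suc k) (\<lambda>x. deriv F 0)"
        by (rule cn_add[OF CP_diff[OF c'(2)]]) auto
      moreover have "cn j (\<lambda>x. c) = \<bar>c\<bar>" for j c
        by (induction j arbitrary: c) (simp_all add: cn_0 cn_Suc)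
      moreover have "cn (Suc k) (\<lambda>x. deriv F (w x) - deriv F 0) \<le> C2 * cn (Suc k) (\<lambda>x. w x - 0)"
        using C2(2)[OF w0 CP_const[of _ 0] R0(2)] R0(2) cn_nonneg[of "Suc k" w] calculation(2)[of "Suc k" 0] by simp
      moreover have "C2 * cn (Suc k) w \<le> C2 * \<bar>R\<bar>" using R0(2) C2(1) by (intro mult_left_mono) auto
      ultimately show ?thesis by (simp add: K_def)
    qed
    have "cn (Suc k) (\<lambda>x. (deriv F (v x) - deriv F (w x)) * deriv v x) \<le> alg k * cn (Suc k) (\<lambda>x. deriv F (v x) - deriv F (w x)) * cn (Suc k) (deriv v)"
      by (rule cn_mult[OF CP_diff[OF c'] v'])
    also have "\<dots> \<le> alg k * (C2 * S) * \<bar>R\<bar>"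
      using 2 a S C2 R cn_deriv_le[of "Suc k" v] by (intro mult_mono mult_nonneg_nonneg) auto
    finally have 4: "cn (Suc k) (\<lambda>x. (deriv F (v x) - deriv F (w x)) * deriv v x) \<le> alg k * C2 * \<bar>R\<bar> * S"
      by (simp add: algebra_simps)
    have "cn (Suc k) (\<lambda>x. deriv F (w x) * deriv z x) \<le> alg k * cn (Suc k) (\<lambda>x. deriv F (w x)) * cn (Suc k) (deriv z)"
      by (rule cn_mult[OF c'(2) z'])
    also have "\<dots> \<le> alg k * K * S"
      using 3 a S K by (intro mult_mono mult_nonneg_nonneg) auto
    finally have 5: "cn (Suc k) (\<lambda>x. deriv F (w x) * deriv z x) \<le> alg k * K * S" .
    have dz: "deriv z = (\<lambda>x. deriv v x - deriv w x)"
      unfolding z_def[abs_def] by (rule CP_deriv_diff) (use v w CP_mono in auto)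
    have F0: "Ck (Suc 0) F" using Ck_mono[OF F1, of "Suc 0"] by simp
    have vw1: "CP (Suc 0) v" "CP (Suc 0) w" using v w CP_mono[of _ _ "Suc 0"] by auto
    have "deriv (\<lambda>x. F (v x) - F (w x)) = (\<lambda>x. deriv F (v x) * deriv v x - deriv F (w x) * deriv w x)"
      using CP_deriv_diff[OF CP_compose_left[OF F0 vw1(1)] CP_compose_left[OF F0 vw1(2)]]
      by (simp add: CP_deriv_comp[OF F0] vw1)
    also have "\<dots> = (\<lambda>x. (deriv F (v x) - deriv F (w x)) * deriv v x + deriv F (w x) * deriv z x)"
      by (simp add: dz algebra_simps)
    finally have "cn (Suc k) (deriv (\<lambda>x. F (v x) - F (w x))) \<le> alg k * C2 * \<bar>R\<bar> * S + alg k * K * S"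
      using cn_add[OF CP_mult[OF CP_diff[OF c'] v'] CP_mult[OF c'(2) z']] 4 5 by simp
    then have "cn (Suc (Suc k)) (\<lambda>x. F (v x) - F (w x)) \<le> C1 * S + (alg k * C2 * \<bar>R\<bar> * S + alg k * K * S)"
      using L2norm_le_cn0[of "\<lambda>x. F (v x) - F (w x)" "Suc k"] 1 unfolding cn_Suc[of "Suc k"] by linarith
    also have "\<dots> = C * S" by (simp add: C_def algebra_simps)
    finally show "cn (Suc (Suc k)) (\<lambda>x. F (v x) - F (w x)) \<le> C * cn (Suc (Suc k)) (\<lambda>x. v x - w x)"
      by (simp add: S_def z_def[abs_def])
  qed
qed

lemma cn_const: "cn j (\<lambda>x. c) = \<bar>c\<bar>"
  by (induction j arbitrary: c) (simp_all add: cn_0 cn_Suc)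

section \<open>Composition with a perturbation of the identity\<close>

text \<open>Velocities for which \<open>x \<mapsto> x - a(x) dt\<close> has a derivative between \<open>1/2\<close>
  and \<open>3/2\<close>. The order is raised to one where \<open>k = 0\<close>, so that the inductions below can
  start with plain \<open>L\<^sup>2\<close> estimates. The bound on \<open>deriv a\<close> is listed separately since
  it follows from the norm only for order at least two.\<close>

definition adm :: "nat \<Rightarrow> real \<Rightarrow> real \<Rightarrow> (real \<Rightarrow> real) \<Rightarrow> bool" where
  "adm k R dt a \<longleftrightarrow> CP (max 1 k) a \<and> cn (max 1 k) a \<le> R \<and> (\<forall>x. \<bar>deriv a x\<bar> \<le> R) \<and> 0 \<le> dt \<and> dt \<le> 1 \<and> dt * R \<le> 1/2"

lemma admD:
  assumes "adm (Suc k) R dt a"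
  shows "CP (Suc k) a" "cn (Suc k) a \<le> R" "\<bar>deriv a x\<bar> \<le> R" "0 \<le> dt" "dt \<le> 1" "dt * R \<le> 1/2" "0 \<le> R"
    "\<bar>a x\<bar> \<le> R" "CP (Suc 0) a"
proof -
  show *: "CP (Suc k) a" "cn (Suc k) a \<le> R" "\<bar>deriv a x\<bar> \<le> R" "0 \<le> dt" "dt \<le> 1" "dt * R \<le> 1/2"
    using assms by (auto simp: adm_def)
  show "0 \<le> R" using *(3) by linarith
  show "\<bar>a x\<bar> \<le> R" using CP_sup'[OF *(1), of x] *(2) by linarith
  show "CP (Suc 0) a" using CP_mono[OF *(1)] by simp
qed

lemma adm_0: "adm 0 R dt a = adm (Suc 0) R dt a"
  by (simp add: adm_def)

lemma adm_Suc:
  assumes "adm (Suc k) R dt a"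
  shows "adm k R dt a" "CP k (deriv a)" "cn k (deriv a) \<le> R"
proof -
  have a: "CP (Suc k) a" "cn (Suc k) a \<le> R" using assms by (auto simp: adm_def)
  have "CP (max 1 k) a" by (rule CP_mono[OF a(1)]) simp
  moreover have "cn (max 1 k) a \<le> R" using cn_mono[of "max 1 k" "Suc k" a] a(2) by simp
  ultimately show "adm k R dt a" using assms by (simp add: adm_def)
  show "CP k (deriv a)" by (rule CP_deriv[OF a(1)])
  show "cn k (deriv a) \<le> R" using cn_deriv_le[of k a] a(2) by simp
qed

lemma adm_zero: "adm k R dt a \<Longrightarrow> adm k R dt (\<lambda>x. 0)"
  using abs_ge_zero[of "deriv a 0"] by (auto simp: adm_def cn_const intro: order_trans[OF abs_ge_zero])

lemma X1_zero [simp]: "X1 dt (\<lambda>x. 0) = (\<lambda>x. x)"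
  by (auto simp: X1_def)

lemma CP_X1: "CP k a \<Longrightarrow> CP k e \<Longrightarrow> CP k (\<lambda>x. e (X1 dt a x))"
proof (rule CPI)
  assume a: "CP k a" and e: "CP k e"
  show "Ck k (\<lambda>x. e (X1 dt a x))"
    unfolding X1_def by (rule Ck_compose[OF CPD(1)[OF e]]) (intro Ck_diff Ck_mult Ck_ident Ck_const CPD(1)[OF a])
  have "X1 dt a (x + 1) = X1 dt a x + 1" for x using CPD(2)[OF a] by (simp add: X1_def)
  then show "e (X1 dt a (x + 1)) = e (X1 dt a x)" for x using CPD(2)[OF e] by simp
qed

lemma X1_DERIV: "CP (Suc 0) a \<Longrightarrow> (X1 dt a has_real_derivative 1 - dt * deriv a x) (at x)"
  unfolding X1_def[abs_def] by (auto intro!: derivative_eq_intros CP_DERIV)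

lemma CP_deriv_X1:
  assumes "CP (Suc 0) a" "CP (Suc 0) e"
  shows "deriv (\<lambda>x. e (X1 dt a x)) = (\<lambda>x. deriv e (X1 dt a x) - dt * (deriv e (X1 dt a x) * deriv a x))"
proof (rule ext, rule DERIV_imp_deriv)
  fix x
  have "((\<lambda>x. e (X1 dt a x)) has_real_derivative deriv e (X1 dt a x) * (1 - dt * deriv a x)) (at x)"
    by (rule DERIV_chain2[OF CP_DERIV[OF assms(2)] X1_DERIV[OF assms(1)]])
  then show "((\<lambda>x. e (X1 dt a x)) has_real_derivative deriv e (X1 dt a x) - dt * (deriv e (X1 dt a x) * deriv a x)) (at x)"
    by (simp add: algebra_simps)
qed

text \<open>Substitution: with the Jacobian \<open>1 - dt a'\<close> as a weight, the integral over a period is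
  exactly preserved. The factor is the bound \<open>1 / (1 - y) \<le> 1 + 2 y\<close> for
  \<open>y = dt R \<le> 1/2\<close>.\<close>

lemma L2norm_X1_sq:
  assumes a: "adm (Suc k) R dt a" and g: "CP 0 g"
  shows "(L2norm (\<lambda>x. g (X1 dt a x)))\<^sup>2 \<le> (1 + 2 * R * dt) * (L2norm g)\<^sup>2"
proof -
  note D = admD[OF a]
  define y where "y = dt * R"
  have y: "0 \<le> y" "y \<le> 1/2" using D(4,6,7) by (auto simp: y_def)
  have gc: "continuous_on UNIV g" by (rule CP_cont[OF g])
  have Xc: "continuous_on UNIV (X1 dt a)" unfolding X1_def[abs_def] by (intro continuous_intros CP_cont[OF D(1)])
  have ac: "continuous_on UNIV (deriv a)" by (rule CP_cont[OF CP_deriv[OF D(9)]])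
  have gXc: "continuous_on UNIV (\<lambda>x. g (X1 dt a x))" by (rule continuous_on_compose2[OF gc Xc]) auto
  have g2p: "(g (x + 1))\<^sup>2 = (g x)\<^sup>2" for x using CPD(2)[OF g] by simp
  have g2c: "continuous_on UNIV (\<lambda>x. (g x)\<^sup>2)" by (intro continuous_intros gc)
  obtain A where A: "\<And>x. (A has_real_derivative (g x)\<^sup>2) (at x)"
    using antiderivative_ex[OF g2c] by blast
  have "((\<lambda>x. (g (X1 dt a x))\<^sup>2 * (1 - dt * deriv a x)) has_integral (A (X1 dt a 1) - A (X1 dt a 0))) {0..1}"
  proof (rule fundamental_theorem_of_calculus)
    fix x :: real
    have "((\<lambda>x. A (X1 dt a x)) has_real_derivative (g (X1 dt a x))\<^sup>2 * (1 - dt * deriv a x)) (at x)"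
      by (rule DERIV_chain2[OF A X1_DERIV[OF D(9)]])
    then show "((\<lambda>x. A (X1 dt a x)) has_vector_derivative (g (X1 dt a x))\<^sup>2 * (1 - dt * deriv a x)) (at x within {0..1})"
      by (simp add: has_real_derivative_iff_has_vector_derivative has_vector_derivative_at_within)
  qed simp
  moreover have "X1 dt a 1 = X1 dt a 0 + 1" using CPD(2)[OF D(1), of 0] by (simp add: X1_def)
  ultimately have I: "integral {0..1} (\<lambda>x. (g (X1 dt a x))\<^sup>2 * (1 - dt * deriv a x)) = integral {0..1} (\<lambda>x. (g x)\<^sup>2)"
    using periodic_antiderivative[OF g2p g2c A, of "X1 dt a 0"] by (simp add: integral_unique)
  have c1: "continuous_on UNIV (\<lambda>x. (g (X1 dt a x))\<^sup>2)" by (intro continuous_intros gXc)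
  have c2: "continuous_on UNIV (\<lambda>x. (g (X1 dt a x))\<^sup>2 * (1 - dt * deriv a x))" by (intro continuous_intros gXc ac)
  have "(L2norm (\<lambda>x. g (X1 dt a x)))\<^sup>2 = (\<integral>x. (g (X1 dt a x))\<^sup>2 \<partial>torus)" by (rule L2norm_sq)
  also have "\<dots> \<le> (\<integral>x. (1 + 2 * y) * ((g (X1 dt a x))\<^sup>2 * (1 - dt * deriv a x)) \<partial>torus)"
  proof (rule integral_mono)
    fix x
    have "dt * deriv a x \<le> y" unfolding y_def using D(3)[of x] D(4) by (intro mult_left_mono) auto
    then have "(1 + 2 * y) * (1 - y) \<le> (1 + 2 * y) * (1 - dt * deriv a x)" using y by (intro mult_left_mono) auto
    moreover have "1 \<le> (1 + 2 * y) * (1 - y)"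
    proof -
      have "0 \<le> y * (1 - 2 * y)" using y by simp
      then show ?thesis by (simp add: algebra_simps)
    qed
    ultimately have "1 \<le> (1 + 2 * y) * (1 - dt * deriv a x)" by linarith
    then have "(g (X1 dt a x))\<^sup>2 * 1 \<le> (g (X1 dt a x))\<^sup>2 * ((1 + 2 * y) * (1 - dt * deriv a x))"
      by (intro mult_left_mono) auto
    then show "(g (X1 dt a x))\<^sup>2 \<le> (1 + 2 * y) * ((g (X1 dt a x))\<^sup>2 * (1 - dt * deriv a x))" by (simp add: algebra_simps)
  qed (use torus_integral_cont(1)[OF c1] torus_integral_cont(1)[OF c2] in auto)
  also have "\<dots> = (1 + 2 * y) * (L2norm g)\<^sup>2"
    using torus_integral_cont(2)[OF c2] torus_integral_cont(2)[OF g2c] I by (simp add: L2norm_sq)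
  finally show ?thesis by (simp add: y_def algebra_simps)
qed

lemma L2norm_X1:
  assumes a: "adm (Suc k) R dt a" and g: "CP 0 g"
  shows "L2norm (\<lambda>x. g (X1 dt a x)) \<le> 2 * L2norm g"
proof (rule power2_le_imp_le)
  have "2 * R * dt \<le> 1" using admD(6)[OF a] by (simp add: mult.commute mult.left_commute)
  then have "(1 + 2 * R * dt) * (L2norm g)\<^sup>2 \<le> 4 * (L2norm g)\<^sup>2" by (intro mult_right_mono) auto
  then show "(L2norm (\<lambda>x. g (X1 dt a x)))\<^sup>2 \<le> (2 * L2norm g)\<^sup>2"
    using L2norm_X1_sq[OF a g] by (simp add: power_mult_distrib)
qed simp

text \<open>At order zero the algebra property fails, but \<open>deriv a\<close> is bounded uniformly; this makes one
  induction step serve for all orders.\<close>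

lemma cn_mult_deriv:
  assumes a: "adm (Suc k) R dt a" and v: "CP k v"
  shows "CP k (\<lambda>x. v x * deriv a x)" "cn k (\<lambda>x. v x * deriv a x) \<le> alg k * R * cn k v"
proof -
  note D = admD[OF a] and A = adm_Suc[OF a]
  show m: "CP k (\<lambda>x. v x * deriv a x)" by (rule CP_mult[OF v A(2)])
  show "cn k (\<lambda>x. v x * deriv a x) \<le> alg k * R * cn k v"
  proof (cases k)
    case 0
    have "L2norm (\<lambda>x. deriv a x * v x) \<le> R * L2norm v"
      by (rule L2norm_mult_bound[OF CP_L2[OF v] _ D(3)]) (use CP_L2[OF m] in \<open>simp add: mult.commute\<close>)
    moreover have "0 \<le> R * L2norm v" using D(7) by simp
    ultimately have "L2norm (\<lambda>x. deriv a x * v x) \<le> 3 * (R * L2norm v)" by linarith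
    then show ?thesis using 0 by (simp add: cn_0 algebra_simps)
  next
    case (Suc j)
    have "cn k (\<lambda>x. v x * deriv a x) \<le> alg j * cn k v * cn k (deriv a)"
      using cn_mult[of j v "deriv a"] v A(2) Suc by simp
    also have "\<dots> \<le> alg k * cn k v * R"
      using A(3) alg_pos[of j] Suc by (intro mult_mono mult_nonneg_nonneg) auto
    finally show ?thesis by (simp add: algebra_simps)
  qed
qed

text \<open>The companion of \<open>cn_mult_deriv\<close> for a first factor with one derivative to spare, which
  gives its uniform bound at order zero.\<close>

lemma cn_mult_spare:
  assumes v: "CP (Suc k) v" and w: "CP k w"
  shows "cn k (\<lambda>x. v x * w x) \<le> alg k * cn (Suc k) v * cn k w"
proof (cases k)
  case 0
  have "L2norm (\<lambda>x. v x * w x) \<le> cn (Suc k) v * L2norm w"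
    by (rule L2norm_mult_sup[OF v CP_L2[OF w] CP_L2[OF CP_mult[OF CP_SucD[OF v] w]]])
  moreover have "0 \<le> cn (Suc k) v * L2norm w" by simp
  ultimately have "L2norm (\<lambda>x. v x * w x) \<le> 3 * (cn (Suc k) v * L2norm w)" by linarith
  then show ?thesis using 0 by (simp add: cn_0 mult.assoc)
next
  case (Suc j)
  have "cn k (\<lambda>x. v x * w x) \<le> alg j * cn k v * cn k w" using cn_mult[of j v w] CP_SucD[OF v] w Suc by simp
  also have "\<dots> \<le> alg k * cn (Suc k) v * cn k w"
    using cn_mono[of k "Suc k" v] alg_pos[of j] Suc by (intro mult_mono mult_nonneg_nonneg) auto
  finally show ?thesis .
qed

text \<open>A crude bound; the sharp constant matters only at the top order and in \<open>L\<^sup>2\<close>, for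
  which see \<open>funpow_X1_sq\<close>.\<close>

lemma cn_X1:
  "\<exists>C\<ge>0. \<forall>a dt e. adm k R dt a \<longrightarrow> CP k e \<longrightarrow> cn k (\<lambda>x. e (X1 dt a x)) \<le> C * cn k e"
proof (induction k)
  case 0
  show ?case by (intro exI[of _ 2]) (auto simp: cn_0 adm_0 intro: L2norm_X1)
next
  case (Suc k)
  then obtain C where C: "C \<ge> 0" "\<And>a dt e. adm k R dt a \<Longrightarrow> CP k e \<Longrightarrow> cn k (\<lambda>x. e (X1 dt a x)) \<le> C * cn k e"
    by blast
  note al = alg_pos[of k]
  show ?case
  proof (intro exI[of _ "2 + C + alg k * \<bar>R\<bar> * C"] conjI allI impI)
    fix a dt e assume a: "adm (Suc k) R dt a" and e: "CP (Suc k) e"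
    note D = admD[OF a] and e' = CP_deriv[OF e]
    define N where "N = cn (Suc k) e"
    have N: "N \<ge> 0" "cn k (deriv e) \<le> N" "L2norm e \<le> N"
      using cn_deriv_le L2norm_le_cn0 by (auto simp: N_def)
    have 0: "L2norm (\<lambda>x. e (X1 dt a x)) \<le> 2 * N"
      using L2norm_X1[OF a CP_mono[OF e, of 0]] N by simp
    define v where "v x = deriv e (X1 dt a x)" for x
    have v: "CP k v" unfolding v_def[abs_def] by (rule CP_X1[OF CP_SucD[OF D(1)] e'])
    have 1: "cn k v \<le> C * N"
      using C(2)[OF adm_Suc(1)[OF a] e'] mult_left_mono[OF N(2) C(1)] unfolding v_def[abs_def] by linarith
    note m = cn_mult_deriv[OF a v]
    have 2: "cn k (\<lambda>x. v x * deriv a x) \<le> alg k * R * (C * N)"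
      by (rule order_trans[OF m(2) mult_left_mono[OF 1]]) (use al D(7) in simp)
    have "cn k (\<lambda>x. v x - dt * (v x * deriv a x)) \<le> cn k v + dt * cn k (\<lambda>x. v x * deriv a x)"
      using cn_diff[OF v CP_cmult[OF m(1)], of dt] cn_cmult[OF m(1), of dt] D(4) by simp
    also have "\<dots> \<le> C * N + 1 * (alg k * R * (C * N))"
      using 1 2 D(4,5,7) al C(1) N(1) by (intro add_mono mult_mono) auto
    finally have "cn k (deriv (\<lambda>x. e (X1 dt a x))) \<le> C * N + alg k * R * (C * N)"
      using CP_deriv_X1[OF D(9) CP_mono[OF e, of "Suc 0"]] by (simp add: v_def[abs_def])
    then show "cn (Suc k) (\<lambda>x. e (X1 dt a x)) \<le> (2 + C + alg k * \<bar>R\<bar> * C) * cn (Suc k) e"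
      using 0 D(7) unfolding cn_Suc[of k "\<lambda>x. e (X1 dt a x)"] N_def[symmetric] by (simp add: algebra_simps)
  qed (use C al in auto)
qed

text \<open>The commutator of differentiation and composition: by
  \<open>(e \<circ> X)' = (e' \<circ> X) (1 - dt a')\<close> all of its terms carry a factor \<open>dt\<close>.\<close>

lemma funpow_X1:
  "\<exists>C\<ge>0. \<forall>a dt e. adm k R dt a \<longrightarrow> CP k e \<longrightarrow>
     L2norm (\<lambda>x. (deriv ^^ k) (\<lambda>x. e (X1 dt a x)) x - (deriv ^^ k) e (X1 dt a x)) \<le> C * dt * cn k e"
proof (induction k)
  case 0
  show ?case by (intro exI[of _ 0]) simp
next
  case (Suc k)
  then obtain C where C: "C \<ge> 0" "\<And>a dt e. adm k R dt a \<Longrightarrow> CP k e \<Longrightarrow>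
     L2norm (\<lambda>x. (deriv ^^ k) (\<lambda>x. e (X1 dt a x)) x - (deriv ^^ k) e (X1 dt a x)) \<le> C * dt * cn k e"
    by blast
  obtain C1 where C1: "C1 \<ge> 0" "\<And>a dt e. adm k R dt a \<Longrightarrow> CP k e \<Longrightarrow> cn k (\<lambda>x. e (X1 dt a x)) \<le> C1 * cn k e"
    using cn_X1[of k R] by blast
  note al = alg_pos[of k]
  show ?case
  proof (intro exI[of _ "C + alg k * \<bar>R\<bar> * C1"] conjI allI impI)
    fix a dt e assume a: "adm (Suc k) R dt a" and e: "CP (Suc k) e"
    note D = admD[OF a] and e' = CP_deriv[OF e] and a0 = adm_Suc(1)[OF a]
    define N where "N = cn (Suc k) e"
    have N: "N \<ge> 0" "cn k (deriv e) \<le> N" using cn_deriv_le by (auto simp: N_def)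
    define v where "v x = deriv e (X1 dt a x)" for x
    have v: "CP k v" unfolding v_def[abs_def] by (rule CP_X1[OF CP_SucD[OF D(1)] e'])
    have 1: "cn k v \<le> C1 * N"
      using C1(2)[OF a0 e'] mult_left_mono[OF N(2) C1(1)] unfolding v_def[abs_def] by linarith
    define m where "m x = v x * deriv a x" for x
    have m: "CP k m" unfolding m_def[abs_def] by (rule cn_mult_deriv(1)[OF a v])
    have "cn k m \<le> alg k * R * (C1 * N)"
      unfolding m_def[abs_def] by (rule order_trans[OF cn_mult_deriv(2)[OF a v] mult_left_mono[OF 1]]) (use al D(7) in simp)
    then have 2: "L2norm ((deriv ^^ k) m) \<le> alg k * R * (C1 * N)"
      using L2norm_le_cn[of k k m] by simp
    have "deriv (\<lambda>x. e (X1 dt a x)) = (\<lambda>x. 1 * v x + (- dt) * m x)"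
      using CP_deriv_X1[OF D(9) CP_mono[OF e, of "Suc 0"]] by (simp add: m_def v_def)
    then have eq: "(deriv ^^ Suc k) (\<lambda>x. e (X1 dt a x)) = (\<lambda>x. 1 * (deriv ^^ k) v x + (- dt) * (deriv ^^ k) m x)"
      unfolding deriv_funpow_Suc[of k] using Ck_funpow_lincomb[OF CPD(1)[OF v] CPD(1)[OF m], of 1 "- dt"] by simp
    define p where "p x = (deriv ^^ k) v x - (deriv ^^ k) (deriv e) (X1 dt a x)" for x
    have pL: "p \<in> L2" unfolding p_def[abs_def]
    proof (intro L2_diff CP_funpow_L2[OF v])
      show "(\<lambda>x. (deriv ^^ k) (deriv e) (X1 dt a x)) \<in> L2"
        by (rule CP_L2[of 0], rule CP_X1[of 0]) (use CP_mono[OF D(1)] CP_funpow[of k 0 "deriv e"] e' in auto)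
    qed simp
    have pn: "L2norm p \<le> C * dt * N"
      using C(2)[OF a0 e'] mult_left_mono[OF N(2), of "C * dt"] C(1) D(4) unfolding p_def[abs_def] v_def[abs_def] by simp
    have "L2norm (\<lambda>x. (deriv ^^ Suc k) (\<lambda>x. e (X1 dt a x)) x - (deriv ^^ Suc k) e (X1 dt a x))
       = L2norm (\<lambda>x. p x - dt * (deriv ^^ k) m x)"
      unfolding eq deriv_funpow_Suc[of k e] by (simp add: p_def algebra_simps)
    also have "\<dots> \<le> L2norm p + dt * L2norm ((deriv ^^ k) m)"
      using L2norm_triangle_diff[OF pL L2_cmult[OF CP_funpow_L2[OF m order_refl]], of dt] D(4) by (simp add: L2norm_cmult)
    also have "\<dots> \<le> C * dt * N + dt * (alg k * R * (C1 * N))"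
      using pn 2 D(4) by (intro add_mono mult_left_mono) auto
    finally show "L2norm (\<lambda>x. (deriv ^^ Suc k) (\<lambda>x. e (X1 dt a x)) x - (deriv ^^ Suc k) e (X1 dt a x))
      \<le> (C + alg k * \<bar>R\<bar> * C1) * dt * cn (Suc k) e"
      using D(7) unfolding N_def by (simp add: algebra_simps)
  qed (use C C1 al in auto)
qed

text \<open>The leading constant one is what keeps the product of \<open>T / dt\<close> such factors bounded.\<close>

lemma funpow_X1_sq:
  "\<exists>C\<ge>0. \<forall>a dt e. adm (Suc k) R dt a \<longrightarrow> CP (Suc k) e \<longrightarrow>
     (L2norm ((deriv ^^ Suc k) (\<lambda>x. e (X1 dt a x))))\<^sup>2 \<le> (L2norm ((deriv ^^ Suc k) e))\<^sup>2 + C * dt * (cn (Suc k) e)\<^sup>2"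
proof -
  obtain C where C: "C \<ge> 0" "\<And>a dt e. adm (Suc k) R dt a \<Longrightarrow> CP (Suc k) e \<Longrightarrow>
     L2norm (\<lambda>x. (deriv ^^ Suc k) (\<lambda>x. e (X1 dt a x)) x - (deriv ^^ Suc k) e (X1 dt a x)) \<le> C * dt * cn (Suc k) e"
    using funpow_X1[of "Suc k" R] by blast
  show ?thesis
  proof (intro exI[of _ "2 * \<bar>R\<bar> + 4 * C + C\<^sup>2"] conjI allI impI)
    fix a dt e assume a: "adm (Suc k) R dt a" and e: "CP (Suc k) e"
    note D = admD[OF a]
    define N where "N = cn (Suc k) e"
    define E where "E = (deriv ^^ Suc k) e"
    have E: "CP 0 E" unfolding E_def by (rule CP_funpow) (use e in auto)
    have EN: "L2norm E \<le> N" "N \<ge> 0" unfolding E_def N_def by (auto intro: L2norm_le_cn simp del: funpow.simps)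
    have EX: "(\<lambda>x. E (X1 dt a x)) \<in> L2"
      by (rule CP_L2[of 0], rule CP_X1[of 0]) (use CP_mono[OF D(1)] E in auto)
    have FX: "(deriv ^^ Suc k) (\<lambda>x. e (X1 dt a x)) \<in> L2" by (rule CP_funpow_L2[OF CP_X1[OF D(1) e]]) simp
    define d where "d x = (deriv ^^ Suc k) (\<lambda>x. e (X1 dt a x)) x - E (X1 dt a x)" for x
    have d: "d \<in> L2" "L2norm d \<le> C * dt * N"
      using L2_diff[OF FX EX] C(2)[OF a e] by (auto simp: d_def[abs_def] E_def N_def)
    have 2: "L2norm (\<lambda>x. E (X1 dt a x)) \<le> 2 * N" using L2norm_X1[OF a E] EN by linarith
    have "L2norm ((deriv ^^ Suc k) (\<lambda>x. e (X1 dt a x))) = L2norm (\<lambda>x. d x + E (X1 dt a x))"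
      unfolding d_def by simp
    also have "\<dots> \<le> L2norm d + L2norm (\<lambda>x. E (X1 dt a x))" by (rule L2norm_triangle[OF d(1) EX])
    also have "\<dots> \<le> C * dt * N + L2norm (\<lambda>x. E (X1 dt a x))" using d(2) by simp
    finally have "(L2norm ((deriv ^^ Suc k) (\<lambda>x. e (X1 dt a x))))\<^sup>2 \<le> (C * dt * N + L2norm (\<lambda>x. E (X1 dt a x)))\<^sup>2"
      by (intro power_mono) auto
    also have "\<dots> = (C * dt * N)\<^sup>2 + 2 * (C * dt * N) * L2norm (\<lambda>x. E (X1 dt a x)) + (L2norm (\<lambda>x. E (X1 dt a x)))\<^sup>2"
      by (simp add: power2_sum)
    also have "\<dots> \<le> C\<^sup>2 * dt * N\<^sup>2 + 4 * C * dt * N\<^sup>2 + ((L2norm E)\<^sup>2 + 2 * R * dt * N\<^sup>2)"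
    proof (intro add_mono)
      have "dt\<^sup>2 \<le> dt" using D(4,5) by (simp add: power2_eq_square mult_left_le)
      then have "C\<^sup>2 * dt\<^sup>2 * N\<^sup>2 \<le> C\<^sup>2 * dt * N\<^sup>2" by (intro mult_right_mono mult_left_mono) auto
      then show "(C * dt * N)\<^sup>2 \<le> C\<^sup>2 * dt * N\<^sup>2" by (simp add: power_mult_distrib)
      have "2 * (C * dt * N) * L2norm (\<lambda>x. E (X1 dt a x)) \<le> 2 * (C * dt * N) * (2 * N)"
        using 2 C(1) D(4) EN by (intro mult_left_mono) auto
      then show "2 * (C * dt * N) * L2norm (\<lambda>x. E (X1 dt a x)) \<le> 4 * C * dt * N\<^sup>2"
        by (simp add: power2_eq_square algebra_simps)
      have "(L2norm E)\<^sup>2 \<le> N\<^sup>2" using EN by (intro power_mono) auto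
      then have "(2 * R * dt) * (L2norm E)\<^sup>2 \<le> (2 * R * dt) * N\<^sup>2" using D(4,7) by (intro mult_left_mono) auto
      then show "(L2norm (\<lambda>x. E (X1 dt a x)))\<^sup>2 \<le> (L2norm E)\<^sup>2 + 2 * R * dt * N\<^sup>2"
        using L2norm_X1_sq[OF a E] by (simp add: algebra_simps)
    qed
    finally show "(L2norm ((deriv ^^ Suc k) (\<lambda>x. e (X1 dt a x))))\<^sup>2 \<le> (L2norm ((deriv ^^ Suc k) e))\<^sup>2 + (2 * \<bar>R\<bar> + 4 * C + C\<^sup>2) * dt * (cn (Suc k) e)\<^sup>2"
      using D(7) unfolding E_def N_def by (simp add: algebra_simps)
  qed (use C in auto)
qed

section \<open>Increments under perturbations of the identity\<close>

lemma CP_lip: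
  assumes "CP (Suc 0) e" "\<And>x. \<bar>deriv e x\<bar> \<le> M" shows "\<bar>e y - e z\<bar> \<le> M * \<bar>y - z\<bar>"
  using field_differentiable_bound[of UNIV e "deriv e" M y z] CP_DERIV[OF assms(1)] assms(2) by auto

lemma CP_sup_deriv: "CP (Suc (Suc k)) e \<Longrightarrow> \<bar>deriv e x\<bar> \<le> cn (Suc (Suc k)) e"
  using CP_sup'[OF CP_deriv, of k e x] cn_deriv_le[of "Suc k" e] by linarith

lemma X1_diff_pointwise:
  assumes "CP (Suc (Suc k)) e" "0 \<le> dt"
  shows "\<bar>e (X1 dt a x) - e (X1 dt b x)\<bar> \<le> cn (Suc (Suc k)) e * dt * \<bar>a x - b x\<bar>"
proof -
  have "\<bar>e (X1 dt a x) - e (X1 dt b x)\<bar> \<le> cn (Suc (Suc k)) e * \<bar>X1 dt a x - X1 dt b x\<bar>"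
    by (rule CP_lip[OF CP_mono[OF assms(1)] CP_sup_deriv[OF assms(1)]]) simp
  also have "X1 dt a x - X1 dt b x = - (dt * (a x - b x))" by (simp add: X1_def algebra_simps)
  finally show ?thesis using assms(2) by (simp add: abs_mult mult.assoc)
qed

lemma L2norm_X1_diff:
  assumes "CP (Suc (Suc k)) e" "0 \<le> dt" "CP 0 a" "CP 0 b"
  shows "L2norm (\<lambda>x. e (X1 dt a x) - e (X1 dt b x)) \<le> cn (Suc (Suc k)) e * dt * L2norm (\<lambda>x. a x - b x)"
proof -
  have e0: "CP 0 e" using CP_mono[OF assms(1)] by simp
  have "L2norm (\<lambda>x. e (X1 dt a x) - e (X1 dt b x)) \<le> L2norm (\<lambda>x. (cn (Suc (Suc k)) e * dt) * (a x - b x))"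
  proof (rule L2norm_mono)
    show "(\<lambda>x. e (X1 dt a x) - e (X1 dt b x)) \<in> L2"
      by (intro CP_L2[of 0] CP_diff CP_X1 assms e0)
    show "(\<lambda>x. cn (Suc (Suc k)) e * dt * (a x - b x)) \<in> L2" by (intro CP_L2[of 0] CP_cmult CP_diff assms)
    show "\<bar>e (X1 dt a x) - e (X1 dt b x)\<bar> \<le> \<bar>cn (Suc (Suc k)) e * dt * (a x - b x)\<bar>" for x
      using X1_diff_pointwise[OF assms(1,2), of a x b] assms(2) by (simp add: abs_mult)
  qed
  then show ?thesis using assms(2) by (simp add: L2norm_cmult abs_mult)
qed

lemma deriv_X1_diff:
  assumes "CP (Suc 0) a" "CP (Suc 0) b" "CP (Suc 0) e"
  shows "deriv (\<lambda>x. e (X1 dt a x) - e (X1 dt b x)) = (\<lambda>x. (deriv e (X1 dt a x) - deriv e (X1 dt b x))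
     - dt * ((deriv e (X1 dt a x) - deriv e (X1 dt b x)) * deriv a x + deriv e (X1 dt b x) * (deriv a x - deriv b x)))"
  unfolding CP_deriv_diff[OF CP_X1[OF assms(1,3)] CP_X1[OF assms(2,3)]] CP_deriv_X1[OF assms(1,3)] CP_deriv_X1[OF assms(2,3)]
  by (simp add: algebra_simps)

text \<open>Changing the velocity moves the foot of the characteristic by \<open>dt |a - b|\<close>. The function
  \<open>e\<close> loses derivatives, which is harmless because its role is played by the averaged exact solution.\<close>

lemma cn_X1_diff:
  "\<exists>C\<ge>0. \<forall>a b dt e. adm k R dt a \<longrightarrow> adm k R dt b \<longrightarrow> CP (Suc (Suc k)) e \<longrightarrow>
     cn k (\<lambda>x. e (X1 dt a x) - e (X1 dt b x)) \<le> C * dt * cn k (\<lambda>x. a x - b x) * cn (Suc (Suc k)) e"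
proof (induction k)
  case 0
  show ?case
  proof (intro exI[of _ 1] conjI allI impI)
    fix a b dt e assume a: "adm 0 R dt a" and b: "adm 0 R dt b" and e: "CP (Suc (Suc 0)) e"
    note D = admD[OF a[unfolded adm_0]] and Db = admD[OF b[unfolded adm_0]]
    show "cn 0 (\<lambda>x. e (X1 dt a x) - e (X1 dt b x)) \<le> 1 * dt * cn 0 (\<lambda>x. a x - b x) * cn (Suc (Suc 0)) e"
      using L2norm_X1_diff[OF e D(4) CP_SucD[OF D(1)] CP_SucD[OF Db(1)]] by (simp add: cn_0 algebra_simps)
  qed auto
next
  case (Suc k)
  then obtain C where C: "C \<ge> 0" "\<And>a b dt e. adm k R dt a \<Longrightarrow> adm k R dt b \<Longrightarrow> CP (Suc (Suc k)) e \<Longrightarrow>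
     cn k (\<lambda>x. e (X1 dt a x) - e (X1 dt b x)) \<le> C * dt * cn k (\<lambda>x. a x - b x) * cn (Suc (Suc k)) e"
    by blast
  obtain C1 where C1: "C1 \<ge> 0" "\<And>a dt e. adm (Suc k) R dt a \<Longrightarrow> CP (Suc k) e \<Longrightarrow> cn (Suc k) (\<lambda>x. e (X1 dt a x)) \<le> C1 * cn (Suc k) e"
    using cn_X1[of "Suc k" R] by blast
  note al = alg_pos[of k]
  show ?case
  proof (intro exI[of _ "1 + C + alg k * \<bar>R\<bar> * C + alg k * C1"] conjI allI impI)
    fix a b dt e assume a: "adm (Suc k) R dt a" and b: "adm (Suc k) R dt b" and e: "CP (Suc (Suc (Suc k))) e"
    note D = admD[OF a] and Db = admD[OF b] and e' = CP_deriv[OF e]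
    define N where "N = cn (Suc (Suc (Suc k))) e"
    define d where "d x = a x - b x" for x
    define W where "W = cn (Suc k) d"
    have d: "CP (Suc k) d" unfolding d_def[abs_def] by (rule CP_diff[OF D(1) Db(1)])
    have dd: "deriv d = (\<lambda>x. deriv a x - deriv b x)" unfolding d_def[abs_def] by (rule CP_deriv_diff[OF D(9) Db(9)])
    have N: "N \<ge> 0" "cn (Suc (Suc 0)) e \<le> N" "cn (Suc (Suc k)) (deriv e) \<le> N" "cn (Suc k) (deriv e) \<le> N"
      using cn_deriv_le[of "Suc (Suc k)" e] cn_mono[of "Suc (Suc 0)" "Suc (Suc (Suc k))" e]
        cn_mono[of "Suc k" "Suc (Suc k)" "deriv e"] by (auto simp: N_def)
    have W: "W \<ge> 0" "L2norm d \<le> W" "cn k d \<le> W" "cn k (deriv d) \<le> W"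
      using cn_deriv_le[of k d] cn_mono[of k "Suc k" d] L2norm_le_cn0[of d] by (auto simp: W_def)
    have e2: "CP (Suc (Suc 0)) e" "CP (Suc 0) e" "CP (Suc k) (deriv e)" "CP k (deriv e)"
      using CP_mono[OF e] CP_mono[OF e'] by auto
    have ab: "CP k a" "CP k b" "CP 0 a" "CP 0 b" using CP_mono[OF D(1)] CP_mono[OF Db(1)] by auto
    define P where "P x = deriv e (X1 dt a x) - deriv e (X1 dt b x)" for x
    have P: "CP k P" unfolding P_def[abs_def] by (intro CP_diff CP_X1 ab e2)
    define Q where "Q x = deriv e (X1 dt b x) * deriv d x" for x
    have eX: "CP (Suc k) (\<lambda>x. deriv e (X1 dt b x))" by (intro CP_X1 Db e2)
    have Q: "CP k Q" unfolding Q_def[abs_def] by (rule CP_mult[OF CP_SucD[OF eX] CP_deriv[OF d]])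
    have 0: "L2norm (\<lambda>x. e (X1 dt a x) - e (X1 dt b x)) \<le> N * dt * W"
      using L2norm_X1_diff[OF e2(1) D(4) ab(3,4)] unfolding d_def[symmetric]
      by (rule order_trans) (intro mult_mono N W D mult_nonneg_nonneg, auto)
    have "cn k P \<le> C * dt * cn k d * cn (Suc (Suc k)) (deriv e)"
      using C(2)[OF adm_Suc(1)[OF a] adm_Suc(1)[OF b] e'] by (simp add: P_def[abs_def] d_def[abs_def])
    also have "\<dots> \<le> C * dt * W * N" using C(1) D(4) N W by (intro mult_mono mult_nonneg_nonneg) auto
    finally have 1: "cn k P \<le> C * dt * W * N" .
    also have "\<dots> \<le> C * 1 * W * N" using C(1) D(5) N W by (intro mult_right_mono mult_left_mono) auto
    finally have 5: "cn k P \<le> C * 1 * W * N" .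
    note Pa = cn_mult_deriv[OF a P]
    have 2: "cn k (\<lambda>x. P x * deriv a x) \<le> alg k * R * (C * 1 * W * N)"
      by (rule order_trans[OF Pa(2) mult_left_mono[OF 5]]) (use al D(7) in simp)
    have "cn k Q \<le> alg k * cn (Suc k) (\<lambda>x. deriv e (X1 dt b x)) * cn k (deriv d)"
      unfolding Q_def[abs_def] by (rule cn_mult_spare[OF eX CP_deriv[OF d]])
    also have "\<dots> \<le> alg k * (C1 * N) * W"
      using C1(2)[OF b e2(3)] mult_left_mono[OF N(4) C1(1)] al C1(1) N W by (intro mult_mono mult_nonneg_nonneg) auto
    finally have 3: "cn k Q \<le> alg k * (C1 * N) * W" .
    have S: "CP k (\<lambda>x. P x * deriv a x + Q x)" by (rule CP_add[OF Pa(1) Q])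
    have "cn k (\<lambda>x. P x * deriv a x + Q x) \<le> alg k * R * (C * 1 * W * N) + alg k * (C1 * N) * W"
      using cn_add[OF Pa(1) Q] 2 3 by linarith
    then have 4: "dt * cn k (\<lambda>x. P x * deriv a x + Q x) \<le> dt * (alg k * R * (C * 1 * W * N) + alg k * (C1 * N) * W)"
      using D(4) by (rule mult_left_mono)
    have "deriv (\<lambda>x. e (X1 dt a x) - e (X1 dt b x)) = (\<lambda>x. P x - dt * (P x * deriv a x + Q x))"
      using deriv_X1_diff[OF D(9) Db(9) e2(2)] by (simp add: P_def Q_def dd)
    then have "cn k (deriv (\<lambda>x. e (X1 dt a x) - e (X1 dt b x))) \<le> C * dt * W * N + dt * (alg k * R * (C * 1 * W * N) + alg k * (C1 * N) * W)"
      using cn_diff[OF P CP_cmult[OF S], of dt] cn_cmult[OF S, of dt] 1 4 D(4) by simp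
    then have "cn (Suc k) (\<lambda>x. e (X1 dt a x) - e (X1 dt b x)) \<le> (1 + C + alg k * \<bar>R\<bar> * C + alg k * C1) * dt * W * N"
      using 0 D(7) unfolding cn_Suc[of k "\<lambda>x. e (X1 dt a x) - e (X1 dt b x)"] by (simp add: algebra_simps)
    then show "cn (Suc k) (\<lambda>x. e (X1 dt a x) - e (X1 dt b x)) \<le> (1 + C + alg k * \<bar>R\<bar> * C + alg k * C1) * dt * cn (Suc k) (\<lambda>x. a x - b x) * cn (Suc (Suc (Suc k))) e"
      by (simp add: W_def N_def d_def[abs_def])
  qed (use C C1 al in auto)
qed

text \<open>The remainder for \<open>e\<close> differentiates into the remainder for \<open>e'\<close> plus
  \<open>dt\<close> times a first-order increment; this drives the induction in \<open>cn_X1_Taylor\<close>.\<close>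

lemma deriv_X1_Taylor:
  assumes "CP (Suc 0) a" "CP (Suc (Suc 0)) e"
  shows "deriv (\<lambda>x. e (X1 dt a x) - e x + dt * (a x * deriv e x)) =
    (\<lambda>x. (deriv e (X1 dt a x) - deriv e x + dt * (a x * deriv (deriv e) x)) - dt * ((deriv e (X1 dt a x) - deriv e x) * deriv a x))"
proof (rule ext, rule DERIV_imp_deriv)
  fix x
  have e1: "CP (Suc 0) e" using CP_mono[OF assms(2)] by simp
  have 1: "((\<lambda>x. e (X1 dt a x)) has_real_derivative deriv e (X1 dt a x) * (1 - dt * deriv a x)) (at x)"
    by (rule DERIV_chain2[OF CP_DERIV[OF e1] X1_DERIV[OF assms(1)]])
  have "((\<lambda>x. e (X1 dt a x) - e x + dt * (a x * deriv e x)) has_real_derivative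
     deriv e (X1 dt a x) * (1 - dt * deriv a x) - deriv e x + dt * (deriv a x * deriv e x + deriv (deriv e) x * a x)) (at x)"
    by (intro DERIV_add DERIV_diff 1 CP_DERIV[OF e1] DERIV_cmult DERIV_mult CP_DERIV[OF assms(1)] CP_DERIV[OF CP_deriv[OF assms(2)]])
  then show "((\<lambda>x. e (X1 dt a x) - e x + dt * (a x * deriv e x)) has_real_derivative
     (deriv e (X1 dt a x) - deriv e x + dt * (a x * deriv (deriv e) x)) - dt * ((deriv e (X1 dt a x) - deriv e x) * deriv a x)) (at x)"
    by (simp add: algebra_simps)
qed

lemma L2norm_X1_Taylor:
  assumes "adm (Suc k) R dt a" "CP (Suc (Suc (Suc j))) e"
  shows "L2norm (\<lambda>x. e (X1 dt a x) - e x + dt * (a x * deriv e x)) \<le> R\<^sup>2 * dt\<^sup>2 * cn (Suc (Suc (Suc j))) e"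
proof (rule L2norm_le_bound)
  note D = admD[OF assms(1)]
  have a0: "CP 0 a" "CP 0 e" "CP 0 (deriv e)" "CP (Suc (Suc 0)) e"
    using CP_mono[OF D(1)] CP_mono[OF assms(2)] CP_mono[OF CP_deriv[OF assms(2)]] by auto
  show "(\<lambda>x. e (X1 dt a x) - e x + dt * (a x * deriv e x)) \<in> L2"
    by (intro CP_L2[of 0] CP_add CP_diff CP_X1 CP_cmult CP_mult a0)
  fix x
  define M where "M = cn (Suc (Suc (Suc j))) e"
  have d2: "\<bar>deriv (deriv e) y\<bar> \<le> M" for y
    using CP_sup_deriv[OF CP_deriv[OF assms(2)], of y] cn_deriv_le[of "Suc (Suc j)" e] by (simp add: M_def)
  have "\<bar>e (x + - (dt * a x)) - e x - (- (dt * a x)) * deriv e x\<bar> \<le> M * (- (dt * a x))\<^sup>2"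
    by (rule CP_Taylor[OF a0(4) d2])
  also have "\<dots> = dt\<^sup>2 * \<bar>a x\<bar>\<^sup>2 * M" by (simp add: power_mult_distrib)
  also have "\<dots> \<le> dt\<^sup>2 * R\<^sup>2 * M"
    using D(8)[of x] by (intro mult_right_mono mult_left_mono power_mono) (auto simp: M_def)
  finally show "\<bar>e (X1 dt a x) - e x + dt * (a x * deriv e x)\<bar> \<le> R\<^sup>2 * dt\<^sup>2 * M"
    by (simp add: X1_def algebra_simps)
qed

lemma cn_X1_Taylor:
  "\<exists>C\<ge>0. \<forall>a dt e. adm k R dt a \<longrightarrow> CP (Suc (Suc (Suc k))) e \<longrightarrow>
     cn k (\<lambda>x. e (X1 dt a x) - e x + dt * (a x * deriv e x)) \<le> C * dt\<^sup>2 * cn (Suc (Suc (Suc k))) e"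
proof (induction k)
  case 0
  show ?case by (intro exI[of _ "R\<^sup>2"]) (auto simp: cn_0 adm_0 intro: L2norm_X1_Taylor)
next
  case (Suc k)
  then obtain C where C: "C \<ge> 0" "\<And>a dt e. adm k R dt a \<Longrightarrow> CP (Suc (Suc (Suc k))) e \<Longrightarrow>
     cn k (\<lambda>x. e (X1 dt a x) - e x + dt * (a x * deriv e x)) \<le> C * dt\<^sup>2 * cn (Suc (Suc (Suc k))) e"
    by blast
  obtain C2 where C2: "C2 \<ge> 0" "\<And>a b dt e. adm k R dt a \<Longrightarrow> adm k R dt b \<Longrightarrow> CP (Suc (Suc k)) e \<Longrightarrow>
     cn k (\<lambda>x. e (X1 dt a x) - e (X1 dt b x)) \<le> C2 * dt * cn k (\<lambda>x. a x - b x) * cn (Suc (Suc k)) e"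
    using cn_X1_diff[of k R] by blast
  note al = alg_pos[of k]
  show ?case
  proof (intro exI[of _ "R\<^sup>2 + C + alg k * C2 * R\<^sup>2"] conjI allI impI)
    fix a dt e assume a: "adm (Suc k) R dt a" and e: "CP (Suc (Suc (Suc (Suc k)))) e"
    note D = admD[OF a] and e' = CP_deriv[OF e] and a0 = adm_Suc(1)[OF a]
    define N where "N = cn (Suc (Suc (Suc (Suc k)))) e"
    have N: "N \<ge> 0" "cn (Suc (Suc (Suc k))) (deriv e) \<le> N" "cn (Suc (Suc k)) (deriv e) \<le> N" "cn (Suc (Suc (Suc 0))) e \<le> N"
      using cn_deriv_le[of "Suc (Suc (Suc k))" e] cn_mono[of "Suc (Suc (Suc 0))" "Suc (Suc (Suc (Suc k)))" e]
        cn_mono[of "Suc (Suc k)" "Suc (Suc (Suc k))" "deriv e"] by (auto simp: N_def)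
    have e3: "CP (Suc (Suc (Suc 0))) e" "CP (Suc (Suc 0)) e" "CP (Suc (Suc k)) (deriv e)" "CP k (deriv e)" "CP k (deriv (deriv e))"
      using CP_mono[OF e] CP_mono[OF e'] CP_mono[OF CP_deriv[OF e']] by auto
    have aS: "CP k a" by (rule CP_SucD[OF D(1)])
    define B where "B x = deriv e (X1 dt a x) - deriv e x + dt * (a x * deriv (deriv e) x)" for x
    define P where "P x = deriv e (X1 dt a x) - deriv e x" for x
    have B: "CP k B" unfolding B_def[abs_def] by (intro CP_add CP_diff CP_X1 CP_cmult CP_mult aS e3)
    have P: "CP k P" unfolding P_def[abs_def] by (intro CP_diff CP_X1 aS e3)
    note Pa = cn_mult_deriv[OF a P]
    have 0: "L2norm (\<lambda>x. e (X1 dt a x) - e x + dt * (a x * deriv e x)) \<le> R\<^sup>2 * dt\<^sup>2 * N"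
      using L2norm_X1_Taylor[OF a e3(1)] mult_left_mono[OF N(4), of "R\<^sup>2 * dt\<^sup>2"] by simp
    have 1: "cn k B \<le> C * dt\<^sup>2 * N"
      using C(2)[OF a0 e'] mult_left_mono[OF N(2), of "C * dt\<^sup>2"] C(1) by (simp add: B_def[abs_def])
    have 2: "cn k P \<le> C2 * dt * R * N"
    proof -
      have "cn k P \<le> C2 * dt * cn k a * cn (Suc (Suc k)) (deriv e)"
        using C2(2)[OF a0 adm_zero[OF a0] e3(3)] by (simp add: P_def[abs_def])
      also have "\<dots> \<le> C2 * dt * R * N"
        using N D(2,4,7) cn_mono[of k "Suc k" a] C2(1) by (intro mult_mono mult_nonneg_nonneg) auto
      finally show ?thesis .
    qed
    have "cn k (\<lambda>x. P x * deriv a x) \<le> alg k * R * (C2 * dt * R * N)"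
      by (rule order_trans[OF Pa(2) mult_left_mono[OF 2]]) (use al D(7) in simp)
    then have 3: "dt * cn k (\<lambda>x. P x * deriv a x) \<le> dt * (alg k * R * (C2 * dt * R * N))" using D(4) by (rule mult_left_mono)
    have "deriv (\<lambda>x. e (X1 dt a x) - e x + dt * (a x * deriv e x)) = (\<lambda>x. B x - dt * (P x * deriv a x))"
      using deriv_X1_Taylor[OF D(9) e3(2)] by (simp add: P_def B_def)
    then have "cn k (deriv (\<lambda>x. e (X1 dt a x) - e x + dt * (a x * deriv e x))) \<le> C * dt\<^sup>2 * N + dt * (alg k * R * (C2 * dt * R * N))"
      using cn_diff[OF B CP_cmult[OF Pa(1)], of dt] cn_cmult[OF Pa(1), of dt] 1 3 D(4) by simp
    then show "cn (Suc k) (\<lambda>x. e (X1 dt a x) - e x + dt * (a x * deriv e x)) \<le> (R\<^sup>2 + C + alg k * C2 * R\<^sup>2) * dt\<^sup>2 * cn (Suc (Suc (Suc (Suc k)))) e"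
      using 0 unfolding cn_Suc[of k "\<lambda>x. e (X1 dt a x) - e x + dt * (a x * deriv e x)"] N_def[symmetric] by (simp add: algebra_simps power2_eq_square)
  qed (use C C2 al in auto)
qed

section \<open>Inversion of perturbations of the identity\<close>

lemma small_product:
  assumes "0 \<le> r" "dt \<le> 1 / (2 * (r + 1))" shows "dt * r \<le> (1/2 :: real)"
proof -
  have "dt * r \<le> 1 / (2 * (r + 1)) * r" using assms by (intro mult_right_mono) auto
  also have "\<dots> \<le> 1/2" using assms(1) by (simp add: field_simps)
  finally show ?thesis .
qed

text \<open>The second statement is that \<open>y \<mapsto> y + g(y) dt\<close> expands distances by at least
  \<open>1/2\<close>; uniqueness of preimages and all continuity properties of the inverse come from it.\<close>

lemma perturbed_identity_inverse:
  fixes g :: "real \<Rightarrow> real" and R dt :: real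
  assumes lip: "\<And>y z. \<bar>g y - g z\<bar> \<le> R * \<bar>y - z\<bar>" and bd: "\<And>y. \<bar>g y\<bar> \<le> R" and dt: "0 \<le> dt" "dt * R \<le> 1/2"
  shows "\<exists>X. \<forall>x y. y = x - g y * dt \<longleftrightarrow> y = X x"
    and "\<bar>y - z\<bar> \<le> 2 * \<bar>(y + g y * dt) - (z + g z * dt)\<bar>"
proof -
  have exp: "\<bar>y - z\<bar> \<le> 2 * \<bar>(y + g y * dt) - (z + g z * dt)\<bar>" for y z
  proof -
    have "dt * \<bar>g y - g z\<bar> \<le> dt * (R * \<bar>y - z\<bar>)" by (rule mult_left_mono[OF lip dt(1)])
    also have "\<dots> = (dt * R) * \<bar>y - z\<bar>" by simp
    also have "\<dots> \<le> (1/2) * \<bar>y - z\<bar>" using dt(2) by (intro mult_right_mono) auto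
    finally have le: "\<bar>dt * (g y - g z)\<bar> \<le> (1/2) * \<bar>y - z\<bar>" using dt(1) by (simp add: abs_mult)
    have "y - z = ((y + g y * dt) - (z + g z * dt)) - dt * (g y - g z)" by (simp add: algebra_simps)
    then have "\<bar>y - z\<bar> \<le> \<bar>(y + g y * dt) - (z + g z * dt)\<bar> + \<bar>dt * (g y - g z)\<bar>" by (metis abs_triangle_ineq4)
    then show ?thesis using le by simp
  qed
  show "\<bar>y - z\<bar> \<le> 2 * \<bar>(y + g y * dt) - (z + g z * dt)\<bar>" by (rule exp)
  have R: "R \<ge> 0" using bd[of 0] by linarith
  have gc: "continuous_on UNIV g"
    by (rule lipschitz_on_continuous_on[of R]) (use lip R in \<open>auto intro!: lipschitz_onI simp: dist_real_def\<close>)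
  have small: "\<bar>g y * dt\<bar> \<le> 1/2" for y
  proof -
    have "\<bar>g y * dt\<bar> = dt * \<bar>g y\<bar>" using dt(1) by (simp add: abs_mult)
    also have "\<dots> \<le> dt * R" using bd dt(1) by (intro mult_left_mono)
    finally show ?thesis using dt(2) by linarith
  qed
  have ex: "\<exists>y. y + g y * dt = x" for x
  proof -
    have "\<exists>y. x - 1 \<le> y \<and> y \<le> x + 1 \<and> y + g y * dt = x"
      by (rule IVT') (use small[of "x - 1"] small[of "x + 1"] in \<open>auto intro!: continuous_intros continuous_on_subset[OF gc] simp: abs_le_iff\<close>)
    then show ?thesis by blast
  qed
  then obtain X where X: "\<And>x. X x + g (X x) * dt = x" by metis
  have "y = x - g y * dt \<longleftrightarrow> y = X x" for x y
  proof
    assume "y = x - g y * dt"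
    then have "y + g y * dt = x" by simp
    then show "y = X x" using exp[of y "X x"] X[of x] by simp
  next
    assume "y = X x" then show "y = x - g y * dt" using X[of x] by simp
  qed
  then show "\<exists>X. \<forall>x y. y = x - g y * dt \<longleftrightarrow> y = X x" by blast
qed

text \<open>With \<open>a = g \<circ> X\<close> the inverse map is itself of the form \<open>X = X1 dt a\<close>. The
  second conclusion is an implicit relation for \<open>a'\<close> and serves to bound norms of \<open>a\<close>
  without differentiating an inverse function repeatedly.\<close>

lemma inverse_flow:
  assumes g: "adm (Suc k) R dt g" and X: "\<And>x. X x = x - g (X x) * dt"
  shows "CP (Suc k) (\<lambda>x. g (X x))" "deriv (\<lambda>x. g (X x)) = (\<lambda>x. deriv g (X x) * (1 - dt * deriv (\<lambda>x. g (X x)) x))"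
    "\<bar>deriv (\<lambda>x. g (X x)) x\<bar> \<le> 2 * R"
proof -
  note D = admD[OF g]
  define Z where "Z y = y + g y * dt" for y
  have ZX: "Z (X x) = x" for x using X[of x] by (simp add: Z_def)
  have Z': "(Z has_real_derivative 1 + dt * deriv g y) (at y)" for y
    unfolding Z_def[abs_def] by (auto intro!: derivative_eq_intros CP_DERIV[OF D(9)])
  have small: "\<bar>dt * deriv g y\<bar> \<le> 1/2" for y
    using D(3)[of y] D(4) D(6) mult_left_mono[OF D(3)[of y] D(4)] by (simp add: abs_mult)
  then have Z'p: "1 + dt * deriv g y \<ge> 1/2" for y using small[of y] by linarith
  have exp: "\<bar>y - z\<bar> \<le> 2 * \<bar>Z y - Z z\<bar>" for y z
    unfolding Z_def by (rule perturbed_identity_inverse(2)[OF CP_lip[OF D(9) D(3)] D(8,4,6)])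
  have "2-lipschitz_on UNIV X"
    using exp[of "X x" "X y" for x y] ZX by (intro lipschitz_onI) (auto simp: dist_real_def)
  then have Xc: "continuous_on UNIV X" by (rule lipschitz_on_continuous_on)
  have X': "(X has_real_derivative inverse (1 + dt * deriv g (X x))) (at x)" for x
  proof (rule DERIV_inverse_function[of Z _ _ _ "x - 1" "x + 1"])
    show "1 + dt * deriv g (X x) \<noteq> 0" using Z'p[of "X x"] by linarith
    show "isCont X x" using Xc by (simp add: continuous_on_eq_continuous_at)
  qed (use Z' ZX in auto)
  have Xp: "X (x + 1) = X x + 1" for x
    using exp[of "X (x + 1)" "X x + 1"] ZX[of "x + 1"] ZX[of x] CPD(2)[OF D(1), of "X x"] by (simp add: Z_def)
  have XC: "Ck j X" if "j \<le> Suc k" for j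
    using that
  proof (induction j)
    case 0 then show ?case using Xc by simp
  next
    case (Suc j)
    have "Ck j (deriv g)" using Ck_mono[OF Ck_deriv[OF CPD(1)[OF D(1)]]] Suc.prems by simp
    then have "Ck j (\<lambda>x. 1 + dt * deriv g (X x))"
      by (intro Ck_add Ck_const Ck_cmult Ck_compose[of j "deriv g" X]) (use Suc in auto)
    then have "Ck j (\<lambda>x. inverse (1 + dt * deriv g (X x)))"
      by (rule Ck_inverse) (metis Z'p not_numeral_le_zero zero_less_divide_1_iff not_less zero_less_numeral)
    then show ?case by (rule Ck_SucI[OF X'])
  qed
  show C: "CP (Suc k) (\<lambda>x. g (X x))"
    by (rule CPI) (use XC[of "Suc k"] CPD[OF D(1)] Xp in \<open>auto intro: Ck_compose\<close>)
  have ga: "((\<lambda>x. g (X x)) has_real_derivative deriv g (X x) * inverse (1 + dt * deriv g (X x))) (at x)" for x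
    by (rule DERIV_chain2[OF CP_DERIV[OF D(9)] X'])
  then have da: "deriv (\<lambda>x. g (X x)) = (\<lambda>x. deriv g (X x) * inverse (1 + dt * deriv g (X x)))"
    by (intro ext DERIV_imp_deriv)
  have "inverse (1 + dt * deriv g (X x)) = 1 - dt * deriv (\<lambda>x. g (X x)) x" for x
    using Z'p[of "X x"] unfolding da by (simp add: field_simps)
  then show "deriv (\<lambda>x. g (X x)) = (\<lambda>x. deriv g (X x) * (1 - dt * deriv (\<lambda>x. g (X x)) x))"
    using da by simp
  have "\<bar>inverse (1 + dt * deriv g (X x))\<bar> \<le> 2" using Z'p[of "X x"] by (simp add: field_simps abs_if)
  then have "\<bar>deriv g (X x)\<bar> * \<bar>inverse (1 + dt * deriv g (X x))\<bar> \<le> R * 2"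
    using D(3,7) by (intro mult_mono) auto
  then show "\<bar>deriv (\<lambda>x. g (X x)) x\<bar> \<le> 2 * R" unfolding da by (simp add: abs_mult mult.commute)
qed

text \<open>In \<open>a' = g'(X) (1 - dt a')\<close> the induction hypothesis bounds \<open>a\<close> in a lower
  norm, hence \<open>g'(X) = g'(X1 dt a)\<close> by \<open>cn_X1\<close>; the norm of \<open>a'\<close> on the right
  carries a factor \<open>dt M \<le> 1/2\<close> and is absorbed.\<close>

lemma inverse_flow_cn:
  "\<exists>C\<ge>0. \<exists>d>0. \<forall>g X dt. adm (Suc k) R dt g \<longrightarrow> (\<forall>x. X x = x - g (X x) * dt) \<longrightarrow> dt \<le> d \<longrightarrow>
     cn (Suc k) (\<lambda>x. g (X x)) \<le> C"
proof (induction k)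
  case 0
  have main: "\<forall>g X dt. adm (Suc 0) R dt g \<longrightarrow> (\<forall>x. X x = x - g (X x) * dt) \<longrightarrow> dt \<le> 1 \<longrightarrow> cn (Suc 0) (\<lambda>x. g (X x)) \<le> 3 * \<bar>R\<bar>"
  proof (intro allI impI)
    fix g X dt assume g: "adm (Suc 0) R dt g" and X: "\<forall>x. X x = x - g (X x) * dt"
    note D = admD[OF g]
    note I = inverse_flow[OF g X[rule_format]]
    have "L2norm (\<lambda>x. g (X x)) \<le> R" by (rule L2norm_le_bound[OF CP_L2[OF I(1)] D(8)])
    moreover have "L2norm (deriv (\<lambda>x. g (X x))) \<le> 2 * R" by (rule L2norm_le_bound[OF CP_L2[OF CP_deriv[OF I(1)]] I(3)])
    ultimately show "cn (Suc 0) (\<lambda>x. g (X x)) \<le> 3 * \<bar>R\<bar>" using D(7) by (simp add: cn_Suc cn_0)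
  qed
  have "3 * \<bar>R\<bar> \<ge> 0" "(1::real) > 0" by auto
  with main show ?case by blast
next
  case (Suc k)
  then obtain C d where C: "C \<ge> 0" "d > 0" "\<And>g X dt. adm (Suc k) R dt g \<Longrightarrow> (\<And>x. X x = x - g (X x) * dt) \<Longrightarrow> dt \<le> d \<Longrightarrow>
     cn (Suc k) (\<lambda>x. g (X x)) \<le> C" by blast
  define R' where "R' = max C (2 * \<bar>R\<bar>)"
  have R': "R' \<ge> 0" "C \<le> R'" "2 * \<bar>R\<bar> \<le> R'" using C by (auto simp: R'_def)
  obtain C1 where C1: "C1 \<ge> 0" "\<And>a dt e. adm (Suc k) R' dt a \<Longrightarrow> CP (Suc k) e \<Longrightarrow> cn (Suc k) (\<lambda>x. e (X1 dt a x)) \<le> C1 * cn (Suc k) e"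
    using cn_X1[of "Suc k" R'] by blast
  note al = alg_pos[of k]
  define M where "M = alg k * C1 * \<bar>R\<bar>"
  have M: "M \<ge> 0" using al C1 by (simp add: M_def)
  \<comment> \<open>Both the admissibility of \<open>a\<close> with radius \<open>R'\<close> and the absorption of its top norm limit the time step.\<close>
  define d' where "d' = min d (min (1 / (2 * (R' + 1))) (1 / (2 * (M + 1))))"
  have d': "d' > 0" using C M R' by (simp add: d'_def)
  have C0: "0 \<le> \<bar>R\<bar> + 2 * C1 * \<bar>R\<bar>" using C1(1) by simp
  have main: "\<forall>g X dt. adm (Suc (Suc k)) R dt g \<longrightarrow> (\<forall>x. X x = x - g (X x) * dt) \<longrightarrow> dt \<le> d' \<longrightarrow> cn (Suc (Suc k)) (\<lambda>x. g (X x)) \<le> \<bar>R\<bar> + 2 * C1 * \<bar>R\<bar>"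
  proof (intro allI impI)
    fix g X dt assume g: "adm (Suc (Suc k)) R dt g" and X: "\<forall>x. X x = x - g (X x) * dt" and dt: "dt \<le> d'"
    note D = admD[OF g]
    note g0 = adm_Suc[OF g]
    note I = inverse_flow[OF g X[rule_format]]
    define a where "a x = g (X x)" for x
    have Xa: "X x = X1 dt a x" for x using X[rule_format, of x] by (simp add: X1_def a_def)
    have dts: "dt \<le> d" "dt * R' \<le> 1/2" "dt * M \<le> 1/2"
      using dt small_product[OF R'(1), of dt] small_product[OF M, of dt] by (auto simp: d'_def)
    have aC: "CP (Suc (Suc k)) a" unfolding a_def[abs_def] by (rule I(1))
    have "cn (Suc k) a \<le> C" unfolding a_def[abs_def] by (rule C(3)[OF g0(1) X[rule_format] dts(1)])
    moreover have "\<bar>deriv a x\<bar> \<le> 2 * R" for x unfolding a_def[abs_def] by (rule I(3))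
    ultimately have adma: "adm (Suc k) R' dt a"
      using CP_SucD[OF aC] D(4,5,7) dts R' by (auto simp: adm_def intro: order_trans[of _ "2 * R"])
    define p where "p x = deriv g (X x)" for x
    have p: "CP (Suc k) p" unfolding p_def[abs_def] Xa by (rule CP_X1[OF CP_SucD[OF aC] g0(2)])
    have pn: "cn (Suc k) p \<le> C1 * \<bar>R\<bar>"
      using C1(2)[OF adma g0(2)] mult_left_mono[OF g0(3) C1(1)] D(7) by (simp add: p_def[abs_def] Xa)
    note a' = CP_deriv[OF aC]
    define Y where "Y = cn (Suc k) (deriv a)"
    have "deriv a = (\<lambda>x. p x - dt * (p x * deriv a x))"
      using I(2) unfolding a_def[abs_def] p_def by (simp add: algebra_simps)
    then have "Y = cn (Suc k) (\<lambda>x. p x - dt * (p x * deriv a x))" by (simp add: Y_def)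
    also have "\<dots> \<le> cn (Suc k) p + dt * cn (Suc k) (\<lambda>x. p x * deriv a x)"
      using cn_diff[OF p CP_cmult[OF CP_mult[OF p a']], of dt] cn_cmult[OF CP_mult[OF p a'], of dt] D(4) by simp
    also have "\<dots> \<le> C1 * \<bar>R\<bar> + dt * (alg k * (C1 * \<bar>R\<bar>) * Y)"
    proof (intro add_mono pn mult_left_mono D(4))
      have "cn (Suc k) (\<lambda>x. p x * deriv a x) \<le> alg k * cn (Suc k) p * cn (Suc k) (deriv a)" by (rule cn_mult[OF p a'])
      also have "\<dots> \<le> alg k * (C1 * \<bar>R\<bar>) * Y"
        unfolding Y_def using pn al C1(1) by (intro mult_right_mono mult_left_mono) auto
      finally show "cn (Suc k) (\<lambda>x. p x * deriv a x) \<le> alg k * (C1 * \<bar>R\<bar>) * Y" .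
    qed
    also have "\<dots> = C1 * \<bar>R\<bar> + (dt * M) * Y" by (simp add: M_def)
    also have "\<dots> \<le> C1 * \<bar>R\<bar> + (1/2) * Y" using dts(3) by (intro add_left_mono mult_right_mono) (auto simp: Y_def)
    finally have "Y \<le> 2 * C1 * \<bar>R\<bar>" by simp
    moreover have "L2norm a \<le> \<bar>R\<bar>"
      using L2norm_le_bound[OF CP_L2[OF aC], of R] D(8) D(7) by (simp add: a_def)
    ultimately show "cn (Suc (Suc k)) (\<lambda>x. g (X x)) \<le> \<bar>R\<bar> + 2 * C1 * \<bar>R\<bar>"
      unfolding a_def[symmetric] cn_Suc[of "Suc k" a] Y_def by simp
  qed
  show ?case using main d' C0 by blast
qed

section \<open>Mean value inequality and the averaging operator\<close>

lemma Riemann_sum_tendsto: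
  assumes d: "0 \<le> d" and F: "\<And>r. r \<in> {0..d} \<Longrightarrow> (F has_real_derivative f r) (at r within {0..d})"
    and f: "continuous_on {0..d} f"
  shows "(\<lambda>n. \<Sum>i<Suc n. d / real (Suc n) * f (real i * (d / real (Suc n)))) \<longlonglongrightarrow> F d - F 0"
proof (rule LIMSEQ_I)
  fix e :: real assume e: "e > 0"
  define e' where "e' = e / (2 * (d + 1))"
  have e': "e' > 0" "d * e' < e" using e d by (auto simp: e'_def field_simps intro!: add_nonneg_pos)
  have "uniformly_continuous_on {0..d} f" by (rule compact_uniformly_continuous[OF f]) simp
  then obtain \<delta> where \<delta>: "\<delta> > 0" "\<And>x y. x \<in> {0..d} \<Longrightarrow> y \<in> {0..d} \<Longrightarrow> dist y x < \<delta> \<Longrightarrow> dist (f y) (f x) < e'"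
    unfolding uniformly_continuous_on_def using e'(1) by metis
  obtain n0 :: nat where n0: "d / \<delta> < real n0" using reals_Archimedean2 by blast
  have "norm ((\<Sum>i<Suc n. d / real (Suc n) * f (real i * (d / real (Suc n)))) - (F d - F 0)) < e" if n: "n \<ge> n0" for n
  proof -
    define h where "h = d / real (Suc n)"
    have "d < \<delta> * real n0" using n0 \<delta>(1) by (simp add: field_simps)
    also have "\<dots> \<le> \<delta> * real (Suc n)" using n \<delta>(1) by (intro mult_left_mono) auto
    finally have h: "0 \<le> h" "h < \<delta>" using d by (auto simp: h_def field_simps)
    have hN: "real (Suc n) * h = d" by (simp add: h_def)
    have "F d - F 0 = (\<Sum>i<Suc n. F (real (Suc i) * h) - F (real i * h))"
      using sum_lessThan_telescope[of "\<lambda>i. F (real i * h)" "Suc n"] hN by (simp del: of_nat_Suc sum.lessThan_Suc)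
    then have "(\<Sum>i<Suc n. h * f (real i * h)) - (F d - F 0) = - (\<Sum>i<Suc n. F (real (Suc i) * h) - F (real i * h) - h * f (real i * h))"
      by (simp only: sum_subtractf)
    also have "\<bar>\<dots>\<bar> \<le> (\<Sum>i<Suc n. \<bar>F (real (Suc i) * h) - F (real i * h) - h * f (real i * h)\<bar>)"
      unfolding abs_minus_cancel by (rule sum_abs)
    also have "\<dots> \<le> (\<Sum>i<Suc n. h * e')"
    proof (rule sum_mono)
      fix i assume "i \<in> {..<Suc n}"
      then have "real (Suc i) * h \<le> real (Suc n) * h" using h by (intro mult_right_mono) auto
      then have i: "0 \<le> real i * h" "real i * h \<le> real (Suc i) * h" "real (Suc i) * h \<le> d"
        using h hN by (auto intro: mult_right_mono)
      have "norm ((F (real (Suc i) * h) - real (Suc i) * h * f (real i * h)) - (F (real i * h) - real i * h * f (real i * h)))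
          \<le> e' * norm (real (Suc i) * h - real i * h)"
      proof (rule field_differentiable_bound[of "{real i * h..real (Suc i) * h}" "\<lambda>t. F t - t * f (real i * h)" "\<lambda>t. f t - f (real i * h)"])
        fix t assume t: "t \<in> {real i * h..real (Suc i) * h}"
        then have td: "t \<in> {0..d}" using i by auto
        have "(F has_real_derivative f t) (at t within {real i * h..real (Suc i) * h})"
          by (rule has_field_derivative_subset[OF F[OF td]]) (use i in auto)
        then show "((\<lambda>t. F t - t * f (real i * h)) has_real_derivative f t - f (real i * h)) (at t within {real i * h..real (Suc i) * h})"
          by (auto intro!: derivative_eq_intros)
        have "dist (f t) (f (real i * h)) < e'"
          by (rule \<delta>(2)) (use td t i h in \<open>auto simp: dist_real_def algebra_simps\<close>)
        then show "norm (f t - f (real i * h)) \<le> e'" by (simp add: dist_real_def)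
      qed (use i in auto)
      then show "\<bar>F (real (Suc i) * h) - F (real i * h) - h * f (real i * h)\<bar> \<le> h * e'"
        using h by (simp add: algebra_simps)
    qed
    also have "\<dots> = (real (Suc n) * h) * e'" by simp
    also have "\<dots> = d * e'" unfolding hN ..
    finally show ?thesis using e'(2) by (simp add: h_def)
  qed
  then show "\<exists>no. \<forall>n\<ge>no. norm ((\<Sum>i<Suc n. d / real (Suc n) * f (real i * (d / real (Suc n)))) - (F d - F 0)) < e" by blast
qed

text \<open>Riemann sums are finite linear combinations, so the norm bound passes to the limit by Fatou and no
  vector-valued integral is required.\<close>

lemma L2_mean_value:
  assumes d: "0 \<le> d" and G: "\<And>r x. r \<in> {0..d} \<Longrightarrow> ((\<lambda>r. G r x) has_real_derivative G' r x) (at r within {0..d})"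
    and c: "\<And>x. continuous_on {0..d} (\<lambda>r. G' r x)"
    and L: "\<And>r. r \<in> {0..d} \<Longrightarrow> G' r \<in> L2" "\<And>r. r \<in> {0..d} \<Longrightarrow> L2norm (G' r) \<le> B"
    and w: "(\<lambda>x. G d x - G 0 x) \<in> L2"
  shows "L2norm (\<lambda>x. G d x - G 0 x) \<le> d * B"
proof -
  define v where "v n x = (\<Sum>i<Suc n. d / real (Suc n) * G' (real i * (d / real (Suc n))) x)" for n x
  have ir: "real i * (d / real (Suc n)) \<in> {0..d}" if "i < Suc n" for i n
  proof -
    have "real i * (d / real (Suc n)) \<le> real (Suc n) * (d / real (Suc n))" using that d by (intro mult_right_mono) auto
    then show ?thesis using d by simp
  qed
  have vL: "v n \<in> L2" for n unfolding v_def[abs_def] by (intro L2_sum L2_cmult L ir) auto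
  have "L2norm (v n) \<le> d * B" for n
  proof -
    have "L2norm (v n) \<le> (\<Sum>i<Suc n. L2norm (\<lambda>x. d / real (Suc n) * G' (real i * (d / real (Suc n))) x))"
      unfolding v_def[abs_def] by (intro L2norm_sum L2_cmult L ir) auto
    also have "\<dots> \<le> (\<Sum>i<Suc n. d / real (Suc n) * B)"
    proof (rule sum_mono)
      fix i assume "i \<in> {..<Suc n}"
      then have "L2norm (G' (real i * (d / real (Suc n)))) \<le> B" by (intro L ir) auto
      then have "\<bar>d / real (Suc n)\<bar> * L2norm (G' (real i * (d / real (Suc n)))) \<le> \<bar>d / real (Suc n)\<bar> * B"
        by (rule mult_left_mono) simp
      then show "L2norm (\<lambda>x. d / real (Suc n) * G' (real i * (d / real (Suc n))) x) \<le> d / real (Suc n) * B"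
        using d unfolding L2norm_cmult by simp
    qed
    also have "\<dots> = d * B" by simp
    finally show ?thesis .
  qed
  moreover have "AE x in torus. (\<lambda>n. v n x) \<longlonglongrightarrow> G d x - G 0 x"
    unfolding v_def by (rule AE_I2, rule Riemann_sum_tendsto[OF d G c])
  ultimately show ?thesis by (rule L2_Fatou(2)[OF vL _ L2D(1,2)[OF w]])
qed

lemma L2norm_shift:
  assumes "CP 0 g" shows "L2norm (\<lambda>x. g (x + d)) = L2norm g"
proof -
  have c: "continuous_on UNIV g" by (rule CP_cont[OF assms])
  have "integral {0..1} (\<lambda>x. (g (x + d))\<^sup>2) = integral {0..1} (\<lambda>x. (g x)\<^sup>2)"
    by (rule cont_periodic_integral_shift[of "\<lambda>x. (g x)\<^sup>2"]) (use CPD(2)[OF assms] in \<open>auto intro!: continuous_intros c\<close>)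
  moreover have "continuous_on UNIV (\<lambda>x. (g (x + d))\<^sup>2)"
    by (intro continuous_intros continuous_on_compose2[OF c]) auto
  ultimately show ?thesis unfolding L2norm_def
    using torus_integral_cont(2)[of "\<lambda>x. (g (x + d))\<^sup>2"] torus_integral_cont(2)[of "\<lambda>x. (g x)\<^sup>2"] c by (simp add: continuous_intros)
qed

lemma CP_shift: "CP k v \<Longrightarrow> CP k (\<lambda>x. v (x + d))"
proof (rule CPI)
  assume v: "CP k v"
  show "Ck k (\<lambda>x. v (x + d))" by (rule Ck_compose[OF CPD(1)[OF v]]) (intro Ck_add Ck_ident Ck_const)
  show "v (x + 1 + d) = v (x + d)" for x using CPD(2)[OF v, of "x + d"] by (simp add: add_ac)
qed

lemma CP_shift_minus: "CP k v \<Longrightarrow> CP k (\<lambda>x. v (x - d))"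
  using CP_shift[of k v "- d"] by simp

lemma L2norm_shift_minus: "CP 0 g \<Longrightarrow> L2norm (\<lambda>x. g (x - d)) = L2norm g"
  using L2norm_shift[of g "- d"] by simp

lemma DERIV_shift_param:
  assumes "CP (Suc 0) v"
  shows "((\<lambda>r. v (x + r)) has_real_derivative deriv v (x + r)) (at r within S)"
    "((\<lambda>r. v (x - r)) has_real_derivative - deriv v (x - r)) (at r within S)"
proof -
  have "((\<lambda>r. v (x + r)) has_real_derivative deriv v (x + r) * 1) (at r within S)"
    by (rule DERIV_chain2[OF CP_DERIV[OF assms]]) (auto intro!: derivative_eq_intros)
  then show "((\<lambda>r. v (x + r)) has_real_derivative deriv v (x + r)) (at r within S)" by simp
  have "((\<lambda>r. v (x - r)) has_real_derivative deriv v (x - r) * (- 1)) (at r within S)"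
    by (rule DERIV_chain2[OF CP_DERIV[OF assms]]) (auto intro!: derivative_eq_intros)
  then show "((\<lambda>r. v (x - r)) has_real_derivative - deriv v (x - r)) (at r within S)" by simp
qed

lemma CP_cont_shift_param:
  assumes "CP k v" shows "continuous_on S (\<lambda>r. v (x + r))" "continuous_on S (\<lambda>r. v (x - r))"
  by (auto intro!: continuous_on_compose2[OF CP_cont[OF assms]] continuous_intros)

text \<open>This and the following differences are mean value estimates in the length of the shift, each using the
  previous one for the derivative.\<close>

lemma L2norm_first_difference:
  assumes h: "CP (Suc 0) h" and r: "0 \<le> r"
  shows "L2norm (\<lambda>x. h (x + r) - h (x - r)) \<le> 2 * r * L2norm (deriv h)"
proof -
  note h' = CP_deriv[OF h] and h0 = CP_SucD[OF h]
  have "L2norm (\<lambda>x. (h (x + r) - h (x - r)) - (h (x + 0) - h (x - 0))) \<le> r * (2 * L2norm (deriv h))"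
  proof (rule L2_mean_value[OF r, of "\<lambda>r x. h (x + r) - h (x - r)" "\<lambda>r x. deriv h (x + r) + deriv h (x - r)"])
    show "((\<lambda>r. h (x + r) - h (x - r)) has_real_derivative deriv h (x + s) + deriv h (x - s)) (at s within {0..r})" for s x
      by (rule DERIV_cong[OF DERIV_diff[OF DERIV_shift_param(1)[OF h] DERIV_shift_param(2)[OF h]]]) simp
    show "(\<lambda>x. deriv h (x + s) + deriv h (x - s)) \<in> L2" for s
      by (intro CP_L2[of 0] CP_add CP_shift CP_shift_minus h')
    show "L2norm (\<lambda>x. deriv h (x + s) + deriv h (x - s)) \<le> 2 * L2norm (deriv h)" for s
      using L2norm_triangle[OF CP_L2[OF CP_shift[OF h', of s]] CP_L2[OF CP_shift_minus[OF h', of s]]]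
      by (simp add: L2norm_shift[OF h'] L2norm_shift_minus[OF h'])
    show "(\<lambda>x. (h (x + r) - h (x - r)) - (h (x + 0) - h (x - 0))) \<in> L2"
      by (intro CP_L2[of 0] CP_diff CP_shift CP_shift_minus h0)
  qed (intro continuous_intros CP_cont_shift_param[OF h'])
  then show ?thesis by simp
qed

lemma L2norm_second_difference:
  assumes h: "CP (Suc (Suc 0)) h" and r: "0 \<le> r"
  shows "L2norm (\<lambda>x. h (x + r) + h (x - r) - 2 * h x) \<le> 2 * r\<^sup>2 * L2norm (deriv (deriv h))"
proof -
  have h1: "CP (Suc 0) h" "CP 0 h" using CP_mono[OF h] by auto
  note h' = CP_deriv[OF h] and h0 = CP_SucD[OF CP_deriv[OF h]]
  have "L2norm (\<lambda>x. (h (x + r) + h (x - r)) - (h (x + 0) + h (x - 0))) \<le> r * (2 * r * L2norm (deriv (deriv h)))"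
  proof (rule L2_mean_value[OF r, of "\<lambda>r x. h (x + r) + h (x - r)" "\<lambda>r x. deriv h (x + r) - deriv h (x - r)"])
    show "((\<lambda>r. h (x + r) + h (x - r)) has_real_derivative deriv h (x + s) - deriv h (x - s)) (at s within {0..r})" for s x
      by (rule DERIV_cong[OF DERIV_add[OF DERIV_shift_param(1)[OF h1(1)] DERIV_shift_param(2)[OF h1(1)]]]) simp
    show "(\<lambda>x. deriv h (x + s) - deriv h (x - s)) \<in> L2" for s
      by (intro CP_L2[of 0] CP_diff CP_shift CP_shift_minus h0)
    show "L2norm (\<lambda>x. deriv h (x + s) - deriv h (x - s)) \<le> 2 * r * L2norm (deriv (deriv h))" if "s \<in> {0..r}" for s
      using L2norm_first_difference[OF h', of s] that
      by (auto intro: order_trans[OF _ mult_right_mono[of "2 * s" "2 * r"]])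
    show "(\<lambda>x. (h (x + r) + h (x - r)) - (h (x + 0) + h (x - 0))) \<in> L2"
      by (intro CP_L2[of 0] CP_diff CP_add CP_shift CP_shift_minus h1)
  qed (intro continuous_intros CP_cont_shift_param[OF h0])
  then show ?thesis by (simp add: power2_eq_square algebra_simps)
qed

lemma L2norm_fourth_difference:
  assumes h: "CP (Suc (Suc (Suc (Suc 0)))) h" and r: "0 \<le> r"
  shows "L2norm (\<lambda>x. h (x + r) + h (x - r) - 2 * h x - r\<^sup>2 * deriv (deriv h) x) \<le> 2 * r ^ 4 * L2norm (deriv (deriv (deriv (deriv h))))"
proof -
  define Y where "Y = L2norm (deriv (deriv (deriv (deriv h))))"
  have Y: "Y \<ge> 0" by (simp add: Y_def)
  have h1: "CP (Suc 0) h" "CP 0 h" using CP_mono[OF h] by auto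
  note h' = CP_deriv[OF h]
  note h'' = CP_deriv[OF h']
  have h'1: "CP (Suc 0) (deriv h)" "CP 0 (deriv h)" "CP 0 (deriv (deriv h))" using CP_mono[OF h'] CP_mono[OF h''] by auto
  have 1: "L2norm (\<lambda>x. deriv h (x + s) - deriv h (x - s) - 2 * s * deriv (deriv h) x) \<le> r * (2 * r\<^sup>2 * Y)" if s: "s \<in> {0..r}" for s
  proof -
    have s0: "0 \<le> s" using s by simp
    have "L2norm (\<lambda>x. (deriv h (x + s) - deriv h (x - s) - 2 * s * deriv (deriv h) x) - (deriv h (x + 0) - deriv h (x - 0) - 2 * 0 * deriv (deriv h) x)) \<le> s * (2 * r\<^sup>2 * Y)"
    proof (rule L2_mean_value[OF s0, of "\<lambda>r x. deriv h (x + r) - deriv h (x - r) - 2 * r * deriv (deriv h) x" "\<lambda>r x. deriv (deriv h) (x + r) + deriv (deriv h) (x - r) - 2 * deriv (deriv h) x"])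
      show "((\<lambda>r. deriv h (x + r) - deriv h (x - r) - 2 * r * deriv (deriv h) x) has_real_derivative deriv (deriv h) (x + t) + deriv (deriv h) (x - t) - 2 * deriv (deriv h) x) (at t within {0..s})" for t x
        by (rule DERIV_cong[OF DERIV_diff[OF DERIV_diff[OF DERIV_shift_param(1)[OF h'1(1)] DERIV_shift_param(2)[OF h'1(1)]]]])
           (auto intro!: derivative_eq_intros)
      show "(\<lambda>x. deriv (deriv h) (x + t) + deriv (deriv h) (x - t) - 2 * deriv (deriv h) x) \<in> L2" for t
        by (intro CP_L2[of 0] CP_diff CP_add CP_cmult CP_shift CP_shift_minus h'1)
      show "L2norm (\<lambda>x. deriv (deriv h) (x + t) + deriv (deriv h) (x - t) - 2 * deriv (deriv h) x) \<le> 2 * r\<^sup>2 * Y" if "t \<in> {0..s}" for t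
      proof -
        have "L2norm (\<lambda>x. deriv (deriv h) (x + t) + deriv (deriv h) (x - t) - 2 * deriv (deriv h) x) \<le> 2 * t\<^sup>2 * Y"
          using L2norm_second_difference[OF h'', of t] that by (simp add: Y_def)
        also have "\<dots> \<le> 2 * r\<^sup>2 * Y" using that s Y by (intro mult_right_mono mult_left_mono power_mono) auto
        finally show ?thesis .
      qed
      show "(\<lambda>x. (deriv h (x + s) - deriv h (x - s) - 2 * s * deriv (deriv h) x) - (deriv h (x + 0) - deriv h (x - 0) - 2 * 0 * deriv (deriv h) x)) \<in> L2"
        by (intro CP_L2[of 0] CP_diff CP_cmult CP_shift CP_shift_minus h'1)
    qed (intro continuous_intros CP_cont_shift_param[OF h'1(3)])
    also have "s * (2 * r\<^sup>2 * Y) \<le> r * (2 * r\<^sup>2 * Y)" using s Y by (intro mult_right_mono) auto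
    finally show ?thesis by simp
  qed
  have "L2norm (\<lambda>x. (h (x + r) + h (x - r) - r\<^sup>2 * deriv (deriv h) x) - (h (x + 0) + h (x - 0) - 0\<^sup>2 * deriv (deriv h) x)) \<le> r * (r * (2 * r\<^sup>2 * Y))"
  proof (rule L2_mean_value[OF r, of "\<lambda>r x. h (x + r) + h (x - r) - r\<^sup>2 * deriv (deriv h) x" "\<lambda>r x. deriv h (x + r) - deriv h (x - r) - 2 * r * deriv (deriv h) x"])
    show "((\<lambda>r. h (x + r) + h (x - r) - r\<^sup>2 * deriv (deriv h) x) has_real_derivative deriv h (x + t) - deriv h (x - t) - 2 * t * deriv (deriv h) x) (at t within {0..r})" for t x
      by (rule DERIV_cong[OF DERIV_diff[OF DERIV_add[OF DERIV_shift_param(1)[OF h1(1)] DERIV_shift_param(2)[OF h1(1)]]]])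
         (auto intro!: derivative_eq_intros)
    show "(\<lambda>x. deriv h (x + t) - deriv h (x - t) - 2 * t * deriv (deriv h) x) \<in> L2" for t
      by (intro CP_L2[of 0] CP_diff CP_cmult CP_shift CP_shift_minus h'1)
    show "(\<lambda>x. (h (x + r) + h (x - r) - r\<^sup>2 * deriv (deriv h) x) - (h (x + 0) + h (x - 0) - 0\<^sup>2 * deriv (deriv h) x)) \<in> L2"
      by (intro CP_L2[of 0] CP_diff CP_add CP_cmult CP_shift CP_shift_minus h1 h'1)
  qed (use 1 in \<open>auto intro!: continuous_intros CP_cont_shift_param[OF h'1(2)]\<close>)
  also have "(\<lambda>x. (h (x + r) + h (x - r) - r\<^sup>2 * deriv (deriv h) x) - (h (x + 0) + h (x - 0) - 0\<^sup>2 * deriv (deriv h) x)) = (\<lambda>x. h (x + r) + h (x - r) - 2 * h x - r\<^sup>2 * deriv (deriv h) x)"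
    by auto
  finally show ?thesis by (simp add: Y_def power2_eq_square power4_eq_xxxx algebra_simps)
qed

text \<open>Half the sum of two translates by \<open>r\<close> expands as \<open>v + (r\<^sup>2 / 2) v''\<close>, and
  \<open>r\<^sup>2 = 2 \<nu> dt\<close> produces the diffusion term.\<close>

definition sv_shift :: "real \<Rightarrow> real \<Rightarrow> real" where
  "sv_shift \<nu> dt = sqrt 2 * sqrt (\<nu> * dt)"

lemma SV_eq: "SV \<nu> dt v = (\<lambda>x. (1/2) * v (x + - sv_shift \<nu> dt) + (1/2) * v (x + sv_shift \<nu> dt))"
  by (auto simp: SV_def sv_shift_def Let_def)

lemma sv_shift_sq: "0 \<le> \<nu> * dt \<Longrightarrow> (sv_shift \<nu> dt)\<^sup>2 = 2 * \<nu> * dt" "0 \<le> \<nu> * dt \<Longrightarrow> sv_shift \<nu> dt \<ge> 0"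
  by (auto simp: sv_shift_def power_mult_distrib)

lemma CP_SV: "CP k v \<Longrightarrow> CP k (SV \<nu> dt v)"
  unfolding SV_eq by (intro CP_add CP_cmult CP_shift)

lemma funpow_deriv_shift: "Ck j v \<Longrightarrow> (deriv ^^ j) (\<lambda>x. v (x + d)) = (\<lambda>x. (deriv ^^ j) v (x + d))"
  using funpow_deriv_affine[of j v 1 d] by simp

lemma funpow_SV: 
  assumes "Ck j v" shows "(deriv ^^ j) (SV \<nu> dt v) = SV \<nu> dt ((deriv ^^ j) v)"
proof -
  have sh: "Ck j (\<lambda>x. v (x + d))" for d
    by (rule Ck_compose[OF assms]) (intro Ck_add Ck_ident Ck_const)
  show ?thesis
    unfolding SV_eq Ck_funpow_lincomb[OF sh sh] funpow_deriv_shift[OF assms] ..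
qed

lemma L2norm_SV: "CP 0 v \<Longrightarrow> L2norm (SV \<nu> dt v) \<le> L2norm v"
  using L2norm_triangle[OF L2_cmult[OF CP_L2[OF CP_shift[of 0 v "- sv_shift \<nu> dt"]]] L2_cmult[OF CP_L2[OF CP_shift[of 0 v "sv_shift \<nu> dt"]]], of "1/2" "1/2"]
  unfolding SV_eq L2norm_cmult L2norm_shift[of v "- sv_shift \<nu> dt"] L2norm_shift[of v "sv_shift \<nu> dt"]
  by (simp add: L2norm_shift L2norm_shift_minus)

lemma cn_SV_first:
  assumes v: "CP (Suc (Suc k)) v" and nn: "0 \<le> \<nu>" "0 \<le> dt"
  shows "cn k (\<lambda>x. SV \<nu> dt v x - v x) \<le> 2 * \<nu> * dt * cn (Suc (Suc k)) v"
proof -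
  have p: "0 \<le> \<nu> * dt" using nn by simp
  have k: "CP k v" by (rule CP_mono[OF v]) simp
  have "L2norm ((deriv ^^ j) (\<lambda>x. SV \<nu> dt v x - v x)) \<le> 2 * \<nu> * dt * L2norm ((deriv ^^ j) (deriv (deriv v)))" if "j \<le> k" for j
  proof -
    define g where "g = (deriv ^^ j) v"
    have g: "CP (Suc (Suc 0)) g" unfolding g_def by (rule CP_funpow, rule CP_mono[OF v]) (use that in auto)
    have c: "Ck j v" by (rule Ck_mono[OF CPD(1)[OF k] that])
    have "(deriv ^^ j) (\<lambda>x. SV \<nu> dt v x - v x) = (\<lambda>x. SV \<nu> dt g x - g x)"
      unfolding g_def by (subst Ck_funpow_diff) (use c CPD(1)[OF CP_SV[OF CP_mono[OF k that]]] funpow_SV[OF c] in auto)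
    also have "\<dots> = (\<lambda>x. (1/2) * (g (x + sv_shift \<nu> dt) + g (x - sv_shift \<nu> dt) - 2 * g x))"
      by (simp add: SV_eq algebra_simps)
    finally have eq: "(deriv ^^ j) (\<lambda>x. SV \<nu> dt v x - v x) = (\<lambda>x. (1/2) * (g (x + sv_shift \<nu> dt) + g (x - sv_shift \<nu> dt) - 2 * g x))" .
    have "L2norm ((deriv ^^ j) (\<lambda>x. SV \<nu> dt v x - v x)) \<le> (1/2) * (2 * (sv_shift \<nu> dt)\<^sup>2 * L2norm (deriv (deriv g)))"
      unfolding eq L2norm_cmult using L2norm_second_difference[OF g sv_shift_sq(2)[OF p]] by simp
    also have "\<dots> = 2 * \<nu> * dt * L2norm (deriv (deriv g))" by (simp add: sv_shift_sq[OF p])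
    also have "deriv (deriv g) = (deriv ^^ j) (deriv (deriv v))"
      by (simp add: g_def funpow_swap1)
    finally show ?thesis .
  qed
  then have "cn k (\<lambda>x. SV \<nu> dt v x - v x) \<le> 2 * \<nu> * dt * cn k (deriv (deriv v))"
    unfolding cn_def sum_distrib_left by (intro sum_mono) auto
  also have "\<dots> \<le> 2 * \<nu> * dt * cn (Suc (Suc k)) v"
    using cn_deriv_le[of k "deriv v"] cn_deriv_le[of "Suc k" v] nn by (intro mult_left_mono) auto
  finally show ?thesis .
qed

lemma cn_SV_second:
  assumes v: "CP (Suc (Suc (Suc (Suc k)))) v" and nn: "0 \<le> \<nu>" "0 \<le> dt"
  shows "cn k (\<lambda>x. SV \<nu> dt v x - v x - \<nu> * dt * deriv (deriv v) x) \<le> 4 * \<nu>\<^sup>2 * dt\<^sup>2 * cn (Suc (Suc (Suc (Suc k)))) v"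
proof -
  have p: "0 \<le> \<nu> * dt" using nn by simp
  have k: "CP k v" "CP k (deriv (deriv v))"
    using CP_mono[OF v] CP_mono[OF CP_deriv[OF CP_deriv[OF v]]] by auto
  have "L2norm ((deriv ^^ j) (\<lambda>x. SV \<nu> dt v x - v x - \<nu> * dt * deriv (deriv v) x)) \<le> 4 * \<nu>\<^sup>2 * dt\<^sup>2 * L2norm ((deriv ^^ j) (deriv (deriv (deriv (deriv v)))))" if "j \<le> k" for j
  proof -
    define g where "g = (deriv ^^ j) v"
    have g: "CP (Suc (Suc (Suc (Suc 0)))) g" unfolding g_def by (rule CP_funpow, rule CP_mono[OF v]) (use that in auto)
    have c: "Ck j v" "Ck j (deriv (deriv v))" using Ck_mono[OF CPD(1)[OF k(1)] that] Ck_mono[OF CPD(1)[OF k(2)] that] by auto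
    have cS: "Ck j (SV \<nu> dt v)" by (rule CPD(1)[OF CP_SV[OF CP_mono[OF k(1) that]]])
    have "(deriv ^^ j) (\<lambda>x. SV \<nu> dt v x - v x - \<nu> * dt * deriv (deriv v) x) = (\<lambda>x. SV \<nu> dt g x - g x - \<nu> * dt * deriv (deriv g) x)"
      using Ck_funpow_diff[OF Ck_diff[OF cS c(1)] Ck_cmult[OF c(2), of "\<nu> * dt"]] Ck_funpow_diff[OF cS c(1)] Ck_funpow_cmult[OF c(2), of "\<nu> * dt"] funpow_SV[OF c(1)]
      by (simp add: g_def funpow_swap1)
    also have "\<dots> = (\<lambda>x. (1/2) * (g (x + sv_shift \<nu> dt) + g (x - sv_shift \<nu> dt) - 2 * g x - (sv_shift \<nu> dt)\<^sup>2 * deriv (deriv g) x))"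
      by (simp add: SV_eq sv_shift_sq[OF p] algebra_simps)
    finally have eq: "(deriv ^^ j) (\<lambda>x. SV \<nu> dt v x - v x - \<nu> * dt * deriv (deriv v) x) = (\<lambda>x. (1/2) * (g (x + sv_shift \<nu> dt) + g (x - sv_shift \<nu> dt) - 2 * g x - (sv_shift \<nu> dt)\<^sup>2 * deriv (deriv g) x))" .
    have "L2norm ((deriv ^^ j) (\<lambda>x. SV \<nu> dt v x - v x - \<nu> * dt * deriv (deriv v) x)) \<le> (1/2) * (2 * (sv_shift \<nu> dt)^4 * L2norm (deriv (deriv (deriv (deriv g)))))"
      unfolding eq L2norm_cmult using L2norm_fourth_difference[OF g sv_shift_sq(2)[OF p]] by simp
    also have "(sv_shift \<nu> dt)^4 = (2 * \<nu> * dt)\<^sup>2" using sv_shift_sq(1)[OF p] by (metis numeral_Bit0 power2_eq_square power_add)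
    also have "deriv (deriv (deriv (deriv g))) = (deriv ^^ j) (deriv (deriv (deriv (deriv v))))"
      by (simp add: g_def funpow_swap1)
    finally show ?thesis by (simp add: power_mult_distrib)
  qed
  then have "cn k (\<lambda>x. SV \<nu> dt v x - v x - \<nu> * dt * deriv (deriv v) x) \<le> 4 * \<nu>\<^sup>2 * dt\<^sup>2 * cn k (deriv (deriv (deriv (deriv v))))"
    unfolding cn_def sum_distrib_left by (intro sum_mono) auto
  also have "\<dots> \<le> 4 * \<nu>\<^sup>2 * dt\<^sup>2 * cn (Suc (Suc (Suc (Suc k)))) v"
    using cn_deriv_le[of k "deriv (deriv (deriv v))"] cn_deriv_le[of "Suc k" "deriv (deriv v)"] cn_deriv_le[of "Suc (Suc k)" "deriv v"] cn_deriv_le[of "Suc (Suc (Suc k))" v] nn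
    by (intro mult_left_mono) auto
  finally show ?thesis .
qed

section \<open>The estimates in Sobolev spaces\<close>

lemma CP_of_Hsob:
  assumes "v \<in> Hsob (Suc k)" "k \<ge> 2" shows "CP (Suc 0) v"
proof (rule CPI)
  have "continuous_on UNIV (deriv v)" using HsobD(2)[OF Hsob_deriv(2)[OF assms]] assms(2) by simp
  then show "Ck (Suc 0) v" by (intro Ck_SucI[OF Hsob_deriv(1)[OF assms]]) simp
qed (rule HsobD(3)[OF assms(1)])

lemma deriv_mollify:
  assumes "CP (Suc 0) v" shows "deriv (mollify n v) = mollify n (deriv v)"
proof (rule ext, rule DERIV_imp_deriv)
  fix x
  have w: "has_weak_deriv (Suc 0) v (deriv v)"
    using has_weak_deriv_classical[of "Suc 0" v] assms by (simp add: CP_def)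
  have kd: "deriv (\<lambda>y. tkernel n (x - y)) = (\<lambda>y. - deriv (tkernel n) (x - y))"
    using kernel_reflected_deriv[of 1 n x] by simp
  have "(\<integral>y. v y * deriv (\<lambda>y. tkernel n (x - y)) y \<partial>torus) = - (\<integral>y. deriv v y * tkernel n (x - y) \<partial>torus)"
    using has_weak_derivD(2)[OF w kernel_reflected_smooth kernel_reflected_periodic] by simp
  then have "conv (deriv (tkernel n)) v x = mollify n (deriv v) x"
    by (simp add: kd conv_def mollify_def mult.commute)
  then show "(mollify n v has_real_derivative mollify n (deriv v) x) (at x)"
    using conv_DERIV[OF kernel_Ck CP_cont[OF assms], of n x] by (simp add: mollify_def)
qed

text \<open>The convergence of mollifications is uniform, hence the argument may move along.\<close>

lemma mollify_diag_tendsto: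
  assumes "\<And>x. v (x + 1) = v x" "continuous_on UNIV v" "y \<longlonglongrightarrow> z"
  shows "(\<lambda>n. mollify n v (y n)) \<longlonglongrightarrow> v z"
proof -
  have "(\<lambda>n. mollify n v (y n) - v (y n)) \<longlonglongrightarrow> 0"
  proof (rule LIMSEQ_I)
    fix r :: real assume "r > 0"
    then have "r / 2 > 0" by simp
    from mollify_uniform[OF assms(1,2) this] obtain n0 where n0: "\<forall>n\<ge>n0. \<forall>x. \<bar>mollify n v x - v x\<bar> \<le> r / 2" by blast
    have "norm (mollify n v (y n) - v (y n) - 0) < r" if "n \<ge> n0" for n
      using n0[rule_format, OF that, of "y n"] \<open>r > 0\<close> by simp
    then show "\<exists>no. \<forall>n\<ge>no. norm (mollify n v (y n) - v (y n) - 0) < r" by blast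
  qed
  moreover have "(\<lambda>n. v (y n)) \<longlonglongrightarrow> v z"
    by (rule continuous_on_tendsto_compose[OF assms(2,3)]) auto
  ultimately have "(\<lambda>n. (mollify n v (y n) - v (y n)) + v (y n)) \<longlonglongrightarrow> 0 + v z" by (rule tendsto_add)
  then show ?thesis by simp
qed

lemma mollify_diff: "v \<in> Hsob k \<Longrightarrow> w \<in> Hsob k \<Longrightarrow> (\<lambda>x. mollify n v x - mollify n w x) = mollify n (\<lambda>x. v x - w x)"
  using mollify_lincomb[of v w n 1 "-1"] HsobD(1)[of v k] HsobD(1)[of w k] by auto

text \<open>The pattern of this part: apply the classical estimate to the mollifications and let the closure property
  do the passage to the limit.\<close>

lemma Hsob_mult:
  assumes "v \<in> Hsob (Suc k)" "w \<in> Hsob (Suc k)"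
  shows "(\<lambda>x. v x * w x) \<in> Hsob (Suc k)"
    "nr (Suc k) (\<lambda>x. v x * w x) \<le> ((real k + 2) * alg k) * nr (Suc k) v * nr (Suc k) w"
proof -
  have C: "CP (Suc k) (\<lambda>x. mollify n v x * mollify n w x)" for n
    by (intro CP_mult mollify_CP[OF assms(1)] mollify_CP[OF assms(2)]) auto
  have L: "(\<lambda>n. mollify n v x * mollify n w x) \<longlonglongrightarrow> v x * w x" for x
    by (intro tendsto_mult mollify_lim[OF assms(1)] mollify_lim[OF assms(2)]) auto
  have c: "continuous_on UNIV (\<lambda>x. v x * w x)"
    using HsobD(2)[OF assms(1)] HsobD(2)[OF assms(2)] by (auto intro!: continuous_intros)
  have B: "cn (Suc k) (\<lambda>x. mollify n v x * mollify n w x) \<le> alg k * nr (Suc k) v * nr (Suc k) w" for n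
    by (rule order_trans[OF cn_mult[OF mollify_CP[OF assms(1)] mollify_CP[OF assms(2)]]])
       (use alg_pos[of k] mollify_cn[OF assms(1), of "Suc k" n] mollify_cn[OF assms(2), of "Suc k" n] in
         \<open>auto intro!: mult_mono mult_nonneg_nonneg\<close>)
  note l = Hsob_lsc_cn[OF C L c B]
  show "(\<lambda>x. v x * w x) \<in> Hsob (Suc k)" by (rule l(1))
  show "nr (Suc k) (\<lambda>x. v x * w x) \<le> ((real k + 2) * alg k) * nr (Suc k) v * nr (Suc k) w" using l(2) by (simp add: mult.assoc)
qed

lemma CP_comp_classical:
  assumes "Ck (Suc (Suc k)) F"
  shows "\<exists>C\<ge>0. \<forall>v. CP (Suc k) v \<longrightarrow> cn (Suc k) v \<le> R \<longrightarrow> cn (Suc k) (\<lambda>x. F (v x)) \<le> C"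
proof -
  obtain C where C: "C \<ge> 0" "\<And>v w. CP (Suc k) v \<Longrightarrow> CP (Suc k) w \<Longrightarrow> cn (Suc k) v \<le> R \<Longrightarrow> cn (Suc k) w \<le> R \<Longrightarrow>
      cn (Suc k) (\<lambda>x. F (v x) - F (w x)) \<le> C * cn (Suc k) (\<lambda>x. v x - w x)"
    using cn_compose_diff[OF assms, of R] by blast
  show ?thesis
  proof (intro exI[of _ "C * \<bar>R\<bar> + \<bar>F 0\<bar>"] conjI allI impI)
    fix v assume v: "CP (Suc k) v" "cn (Suc k) v \<le> R"
    have R: "0 \<le> R" using v(2) cn_nonneg[of "Suc k" v] by linarith
    have Fv: "CP (Suc k) (\<lambda>x. F (v x) - F 0)"
      using CP_compose_left[OF Ck_SucD[OF assms] v(1)] by (intro CP_diff) auto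
    have "cn (Suc k) (\<lambda>x. (F (v x) - F 0) + F 0) \<le> cn (Suc k) (\<lambda>x. F (v x) - F 0) + \<bar>F 0\<bar>"
      using cn_add[OF Fv CP_const[of _ "F 0"]] unfolding cn_const .
    moreover have "cn (Suc k) (\<lambda>x. F (v x) - F 0) \<le> C * cn (Suc k) v"
      using C(2)[OF v(1) CP_const[of _ 0] v(2)] R by (simp add: cn_const)
    moreover have "C * cn (Suc k) v \<le> C * \<bar>R\<bar>" using C(1) v(2) R by (intro mult_left_mono) auto
    ultimately show "cn (Suc k) (\<lambda>x. F (v x)) \<le> C * \<bar>R\<bar> + \<bar>F 0\<bar>" by simp
  qed (use C in auto)
qed

lemma Hsob_compose:
  assumes "Ck (Suc (Suc k)) F"
  shows "\<exists>C\<ge>0. (\<forall>v\<in>Hsob (Suc k). nr (Suc k) v \<le> R \<longrightarrow> (\<lambda>x. F (v x)) \<in> Hsob (Suc k) \<and> nr (Suc k) (\<lambda>x. F (v x)) \<le> C) \<and>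
    (\<forall>v\<in>Hsob (Suc k). \<forall>w\<in>Hsob (Suc k). nr (Suc k) v \<le> R \<longrightarrow> nr (Suc k) w \<le> R \<longrightarrow>
       nr (Suc k) (\<lambda>x. F (v x) - F (w x)) \<le> C * nr (Suc k) (\<lambda>x. v x - w x))"
proof -
  obtain C where C: "C \<ge> 0" "\<And>v w. CP (Suc k) v \<Longrightarrow> CP (Suc k) w \<Longrightarrow> cn (Suc k) v \<le> R \<Longrightarrow> cn (Suc k) w \<le> R \<Longrightarrow>
      cn (Suc k) (\<lambda>x. F (v x) - F (w x)) \<le> C * cn (Suc k) (\<lambda>x. v x - w x)"
    using cn_compose_diff[OF assms, of R] by blast
  obtain C' where C': "C' \<ge> 0" "\<And>v. CP (Suc k) v \<Longrightarrow> cn (Suc k) v \<le> R \<Longrightarrow> cn (Suc k) (\<lambda>x. F (v x)) \<le> C'"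
    using CP_comp_classical[OF assms, of R] by blast
  have Fc: "continuous_on UNIV F" by (rule Ck_cont[OF assms])
  have Fm: "CP (Suc k) (\<lambda>x. F (mollify n v x))" if "v \<in> Hsob (Suc k)" for v n
    by (rule CP_compose_left[OF Ck_SucD[OF assms] mollify_CP[OF that]]) simp
  have FL: "(\<lambda>n. F (mollify n v x)) \<longlonglongrightarrow> F (v x)" if "v \<in> Hsob (Suc k)" for v x
    by (rule continuous_on_tendsto_compose[OF Fc mollify_lim[OF that]]) auto
  have FC: "continuous_on UNIV (\<lambda>x. F (v x))" if "v \<in> Hsob (Suc k)" for v
    using HsobD(2)[OF that] by (auto intro!: continuous_on_compose2[OF Fc])
  have mc: "cn (Suc k) (mollify n v) \<le> nr (Suc k) v" if "v \<in> Hsob (Suc k)" for v n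
    by (rule mollify_cn[OF that]) auto
  define K where "K = (real k + 2) * max C C'"
  have K: "K \<ge> 0" "(real k + 2) * C \<le> K" "(real k + 2) * C' \<le> K" using C C' by (auto simp: K_def mult_left_mono)
  show ?thesis
  proof (intro exI[of _ K] conjI ballI impI K)
    fix v assume v: "v \<in> Hsob (Suc k)" "nr (Suc k) v \<le> R"
    have B: "cn (Suc k) (\<lambda>x. F (mollify n v x)) \<le> C'" for n
      by (rule C'(2)[OF mollify_CP[OF v(1)]]) (use mc[OF v(1), of n] v(2) in auto)
    note l = Hsob_lsc_cn[OF Fm[OF v(1)] FL[OF v(1)] FC[OF v(1)] B]
    show "(\<lambda>x. F (v x)) \<in> Hsob (Suc k)" by (rule l(1))
    show "nr (Suc k) (\<lambda>x. F (v x)) \<le> K" using l(2) K by linarith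
  next
    fix v w assume v: "v \<in> Hsob (Suc k)" "nr (Suc k) v \<le> R" and w: "w \<in> Hsob (Suc k)" "nr (Suc k) w \<le> R"
    have B: "cn (Suc k) (\<lambda>x. F (mollify n v x) - F (mollify n w x)) \<le> C * nr (Suc k) (\<lambda>x. v x - w x)" for n
    proof -
      have "cn (Suc k) (\<lambda>x. F (mollify n v x) - F (mollify n w x)) \<le> C * cn (Suc k) (\<lambda>x. mollify n v x - mollify n w x)"
        by (rule C(2)[OF mollify_CP[OF v(1)] mollify_CP[OF w(1)]])
           (use mc[OF v(1), of n] v(2) mc[OF w(1), of n] w(2) in auto)
      also have "\<dots> \<le> C * nr (Suc k) (\<lambda>x. v x - w x)"
        unfolding mollify_diff[OF v(1) w(1)] by (intro mult_left_mono mc Hsob_diff v w C)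
      finally show ?thesis .
    qed
    have "nr (Suc k) (\<lambda>x. F (v x) - F (w x)) \<le> (real k + 2) * (C * nr (Suc k) (\<lambda>x. v x - w x))"
      by (rule Hsob_lsc_cn(2)[OF CP_diff[OF Fm[OF v(1)] Fm[OF w(1)]] tendsto_diff[OF FL[OF v(1)] FL[OF w(1)]] continuous_on_diff[OF FC[OF v(1)] FC[OF w(1)]] B])
    also have "\<dots> \<le> K * nr (Suc k) (\<lambda>x. v x - w x)" using K(2) by (simp add: mult.assoc[symmetric] mult_right_mono)
    finally show "nr (Suc k) (\<lambda>x. F (v x) - F (w x)) \<le> K * nr (Suc k) (\<lambda>x. v x - w x)" .
  qed
qed

text \<open>The Sobolev version of \<open>adm\<close>; the order is at least two, so the norm controls the
  derivative.\<close>

definition admS :: "nat \<Rightarrow> real \<Rightarrow> real \<Rightarrow> (real \<Rightarrow> real) \<Rightarrow> bool" where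
  "admS k R dt a \<longleftrightarrow> a \<in> Hsob (Suc (Suc k)) \<and> nr (Suc (Suc k)) a \<le> R \<and> 0 \<le> dt \<and> dt \<le> 1 \<and> dt * R \<le> 1/2"

lemma admS_mollify: "admS k R dt a \<Longrightarrow> adm (Suc (Suc k)) R dt (mollify n a)"
proof -
  assume a: "admS k R dt a"
  then have H: "a \<in> Hsob (Suc (Suc k))" by (simp add: admS_def)
  have C: "CP m (mollify n a)" for m by (rule mollify_CP[OF H]) simp
  have "cn (Suc (Suc k)) (mollify n a) \<le> nr (Suc (Suc k)) a" by (rule mollify_cn[OF H]) auto
  moreover have "nr (Suc (Suc k)) a \<le> R" using a by (simp add: admS_def)
  ultimately have n: "cn (Suc (Suc k)) (mollify n a) \<le> R" by linarith
  have "\<bar>deriv (mollify n a) x\<bar> \<le> R" for x using CP_sup_deriv[of k "mollify n a" x, OF C] n by linarith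
  then show ?thesis using a C n by (auto simp: adm_def admS_def)
qed

lemma X1_mollify_tendsto:
  assumes "admS k R dt a" "e \<in> Hsob (Suc j)"
  shows "(\<lambda>n. mollify n e (X1 dt (mollify n a) x)) \<longlonglongrightarrow> e (X1 dt a x)"
proof (rule mollify_diag_tendsto)
  have H: "a \<in> Hsob (Suc (Suc k))" using assms(1) by (simp add: admS_def)
  show "(\<lambda>n. X1 dt (mollify n a) x) \<longlonglongrightarrow> X1 dt a x"
    unfolding X1_def by (intro tendsto_intros mollify_lim[OF H]) auto
  show "continuous_on UNIV e" by (rule HsobD(2)[OF assms(2)]) simp
qed (rule HsobD(3)[OF assms(2)])

lemma X1_continuous:
  assumes "admS k R dt a" "continuous_on UNIV e" shows "continuous_on UNIV (\<lambda>x. e (X1 dt a x))"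
proof -
  have "a \<in> Hsob (Suc (Suc k))" using assms(1) by (simp add: admS_def)
  then have "continuous_on UNIV a" by (rule HsobD(2)) simp
  then show ?thesis unfolding X1_def by (intro continuous_on_compose2[OF assms(2)] continuous_intros) auto
qed

text \<open>The \<open>L\<^sup>2\<close> and top-order bounds are closed separately, since the sum of all seminorms
  would spoil the leading constant.\<close>

lemma Hsob_X1:
  "\<exists>C\<ge>0. \<forall>a dt e. admS k R dt a \<longrightarrow> e \<in> Hsob (Suc (Suc k)) \<longrightarrow>
     (\<lambda>x. e (X1 dt a x)) \<in> Hsob (Suc (Suc k)) \<and> nr (Suc (Suc k)) (\<lambda>x. e (X1 dt a x)) \<le> C * nr (Suc (Suc k)) e \<and>
     (L2norm (\<lambda>x. e (X1 dt a x)))\<^sup>2 \<le> (1 + C * dt) * (L2norm e)\<^sup>2 \<and>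
     (Hsemi (Suc (Suc k)) (\<lambda>x. e (X1 dt a x)))\<^sup>2 \<le> (Hsemi (Suc (Suc k)) e)\<^sup>2 + C * dt * (nr (Suc (Suc k)) e)\<^sup>2"
proof -
  obtain C1 where C1: "C1 \<ge> 0" "\<And>a dt e. adm (Suc (Suc k)) R dt a \<Longrightarrow> CP (Suc (Suc k)) e \<Longrightarrow> cn (Suc (Suc k)) (\<lambda>x. e (X1 dt a x)) \<le> C1 * cn (Suc (Suc k)) e"
    using cn_X1[of "Suc (Suc k)" R] by blast
  obtain C2 where C2: "C2 \<ge> 0" "\<And>a dt e. adm (Suc (Suc k)) R dt a \<Longrightarrow> CP (Suc (Suc k)) e \<Longrightarrow>
     (L2norm ((deriv ^^ Suc (Suc k)) (\<lambda>x. e (X1 dt a x))))\<^sup>2 \<le> (L2norm ((deriv ^^ Suc (Suc k)) e))\<^sup>2 + C2 * dt * (cn (Suc (Suc k)) e)\<^sup>2"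
    using funpow_X1_sq[of "Suc k" R] by blast
  define s where "s = Suc (Suc k)"
  define K where "K = max ((real s + 1) * C1) (max C2 (2 * \<bar>R\<bar>))"
  have K: "K \<ge> 0" "(real s + 1) * C1 \<le> K" "C2 \<le> K" "2 * \<bar>R\<bar> \<le> K" by (auto simp: K_def)
  show ?thesis
  proof (intro exI[of _ K] conjI allI impI)
    show "0 \<le> K" by (rule K)
    fix a dt e assume a: "admS k R dt a" and e': "e \<in> Hsob (Suc (Suc k))"
    have e: "e \<in> Hsob s" using e' by (simp add: s_def)
    have s0: "0 < s" by (simp add: s_def)
    have dt: "0 \<le> dt" using a by (simp add: admS_def)
    note am = admS_mollify[OF a]
    define v where "v n x = mollify n e (X1 dt (mollify n a) x)" for n x
    have CPe: "CP m (mollify n e)" for m n by (rule mollify_CP[OF e s0])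
    have vC: "CP s (v n)" for n unfolding v_def[abs_def] s_def by (rule CP_X1[OF admD(1)[OF am] CPe])
    have vL: "(\<lambda>n. v n x) \<longlonglongrightarrow> e (X1 dt a x)" for x unfolding v_def by (rule X1_mollify_tendsto[OF a e'])
    have c: "continuous_on UNIV (\<lambda>x. e (X1 dt a x))" by (rule X1_continuous[OF a HsobD(2)[OF e s0]])
    have me: "cn s (mollify n e) \<le> nr s e" for n by (rule mollify_cn[OF e s0]) simp
    have vn: "cn s (v n) \<le> C1 * nr s e" for n
      using C1(2)[OF am CPe, of n n] mult_left_mono[OF me[of n] C1(1)] unfolding v_def s_def by linarith
    have B: "\<bar>v n x\<bar> \<le> C1 * nr s e" for n x
      using CP_sup'[of "Suc k" "v n" x] vC[of n] vn[of n] by (simp add: s_def)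
    define M where "M j = (if j = 0 then sqrt (1 + 2 * \<bar>R\<bar> * dt) * L2norm e else if j = s then sqrt ((Hsemi s e)\<^sup>2 + C2 * dt * (nr s e)\<^sup>2) else C1 * nr s e)" for j
    have S: "Hsemi j (v n) \<le> M j" if "j \<le> s" for j n
    proof -
      have eq: "Hsemi j (v n) = L2norm ((deriv ^^ j) (v n))"
        by (rule Hsob_classical(2)[OF CPD(1)[OF vC] CPD(2)[OF vC] that])
      consider "j = 0" | "j = s" | "j \<noteq> 0" "j \<noteq> s" by blast
      then show ?thesis
      proof cases
        case 1
        have "L2norm (mollify n e) \<le> L2norm e"
          using mollify_Hsemi[OF e s0, of 0 n] Hsemi_0[OF HsobD(1)[OF e]] by simp
        then have "(1 + 2 * R * dt) * (L2norm (mollify n e))\<^sup>2 \<le> (1 + 2 * \<bar>R\<bar> * dt) * (L2norm e)\<^sup>2"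
          using dt by (intro mult_mono power_mono add_left_mono mult_right_mono[OF mult_left_mono[OF abs_ge_self]] add_nonneg_nonneg mult_nonneg_nonneg) auto
        then have "(L2norm (v n))\<^sup>2 \<le> (1 + 2 * \<bar>R\<bar> * dt) * (L2norm e)\<^sup>2"
          using L2norm_X1_sq[OF am[of n] CPe[of 0 n]] unfolding v_def[abs_def] by linarith
        then have "sqrt ((L2norm (v n))\<^sup>2) \<le> sqrt ((1 + 2 * \<bar>R\<bar> * dt) * (L2norm e)\<^sup>2)" by (rule real_sqrt_le_mono)
        then show ?thesis using 1 eq by (simp add: M_def real_sqrt_mult)
      next
        case 2
        have "L2norm ((deriv ^^ s) (mollify n e)) \<le> Hsemi s e" by (rule mollify_Hsemi[OF e s0 order_refl])
        then have "(L2norm ((deriv ^^ s) (mollify n e)))\<^sup>2 + C2 * dt * (cn s (mollify n e))\<^sup>2 \<le> (Hsemi s e)\<^sup>2 + C2 * dt * (nr s e)\<^sup>2"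
          using me[of n] C2(1) dt by (intro add_mono power_mono mult_left_mono) auto
        then have "(L2norm ((deriv ^^ s) (v n)))\<^sup>2 \<le> (Hsemi s e)\<^sup>2 + C2 * dt * (nr s e)\<^sup>2"
          using C2(2)[OF am CPe, of n n] unfolding v_def[abs_def] s_def by linarith
        then have "sqrt ((L2norm ((deriv ^^ s) (v n)))\<^sup>2) \<le> sqrt ((Hsemi s e)\<^sup>2 + C2 * dt * (nr s e)\<^sup>2)" by (rule real_sqrt_le_mono)
        then show ?thesis using 2 s0 unfolding eq M_def by (simp add: s_def)
      next
        case 3
        then show ?thesis using L2norm_le_cn[OF that, of "v n"] vn[of n] unfolding eq M_def by simp
      qed
    qed
    note l = Hsob_lsc[OF CP_Hsob[OF vC] vL c B S]
    show "(\<lambda>x. e (X1 dt a x)) \<in> Hsob (Suc (Suc k))" using l(1) by (simp add: s_def)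
    have "nr s (\<lambda>x. e (X1 dt a x)) \<le> (real (Suc k) + 2) * (C1 * nr s e)"
      using Hsob_lsc_cn(2)[of "Suc k" v "\<lambda>x. e (X1 dt a x)" "C1 * nr s e"] vC vL c vn by (simp add: s_def)
    also have "\<dots> = ((real s + 1) * C1) * nr s e" by (simp add: s_def algebra_simps)
    also have "\<dots> \<le> K * nr s e" using K(2) by (intro mult_right_mono) auto
    finally show "nr (Suc (Suc k)) (\<lambda>x. e (X1 dt a x)) \<le> K * nr (Suc (Suc k)) e" by (simp add: s_def)
    have "L2norm (\<lambda>x. e (X1 dt a x)) \<le> M 0" using l(2)[of 0] Hsemi_0[OF HsobD(1)[OF l(1)]] by simp
    then have "(L2norm (\<lambda>x. e (X1 dt a x)))\<^sup>2 \<le> (M 0)\<^sup>2" by (rule power_mono) simp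
    also have "\<dots> = (1 + 2 * \<bar>R\<bar> * dt) * (L2norm e)\<^sup>2" using dt by (simp add: M_def power_mult_distrib)
    also have "\<dots> \<le> (1 + K * dt) * (L2norm e)\<^sup>2" using K(4) dt by (intro mult_right_mono add_left_mono) auto
    finally show "(L2norm (\<lambda>x. e (X1 dt a x)))\<^sup>2 \<le> (1 + K * dt) * (L2norm e)\<^sup>2" .
    have "(Hsemi s (\<lambda>x. e (X1 dt a x)))\<^sup>2 \<le> (M s)\<^sup>2" using l(2)[of s] by (intro power_mono) auto
    also have "\<dots> = (Hsemi s e)\<^sup>2 + C2 * dt * (nr s e)\<^sup>2" using dt C2(1) s0 by (simp add: M_def)
    also have "\<dots> \<le> (Hsemi s e)\<^sup>2 + K * dt * (nr s e)\<^sup>2" using K(3) dt by (intro add_left_mono mult_right_mono) auto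
    finally show "(Hsemi (Suc (Suc k)) (\<lambda>x. e (X1 dt a x)))\<^sup>2 \<le> (Hsemi (Suc (Suc k)) e)\<^sup>2 + K * dt * (nr (Suc (Suc k)) e)\<^sup>2"
      by (simp add: s_def)
  qed
qed

lemma Hsob_X1_diff:
  "\<exists>C\<ge>0. \<forall>a b dt e. admS k R dt a \<longrightarrow> admS k R dt b \<longrightarrow> e \<in> Hsob (k + 4) \<longrightarrow>
     nr (Suc (Suc k)) (\<lambda>x. e (X1 dt a x) - e (X1 dt b x)) \<le> C * dt * nr (Suc (Suc k)) (\<lambda>x. a x - b x) * nr (k + 4) e"
proof -
  obtain C where C: "C \<ge> 0" "\<And>a b dt e. adm (Suc (Suc k)) R dt a \<Longrightarrow> adm (Suc (Suc k)) R dt b \<Longrightarrow> CP (k + 4) e \<Longrightarrow>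
     cn (Suc (Suc k)) (\<lambda>x. e (X1 dt a x) - e (X1 dt b x)) \<le> C * dt * cn (Suc (Suc k)) (\<lambda>x. a x - b x) * cn (k + 4) e"
    using cn_X1_diff[of "Suc (Suc k)" R] by (auto simp: numeral_eq_Suc)
  show ?thesis
  proof (intro exI[of _ "(real (Suc k) + 2) * C"] conjI allI impI)
    fix a b dt e assume a: "admS k R dt a" and b: "admS k R dt b" and e: "e \<in> Hsob (k + 4)"
    have aH: "a \<in> Hsob (Suc (Suc k))" "b \<in> Hsob (Suc (Suc k))" and dt: "0 \<le> dt" using a b by (auto simp: admS_def)
    have e1: "e \<in> Hsob (Suc (k + 3))" using e by (simp add: numeral_eq_Suc)
    have CPe: "CP m (mollify n e)" for m n by (rule mollify_CP[OF e]) simp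
    have c: "continuous_on UNIV (\<lambda>x. e (X1 dt a x) - e (X1 dt b x))"
      by (intro continuous_on_diff X1_continuous[OF a] X1_continuous[OF b] HsobD(2)[OF e]) auto
    have "nr (Suc (Suc k)) (\<lambda>x. e (X1 dt a x) - e (X1 dt b x)) \<le> (real (Suc k) + 2) * (C * dt * nr (Suc (Suc k)) (\<lambda>x. a x - b x) * nr (k + 4) e)"
    proof (rule Hsob_lsc_cn(2)[OF _ _ c])
      fix n
      show "CP (Suc (Suc k)) (\<lambda>x. mollify n e (X1 dt (mollify n a) x) - mollify n e (X1 dt (mollify n b) x))"
        by (intro CP_diff CP_X1 CPe admD(1)[OF admS_mollify[OF a]] admD(1)[OF admS_mollify[OF b]])
      have "cn (Suc (Suc k)) (\<lambda>x. mollify n e (X1 dt (mollify n a) x) - mollify n e (X1 dt (mollify n b) x))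
        \<le> C * dt * cn (Suc (Suc k)) (\<lambda>x. mollify n a x - mollify n b x) * cn (k + 4) (mollify n e)"
        by (rule C(2)[OF admS_mollify[OF a] admS_mollify[OF b] CPe])
      also have "\<dots> \<le> C * dt * nr (Suc (Suc k)) (\<lambda>x. a x - b x) * nr (k + 4) e"
        unfolding mollify_diff[OF aH]
        using mollify_cn[OF e, of "k + 4" n] mollify_cn[OF Hsob_diff[OF aH], of "Suc (Suc k)" n] C(1) dt
        by (intro mult_mono mult_nonneg_nonneg) auto
      finally show "cn (Suc (Suc k)) (\<lambda>x. mollify n e (X1 dt (mollify n a) x) - mollify n e (X1 dt (mollify n b) x)) \<le> C * dt * nr (Suc (Suc k)) (\<lambda>x. a x - b x) * nr (k + 4) e" .
    next
      fix x
      show "(\<lambda>n. mollify n e (X1 dt (mollify n a) x) - mollify n e (X1 dt (mollify n b) x)) \<longlonglongrightarrow> e (X1 dt a x) - e (X1 dt b x)"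
        by (intro tendsto_diff X1_mollify_tendsto[OF a e1] X1_mollify_tendsto[OF b e1])
    qed
    then show "nr (Suc (Suc k)) (\<lambda>x. e (X1 dt a x) - e (X1 dt b x)) \<le> (real (Suc k) + 2) * C * dt * nr (Suc (Suc k)) (\<lambda>x. a x - b x) * nr (k + 4) e"
      by (simp add: mult.assoc)
  qed (use C in auto)
qed

lemma mollify_deriv_lim:
  assumes "v \<in> Hsob (Suc k)" "k \<ge> 2" shows "(\<lambda>n. deriv (mollify n v) x) \<longlonglongrightarrow> deriv v x"
  unfolding deriv_mollify[OF CP_of_Hsob[OF assms]]
  by (rule mollify_lim[OF Hsob_deriv(2)[OF assms]]) (use assms(2) in simp)

lemma Hsob_X1_Taylor:
  "\<exists>C\<ge>0. \<forall>a dt e. admS k R dt a \<longrightarrow> e \<in> Hsob (k + 5) \<longrightarrow>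
     nr (Suc (Suc k)) (\<lambda>x. e (X1 dt a x) - e x + dt * (a x * deriv e x)) \<le> C * dt\<^sup>2 * nr (k + 5) e"
proof -
  obtain C where C: "C \<ge> 0" "\<And>a dt e. adm (Suc (Suc k)) R dt a \<Longrightarrow> CP (k + 5) e \<Longrightarrow>
     cn (Suc (Suc k)) (\<lambda>x. e (X1 dt a x) - e x + dt * (a x * deriv e x)) \<le> C * dt\<^sup>2 * cn (k + 5) e"
    using cn_X1_Taylor[of "Suc (Suc k)" R] by (auto simp: numeral_eq_Suc)
  show ?thesis
  proof (intro exI[of _ "(real (Suc k) + 2) * C"] conjI allI impI)
    fix a dt e assume a: "admS k R dt a" and e: "e \<in> Hsob (k + 5)"
    have aH: "a \<in> Hsob (Suc (Suc k))" and dt: "0 \<le> dt" using a by (auto simp: admS_def)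
    have e1: "e \<in> Hsob (Suc (k + 4))" using e by (simp add: numeral_eq_Suc)
    have CPe: "CP m (mollify n e)" for m n by (rule mollify_CP[OF e]) simp
    have cd: "continuous_on UNIV (deriv e)" by (rule HsobD(2)[OF Hsob_deriv(2)[OF e1]]) auto
    have c: "continuous_on UNIV (\<lambda>x. e (X1 dt a x) - e x + dt * (a x * deriv e x))"
      by (intro continuous_intros X1_continuous[OF a] HsobD(2)[OF e] HsobD(2)[OF aH] cd) auto
    have "nr (Suc (Suc k)) (\<lambda>x. e (X1 dt a x) - e x + dt * (a x * deriv e x)) \<le> (real (Suc k) + 2) * (C * dt\<^sup>2 * nr (k + 5) e)"
    proof (rule Hsob_lsc_cn(2)[OF _ _ c])
      fix n
      show "CP (Suc (Suc k)) (\<lambda>x. mollify n e (X1 dt (mollify n a) x) - mollify n e x + dt * (mollify n a x * deriv (mollify n e) x))"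
        by (intro CP_add CP_diff CP_X1 CP_cmult CP_mult CPe CP_deriv[OF CPe] admD(1)[OF admS_mollify[OF a]])
      have "cn (Suc (Suc k)) (\<lambda>x. mollify n e (X1 dt (mollify n a) x) - mollify n e x + dt * (mollify n a x * deriv (mollify n e) x))
        \<le> C * dt\<^sup>2 * cn (k + 5) (mollify n e)"
        by (rule C(2)[OF admS_mollify[OF a] CPe])
      also have "\<dots> \<le> C * dt\<^sup>2 * nr (k + 5) e"
        using mollify_cn[OF e, of "k + 5" n] C(1) by (intro mult_left_mono) auto
      finally show "cn (Suc (Suc k)) (\<lambda>x. mollify n e (X1 dt (mollify n a) x) - mollify n e x + dt * (mollify n a x * deriv (mollify n e) x)) \<le> C * dt\<^sup>2 * nr (k + 5) e" .
    next
      fix x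
      show "(\<lambda>n. mollify n e (X1 dt (mollify n a) x) - mollify n e x + dt * (mollify n a x * deriv (mollify n e) x)) \<longlonglongrightarrow> e (X1 dt a x) - e x + dt * (a x * deriv e x)"
        by (intro tendsto_intros X1_mollify_tendsto[OF a e1] mollify_lim[OF e1] mollify_lim[OF aH] mollify_deriv_lim[OF e1]) auto
    qed
    then show "nr (Suc (Suc k)) (\<lambda>x. e (X1 dt a x) - e x + dt * (a x * deriv e x)) \<le> (real (Suc k) + 2) * C * dt\<^sup>2 * nr (k + 5) e"
      by (simp add: mult.assoc)
  qed (use C in auto)
qed

lemma SV_tendsto:
  "v \<in> Hsob (Suc k) \<Longrightarrow> (\<lambda>n. SV \<nu> dt (mollify n v) x) \<longlonglongrightarrow> SV \<nu> dt v x"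
  unfolding SV_eq by (intro tendsto_intros mollify_lim) auto

lemma SV_continuous: 
  assumes "continuous_on UNIV v" shows "continuous_on UNIV (SV \<nu> dt v)"
proof -
  have "continuous_on UNIV (\<lambda>x. v (x + d))" for d
    by (rule continuous_on_compose2[OF assms]) (auto intro!: continuous_intros)
  then show ?thesis unfolding SV_eq by (intro continuous_on_add continuous_on_mult continuous_on_const)
qed

lemma Hsob_SV:
  assumes v: "v \<in> Hsob (Suc k)"
  shows "SV \<nu> dt v \<in> Hsob (Suc k)" "j \<le> Suc k \<Longrightarrow> Hsemi j (SV \<nu> dt v) \<le> Hsemi j v"
proof -
  have C: "CP m (mollify n v)" for m n by (rule mollify_CP[OF v]) simp
  have S: "Hsemi j (SV \<nu> dt (mollify n v)) \<le> Hsemi j v" if "j \<le> Suc k" for j n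
  proof -
    have "Hsemi j (SV \<nu> dt (mollify n v)) = L2norm ((deriv ^^ j) (SV \<nu> dt (mollify n v)))"
      by (rule Hsob_classical(2)[OF CPD(1)[OF CP_SV[OF C]] CPD(2)[OF CP_SV[OF C]] order_refl])
    also have "\<dots> = L2norm (SV \<nu> dt ((deriv ^^ j) (mollify n v)))" by (simp add: funpow_SV[OF CPD(1)[OF C]])
    also have "\<dots> \<le> L2norm ((deriv ^^ j) (mollify n v))"
      by (rule L2norm_SV, rule CP_funpow[of j 0], rule C)
    also have "\<dots> \<le> Hsemi j v" by (rule mollify_Hsemi[OF v _ that]) simp
    finally show ?thesis .
  qed
  have B: "\<bar>SV \<nu> dt (mollify n v) x\<bar> \<le> nr 1 v" for n x
  proof -
    have "\<bar>mollify n v y\<bar> \<le> nr 1 v" for y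
      using CP_sup[OF C, of n y] mollify_cn[OF v, of 1 n] by simp
    from this[of "x + - sv_shift \<nu> dt"] this[of "x + sv_shift \<nu> dt"] show ?thesis unfolding SV_eq by linarith
  qed
  note l = Hsob_lsc[OF CP_Hsob[OF CP_SV[OF C]] SV_tendsto[OF v] SV_continuous[OF HsobD(2)[OF v zero_less_Suc]] B S]
  show "SV \<nu> dt v \<in> Hsob (Suc k)" by (rule l(1))
  show "j \<le> Suc k \<Longrightarrow> Hsemi j (SV \<nu> dt v) \<le> Hsemi j v" by (rule l(2))
qed

lemma nr_SV: "v \<in> Hsob (Suc k) \<Longrightarrow> nr (Suc k) (SV \<nu> dt v) \<le> nr (Suc k) v"
  unfolding nr_def by (rule sum_mono) (auto intro: Hsob_SV(2))

lemma L2norm_SV_le: "v \<in> Hsob (Suc k) \<Longrightarrow> L2norm (SV \<nu> dt v) \<le> L2norm v"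
  using Hsob_SV(2)[of v k 0 \<nu> dt] Hsob_SV(1)[of v k \<nu> dt] Hsemi_0 HsobD(1) by (metis le0)

lemma SV_diff: "SV \<nu> dt (\<lambda>x. v x - w x) = (\<lambda>x. SV \<nu> dt v x - SV \<nu> dt w x)"
  by (auto simp: SV_def Let_def field_simps)

lemma Hsob_SV_first:
  assumes v: "v \<in> Hsob (k + 3)" and nn: "0 \<le> \<nu>" "0 \<le> dt"
  shows "nr (Suc k) (\<lambda>x. SV \<nu> dt v x - v x) \<le> (real k + 2) * (2 * \<nu> * dt * nr (k + 3) v)"
proof (rule Hsob_lsc_cn(2)[of k "\<lambda>n x. SV \<nu> dt (mollify n v) x - mollify n v x"])
  have v': "v \<in> Hsob (Suc (k + 2))" using v by (simp add: numeral_eq_Suc)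
  have C: "CP m (mollify n v)" for m n by (rule mollify_CP[OF v]) simp
  show "CP (Suc k) (\<lambda>x. SV \<nu> dt (mollify n v) x - mollify n v x)" for n by (intro CP_diff CP_SV C)
  show "(\<lambda>n. SV \<nu> dt (mollify n v) x - mollify n v x) \<longlonglongrightarrow> SV \<nu> dt v x - v x" for x
    by (intro tendsto_diff SV_tendsto[OF v'] mollify_lim[OF v']) simp
  show "continuous_on UNIV (\<lambda>x. SV \<nu> dt v x - v x)" by (intro continuous_on_diff SV_continuous HsobD(2)[OF v]) auto
  fix n
  have "cn (Suc k) (\<lambda>x. SV \<nu> dt (mollify n v) x - mollify n v x) \<le> 2 * \<nu> * dt * cn (k + 3) (mollify n v)"
    using cn_SV_first[OF C nn, of "Suc k" n] by (simp add: numeral_eq_Suc)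
  also have "\<dots> \<le> 2 * \<nu> * dt * nr (k + 3) v"
    using mollify_cn[OF v, of "k + 3" n] nn by (intro mult_left_mono) auto
  finally show "cn (Suc k) (\<lambda>x. SV \<nu> dt (mollify n v) x - mollify n v x) \<le> 2 * \<nu> * dt * nr (k + 3) v" .
qed

lemma Hsob_SV_second:
  assumes v: "v \<in> Hsob (k + 5)" and nn: "0 \<le> \<nu>" "0 \<le> dt"
  shows "nr (Suc k) (\<lambda>x. SV \<nu> dt v x - v x - \<nu> * dt * deriv (deriv v) x) \<le> (real k + 2) * (4 * \<nu>\<^sup>2 * dt\<^sup>2 * nr (k + 5) v)"
proof (rule Hsob_lsc_cn(2)[of k "\<lambda>n x. SV \<nu> dt (mollify n v) x - mollify n v x - \<nu> * dt * deriv (deriv (mollify n v)) x"])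
  have v': "v \<in> Hsob (Suc (k + 4))" using v by (simp add: numeral_eq_Suc)
  have dv: "deriv v \<in> Hsob (Suc (k + 3))" using Hsob_deriv(2)[OF v'] by (simp add: numeral_eq_Suc)
  have ddv: "deriv (deriv v) \<in> Hsob (k + 3)" using Hsob_deriv(2)[OF dv] by simp
  have C: "CP m (mollify n v)" for m n by (rule mollify_CP[OF v]) simp
  show "CP (Suc k) (\<lambda>x. SV \<nu> dt (mollify n v) x - mollify n v x - \<nu> * dt * deriv (deriv (mollify n v)) x)" for n
    by (intro CP_diff CP_SV CP_cmult CP_deriv C)
  have "(\<lambda>n. deriv (deriv (mollify n v)) x) \<longlonglongrightarrow> deriv (deriv v) x" for x
    using mollify_deriv_lim[OF dv, of x] deriv_mollify[OF CP_of_Hsob[OF v']] by simp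
  then show "(\<lambda>n. SV \<nu> dt (mollify n v) x - mollify n v x - \<nu> * dt * deriv (deriv (mollify n v)) x) \<longlonglongrightarrow> SV \<nu> dt v x - v x - \<nu> * dt * deriv (deriv v) x" for x
    by (intro tendsto_intros SV_tendsto[OF v'] mollify_lim[OF v']) simp
  show "continuous_on UNIV (\<lambda>x. SV \<nu> dt v x - v x - \<nu> * dt * deriv (deriv v) x)"
    by (intro continuous_intros SV_continuous HsobD(2)[OF v] HsobD(2)[OF ddv]) auto
  fix n
  have "cn (Suc k) (\<lambda>x. SV \<nu> dt (mollify n v) x - mollify n v x - \<nu> * dt * deriv (deriv (mollify n v)) x) \<le> 4 * \<nu>\<^sup>2 * dt\<^sup>2 * cn (k + 5) (mollify n v)"
    using cn_SV_second[OF C nn, of "Suc k" n] by (simp add: numeral_eq_Suc)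
  also have "\<dots> \<le> 4 * \<nu>\<^sup>2 * dt\<^sup>2 * nr (k + 5) v"
    using mollify_cn[OF v, of "k + 5" n] nn by (intro mult_left_mono) auto
  finally show "cn (Suc k) (\<lambda>x. SV \<nu> dt (mollify n v) x - mollify n v x - \<nu> * dt * deriv (deriv (mollify n v)) x) \<le> 4 * \<nu>\<^sup>2 * dt\<^sup>2 * nr (k + 5) v" .
qed

section \<open>The implicit advection step\<close>

text \<open>If \<open>w\<close> solves the implicit equation, then \<open>y = x - f(w(x)) dt\<close> satisfies
  \<open>y + f(b(y)) dt = x\<close>, so \<open>y\<close> is determined by \<open>x\<close> and
  \<open>w = b \<circ> X\<close> is the only candidate. It is the limit of the corresponding functions for mollified
  data, whose norms are bounded by \<open>inverse_flow_cn\<close> and \<open>cn_X1\<close>.\<close>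

lemma SA_wellposed:
  assumes F: "Ck (k + 3) f"
  shows "\<exists>C\<ge>0. \<exists>d>0. \<forall>b dt. b \<in> Hsob (Suc (Suc k)) \<longrightarrow> nr (Suc (Suc k)) b \<le> R \<longrightarrow> 0 \<le> dt \<longrightarrow> dt \<le> d \<longrightarrow>
     (\<exists>!w. is_SA (Suc (Suc k)) f dt b w) \<and> is_SA (Suc (Suc k)) f dt b (SA (Suc (Suc k)) f dt b) \<and>
     nr (Suc (Suc k)) (SA (Suc (Suc k)) f dt b) \<le> C"
proof -
  have F': "Ck (Suc (Suc (Suc k))) f" using F by (simp add: numeral_eq_Suc)
  obtain R1 where R1: "R1 \<ge> 0" "\<And>v. v \<in> Hsob (Suc (Suc k)) \<Longrightarrow> nr (Suc (Suc k)) v \<le> R \<Longrightarrow> (\<lambda>x. f (v x)) \<in> Hsob (Suc (Suc k)) \<and> nr (Suc (Suc k)) (\<lambda>x. f (v x)) \<le> R1"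
    using Hsob_compose[OF F', of R] by blast
  obtain R2 where R2: "R2 \<ge> 0" "\<And>v. CP (Suc (Suc k)) v \<Longrightarrow> cn (Suc (Suc k)) v \<le> R \<Longrightarrow> cn (Suc (Suc k)) (\<lambda>x. f (v x)) \<le> R2"
    using CP_comp_classical[OF F', of R] by blast
  obtain C2 d where C2: "C2 \<ge> 0" "d > 0" "\<And>g X dt. adm (Suc (Suc k)) R2 dt g \<Longrightarrow> (\<And>x. X x = x - g (X x) * dt) \<Longrightarrow> dt \<le> d \<Longrightarrow>
     cn (Suc (Suc k)) (\<lambda>x. g (X x)) \<le> C2"
    using inverse_flow_cn[of "Suc k" R2] by blast
  define R3 where "R3 = max C2 (2 * R2)"
  have R3: "R3 \<ge> 0" "C2 \<le> R3" "2 * R2 \<le> R3" using C2 by (auto simp: R3_def)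
  obtain C1 where C1: "C1 \<ge> 0" "\<And>a dt e. adm (Suc (Suc k)) R3 dt a \<Longrightarrow> CP (Suc (Suc k)) e \<Longrightarrow> cn (Suc (Suc k)) (\<lambda>x. e (X1 dt a x)) \<le> C1 * cn (Suc (Suc k)) e"
    using cn_X1[of "Suc (Suc k)" R3] by blast
  define D where "D = min (min 1 d) (1 / (2 * (R1 + R2 + R3 + 1)))"
  have D: "D > 0" using C2 R1 R2 R3 by (simp add: D_def)
  have main: "(\<exists>!w. is_SA (Suc (Suc k)) f dt b w) \<and> is_SA (Suc (Suc k)) f dt b (SA (Suc (Suc k)) f dt b) \<and>
     nr (Suc (Suc k)) (SA (Suc (Suc k)) f dt b) \<le> (real (Suc k) + 2) * (C1 * \<bar>R\<bar>)"
    if b: "b \<in> Hsob (Suc (Suc k))" "nr (Suc (Suc k)) b \<le> R" and dt: "0 \<le> dt" "dt \<le> D" for b dt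
  proof -
    have RR: "dt * r \<le> 1/2" if "0 \<le> r" "r \<le> R1 + R2 + R3" for r
    proof -
      have "dt * r \<le> dt * (R1 + R2 + R3)" using dt that by (intro mult_left_mono) auto
      also have "\<dots> \<le> 1/2" by (rule small_product) (use R1 R2 R3 dt in \<open>auto simp: D_def\<close>)
      finally show ?thesis .
    qed
    have dtR: "dt * R1 \<le> 1/2" "dt * R2 \<le> 1/2" "dt * R3 \<le> 1/2" "dt \<le> 1" "dt \<le> d"
      using RR[of R1] RR[of R2] RR[of R3] R1 R2 R3 dt by (auto simp: D_def)
    define g where "g x = f (b x)" for x
    have g: "g \<in> Hsob (Suc (Suc k))" "nr (Suc (Suc k)) g \<le> R1" using R1(2)[OF b] by (auto simp: g_def[abs_def])
    have glip: "\<bar>g y - g z\<bar> \<le> R1 * \<bar>y - z\<bar>" for y z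
    proof -
      have "nr 2 g \<le> R1" using nr_mono[of 2 "Suc (Suc k)" g] g(2) by simp
      then have "nr 2 g * \<bar>y - z\<bar> \<le> R1 * \<bar>y - z\<bar>" by (rule mult_right_mono) simp
      then show ?thesis using Hsob_Lipschitz[OF g(1), of y z] by linarith
    qed
    have gbd: "\<bar>g y\<bar> \<le> R1" for y using Hsob_sup'[OF g(1), of y] g(2) by linarith
    obtain X where X: "\<And>x y. y = x - g y * dt \<longleftrightarrow> y = X x"
      using perturbed_identity_inverse(1)[OF glip gbd dt(1) dtR(1)] by blast
    have Xeq: "X x = x - g (X x) * dt" for x using X by blast
    define w where "w x = b (X x)" for x
    have Xexp: "\<bar>X x - X y\<bar> \<le> 2 * \<bar>x - y\<bar>" for x y
      using perturbed_identity_inverse(2)[OF glip gbd dt(1) dtR(1), of "X x" "X y"] Xeq[of x] Xeq[of y] by (simp add: algebra_simps)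
    have "2-lipschitz_on UNIV X" using Xexp by (intro lipschitz_onI) (auto simp: dist_real_def)
    then have Xc: "continuous_on UNIV X" by (rule lipschitz_on_continuous_on)
    have bc: "continuous_on UNIV b" by (rule HsobD(2)[OF b(1)]) simp
    have wc: "continuous_on UNIV w" unfolding w_def[abs_def] by (rule continuous_on_compose2[OF bc Xc]) auto
    have weq: "w = b \<circ> X1 dt (f \<circ> w)"
      using Xeq by (auto simp: w_def X1_def g_def fun_eq_iff)
    define bn where "bn n = mollify n b" for n
    have bnC: "CP m (bn n)" for m n unfolding bn_def by (rule mollify_CP[OF b(1)]) simp
    have bnn: "cn (Suc (Suc k)) (bn n) \<le> R" for n unfolding bn_def using mollify_cn[OF b(1), of "Suc (Suc k)" n] b(2) by simp
    define gn where "gn n x = f (bn n x)" for n x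
    have gnC: "CP (Suc (Suc k)) (gn n)" for n unfolding gn_def[abs_def] by (rule CP_compose_left[OF Ck_SucD[OF F'] bnC])
    have gnn: "cn (Suc (Suc k)) (gn n) \<le> R2" for n unfolding gn_def[abs_def] by (rule R2(2)[OF bnC bnn])
    have gnd: "\<bar>deriv (gn n) x\<bar> \<le> R2" for n x using CP_sup_deriv[OF gnC, of n x] gnn[of n] by linarith
    have gna: "adm (Suc (Suc k)) R2 dt (gn n)" for n using gnC gnn gnd dt(1) dtR by (simp add: adm_def)
    have gnlip: "\<bar>gn n y - gn n z\<bar> \<le> R2 * \<bar>y - z\<bar>" for n y z by (rule CP_lip[OF admD(9)[OF gna] gnd])
    have "\<exists>X. \<forall>x y. y = x - gn n y * dt \<longleftrightarrow> y = X x" for n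
      by (rule perturbed_identity_inverse(1)[OF gnlip admD(8)[OF gna] dt(1) dtR(2)])
    then obtain Xn where Xn: "\<And>n x y. y = x - gn n y * dt \<longleftrightarrow> y = Xn n x" by metis
    have Xneq: "Xn n x = x - gn n (Xn n x) * dt" for n x using Xn by blast
    define an where "an n x = gn n (Xn n x)" for n x
    note I = inverse_flow[OF gna Xneq]
    have ann: "cn (Suc (Suc k)) (an n) \<le> C2" for n unfolding an_def[abs_def] by (rule C2(3)[OF gna Xneq dtR(5)])
    have ana: "adm (Suc (Suc k)) R3 dt (an n)" for n
      using I(1)[of n] I(3)[of n] ann[of n] R3 dt(1) dtR by (auto simp: adm_def an_def[abs_def] intro: order_trans[of _ "2 * R2"])
    have Xna: "Xn n x = X1 dt (an n) x" for n x using Xneq[of n x] by (simp add: X1_def an_def)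
    define wn where "wn n x = bn n (X1 dt (an n) x)" for n x
    have wnC: "CP (Suc (Suc k)) (wn n)" for n unfolding wn_def[abs_def] by (rule CP_X1[OF admD(1)[OF ana] bnC])
    have wnn: "cn (Suc (Suc k)) (wn n) \<le> C1 * \<bar>R\<bar>" for n
      using C1(2)[OF ana bnC, of n n] mult_left_mono[OF bnn[of n] C1(1)] mult_left_mono[OF abs_ge_self[of R] C1(1)]
      unfolding wn_def[abs_def] by linarith
    have fc: "continuous_on UNIV f" by (rule Ck_cont[OF F])
    have Xlim: "(\<lambda>n. Xn n x) \<longlonglongrightarrow> X x" for x
    proof -
      have "(\<lambda>n. gn n (X x)) \<longlonglongrightarrow> g (X x)" unfolding gn_def g_def bn_def
        by (rule continuous_on_tendsto_compose[OF fc mollify_lim[OF b(1)]]) auto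
      then have "(\<lambda>n. 2 * \<bar>(gn n (X x) - g (X x)) * dt\<bar>) \<longlonglongrightarrow> 2 * \<bar>(g (X x) - g (X x)) * dt\<bar>"
        by (intro tendsto_intros)
      then have z: "(\<lambda>n. 2 * \<bar>(gn n (X x) - g (X x)) * dt\<bar>) \<longlonglongrightarrow> 0" by simp
      have "norm (Xn n x - X x) \<le> 2 * \<bar>(gn n (X x) - g (X x)) * dt\<bar>" for n
      proof -
        have e: "(X x + gn n (X x) * dt) - (Xn n x + gn n (Xn n x) * dt) = (gn n (X x) - g (X x)) * dt"
          using Xneq[of n x] Xeq[of x] by (simp add: algebra_simps)
        show ?thesis using perturbed_identity_inverse(2)[OF gnlip admD(8)[OF gna] dt(1) dtR(2), of "X x" "Xn n x" n]
          unfolding e by (simp add: abs_minus_commute)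
      qed
      then have "\<forall>\<^sub>F n in sequentially. norm (Xn n x - X x) \<le> 2 * \<bar>(gn n (X x) - g (X x)) * dt\<bar>"
        by (intro always_eventually allI)
      then have "(\<lambda>n. Xn n x - X x) \<longlonglongrightarrow> 0" by (rule Lim_null_comparison[OF _ z])
      then show ?thesis by (rule LIM_zero_cancel)
    qed
    have wL: "(\<lambda>n. wn n x) \<longlonglongrightarrow> w x" for x
      unfolding wn_def w_def bn_def Xna[symmetric]
      by (rule mollify_diag_tendsto[OF HsobD(3)[OF b(1)] bc Xlim])
    note l = Hsob_lsc_cn[OF wnC wL wc wnn]
    have isw: "is_SA (Suc (Suc k)) f dt b w" unfolding is_SA_def using l(1) weq by blast
    have uniq: "w' = w" if "is_SA (Suc (Suc k)) f dt b w'" for w'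
    proof
      fix x
      have e: "w' x = b (X1 dt (f \<circ> w') x)" using that unfolding is_SA_def by (metis comp_apply)
      define y where "y = X1 dt (f \<circ> w') x"
      have "y = x - g y * dt" using e by (simp add: y_def X1_def g_def)
      then have "y = X x" using X by blast
      then show "w' x = w x" using e by (simp add: w_def y_def)
    qed
    have SAw: "SA (Suc (Suc k)) f dt b = w" unfolding SA_def by (rule the_equality[where P="is_SA (Suc (Suc k)) f dt b", OF isw]) (rule uniq)
    show ?thesis unfolding SAw using isw uniq l(2) by blast
  qed
  have "0 \<le> (real (Suc k) + 2) * (C1 * \<bar>R\<bar>)" using C1(1) by simp
  then show ?thesis using main D by blast
qed

section \<open>Regularity in time\<close>

abbreviation slab :: "real \<Rightarrow> real measure" where
  "slab T \<equiv> lebesgue_on {0<..<T}"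

lemma slab_finite: "finite_measure (slab T)"
  by (rule finite_measure_lebesgue_on) auto

lemma slab_indicator: "A \<in> sets lebesgue \<Longrightarrow> (indicator A :: real \<Rightarrow> real) \<in> borel_measurable (slab T)"
  by (intro measurable_restrict_space1 borel_measurable_indicator)

lemma slab_AE_dense:
  assumes "AE t in slab T. P t" "0 \<le> a" "a < b" "b \<le> T"
  shows "\<exists>t. a < t \<and> t < b \<and> P t"
proof (rule ccontr)
  assume no: "\<nexists>t. a < t \<and> t < b \<and> P t"
  obtain N where N: "{t \<in> space (slab T). \<not> P t} \<subseteq> N" "emeasure (slab T) N = 0" "N \<in> sets (slab T)"
    using AE_E[OF assms(1)] by blast
  have "{a<..<b} \<subseteq> N" using N(1) no assms by auto
  then have "emeasure (slab T) {a<..<b} \<le> 0" using N emeasure_mono[of "{a<..<b}" N "slab T"] by simp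
  moreover have "emeasure (slab T) {a<..<b} = emeasure lebesgue {a<..<b}"
    by (rule emeasure_restrict_space) (use assms in auto)
  ultimately show False using assms by simp
qed

lemma Hsemi_le_Hnorm: "j \<le> m \<Longrightarrow> Hsemi j v \<le> Hnorm m v"
  unfolding Hnorm_def by (rule real_le_rsqrt, rule member_le_sum[of j "{..m}" "\<lambda>j. (Hsemi j v)\<^sup>2"]) auto

lemma Hnorm_nonneg [simp]: "Hnorm m v \<ge> 0"
  by (simp add: Hnorm_def sum_nonneg)

lemma Linf_AE:
  assumes "u \<in> Linf T m" "T > 0"
  shows "AE t in slab T. u t \<in> Hsob m \<and> Hnorm m (u t) \<le> Linf_norm T m u" "0 \<le> Linf_norm T m u"
proof -
  have fin: "Linf_esssup T m u < \<infinity>" and H: "AE t in slab T. u t \<in> Hsob m" using assms(1) by (auto simp: Linf_def)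
  have le: "AE t in slab T. ereal (Hnorm m (u t)) \<le> Linf_esssup T m u" unfolding Linf_esssup_def by (rule esssup_AE)
  obtain t where "ereal (Hnorm m (u t)) \<le> Linf_esssup T m u" using slab_AE_dense[OF le, of 0 T] assms(2) by auto
  then have nn: "0 \<le> Linf_esssup T m u" by (rule order_trans[rotated]) simp
  then have E: "Linf_esssup T m u = ereal (Linf_norm T m u)"
    using fin unfolding Linf_norm_def by (cases "Linf_esssup T m u") auto
  show "0 \<le> Linf_norm T m u" using nn E by simp
  show "AE t in slab T. u t \<in> Hsob m \<and> Hnorm m (u t) \<le> Linf_norm T m u"
    using H le unfolding E by eventually_elim simp
qed

text \<open>Every time is a limit of times at which the essential bound holds.\<close>

lemma Linf_all_times:
  assumes u: "u \<in> Linf T (Suc m)" and T: "T > 0" and ct: "\<And>x. continuous_on {0..T} (\<lambda>t. u t x)"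
    and t: "t \<in> {0..T}" and cx: "continuous_on UNIV (u t)"
  shows "u t \<in> Hsob (Suc m)" "j \<le> Suc m \<Longrightarrow> Hsemi j (u t) \<le> Linf_norm T (Suc m) u"
proof -
  define L where "L = Linf_norm T (Suc m) u"
  have "\<exists>r. r \<in> {0..T} \<and> \<bar>r - t\<bar> < 1 / real (Suc n) \<and> u r \<in> Hsob (Suc m) \<and> Hnorm (Suc m) (u r) \<le> L" for n
  proof -
    define d where "d = 1 / real (Suc n)"
    have d: "d > 0" by (simp add: d_def)
    have "max 0 (t - d) < min T (t + d)" using t T d by auto
    then obtain r where "max 0 (t - d) < r" "r < min T (t + d)" "u r \<in> Hsob (Suc m) \<and> Hnorm (Suc m) (u r) \<le> L"
      using slab_AE_dense[OF Linf_AE(1)[OF u T], of "max 0 (t - d)" "min T (t + d)"] unfolding L_def by auto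
    then show ?thesis by (intro exI[of _ r]) (auto simp: d_def abs_less_iff)
  qed
  then obtain r where r: "\<And>n. r n \<in> {0..T}" "\<And>n. \<bar>r n - t\<bar> < 1 / real (Suc n)" "\<And>n. u (r n) \<in> Hsob (Suc m)" "\<And>n. Hnorm (Suc m) (u (r n)) \<le> L"
    by metis
  have "(\<lambda>n. r n - t) \<longlonglongrightarrow> 0"
  proof (rule Lim_null_comparison)
    show "\<forall>\<^sub>F n in sequentially. norm (r n - t) \<le> inverse (real (Suc n))"
      using r(2) by (intro always_eventually allI) (simp add: inverse_eq_divide less_imp_le)
  qed (rule LIMSEQ_inverse_real_of_nat)
  then have rt: "r \<longlonglongrightarrow> t" by (rule LIM_zero_cancel)
  have lim: "(\<lambda>n. u (r n) x) \<longlonglongrightarrow> u t x" for x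
    by (rule continuous_on_tendsto_compose[OF ct rt t]) (use r(1) in auto)
  have S: "Hsemi j (u (r n)) \<le> L" if "j \<le> Suc m" for j n
    using Hsemi_le_Hnorm[OF that, of "u (r n)"] r(4)[of n] by linarith
  have B: "\<bar>u (r n) x\<bar> \<le> 2 * L" for n x
    using Hsob_sup[OF r(3)[of n], of x] S[of 0 n] S[of 1 n] by (simp add: nr_def)
  note l = Hsob_lsc[OF r(3) lim cx B S]
  show "u t \<in> Hsob (Suc m)" by (rule l(1))
  show "j \<le> Suc m \<Longrightarrow> Hsemi j (u t) \<le> Linf_norm T (Suc m) u" using l(2) by (simp add: L_def)
qed

definition smooth_step :: "real \<Rightarrow> real" where
  "smooth_step x = bump x * inverse (bump x + bump (1 - x))"

lemma smooth_step_denominator: "bump x + bump (1 - x) > 0"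
  using bump_nonneg[of x] bump_nonneg[of "1 - x"] bump_pos_iff[of x] bump_pos_iff[of "1 - x"]
  by (cases "x > 0") (auto intro: add_pos_nonneg add_nonneg_pos)

lemma smooth_step_Ck: "Ck k smooth_step"
  unfolding smooth_step_def
proof (intro Ck_mult bump_Ck Ck_inverse Ck_add)
  show "Ck k (\<lambda>x. bump (1 - x))" by (rule Ck_compose[OF bump_Ck]) (intro Ck_diff Ck_const Ck_ident)
  show "bump x + bump (1 - x) \<noteq> 0" for x using smooth_step_denominator[of x] by linarith
qed

lemma smooth_step_0: "x \<le> 0 \<Longrightarrow> smooth_step x = 0"
  using bump_eq_0_iff[of x] by (simp add: smooth_step_def)

lemma smooth_step_1: "x \<ge> 1 \<Longrightarrow> smooth_step x = 1"
  using bump_eq_0_iff[of "1 - x"] bump_pos_iff[of x] by (simp add: smooth_step_def)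

lemma smooth_step_range: "0 \<le> smooth_step x" "smooth_step x \<le> 1"
proof -
  have eq: "smooth_step x = bump x / (bump x + bump (1 - x))" by (simp add: smooth_step_def divide_inverse)
  show "0 \<le> smooth_step x" unfolding eq
    using smooth_step_denominator[of x] bump_nonneg[of x] by simp
  show "smooth_step x \<le> 1" unfolding eq
    using smooth_step_denominator[of x] bump_nonneg[of "1 - x"] by simp
qed

lemma smooth_step_deriv_outside: "x < 0 \<or> x > 1 \<Longrightarrow> deriv smooth_step x = 0"
proof (rule DERIV_imp_deriv)
  assume x: "x < 0 \<or> x > 1"
  then show "(smooth_step has_real_derivative 0) (at x)"
  proof
    assume "x < 0"
    then have "\<forall>\<^sub>F y in nhds x. smooth_step y = 0"
      using eventually_nhds_in_open[of "{..<0}" x] by (auto elim!: eventually_mono intro: smooth_step_0)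
    then show ?thesis using DERIV_cong_ev[of x x smooth_step "\<lambda>_. 0" 0 0] by simp
  next
    assume "x > 1"
    then have "\<forall>\<^sub>F y in nhds x. smooth_step y = 1"
      using eventually_nhds_in_open[of "{1<..}" x] by (auto elim!: eventually_mono intro: smooth_step_1)
    then show ?thesis using DERIV_cong_ev[of x x smooth_step "\<lambda>_. 1" 0 0] by simp
  qed
qed

lemma smooth_step_deriv_bound: "\<exists>B>0. \<forall>x. \<bar>deriv smooth_step x\<bar> \<le> B"
proof -
  have "continuous_on UNIV (deriv smooth_step)" using Ck_deriv[OF smooth_step_Ck[of "Suc 0"]] by simp
  then have "compact (deriv smooth_step ` {0..1})"
    by (intro compact_continuous_image) (auto intro: continuous_on_subset)
  then obtain B where B: "\<forall>x\<in>{0..1}. norm (deriv smooth_step x) \<le> B"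
    by (metis bounded_iff compact_imp_bounded image_eqI)
  have "\<bar>deriv smooth_step x\<bar> \<le> max 1 B" for x
    using B smooth_step_deriv_outside[of x] by (cases "x \<in> {0..1}") (auto simp: le_max_iff_disj)
  then show ?thesis by (intro exI[of _ "max 1 B"]) auto
qed

lemma slab_integral_cont:
  assumes "continuous_on {0..T} (v::real\<Rightarrow>real)"
  shows "integrable (slab T) v" "(\<integral>x. v x \<partial>slab T) = integral {0..T} v"
proof -
  interpret finite_measure "slab T" by (rule slab_finite)
  have "compact (v ` {0..T})" by (rule compact_continuous_image[OF assms]) auto
  then obtain B where B: "\<forall>x\<in>{0..T}. norm (v x) \<le> B"
    by (metis bounded_iff compact_imp_bounded image_eqI)
  have m: "v \<in> borel_measurable (slab T)"
    by (rule continuous_imp_measurable_on_sets_lebesgue[OF continuous_on_subset[OF assms]]) auto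
  show i: "integrable (slab T) v" by (rule integrable_const_bound[of _ B]) (use B m in auto)
  show "(\<integral>x. v x \<partial>slab T) = integral {0..T} v"
    using lebesgue_integral_eq_integral[OF i] integral_open_interval_real[of 0 T v] by simp
qed

text \<open>The kernels are derivatives of functions rising from zero to one on \<open>[a, a + 1 / N n]\<close>: they
  have unit mass, but may change sign, so the bound on their absolute values enters.\<close>

lemma smooth_step_approx_identity:
  assumes U: "continuous_on {0..T} U" and a: "0 < a" "a < T"
    and N: "\<And>n. N n > 0" "filterlim N at_top sequentially" "\<And>n. 1 \<le> (T - a) * N n"
  shows "(\<lambda>n. \<integral>t. N n * deriv smooth_step ((t - a) * N n) * U t \<partial>slab T) \<longlonglongrightarrow> U a"
proof (rule LIMSEQ_I)
  fix e :: real assume e: "e > 0"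
  obtain B where B: "B > 0" "\<And>x. \<bar>deriv smooth_step x\<bar> \<le> B" using smooth_step_deriv_bound by blast
  define e' where "e' = e / (2 * B)"
  have e': "e' > 0" using e B by (simp add: e'_def)
  have "a \<in> {0..T}" using a by simp
  then obtain d where d: "d > 0" "\<And>t. t \<in> {0..T} \<Longrightarrow> dist t a < d \<Longrightarrow> dist (U t) (U a) < e'"
    using U e' unfolding continuous_on_iff by metis
  have "\<forall>\<^sub>F n in sequentially. N n > 1 / d" using N(2) by (simp add: filterlim_at_top_dense)
  then obtain n0 where n0: "\<And>n. n \<ge> n0 \<Longrightarrow> N n > 1 / d" unfolding eventually_sequentially by blast
  have dc: "continuous_on UNIV (deriv smooth_step)" using Ck_deriv[OF smooth_step_Ck[of "Suc 0"]] by simp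
  have sc: "continuous_on S (\<lambda>t. deriv smooth_step ((t - a) * c))" for S c
    by (rule continuous_on_compose2[OF dc]) (auto intro!: continuous_intros)
  have "norm ((\<integral>t. N n * deriv smooth_step ((t - a) * N n) * U t \<partial>slab T) - U a) < e" if n: "n \<ge> n0" for n
  proof -
    define c where "c = N n"
    have c: "c > 0" "1 / c < d" "1 \<le> (T - a) * c"
      using N(1,3)[of n] n0[OF n] d(1) by (auto simp: c_def field_simps)
    define k where "k t = c * deriv smooth_step ((t - a) * c)" for t
    have kc: "continuous_on S k" for S unfolding k_def by (intro continuous_intros sc)
    have "((\<lambda>t. k t) has_integral (smooth_step ((T - a) * c) - smooth_step ((0 - a) * c))) {0..T}"
    proof (rule fundamental_theorem_of_calculus)
      fix t
      have "((\<lambda>t. smooth_step ((t - a) * c)) has_real_derivative deriv smooth_step ((t - a) * c) * c) (at t)"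
        by (rule DERIV_chain2[OF Ck_DERIV[OF smooth_step_Ck]]) (auto intro!: derivative_eq_intros)
      then show "((\<lambda>t. smooth_step ((t - a) * c)) has_vector_derivative k t) (at t within {0..T})"
        by (simp add: k_def mult.commute has_real_derivative_iff_has_vector_derivative has_vector_derivative_at_within)
    qed (use a in auto)
    then have one: "(\<integral>t. k t \<partial>slab T) = 1"
      using slab_integral_cont(2)[OF kc] smooth_step_1[OF c(3)] smooth_step_0[of "- a * c"] a c(1) by (simp add: integral_unique)
    have i1: "integrable (slab T) k" by (rule slab_integral_cont(1)[OF kc])
    have i2: "integrable (slab T) (\<lambda>t. k t * U t)" by (rule slab_integral_cont(1)) (intro continuous_intros kc U)
    have "(\<integral>t. k t * U t \<partial>slab T) - U a = (\<integral>t. k t * U t \<partial>slab T) - (\<integral>t. k t \<partial>slab T) * U a" using one by simp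
    also have "\<dots> = (\<integral>t. k t * U t - k t * U a \<partial>slab T)" using i1 i2 by simp
    also have "\<bar>\<dots>\<bar> \<le> (\<integral>t. \<bar>k t * U t - k t * U a\<bar> \<partial>slab T)" by (rule integral_abs_bound)
    also have "\<dots> \<le> (\<integral>t. (c * B * e') * indicator {a..a + 1 / c} t \<partial>slab T)"
    proof (rule integral_mono)
      show "integrable (slab T) (\<lambda>t. \<bar>k t * U t - k t * U a\<bar>)" using i1 i2 by simp
      show "integrable (slab T) (\<lambda>t. (c * B * e') * indicator {a..a + 1 / c} t)"
      proof (intro integrable_mult_right finite_measure.integrable_const_bound[OF slab_finite, of _ 1])
        show "(indicator {a..a + 1 / c} :: real \<Rightarrow> real) \<in> borel_measurable (slab T)"
          by (rule slab_indicator) simp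
      qed (auto simp: indicator_def)
      fix t assume "t \<in> space (slab T)"
      then have t: "t \<in> {0..T}" by auto
      show "\<bar>k t * U t - k t * U a\<bar> \<le> (c * B * e') * indicator {a..a + 1 / c} t"
      proof (cases "t \<in> {a..a + 1 / c}")
        case True
        then have "dist (U t) (U a) < e'" using d(2)[OF t] c by (auto simp: dist_real_def)
        moreover have "\<bar>k t\<bar> \<le> c * B" using B(2) c(1) by (simp add: k_def abs_mult)
        ultimately have "\<bar>k t\<bar> * \<bar>U t - U a\<bar> \<le> (c * B) * e'"
          by (intro mult_mono) (use c(1) B(1) in \<open>auto simp: dist_real_def\<close>)
        then show ?thesis using True by (simp add: abs_mult right_diff_distrib[symmetric])
      next
        case False
        then have "(t - a) * c < 0 \<or> (t - a) * c > 1" using c(1) by (auto simp: field_simps mult_less_0_iff)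
        then show ?thesis using False by (simp add: k_def smooth_step_deriv_outside)
      qed
    qed
    also have "\<dots> = (c * B * e') * measure (slab T) ({a..a + 1 / c} \<inter> space (slab T))" by simp
    also have "\<dots> \<le> (c * B * e') * (1 / c)"
    proof (rule mult_left_mono)
      have "measure (slab T) ({a..a + 1 / c} \<inter> {0<..<T}) = measure lebesgue ({a..a + 1 / c} \<inter> {0<..<T})"
        by (rule measure_restrict_space) auto
      also have "\<dots> \<le> measure lebesgue {a..a + 1 / c}" by (rule measure_mono_fmeasurable) auto
      also have "\<dots> = 1 / c" using c(1) by simp
      finally show "measure (slab T) ({a..a + 1 / c} \<inter> space (slab T)) \<le> 1 / c" by simp
      show "0 \<le> c * B * e'" using c(1) B(1) e' by simp
    qed
    also have "\<dots> < e" using c(1) B(1) e by (simp add: e'_def)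
    finally show ?thesis by (simp add: k_def c_def)
  qed
  then show "\<exists>no. \<forall>n\<ge>no. norm ((\<integral>t. N n * deriv smooth_step ((t - a) * N n) * U t \<partial>slab T) - U a) < e" by blast
qed

text \<open>The test functions are differences of two smooth steps, at \<open>r\<close> and at \<open>t\<close>, that
  steepen to the indicator of \<open>(r, t]\<close>; their derivatives are approximations of two Dirac masses, which
  read off \<open>U r\<close> and \<open>U t\<close>.\<close>

lemma increment_of_weak_derivative:
  assumes rt: "0 < r" "r < t" "t < T" and U: "continuous_on {0..T} U"
    and Gm: "G \<in> borel_measurable (slab T)" and GB: "AE \<tau> in slab T. \<bar>G \<tau>\<bar> \<le> B"
    and weak: "\<And>\<phi>. smooth \<phi> \<Longrightarrow> closure {t. \<phi> t \<noteq> 0} \<subseteq> {0<..<T} \<Longrightarrow>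
      (\<integral>t. deriv \<phi> t * U t \<partial>slab T) = - (\<integral>t. \<phi> t * G t \<partial>slab T)"
  shows "U t - U r = (\<integral>\<tau>. indicator {r<..t} \<tau> * G \<tau> \<partial>slab T)"
proof -
  \<comment> \<open>The slopes are so large that the second step is completed before \<open>T\<close>.\<close>
  define N where "N n = 2 * real (Suc n) / (T - t)" for n
  have N0: "N n > 0" for n using rt by (simp add: N_def)
  have Nt: "filterlim N at_top sequentially"
  proof -
    have "filterlim (\<lambda>n. (2 / (T - t)) * real (Suc n)) at_top sequentially"
      using rt by (intro filterlim_tendsto_pos_mult_at_top[OF tendsto_const]
          filterlim_compose[OF filterlim_real_sequentially filterlim_Suc]) auto
    then show ?thesis unfolding N_def by (simp add: field_simps)
  qed
  have N1: "1 \<le> (T - t) * N n" "1 / N n < T - t" for n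
  proof -
    have eq: "(T - t) * N n = 2 * real (Suc n)" using rt by (simp add: N_def)
    then show "1 \<le> (T - t) * N n" by simp
    have "1 < (T - t) * N n" unfolding eq by simp
    then show "1 / N n < T - t" using N0[of n] by (simp add: divide_less_eq)
  qed
  have "(T - t) * N n \<le> (T - r) * N n" for n using rt N0[of n] by (intro mult_right_mono) auto
  then have N2: "1 \<le> (T - r) * N n" for n using N1(1)[of n] by (rule order_trans[rotated])
  define \<phi> where "\<phi> n \<tau> = smooth_step ((\<tau> - r) * N n) - smooth_step ((\<tau> - t) * N n)" for n \<tau>
  have stC: "Ck k (\<lambda>\<tau>. smooth_step ((\<tau> - a) * c))" for k a c
    by (rule Ck_compose[OF smooth_step_Ck]) (intro Ck_mult Ck_diff Ck_ident Ck_const)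
  have \<phi>s: "smooth (\<phi> n)" for n unfolding smooth_def \<phi>_def[abs_def] by (intro allI Ck_diff stC)
  have supp: "closure {\<tau>. \<phi> n \<tau> \<noteq> 0} \<subseteq> {0<..<T}" for n
  proof -
    have "{\<tau>. \<phi> n \<tau> \<noteq> 0} \<subseteq> {r..t + 1 / N n}"
    proof
      fix \<tau> assume "\<tau> \<in> {\<tau>. \<phi> n \<tau> \<noteq> 0}"
      then have nz: "\<phi> n \<tau> \<noteq> 0" by simp
      have "\<not> \<tau> < r"
      proof
        assume "\<tau> < r"
        then have "(\<tau> - r) * N n \<le> 0" "(\<tau> - t) * N n \<le> 0" using N0[of n] rt by (auto simp: mult_le_0_iff)
        then show False using nz by (simp add: \<phi>_def smooth_step_0)
      qed
      moreover have "\<not> \<tau> > t + 1 / N n"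
      proof
        assume "\<tau> > t + 1 / N n"
        then have "(\<tau> - t) * N n \<ge> 1" using N0[of n] by (simp add: field_simps)
        moreover have "(\<tau> - t) * N n \<le> (\<tau> - r) * N n" using N0[of n] rt by (intro mult_right_mono) auto
        ultimately show False using nz by (simp add: \<phi>_def smooth_step_1)
      qed
      ultimately show "\<tau> \<in> {r..t + 1 / N n}" by auto
    qed
    then have "closure {\<tau>. \<phi> n \<tau> \<noteq> 0} \<subseteq> {r..t + 1 / N n}" by (rule closure_minimal) simp
    also have "\<dots> \<subseteq> {0<..<T}" using rt N1(2)[of n] by auto
    finally show ?thesis .
  qed
  have D: "deriv (\<phi> n) \<tau> = N n * deriv smooth_step ((\<tau> - r) * N n) - N n * deriv smooth_step ((\<tau> - t) * N n)" for n \<tau>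
  proof (rule DERIV_imp_deriv)
    have "((\<lambda>\<tau>. smooth_step ((\<tau> - a) * c)) has_real_derivative deriv smooth_step ((\<tau> - a) * c) * c) (at \<tau>)" for a c
      by (rule DERIV_chain2[OF Ck_DERIV[OF smooth_step_Ck]]) (auto intro!: derivative_eq_intros)
    from DERIV_diff[OF this this]
    show "(\<phi> n has_real_derivative N n * deriv smooth_step ((\<tau> - r) * N n) - N n * deriv smooth_step ((\<tau> - t) * N n)) (at \<tau>)"
      unfolding \<phi>_def[abs_def] by (simp add: mult.commute)
  qed
  have dc: "continuous_on UNIV (deriv smooth_step)" using Ck_deriv[OF smooth_step_Ck[of "Suc 0"]] by simp
  have ii: "integrable (slab T) (\<lambda>\<tau>. N n * deriv smooth_step ((\<tau> - a) * N n) * U \<tau>)" for n a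
    by (rule slab_integral_cont(1)) (intro continuous_intros U continuous_on_compose2[OF dc], auto)
  have "(\<lambda>n. (\<integral>\<tau>. N n * deriv smooth_step ((\<tau> - r) * N n) * U \<tau> \<partial>slab T) - (\<integral>\<tau>. N n * deriv smooth_step ((\<tau> - t) * N n) * U \<tau> \<partial>slab T)) \<longlonglongrightarrow> U r - U t"
    by (intro tendsto_diff smooth_step_approx_identity U N0 Nt N1(1) N2) (use rt in auto)
  moreover have "(\<integral>\<tau>. N n * deriv smooth_step ((\<tau> - r) * N n) * U \<tau> \<partial>slab T) - (\<integral>\<tau>. N n * deriv smooth_step ((\<tau> - t) * N n) * U \<tau> \<partial>slab T)
     = (\<integral>\<tau>. deriv (\<phi> n) \<tau> * U \<tau> \<partial>slab T)" for n
    unfolding D by (subst Bochner_Integration.integral_diff[OF ii ii, symmetric]) (simp add: left_diff_distrib)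
  ultimately have 1: "(\<lambda>n. - (\<integral>\<tau>. \<phi> n \<tau> * G \<tau> \<partial>slab T)) \<longlonglongrightarrow> U r - U t"
    using weak[OF \<phi>s supp] by simp
  have "(\<lambda>n. \<integral>\<tau>. \<phi> n \<tau> * G \<tau> \<partial>slab T) \<longlonglongrightarrow> (\<integral>\<tau>. indicator {r<..t} \<tau> * G \<tau> \<partial>slab T)"
  proof (rule integral_dominated_convergence)
    show "integrable (slab T) (\<lambda>\<tau>. \<bar>B\<bar>)" using finite_measure.emeasure_finite[OF slab_finite[of T]] by (simp add: finite_measure.integrable_const[OF slab_finite])
    have \<phi>1: "\<bar>\<phi> n \<tau>\<bar> \<le> 1" for n \<tau>
      using smooth_step_range[of "(\<tau> - r) * N n"] smooth_step_range[of "(\<tau> - t) * N n"] by (simp add: \<phi>_def abs_le_iff)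
    show "AE \<tau> in slab T. norm (\<phi> n \<tau> * G \<tau>) \<le> \<bar>B\<bar>" for n
      using GB
    proof eventually_elim
      case (elim \<tau>)
      have "\<bar>\<phi> n \<tau>\<bar> * \<bar>G \<tau>\<bar> \<le> 1 * \<bar>B\<bar>" using elim \<phi>1 by (intro mult_mono) auto
      then show ?case by (simp add: abs_mult)
    qed
    show "AE \<tau> in slab T. (\<lambda>n. \<phi> n \<tau> * G \<tau>) \<longlonglongrightarrow> indicator {r<..t} \<tau> * G \<tau>"
    proof (rule AE_I2, rule tendsto_mult[OF _ tendsto_const])
      fix \<tau>
      have st: "(\<lambda>n. smooth_step ((\<tau> - a) * N n)) \<longlonglongrightarrow> (if \<tau> > a then 1 else 0)" for a
      proof (cases "\<tau> > a")
        case True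
        have "\<forall>\<^sub>F n in sequentially. N n > 1 / (\<tau> - a)" using Nt by (simp add: filterlim_at_top_dense)
        then have "\<forall>\<^sub>F n in sequentially. smooth_step ((\<tau> - a) * N n) = 1"
          by eventually_elim (use True in \<open>auto intro!: smooth_step_1 simp: field_simps\<close>)
        then show ?thesis using True by (simp add: tendsto_eventually)
      next
        case False
        then have "(\<tau> - a) * N n \<le> 0" for n using N0[of n] by (simp add: mult_le_0_iff)
        then show ?thesis using False by (simp add: smooth_step_0)
      qed
      have "indicat_real {r<..t} \<tau> = (if \<tau> > r then 1 else 0) - (if \<tau> > t then 1 else 0)" using rt by (auto simp: indicator_def)
      then show "(\<lambda>n. \<phi> n \<tau>) \<longlonglongrightarrow> indicator {r<..t} \<tau>" unfolding \<phi>_def using tendsto_diff[OF st[of r] st[of t]] by simp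
    qed
    show "(\<lambda>\<tau>. indicator {r<..t} \<tau> * G \<tau>) \<in> borel_measurable (slab T)"
      by (rule borel_measurable_times[OF slab_indicator Gm]) simp
    show "(\<lambda>\<tau>. \<phi> n \<tau> * G \<tau>) \<in> borel_measurable (slab T)" for n
      by (intro borel_measurable_times Gm continuous_imp_measurable_on_sets_lebesgue continuous_on_subset[OF Ck_cont[OF smooth_Ck[OF \<phi>s]]]) auto
  qed
  from tendsto_minus[OF this] 1 have "U r - U t = - (\<integral>\<tau>. indicator {r<..t} \<tau> * G \<tau> \<partial>slab T)"
    by (rule LIMSEQ_unique[rotated])
  then show ?thesis by simp
qed

lemma Hsob_weighted_sum:
  "finite Y \<Longrightarrow> (\<And>y. y \<in> Y \<Longrightarrow> g y \<in> Hsob m) \<Longrightarrow>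
    (\<lambda>x. \<Sum>y\<in>Y. c y * g y x) \<in> Hsob m \<and> (\<forall>j\<le>m. Hsemi j (\<lambda>x. \<Sum>y\<in>Y. c y * g y x) \<le> (\<Sum>y\<in>Y. \<bar>c y\<bar> * Hsemi j (g y)))"
proof (induction Y rule: finite_induct)
  case empty
  have z: "(\<lambda>x. 0) \<in> Hsob m" by (rule CP_Hsob) simp
  then show ?case using Hsemi_cmult_le[OF z, of _ 0] by simp
next
  case (insert z Y)
  have IH: "(\<lambda>x. \<Sum>y\<in>Y. c y * g y x) \<in> Hsob m" "\<And>j. j \<le> m \<Longrightarrow> Hsemi j (\<lambda>x. \<Sum>y\<in>Y. c y * g y x) \<le> (\<Sum>y\<in>Y. \<bar>c y\<bar> * Hsemi j (g y))"
    using insert by auto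
  have z: "g z \<in> Hsob m" using insert by simp
  have "Hsemi j (\<lambda>x. c z * g z x + 1 * (\<Sum>y\<in>Y. c y * g y x)) \<le> \<bar>c z\<bar> * Hsemi j (g z) + \<bar>1\<bar> * Hsemi j (\<lambda>x. \<Sum>y\<in>Y. c y * g y x)" if "j \<le> m" for j
    by (rule Hsob_lincomb(2)[OF z IH(1) that])
  then show ?case using Hsob_lincomb(1)[OF z IH(1), of "c z" 1] IH(2) insert(1,2) by fastforce
qed

lemma slab_measurable_AE:
  assumes "f \<in> borel_measurable (slab T)" "AE t in slab T. f t = (g t :: real)"
  shows "g \<in> borel_measurable (slab T)"
proof -
  have "(\<lambda>x. if x \<in> {0<..<T} then f x else 0) \<in> borel_measurable lebesgue"
    using assms(1) by (intro borel_measurable_if_I) auto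
  moreover have "AE x in lebesgue. (if x \<in> {0<..<T} then f x else 0) = (if x \<in> {0<..<T} then g x else 0)"
    using assms(2) by (subst (asm) AE_restrict_space_iff) (auto elim!: eventually_mono)
  ultimately have "(\<lambda>x. if x \<in> {0<..<T} then g x else 0) \<in> borel_measurable lebesgue"
    by (rule borel_measurable_AE)
  then show ?thesis by (rule borel_measurable_if_D)
qed

lemma Hsob_sup_Hnorm: "v \<in> Hsob (Suc m) \<Longrightarrow> \<bar>v x\<bar> \<le> 2 * Hnorm (Suc m) v"
  using Hsob_sup[of v m x] Hsemi_le_Hnorm[of 0 "Suc m" v] Hsemi_le_Hnorm[of 1 "Suc m" v] by (simp add: nr_def)

lemma Linf_simple:
  assumes "g \<in> Linf T m"
  obtains S where "\<And>n. simple_function (slab T) (S n)" "\<And>n t. t \<in> {0<..<T} \<Longrightarrow> S n t \<in> Hsob m"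
    "AE t in slab T. (\<lambda>n. Hnorm m (\<lambda>x. S n t x - g t x)) \<longlonglongrightarrow> 0"
proof -
  have "\<exists>S::nat \<Rightarrow> real \<Rightarrow> real \<Rightarrow> real. (\<forall>n. simple_function (slab T) (S n) \<and> (\<forall>t\<in>{0<..<T}. S n t \<in> Hsob m)) \<and>
        (AE t in slab T. (\<lambda>n. Hnorm m (\<lambda>x. S n t x - g t x)) \<longlonglongrightarrow> 0)"
    using assms by (simp add: Linf_def strongly_measurable_def)
  then show ?thesis using that by blast
qed

text \<open>Point evaluation is bounded on \<open>H\<^sup>m\<close> for positive \<open>m\<close>, so approximation
  by simple functions in \<open>H\<^sup>m\<close> is also pointwise approximation.\<close>

lemma Linf_pointwise:
  assumes g: "g \<in> Linf T (Suc m)" and T: "T > 0"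
  shows "(\<lambda>t. g t x) \<in> borel_measurable (slab T)" "AE t in slab T. \<bar>g t x\<bar> \<le> 2 * Linf_norm T (Suc m) g"
proof -
  note A = Linf_AE[OF g T]
  show "AE t in slab T. \<bar>g t x\<bar> \<le> 2 * Linf_norm T (Suc m) g"
    using A(1)
  proof eventually_elim
    case (elim t)
    then have "g t \<in> Hsob (Suc m)" "Hnorm (Suc m) (g t) \<le> Linf_norm T (Suc m) g" by auto
    then show ?case using Hsob_sup_Hnorm[of "g t" m x] by linarith
  qed
  obtain S where S: "\<And>n. simple_function (slab T) (S n)" "\<And>n t. t \<in> {0<..<T} \<Longrightarrow> S n t \<in> Hsob (Suc m)"
    "AE t in slab T. (\<lambda>n. Hnorm (Suc m) (\<lambda>x. S n t x - g t x)) \<longlonglongrightarrow> 0"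
    by (rule Linf_simple[OF g]) blast
  have sp: "AE t in slab T. t \<in> space (slab T)" by (rule AE_space)
  have lim: "AE t in slab T. (\<lambda>n. S n t x) \<longlonglongrightarrow> g t x"
    using A(1) S(3) sp
  proof eventually_elim
    case (elim t)
    have z: "(\<lambda>n. 2 * Hnorm (Suc m) (\<lambda>x. S n t x - g t x)) \<longlonglongrightarrow> 0"
      using tendsto_mult_right_zero[OF elim(2)] .
    have "(\<lambda>n. S n t x - g t x) \<longlonglongrightarrow> 0"
    proof (rule Lim_null_comparison[OF always_eventually z], rule allI)
      fix n
      have "(\<lambda>x. S n t x - g t x) \<in> Hsob (Suc m)" by (intro Hsob_diff S) (use elim in auto)
      from Hsob_sup_Hnorm[OF this, of x] show "norm (S n t x - g t x) \<le> 2 * Hnorm (Suc m) (\<lambda>x. S n t x - g t x)" by simp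
    qed
    then show ?case by (rule LIM_zero_cancel)
  qed
  have m: "(\<lambda>t. S n t x) \<in> borel_measurable (slab T)" for n
    by (rule borel_measurable_simple_function[OF simple_function_compose1[OF S(1)]])
  have "(\<lambda>t. lim (\<lambda>n. S n t x)) \<in> borel_measurable (slab T)" by (rule borel_measurable_lim_metric[OF m])
  moreover have "AE t in slab T. lim (\<lambda>n. S n t x) = g t x" using lim by eventually_elim (rule limI)
  ultimately show "(\<lambda>t. g t x) \<in> borel_measurable (slab T)" by (rule slab_measurable_AE)
qed

lemma simple_function_slab_integral:
  assumes S: "simple_function (slab T) S" and rt: "0 < r" "r < t" "t < T"
  shows "(\<integral>\<tau>. indicator {r<..t} \<tau> * h (S \<tau>) \<partial>slab T) =
    (\<Sum>y\<in>S ` space (slab T). measure (slab T) ({r<..t} \<inter> (S -` {y} \<inter> space (slab T))) * (h y :: real))"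
proof -
  interpret finite_measure "slab T" by (rule slab_finite)
  define Y where "Y = S ` space (slab T)"
  define A where "A y = {r<..t} \<inter> (S -` {y} \<inter> space (slab T))" for y
  have fin: "finite Y" using S unfolding Y_def by (rule simple_functionD)
  have rts: "{r<..t} \<in> sets (slab T)" using rt by (auto simp: sets_restrict_space_iff)
  have A: "A y \<in> sets (slab T)" for y unfolding A_def by (intro sets.Int rts simple_functionD(2)[OF S])
  have "(\<integral>\<tau>. indicator {r<..t} \<tau> * h (S \<tau>) \<partial>slab T) = (\<integral>\<tau>. (\<Sum>y\<in>Y. indicator (A y) \<tau> * h y) \<partial>slab T)"
  proof (rule Bochner_Integration.integral_cong[OF refl])
    fix \<tau> assume \<tau>: "\<tau> \<in> space (slab T)"
    have "(\<Sum>y\<in>Y. indicator (A y) \<tau> * h y) = (\<Sum>y\<in>Y. if y = S \<tau> then indicator {r<..t} \<tau> * h y else 0)"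
      by (rule sum.cong) (use \<tau> in \<open>auto simp: A_def indicator_def\<close>)
    also have "\<dots> = indicator {r<..t} \<tau> * h (S \<tau>)" using fin \<tau> by (simp add: Y_def)
    finally show "indicator {r<..t} \<tau> * h (S \<tau>) = (\<Sum>y\<in>Y. indicator (A y) \<tau> * h y)" ..
  qed
  also have "\<dots> = (\<Sum>y\<in>Y. \<integral>\<tau>. indicator (A y) \<tau> * h y \<partial>slab T)"
    by (rule Bochner_Integration.integral_sum) (use A in \<open>auto intro!: integrable_real_indicator simp: emeasure_finite less_top[symmetric]\<close>)
  also have "\<dots> = (\<Sum>y\<in>Y. measure (slab T) (A y) * h y)"
  proof (intro sum.cong refl)
    fix y
    have "A y \<inter> {0<..<T} = A y" by (auto simp: A_def)
    then show "(\<integral>\<tau>. indicator (A y) \<tau> * h y \<partial>slab T) = measure (slab T) (A y) * h y"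
      using Bochner_Integration.integral_indicator[of "slab T" "A y"] by simp
  qed
  finally show ?thesis unfolding Y_def A_def .
qed

text \<open>Integrals of simple functions are finite combinations whose weights add up to \<open>t - r\<close>.
  Replacing the values that exceed the essential bound by more than \<open>e\<close> by zero keeps the approximating
  simple functions bounded without changing their limit.\<close>

lemma time_integral_Hsob:
  assumes g: "g \<in> Linf T (Suc m)" and T: "T > 0" and rt: "0 < r" "r < t" "t < T"
    and w: "\<And>x. w x = (\<integral>\<tau>. indicator {r<..t} \<tau> * g \<tau> x \<partial>slab T)" and wc: "continuous_on UNIV w"
  shows "w \<in> Hsob (Suc m)" "j \<le> Suc m \<Longrightarrow> Hsemi j w \<le> (t - r) * Linf_norm T (Suc m) g"
proof -
  interpret finite_measure "slab T" by (rule slab_finite)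
  define L where "L = Linf_norm T (Suc m) g"
  note A = Linf_AE[OF g T]
  obtain S where S: "\<And>n. simple_function (slab T) (S n)" "\<And>n t. t \<in> {0<..<T} \<Longrightarrow> S n t \<in> Hsob (Suc m)"
    "AE t in slab T. (\<lambda>n. Hnorm (Suc m) (\<lambda>x. S n t x - g t x)) \<longlonglongrightarrow> 0"
    by (rule Linf_simple[OF g]) blast
  have rts: "{r<..t} \<in> sets (slab T)" using rt by (auto simp: sets_restrict_space_iff)
  have key: "w \<in> Hsob (Suc m) \<and> (\<forall>j\<le>Suc m. Hsemi j w \<le> (t - r) * (L + e))" if e: "e > 0" for e
  proof -
    define good where "good v \<longleftrightarrow> v \<in> Hsob (Suc m) \<and> (\<forall>j\<le>Suc m. Hsemi j v \<le> L + e)" for v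
    have L0: "L \<ge> 0" using A(2) by (simp add: L_def)
    have good0: "good (\<lambda>x. 0)"
    proof -
      have z: "(\<lambda>x. 0) \<in> Hsob (Suc m)" by (rule CP_Hsob) simp
      show ?thesis unfolding good_def using z Hsemi_cmult_le[OF z, of _ 0] L0 e by (auto intro: order_trans[of _ 0])
    qed
    have good_sup: "\<bar>v x\<bar> \<le> 2 * (L + e)" if "good v" for v x
    proof -
      have "\<bar>v x\<bar> \<le> nr 1 v" using that Hsob_sup unfolding good_def by blast
      also have "\<dots> = Hsemi 0 v + Hsemi 1 v" by (simp add: nr_def)
      also have "\<dots> \<le> 2 * (L + e)" using that unfolding good_def by (smt (verit) One_nat_def Suc_le_mono le0)
      finally show ?thesis .
    qed
    \<comment> \<open>Truncation at the essential bound; almost everywhere it is inactive for large \<open>n\<close>.\<close>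
    define P where "P n \<tau> = (if good (S n \<tau>) then S n \<tau> else (\<lambda>x. 0))" for n \<tau>
    have Ps: "simple_function (slab T) (P n)" for n
      unfolding P_def using simple_function_compose1[OF S(1), of "\<lambda>v. if good v then v else (\<lambda>x. 0)"] .
    have Pg: "good (P n \<tau>)" for n \<tau> using good0 by (simp add: P_def)
    define v where "v n x = (\<integral>\<tau>. indicator {r<..t} \<tau> * P n \<tau> x \<partial>slab T)" for n x
    define Y where "Y n = P n ` space (slab T)" for n
    define c where "c n y = measure (slab T) ({r<..t} \<inter> (P n -` {y} \<inter> space (slab T)))" for n y
    have Yfin: "finite (Y n)" for n unfolding Y_def by (rule simple_functionD(1)[OF Ps])
    have vs: "v n = (\<lambda>x. \<Sum>y\<in>Y n. c n y * y x)" for n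
      unfolding v_def Y_def c_def using simple_function_slab_integral[OF Ps rt, of "\<lambda>y. y _"] by (intro ext) simp
    have csum: "(\<Sum>y\<in>Y n. c n y) = t - r" for n
    proof -
      have "(\<Sum>y\<in>Y n. c n y) = (\<integral>\<tau>. indicator {r<..t} \<tau> \<partial>slab T)"
        using simple_function_slab_integral[OF Ps rt, of "\<lambda>y. 1"] by (simp add: Y_def c_def)
      also have "\<dots> = measure (slab T) ({r<..t} \<inter> space (slab T))" by (rule Bochner_Integration.integral_indicator)
      also have "\<dots> = measure (slab T) {r<..t}" by (rule arg_cong[where f="measure (slab T)"]) (use rt in auto)
      also have "\<dots> = measure lebesgue {r<..t}" by (rule measure_restrict_space) (use rt in auto)
      also have "\<dots> = t - r" using rt by simp
      finally show ?thesis .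
    qed
    have Yg: "good y" if "y \<in> Y n" for y n using that Pg by (auto simp: Y_def)
    have ws: "v n \<in> Hsob (Suc m) \<and> (\<forall>j\<le>Suc m. Hsemi j (v n) \<le> (\<Sum>y\<in>Y n. \<bar>c n y\<bar> * Hsemi j y))" for n
      unfolding vs by (rule Hsob_weighted_sum[OF Yfin, where g = "\<lambda>y. y"]) (use Yg good_def in auto)
    have vH: "v n \<in> Hsob (Suc m)" for n using ws by blast
    have vS: "Hsemi j (v n) \<le> (t - r) * (L + e)" if "j \<le> Suc m" for j n
    proof -
      have "Hsemi j (v n) \<le> (\<Sum>y\<in>Y n. \<bar>c n y\<bar> * Hsemi j y)" using ws that by blast
      also have "\<dots> \<le> (\<Sum>y\<in>Y n. c n y * (L + e))"
        by (rule sum_mono) (use Yg that good_def in \<open>auto simp: c_def intro!: mult_left_mono\<close>)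
      also have "\<dots> = (t - r) * (L + e)" by (simp add: sum_distrib_right[symmetric] csum)
      finally show ?thesis .
    qed
    have vB: "\<bar>v n x\<bar> \<le> 2 * ((t - r) * (L + e))" for n x
      using Hsob_sup[OF vH[of n], of x] vS[of 0 n] vS[of 1 n] by (simp add: nr_def)
    have sp: "AE \<tau> in slab T. \<tau> \<in> space (slab T)" by (rule AE_space)
    have lim: "(\<lambda>n. v n x) \<longlonglongrightarrow> w x" for x
      unfolding v_def w
    proof (rule integral_dominated_convergence)
      show "integrable (slab T) (\<lambda>\<tau>. 2 * (L + e))" by simp
      show "AE \<tau> in slab T. norm (indicator {r<..t} \<tau> * P n \<tau> x) \<le> 2 * (L + e)" for n
        using good_sup[OF Pg, of n] L0 e by (intro AE_I2) (auto simp: indicator_def)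
      show "(\<lambda>\<tau>. indicator {r<..t} \<tau> * g \<tau> x) \<in> borel_measurable (slab T)"
        by (rule borel_measurable_times[OF slab_indicator Linf_pointwise(1)[OF g T]]) simp
      show "(\<lambda>\<tau>. indicator {r<..t} \<tau> * P n \<tau> x) \<in> borel_measurable (slab T)" for n
        by (rule borel_measurable_times[OF slab_indicator borel_measurable_simple_function[OF simple_function_compose1[OF Ps]]]) simp
      show "AE \<tau> in slab T. (\<lambda>n. indicator {r<..t} \<tau> * P n \<tau> x) \<longlonglongrightarrow> indicator {r<..t} \<tau> * g \<tau> x"
        using A(1) S(3) sp
      proof eventually_elim
        case (elim \<tau>)
        have \<tau>: "\<tau> \<in> {0<..<T}" using elim(3) by simp
        have gH: "g \<tau> \<in> Hsob (Suc m)" using elim(1) by simp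
        have dH: "(\<lambda>x. S n \<tau> x - g \<tau> x) \<in> Hsob (Suc m)" for n by (intro Hsob_diff S \<tau> gH)
        have ev: "\<forall>\<^sub>F n in sequentially. Hnorm (Suc m) (\<lambda>x. S n \<tau> x - g \<tau> x) < e"
          using elim(2) e by (rule order_tendstoD)
        have eq: "\<forall>\<^sub>F n in sequentially. S n \<tau> x = P n \<tau> x"
          using ev
        proof eventually_elim
          case (elim n)
          have "Hsemi j (S n \<tau>) \<le> L + e" if "j \<le> Suc m" for j
          proof -
            have "Hsemi j (\<lambda>x. (S n \<tau> x - g \<tau> x) + g \<tau> x) \<le> Hsemi j (\<lambda>x. S n \<tau> x - g \<tau> x) + Hsemi j (g \<tau>)"
              by (rule Hsemi_add[OF dH gH that])
            moreover have "Hsemi j (\<lambda>x. S n \<tau> x - g \<tau> x) \<le> e"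
              using Hsemi_le_Hnorm[OF that, of "\<lambda>x. S n \<tau> x - g \<tau> x"] elim by linarith
            moreover have "Hsemi j (g \<tau>) \<le> L"
              using Hsemi_le_Hnorm[OF that, of "g \<tau>"] \<open>g \<tau> \<in> Hsob (Suc m) \<and> Hnorm (Suc m) (g \<tau>) \<le> Linf_norm T (Suc m) g\<close> unfolding L_def by linarith
            ultimately show ?thesis by simp
          qed
          then have "good (S n \<tau>)" unfolding good_def using S(2)[OF \<tau>] by blast
          then show ?case by (simp add: P_def)
        qed
        have z: "(\<lambda>n. 2 * Hnorm (Suc m) (\<lambda>x. S n \<tau> x - g \<tau> x)) \<longlonglongrightarrow> 0"
          using tendsto_mult_right_zero[OF elim(2)] .
        have "(\<lambda>n. S n \<tau> x - g \<tau> x) \<longlonglongrightarrow> 0"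
          by (rule Lim_null_comparison[OF always_eventually z], rule allI) (use Hsob_sup_Hnorm[OF dH, of _ x] in simp)
        then have "(\<lambda>n. S n \<tau> x) \<longlonglongrightarrow> g \<tau> x" by (rule LIM_zero_cancel)
        then have "(\<lambda>n. P n \<tau> x) \<longlonglongrightarrow> g \<tau> x" using eq by (rule Lim_transform_eventually)
        then show ?case by (rule tendsto_mult_left)
      qed
    qed
    note l = Hsob_lsc[OF vH lim wc vB vS]
    show ?thesis using l by blast
  qed
  show "w \<in> Hsob (Suc m)" using key[of 1] by simp
  assume j: "j \<le> Suc m"
  show "Hsemi j w \<le> (t - r) * Linf_norm T (Suc m) g"
  proof (rule field_le_epsilon)
    fix e :: real assume e: "e > 0"
    have "Hsemi j w \<le> (t - r) * (L + e / (t - r))" using key[of "e / (t - r)"] e rt j by simp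
    also have "\<dots> = (t - r) * Linf_norm T (Suc m) g + e" using rt by (simp add: L_def distrib_left)
    finally show "Hsemi j w \<le> (t - r) * Linf_norm T (Suc m) g + e" .
  qed
qed

text \<open>Weak time derivatives are tested in the open interval only, so the increments are first treated inside
  and the end points are reached by continuity.\<close>

lemma Winf_Lipschitz:
  assumes u: "u \<in> Winf 1 T (Suc m)" and T: "T > 0" and ct: "\<And>x. continuous_on {0..T} (\<lambda>t. u t x)"
    and cx: "\<And>t. t \<in> {0..T} \<Longrightarrow> continuous_on UNIV (u t)"
    and rt: "r \<in> {0..T}" "t \<in> {0..T}" "r < t"
  shows "(\<lambda>x. u t x - u r x) \<in> Hsob (Suc m)" "j \<le> Suc m \<Longrightarrow> Hsemi j (\<lambda>x. u t x - u r x) \<le> (t - r) * Winf_norm 1 T (Suc m) u"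
proof -
  define g where "g = weak_time_deriv T (Suc m) 1 u"
  define W where "W = Winf_norm 1 T (Suc m) u"
  have "\<exists>g. has_weak_time_deriv T (Suc m) 1 u g" using u unfolding Winf_def by auto
  then have g: "has_weak_time_deriv T (Suc m) 1 u g" unfolding g_def weak_time_deriv_def by (rule someI_ex)
  have gL: "g \<in> Linf T (Suc m)" using g by (simp add: has_weak_time_deriv_def)
  have gW: "Linf_norm T (Suc m) g \<le> W" unfolding W_def Winf_norm_def g_def by (rule Max_ge) auto
  have W0: "W \<ge> 0" using gW Linf_AE(2)[OF gL T] by linarith
  have inner: "(\<lambda>x. u b x - u a x) \<in> Hsob (Suc m) \<and> (\<forall>j\<le>Suc m. Hsemi j (\<lambda>x. u b x - u a x) \<le> (b - a) * W)"
    if ab: "0 < a" "a < b" "b < T" for a b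
  proof -
    have w: "u b x - u a x = (\<integral>\<tau>. indicator {a<..b} \<tau> * g \<tau> x \<partial>slab T)" for x
    proof (rule increment_of_weak_derivative[OF ab ct Linf_pointwise[OF gL T]])
      fix \<phi> assume "smooth \<phi>" "closure {t. \<phi> t \<noteq> 0} \<subseteq> {0<..<T}"
      then show "(\<integral>t. deriv \<phi> t * u t x \<partial>slab T) = - (\<integral>t. \<phi> t * g t x \<partial>slab T)"
        using g unfolding has_weak_time_deriv_def by simp
    qed
    have c: "continuous_on UNIV (\<lambda>x. u b x - u a x)" using ab by (intro continuous_on_diff cx) auto
    note ti = time_integral_Hsob[OF gL T ab w c]
    have "(b - a) * Linf_norm T (Suc m) g \<le> (b - a) * W" using gW ab by (intro mult_left_mono) auto
    then show ?thesis using ti order_trans by blast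
  qed
  \<comment> \<open>The shift by three makes the inner intervals nonempty for every \<open>n\<close>.\<close>
  define p where "p n = r + (t - r) / real (n + 3)" for n
  define q where "q n = t - (t - r) / real (n + 3)" for n
  have pq: "0 < p n" "p n < q n" "q n < T" "p n \<in> {0..T}" "q n \<in> {0..T}" "q n - p n \<le> t - r" for n
  proof -
    define h where "h = (t - r) / real (n + 3)"
    have h: "h > 0" using rt by (simp add: h_def)
    have h3: "h \<le> (t - r) / 3" unfolding h_def using rt by (intro divide_left_mono) auto
    show "0 < p n" "p n < q n" "q n < T" "p n \<in> {0..T}" "q n \<in> {0..T}" "q n - p n \<le> t - r"
      unfolding p_def q_def h_def[symmetric] using rt h h3 by auto
  qed
  have z: "(\<lambda>n. (t - r) / real (n + 3)) \<longlonglongrightarrow> 0"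
  proof -
    have "(\<lambda>n. (t - r) / real n) \<longlonglongrightarrow> 0" by (rule lim_const_over_n)
    then show ?thesis by (rule LIMSEQ_ignore_initial_segment)
  qed
  have pl: "p \<longlonglongrightarrow> r" unfolding p_def using tendsto_add[OF tendsto_const z, of r] by simp
  have ql: "q \<longlonglongrightarrow> t" unfolding q_def using tendsto_diff[OF tendsto_const z, of t] by simp
  have lim: "(\<lambda>n. u (q n) x - u (p n) x) \<longlonglongrightarrow> u t x - u r x" for x
    by (intro tendsto_diff continuous_on_tendsto_compose[OF ct ql rt(2)] continuous_on_tendsto_compose[OF ct pl rt(1)]) (use pq in auto)
  have S: "Hsemi j (\<lambda>x. u (q n) x - u (p n) x) \<le> (t - r) * W" if "j \<le> Suc m" for j n
    using inner[OF pq(1-3), of n] that mult_right_mono[OF pq(6)[of n] W0] by fastforce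
  have H: "(\<lambda>x. u (q n) x - u (p n) x) \<in> Hsob (Suc m)" for n using inner[OF pq(1-3), of n] by blast
  have B: "\<bar>u (q n) x - u (p n) x\<bar> \<le> 2 * ((t - r) * W)" for n x
    using Hsob_sup[OF H[of n], of x] S[of 0 n] S[of 1 n] by (simp add: nr_def)
  have c: "continuous_on UNIV (\<lambda>x. u t x - u r x)" using rt by (intro continuous_on_diff cx) auto
  note l = Hsob_lsc[OF H lim c B S]
  show "(\<lambda>x. u t x - u r x) \<in> Hsob (Suc m)" by (rule l(1))
  show "j \<le> Suc m \<Longrightarrow> Hsemi j (\<lambda>x. u t x - u r x) \<le> (t - r) * Winf_norm 1 T (Suc m) u" using l(2) by (simp add: W_def)
qed

text \<open>What the error analysis retains of the exact solution, with \<open>s = k + 2\<close>: bounds of order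
  \<open>s + 4\<close>, Lipschitz continuity in time of order \<open>s + 2\<close>, and the equation. The latter
  turns the Lipschitz bound into one for the time derivative in order \<open>s\<close>, which replaces second time
  derivatives.\<close>

definition reg_sol :: "nat \<Rightarrow> (real \<Rightarrow> real) \<Rightarrow> real \<Rightarrow> real \<Rightarrow> real \<Rightarrow> real \<Rightarrow> (real \<Rightarrow> real \<Rightarrow> real) \<Rightarrow> bool" where
  "reg_sol k f \<nu> T Ra Rb u \<longleftrightarrow>
     (\<forall>t\<in>{0..T}. u t \<in> Hsob (k + 6) \<and> nr (k + 6) (u t) \<le> Rb) \<and>
     (\<forall>t\<in>{0..T}. \<forall>r\<in>{0..T}. nr (k + 4) (\<lambda>x. u t x - u r x) \<le> Ra * \<bar>t - r\<bar>) \<and>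
     (\<forall>t\<in>{0..T}. \<forall>x. ((\<lambda>r. u r x) has_real_derivative (\<nu> * deriv (deriv (u t)) x - f (u t x) * deriv (u t) x)) (at t within {0..T}))"

lemma smooth_solution_regular:
  assumes sol: "smooth_solution (Suc (Suc k)) q f \<nu> T u0 u" and T: "T > 0" and q: "q > 0"
  shows "reg_sol k f \<nu> T (real (k + 5) * Winf_norm 1 T (k + 4) u) (real (k + 7) * Linf_norm T (k + 6) u) u"
    "t \<in> {0..T} \<Longrightarrow> u t \<in> Hsob q \<and> Hsemi q (u t) \<le> Linf_norm T q u"
    "0 \<le> Winf_norm 1 T (k + 4) u" "0 \<le> Linf_norm T (k + 6) u" "0 \<le> Linf_norm T q u"
proof -
  have pr: "solves_problem f \<nu> T u0 u" and W1: "u \<in> Winf 1 T (Suc (k + 3))" and L4: "u \<in> Linf T (Suc (k + 5))" and Lq: "u \<in> Linf T q"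
    using sol unfolding smooth_solution_def by (auto simp: numeral_eq_Suc)
  have D: "((\<lambda>r. u r x) has_real_derivative (\<nu> * deriv (deriv (u t)) x - f (u t x) * deriv (u t) x)) (at t within {0..T})"
    if "t \<in> {0..T}" for t x
  proof -
    have "\<exists>ut. ((\<lambda>r. u r x) has_real_derivative ut) (at t within {0..T}) \<and> ut + f (u t x) * deriv (u t) x - \<nu> * deriv (deriv (u t)) x = 0"
      using pr that unfolding solves_problem_def by blast
    then obtain ut where "((\<lambda>r. u r x) has_real_derivative ut) (at t within {0..T})" "ut + f (u t x) * deriv (u t) x - \<nu> * deriv (deriv (u t)) x = 0"
      by blast
    moreover from this(2) have "ut = \<nu> * deriv (deriv (u t)) x - f (u t x) * deriv (u t) x" by simp
    ultimately show ?thesis by simp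
  qed
  have ct: "continuous_on {0..T} (\<lambda>t. u t x)" for x
    unfolding continuous_on_eq_continuous_within using D DERIV_continuous by blast
  have cx: "continuous_on UNIV (u t)" if "t \<in> {0..T}" for t
  proof -
    have "u t differentiable (at x)" for x using pr that unfolding solves_problem_def by blast
    then show ?thesis by (simp add: continuous_at_imp_continuous_on differentiable_imp_continuous_within)
  qed
  obtain q' where q': "q = Suc q'" using q by (cases q) auto
  show "t \<in> {0..T} \<Longrightarrow> u t \<in> Hsob q \<and> Hsemi q (u t) \<le> Linf_norm T q u"
    using Linf_all_times[of u T q', OF _ T ct _ cx] Lq unfolding q' by blast
  show "0 \<le> Linf_norm T (k + 6) u" "0 \<le> Linf_norm T q u" using Linf_AE(2)[OF L4 T] Linf_AE(2)[OF Lq T] by (auto simp: numeral_eq_Suc)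
  have "\<exists>g. has_weak_time_deriv T (Suc (k + 3)) 1 u g" using W1 unfolding Winf_def by auto
  then have "has_weak_time_deriv T (Suc (k + 3)) 1 u (weak_time_deriv T (Suc (k + 3)) 1 u)" unfolding weak_time_deriv_def by (rule someI_ex)
  then have "weak_time_deriv T (Suc (k + 3)) 1 u \<in> Linf T (Suc (k + 3))" by (simp add: has_weak_time_deriv_def)
  then have "0 \<le> Linf_norm T (Suc (k + 3)) (weak_time_deriv T (Suc (k + 3)) 1 u)" by (rule Linf_AE(2)[OF _ T])
  also have "\<dots> \<le> Winf_norm 1 T (Suc (k + 3)) u" unfolding Winf_norm_def by (rule Max_ge) auto
  finally have W0: "0 \<le> Winf_norm 1 T (Suc (k + 3)) u" .
  then show "0 \<le> Winf_norm 1 T (k + 4) u" by (simp add: numeral_eq_Suc)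
  define Wn where "Wn = Winf_norm 1 T (k + 4) u"
  have lip1: "nr (k + 4) (\<lambda>x. u t x - u r x) \<le> real (k + 5) * Wn * \<bar>t - r\<bar>" if "r \<in> {0..T}" "t \<in> {0..T}" "r < t" for r t
  proof -
    have "nr (k + 4) (\<lambda>x. u t x - u r x) \<le> (\<Sum>j\<le>k + 4. (t - r) * Wn)"
      unfolding nr_def Wn_def using Winf_Lipschitz(2)[OF W1 T ct cx that] by (intro sum_mono) (simp add: numeral_eq_Suc)
    then show ?thesis using that by (simp add: algebra_simps)
  qed
  have lip: "nr (k + 4) (\<lambda>x. u t x - u r x) \<le> real (k + 5) * Wn * \<bar>t - r\<bar>" if "r \<in> {0..T}" "t \<in> {0..T}" for r t
  proof -
    consider "r < t" | "t < r" | "r = t" by linarith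
    then show ?thesis
    proof cases
      case 1 then show ?thesis using lip1 that by blast
    next
      case 2
      have "(\<lambda>x. u r x - u t x) \<in> Hsob (k + 4)" using Winf_Lipschitz(1)[OF W1 T ct cx that(2,1) 2] by (simp add: numeral_eq_Suc)
      from nr_cmult[OF this, of "-1"] lip1[OF that(2,1) 2] show ?thesis by (simp add: abs_minus_commute)
    next
      case 3
      have "nr (k + 4) (\<lambda>x. 0) = 0" by (subst nr_classical) (simp_all add: cn_const)
      then show ?thesis using 3 by simp
    qed
  qed
  have reg: "u t \<in> Hsob (k + 6) \<and> nr (k + 6) (u t) \<le> real (k + 7) * Linf_norm T (k + 6) u" if "t \<in> {0..T}" for t
  proof -
    note A = Linf_all_times[OF L4 T ct that cx[OF that]]
    have "nr (k + 6) (u t) \<le> (\<Sum>j\<le>k + 6. Linf_norm T (k + 6) u)"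
      unfolding nr_def using A(2) by (intro sum_mono) (simp add: numeral_eq_Suc)
    then show ?thesis using A(1) by (simp add: numeral_eq_Suc algebra_simps)
  qed
  show "reg_sol k f \<nu> T (real (k + 5) * Winf_norm 1 T (k + 4) u) (real (k + 7) * Linf_norm T (k + 6) u) u"
    unfolding reg_sol_def using reg lip D by (simp add: Wn_def)
qed

section \<open>Truncation error\<close>

text \<open>As for \<open>L2_mean_value\<close>, by Riemann sums; the factor \<open>k + 2\<close> is the number of
  seminorms in \<open>nr\<close>.\<close>

lemma Hsob_mean_value:
  assumes d: "0 \<le> d" and G: "\<And>r x. r \<in> {0..d} \<Longrightarrow> ((\<lambda>r. G r x) has_real_derivative G' r x) (at r within {0..d})"
    and c: "\<And>x. continuous_on {0..d} (\<lambda>r. G' r x)"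
    and L: "\<And>r. r \<in> {0..d} \<Longrightarrow> G' r \<in> Hsob (Suc k)" "\<And>r. r \<in> {0..d} \<Longrightarrow> nr (Suc k) (G' r) \<le> B"
    and w: "continuous_on UNIV (\<lambda>x. G d x - G 0 x)"
  shows "(\<lambda>x. G d x - G 0 x) \<in> Hsob (Suc k)" "nr (Suc k) (\<lambda>x. G d x - G 0 x) \<le> (real k + 2) * (d * B)"
proof -
  define v where "v n x = (\<Sum>i<Suc n. d / real (Suc n) * G' (real i * (d / real (Suc n))) x)" for n x
  have ir: "real i * (d / real (Suc n)) \<in> {0..d}" if "i < Suc n" for i n
  proof -
    have "real i * (d / real (Suc n)) \<le> real (Suc n) * (d / real (Suc n))" using that d by (intro mult_right_mono) auto
    then show ?thesis using d by simp
  qed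
  have ws: "v n \<in> Hsob (Suc k) \<and> (\<forall>j\<le>Suc k. Hsemi j (v n) \<le> (\<Sum>i<Suc n. \<bar>d / real (Suc n)\<bar> * Hsemi j (G' (real i * (d / real (Suc n))))))" for n
    unfolding v_def[abs_def] by (rule Hsob_weighted_sum) (use L(1) ir in \<open>auto simp del: of_nat_Suc\<close>)
  then have vH: "v n \<in> Hsob (Suc k)" for n by blast
  have vS: "Hsemi j (v n) \<le> d * B" if j: "j \<le> Suc k" for j n
  proof -
    have "Hsemi j (G' (real i * (d / real (Suc n)))) \<le> B" if "i < Suc n" for i
      using order_trans[OF Hsemi_le_nr[OF j] L(2)[OF ir[OF that]]] .
    then have "(\<Sum>i<Suc n. \<bar>d / real (Suc n)\<bar> * Hsemi j (G' (real i * (d / real (Suc n))))) \<le> (\<Sum>i<Suc n. \<bar>d / real (Suc n)\<bar> * B)"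
      by (intro sum_mono mult_left_mono) auto
    also have "\<dots> = d * B" using d by simp
    finally show ?thesis using ws[of n] j order_trans by blast
  qed
  have vB: "\<bar>v n x\<bar> \<le> 2 * (d * B)" for n x using Hsob_sup[OF vH[of n], of x] vS[of 0 n] vS[of 1 n] by (simp add: nr_def)
  have lim: "(\<lambda>n. v n x) \<longlonglongrightarrow> G d x - G 0 x" for x
    unfolding v_def by (rule Riemann_sum_tendsto[OF d G c])
  note l = Hsob_lsc[OF vH lim w vB vS]
  show "(\<lambda>x. G d x - G 0 x) \<in> Hsob (Suc k)" by (rule l(1))
  have "nr (Suc k) (\<lambda>x. G d x - G 0 x) \<le> (\<Sum>j\<le>Suc k. d * B)" unfolding nr_def using l(2) by (intro sum_mono) auto
  then show "nr (Suc k) (\<lambda>x. G d x - G 0 x) \<le> (real k + 2) * (d * B)" by (simp add: algebra_simps)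
qed

lemma deriv_SV: "CP (Suc 0) v \<Longrightarrow> deriv (SV \<nu> dt v) = SV \<nu> dt (deriv v)"
  using funpow_SV[of 1 v \<nu> dt] CPD(1)[of "Suc 0" v] by simp

lemma reg_solD:
  assumes "reg_sol k f \<nu> T Ra Rb u" "t \<in> {0..T}"
  shows "u t \<in> Hsob (k + 6)" "nr (k + 6) (u t) \<le> Rb" "deriv (u t) \<in> Hsob (k + 5)" "nr (k + 5) (deriv (u t)) \<le> Rb"
    "deriv (deriv (u t)) \<in> Hsob (k + 4)" "r \<in> {0..T} \<Longrightarrow> nr (k + 4) (\<lambda>x. u t x - u r x) \<le> Ra * \<bar>t - r\<bar>"
    "((\<lambda>r. u r x) has_real_derivative (\<nu> * deriv (deriv (u t)) x - f (u t x) * deriv (u t) x)) (at t within {0..T})"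
proof -
  show u: "u t \<in> Hsob (k + 6)" "nr (k + 6) (u t) \<le> Rb" using assms by (auto simp: reg_sol_def)
  have u': "u t \<in> Hsob (Suc (k + 5))" using u(1) by (simp add: numeral_eq_Suc)
  show d: "deriv (u t) \<in> Hsob (k + 5)" by (rule Hsob_deriv(2)[OF u']) simp
  show "nr (k + 5) (deriv (u t)) \<le> Rb" using nr_deriv[OF u'] u(2) by (simp add: numeral_eq_Suc)
  have "deriv (u t) \<in> Hsob (Suc (k + 4))" using d by (simp add: numeral_eq_Suc)
  then show "deriv (deriv (u t)) \<in> Hsob (k + 4)" by (rule Hsob_deriv(2)) simp
  show "r \<in> {0..T} \<Longrightarrow> nr (k + 4) (\<lambda>x. u t x - u r x) \<le> Ra * \<bar>t - r\<bar>"
    "((\<lambda>r. u r x) has_real_derivative (\<nu> * deriv (deriv (u t)) x - f (u t x) * deriv (u t) x)) (at t within {0..T})"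
    using assms by (auto simp: reg_sol_def)
qed

text \<open>Each space derivative costs one of the two orders to spare.\<close>

lemma reg_sol_derivs_Lipschitz:
  assumes S: "reg_sol k f \<nu> T Ra Rb u" and t: "t \<in> {0..T}" and r: "r \<in> {0..T}"
  shows "nr (Suc (Suc k)) (\<lambda>x. u t x - u r x) \<le> Ra * \<bar>t - r\<bar>"
    "nr (Suc (Suc k)) (\<lambda>x. deriv (u t) x - deriv (u r) x) \<le> Ra * \<bar>t - r\<bar>"
    "nr (Suc (Suc k)) (\<lambda>x. deriv (deriv (u t)) x - deriv (deriv (u r)) x) \<le> Ra * \<bar>t - r\<bar>"
proof -
  define z where "z x = u t x - u r x" for x
  have ut: "u t \<in> Hsob (Suc (k + 5))" "u r \<in> Hsob (Suc (k + 5))"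
    using reg_solD(1)[OF S t] reg_solD(1)[OF S r] by (simp_all add: numeral_eq_Suc)
  have du: "deriv (u t) \<in> Hsob (Suc (k + 4))" "deriv (u r) \<in> Hsob (Suc (k + 4))"
    using reg_solD(3)[OF S t] reg_solD(3)[OF S r] by (simp_all add: numeral_eq_Suc)
  have z: "z \<in> Hsob (Suc (k + 5))" unfolding z_def[abs_def] by (rule Hsob_diff[OF ut])
  have z4: "z \<in> Hsob (Suc (k + 3))" by (rule Hsob_mono[OF z]) simp
  have zn: "nr (k + 4) z \<le> Ra * \<bar>t - r\<bar>" unfolding z_def[abs_def] by (rule reg_solD(6)[OF S t r])
  have dz: "deriv z = (\<lambda>x. deriv (u t) x - deriv (u r) x)"
    unfolding z_def[abs_def] by (rule CP_deriv_diff) (auto intro: CP_of_Hsob ut)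
  have ddz: "deriv (deriv z) = (\<lambda>x. deriv (deriv (u t)) x - deriv (deriv (u r)) x)"
    unfolding dz by (rule CP_deriv_diff) (auto intro: CP_of_Hsob du)
  have d1: "nr (k + 3) (deriv z) \<le> nr (k + 4) z" using nr_deriv[OF z4] by (simp add: numeral_eq_Suc)
  have dz3: "deriv z \<in> Hsob (Suc (k + 2))" using Hsob_deriv(2)[OF z4] by (simp add: numeral_eq_Suc)
  have d2: "nr (k + 2) (deriv (deriv z)) \<le> nr (k + 3) (deriv z)" using nr_deriv[OF dz3] by (simp add: numeral_eq_Suc)
  show "nr (Suc (Suc k)) (\<lambda>x. u t x - u r x) \<le> Ra * \<bar>t - r\<bar>"
    using nr_mono[of "Suc (Suc k)" "k + 4" z] zn by (simp add: z_def[abs_def])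
  show "nr (Suc (Suc k)) (\<lambda>x. deriv (u t) x - deriv (u r) x) \<le> Ra * \<bar>t - r\<bar>"
    using nr_mono[of "Suc (Suc k)" "k + 3" "deriv z"] zn d1 by (simp add: dz)
  show "nr (Suc (Suc k)) (\<lambda>x. deriv (deriv (u t)) x - deriv (deriv (u r)) x) \<le> Ra * \<bar>t - r\<bar>"
    using zn d1 d2 by (simp add: ddz)
qed

lemma Lipschitz_in_time_continuous:
  assumes L: "\<And>t r. t \<in> {0..T} \<Longrightarrow> r \<in> {0..T} \<Longrightarrow> nr (Suc (Suc k)) (\<lambda>x. v t x - v r x) \<le> Ra * \<bar>t - r\<bar>"
    and H: "\<And>t. t \<in> {0..T} \<Longrightarrow> v t \<in> Hsob (Suc (Suc k))" and t: "0 \<le> t" "t + d \<le> T"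
  shows "continuous_on {0..d} (\<lambda>r. v (t + r) x)"
proof (rule lipschitz_on_continuous_on[of "\<bar>Ra\<bar>"], rule lipschitz_onI)
  fix a b assume ab: "a \<in> {0..d}" "b \<in> {0..d}"
  then have T: "t + a \<in> {0..T}" "t + b \<in> {0..T}" using t by auto
  have "\<bar>v (t + a) x - v (t + b) x\<bar> \<le> nr (Suc (Suc k)) (\<lambda>x. v (t + a) x - v (t + b) x)"
    by (rule Hsob_sup'[OF Hsob_diff[OF H[OF T(1)] H[OF T(2)]]])
  also have "\<dots> \<le> Ra * \<bar>(t + a) - (t + b)\<bar>" by (rule L[OF T])
  also have "\<dots> \<le> \<bar>Ra\<bar> * \<bar>a - b\<bar>" by (simp add: mult_right_mono)
  finally show "dist (v (t + a) x) (v (t + b) x) \<le> \<bar>Ra\<bar> * dist a b" by (simp add: dist_real_def)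
qed simp

text \<open>Four errors of size \<open>dt\<^sup>2\<close> add up: replacing the increment of \<open>u\<close> by
  \<open>dt\<close> times the equation with the velocity frozen at the new time, replacing the average by the
  diffusion term, linearising the transport of the averaged function \<open>V\<close>, and exchanging
  \<open>V'\<close> for \<open>u'\<close> in the linear transport term.\<close>

lemma truncation_error:
  assumes F: "Ck (k + 3) f" and \<nu>: "0 \<le> \<nu>"
  shows "\<exists>C\<ge>0. \<exists>d>0. \<forall>T u t dt. reg_sol k f \<nu> T Ra Rb u \<longrightarrow> 0 \<le> t \<longrightarrow> t + dt \<le> T \<longrightarrow> 0 < dt \<longrightarrow> dt \<le> d \<longrightarrow>
    (\<lambda>x. u (t + dt) x - SV \<nu> dt (u t) (X1 dt (\<lambda>x. f (u (t + dt) x)) x)) \<in> Hsob (Suc (Suc k)) \<and>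
    nr (Suc (Suc k)) (\<lambda>x. u (t + dt) x - SV \<nu> dt (u t) (X1 dt (\<lambda>x. f (u (t + dt) x)) x)) \<le> C * dt\<^sup>2"
proof -
  define s where "s = Suc (Suc k)"
  have F': "Ck (Suc (Suc (Suc k))) f" using F by (simp add: numeral_eq_Suc)
  obtain C0 where C00: "C0 \<ge> 0"
    and C01: "\<forall>v\<in>Hsob s. nr s v \<le> Rb \<longrightarrow> (\<lambda>x. f (v x)) \<in> Hsob s \<and> nr s (\<lambda>x. f (v x)) \<le> C0"
    and C02: "\<forall>v\<in>Hsob s. \<forall>w\<in>Hsob s. nr s v \<le> Rb \<longrightarrow> nr s w \<le> Rb \<longrightarrow> nr s (\<lambda>x. f (v x) - f (w x)) \<le> C0 * nr s (\<lambda>x. v x - w x)"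
    using Hsob_compose[OF F', of Rb, folded s_def] by (elim exE conjE) (rule that)
  note C0 = C00 C01[rule_format] C02[rule_format]
  have CX: "(\<lambda>x. e (X1 dt a x)) \<in> Hsob s" if "admS k C0 dt a" "e \<in> Hsob s" for a dt e
    using Hsob_X1[of k C0, folded s_def] that by (elim exE conjE allE impE) assumption+
  obtain CT where CT: "CT \<ge> 0" "\<And>a dt e. admS k C0 dt a \<Longrightarrow> e \<in> Hsob (k + 5) \<Longrightarrow>
     nr s (\<lambda>x. e (X1 dt a x) - e x + dt * (a x * deriv e x)) \<le> CT * dt\<^sup>2 * nr (k + 5) e"
    using Hsob_X1_Taylor[of k C0] unfolding s_def by blast
  define A where "A = (real (Suc k) + 2) * alg (Suc k)"
  have A: "A \<ge> 0" using alg_pos[of "Suc k"] by (simp add: A_def)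
  have prod: "(\<lambda>x. v x * w x) \<in> Hsob s" "nr s (\<lambda>x. v x * w x) \<le> A * nr s v * nr s w" if "v \<in> Hsob s" "w \<in> Hsob s" for v w
    using Hsob_mult[of v "Suc k" w] that unfolding A_def s_def by auto
  define R where "R = \<bar>Rb\<bar>"
  define L where "L = \<bar>Ra\<bar>"
  define n3 where "n3 = real (Suc k) + 2"
  have pos: "0 \<le> R" "0 \<le> L" "0 \<le> n3" by (auto simp: R_def L_def n3_def)
  define K1 where "K1 = \<nu> * L + (A * (C0 * L) * R + A * C0 * L)"
  have K1: "K1 \<ge> 0" using \<nu> A C0(1) pos by (simp add: K1_def)
  define C where "C = n3 * K1 + n3 * (4 * \<nu>\<^sup>2 * R) + CT * R + A * C0 * (n3 * (2 * \<nu> * R))"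
  have C: "C \<ge> 0" using K1 \<nu> A C0(1) CT(1) pos by (simp add: C_def)
  define d where "d = min 1 (1 / (2 * (C0 + 1)))"
  have d: "d > 0" using C0(1) by (simp add: d_def)
  have main: "(\<lambda>x. u (t + dt) x - SV \<nu> dt (u t) (X1 dt (\<lambda>x. f (u (t + dt) x)) x)) \<in> Hsob s \<and>
    nr s (\<lambda>x. u (t + dt) x - SV \<nu> dt (u t) (X1 dt (\<lambda>x. f (u (t + dt) x)) x)) \<le> C * dt\<^sup>2"
    if S: "reg_sol k f \<nu> T Ra Rb u" and t: "0 \<le> t" "t + dt \<le> T" and dt: "0 < dt" "dt \<le> d" for T u t dt
  proof -
    have dt0: "0 \<le> dt" using dt by simp
    have t0: "t \<in> {0..T}" and t1: "t + dt \<in> {0..T}" and tr: "\<And>r. r \<in> {0..dt} \<Longrightarrow> t + r \<in> {0..T}" using t dt by auto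
    have uH: "u r \<in> Hsob s" "nr s (u r) \<le> Rb" "nr s (u r) \<le> R" if "r \<in> {0..T}" for r
      using Hsob_mono[OF reg_solD(1)[OF S that], of s] nr_mono[of s "k + 6" "u r"] reg_solD(2)[OF S that] by (auto simp: s_def R_def)
    have DH: "deriv (u r) \<in> Hsob s" "nr s (deriv (u r)) \<le> R" if "r \<in> {0..T}" for r
      using Hsob_mono[OF reg_solD(3)[OF S that], of s] nr_mono[of s "k + 5" "deriv (u r)"] reg_solD(4)[OF S that] by (auto simp: s_def R_def)
    have DDH: "deriv (deriv (u r)) \<in> Hsob s" if "r \<in> {0..T}" for r
      using Hsob_mono[OF reg_solD(5)[OF S that], of s] by (simp add: s_def)
    note lip = reg_sol_derivs_Lipschitz[OF S, folded s_def]
    define al where "al x = f (u (t + dt) x)" for x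
    have al: "al \<in> Hsob s" "nr s al \<le> C0" using C0(2)[OF uH(1,2)[OF t1]] by (auto simp: al_def[abs_def])
    have adm: "admS k C0 dt al"
      using small_product[OF C0(1), of dt] al dt by (auto simp: admS_def s_def d_def)
    define V where "V = SV \<nu> dt (u t)"
    have u6: "u t \<in> Hsob (Suc (k + 5))" using reg_solD(1)[OF S t0] by (simp add: numeral_eq_Suc)
    have VH: "V \<in> Hsob (Suc (k + 5))" unfolding V_def by (rule Hsob_SV(1)[OF u6])
    have V5: "V \<in> Hsob (k + 5)" "V \<in> Hsob s" using Hsob_mono[OF VH] by (auto simp: s_def)
    have Vn: "nr (k + 5) V \<le> R"
      using nr_mono[of "k + 5" "Suc (k + 5)" V] nr_SV[OF u6, of \<nu> dt] reg_solD(2)[OF S t0] by (simp add: V_def R_def numeral_eq_Suc)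
    have dV: "deriv V = SV \<nu> dt (deriv (u t))" unfolding V_def by (rule deriv_SV[OF CP_of_Hsob[OF u6]]) simp
    define \<tau> where "\<tau> x = u (t + dt) x - V (X1 dt al x)" for x
    \<comment> \<open>The right-hand side of the equation at time \<open>t\<close>, except that the velocity is taken at \<open>t + dt\<close>, as in the implicit scheme.\<close>
    define Q where "Q x = \<nu> * deriv (deriv (u t)) x - al x * deriv (u t) x" for x
    have QH: "Q \<in> Hsob s" unfolding Q_def[abs_def] by (intro Hsob_diff Hsob_cmult prod al DH DDH t0)
    define G where "G r x = u (t + r) x - r * Q x" for r x
    define G' where "G' r x = (\<nu> * deriv (deriv (u (t + r))) x - f (u (t + r) x) * deriv (u (t + r)) x) - Q x" for r x
    have fH: "(\<lambda>x. f (u (t + r) x)) \<in> Hsob s" if "r \<in> {0..dt}" for r using C0(2)[OF uH(1,2)[OF tr[OF that]]] by simp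
    have GD: "((\<lambda>r. G r x) has_real_derivative G' r x) (at r within {0..dt})" if r: "r \<in> {0..dt}" for r x
    proof -
      define D where "D = \<nu> * deriv (deriv (u (t + r))) x - f (u (t + r) x) * deriv (u (t + r)) x"
      have "((\<lambda>r. u r x) has_real_derivative D) (at (t + r) within {0..T})" unfolding D_def by (rule reg_solD(7)[OF S tr[OF r]])
      then have "((\<lambda>r. u r x) has_real_derivative D) (at (t + r) within (+) t ` {0..dt})"
        by (rule has_field_derivative_subset) (rule image_subsetI, rule tr)
      then have "((\<lambda>r. u r x) \<circ> (+) t has_real_derivative D * 1) (at r within {0..dt})"
        by (rule DERIV_image_chain) (auto intro!: derivative_eq_intros)
      then have "((\<lambda>r. u (t + r) x) has_real_derivative D) (at r within {0..dt})" by (simp add: o_def)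
      then show ?thesis unfolding G_def G'_def D_def by (auto intro!: derivative_eq_intros)
    qed
    have fc: "continuous_on UNIV f" by (rule Ck_cont[OF F])
    have Gc: "continuous_on {0..dt} (\<lambda>r. G' r x)" for x
    proof -
      have 1: "continuous_on {0..dt} (\<lambda>r. u (t + r) x)"
        by (rule Lipschitz_in_time_continuous[of T k u Ra]) (use lip(1) uH(1) t in \<open>auto simp: s_def\<close>)
      have 2: "continuous_on {0..dt} (\<lambda>r. deriv (u (t + r)) x)"
        by (rule Lipschitz_in_time_continuous[of T k "\<lambda>r. deriv (u r)" Ra]) (use lip(2) DH(1) t in \<open>auto simp: s_def\<close>)
      have 3: "continuous_on {0..dt} (\<lambda>r. deriv (deriv (u (t + r))) x)"
        by (rule Lipschitz_in_time_continuous[of T k "\<lambda>r. deriv (deriv (u r))" Ra]) (use lip(3) DDH t in \<open>auto simp: s_def\<close>)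
      have 4: "continuous_on {0..dt} (\<lambda>r. f (u (t + r) x))" by (rule continuous_on_compose2[OF fc 1]) simp
      show ?thesis unfolding G'_def by (intro continuous_intros 2 3 4)
    qed
    have GH: "G' r \<in> Hsob s" if "r \<in> {0..dt}" for r
      unfolding G'_def[abs_def] by (intro Hsob_diff Hsob_cmult prod fH DH DDH QH tr that)
    have Gn: "nr s (G' r) \<le> K1 * dt" if r: "r \<in> {0..dt}" for r
    proof -
      define p where "p x = deriv (deriv (u (t + r))) x - deriv (deriv (u t)) x" for x
      define p1 where "p1 x = f (u (t + r) x) - al x" for x
      define p2 where "p2 x = deriv (u (t + r)) x - deriv (u t) x" for x
      have pH: "p \<in> Hsob s" "p1 \<in> Hsob s" "p2 \<in> Hsob s"
        unfolding p_def[abs_def] p1_def[abs_def] p2_def[abs_def] by (intro Hsob_diff fH DH DDH al tr r t0)+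
      have Lle: "Ra * \<bar>x\<bar> \<le> L * dt" if "\<bar>x\<bar> \<le> dt" for x
        using that by (intro mult_mono) (auto simp: L_def)
      have rr: "\<bar>(t + r) - t\<bar> \<le> dt" "\<bar>(t + r) - (t + dt)\<bar> \<le> dt" using r by auto
      have pn: "nr s p \<le> L * dt" "nr s p2 \<le> L * dt"
        using lip(3)[OF tr[OF r] t0] lip(2)[OF tr[OF r] t0] Lle[OF rr(1)] unfolding p_def[abs_def] p2_def[abs_def] by linarith+
      have "nr s p1 \<le> C0 * nr s (\<lambda>x. u (t + r) x - u (t + dt) x)"
        unfolding p1_def[abs_def] al_def by (rule C0(3)[OF uH(1)[OF tr[OF r]] uH(1)[OF t1] uH(2)[OF tr[OF r]] uH(2)[OF t1]])
      also have "\<dots> \<le> C0 * (L * dt)" using lip(1)[OF tr[OF r] t1] Lle[OF rr(2)] C0(1) by (intro mult_left_mono) auto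
      finally have p1n: "nr s p1 \<le> C0 * (L * dt)" .
      have "nr s (\<lambda>x. p1 x * deriv (u (t + r)) x) \<le> A * nr s p1 * nr s (deriv (u (t + r)))" by (rule prod(2)[OF pH(2) DH(1)[OF tr[OF r]]])
      also have "\<dots> \<le> A * (C0 * (L * dt)) * R" using p1n DH(2)[OF tr[OF r]] A C0(1) pos dt0 by (intro mult_mono mult_nonneg_nonneg) auto
      finally have 1: "nr s (\<lambda>x. p1 x * deriv (u (t + r)) x) \<le> A * (C0 * (L * dt)) * R" .
      have "nr s (\<lambda>x. al x * p2 x) \<le> A * nr s al * nr s p2" by (rule prod(2)[OF al(1) pH(3)])
      also have "\<dots> \<le> A * C0 * (L * dt)" using pn(2) al(2) A C0(1) pos dt0 by (intro mult_mono mult_nonneg_nonneg) auto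
      finally have 2: "nr s (\<lambda>x. al x * p2 x) \<le> A * C0 * (L * dt)" .
      note H1 = prod(1)[OF pH(2) DH(1)[OF tr[OF r]]] and H2 = prod(1)[OF al(1) pH(3)]
      have eq: "G' r = (\<lambda>x. \<nu> * p x - (p1 x * deriv (u (t + r)) x + al x * p2 x))"
        by (auto simp: G'_def Q_def p_def p1_def p2_def algebra_simps)
      have "nr s (G' r) \<le> nr s (\<lambda>x. \<nu> * p x) + nr s (\<lambda>x. p1 x * deriv (u (t + r)) x + al x * p2 x)"
        unfolding eq by (rule nr_diff[OF Hsob_cmult[OF pH(1)] Hsob_add[OF H1 H2]])
      also have "nr s (\<lambda>x. \<nu> * p x) \<le> \<nu> * (L * dt)"
        using nr_cmult[OF pH(1), of \<nu>] mult_left_mono[OF pn(1) \<nu>] \<nu> by simp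
      also have "nr s (\<lambda>x. p1 x * deriv (u (t + r)) x + al x * p2 x) \<le> A * (C0 * (L * dt)) * R + A * C0 * (L * dt)"
        using nr_add[OF H1 H2] 1 2 by linarith
      finally show ?thesis by (simp add: K1_def algebra_simps)
    qed
    have Gw: "continuous_on UNIV (\<lambda>x. G dt x - G 0 x)"
      unfolding G_def using HsobD(2)[OF uH(1)[OF t1]] HsobD(2)[OF uH(1)[OF t0]] HsobD(2)[OF QH] by (auto intro!: continuous_intros simp: s_def)
    note M = Hsob_mean_value[OF dt0 GD Gc GH[unfolded s_def] Gn[unfolded s_def] Gw, folded s_def n3_def]
    define T1 where "T1 x = G dt x - G 0 x" for x
    define T2 where "T2 x = V x - u t x - \<nu> * dt * deriv (deriv (u t)) x" for x
    define T3 where "T3 x = V (X1 dt al x) - V x + dt * (al x * deriv V x)" for x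
    define T4 where "T4 x = dt * (al x * (deriv V x - deriv (u t) x))" for x
    have T1: "T1 \<in> Hsob s" "nr s T1 \<le> n3 * K1 * dt\<^sup>2"
      using M by (auto simp: T1_def[abs_def] power2_eq_square algebra_simps)
    have T2H: "T2 \<in> Hsob s" unfolding T2_def[abs_def] by (intro Hsob_diff Hsob_cmult V5 uH DDH t0)
    have "nr s T2 \<le> n3 * (4 * \<nu>\<^sup>2 * dt\<^sup>2 * nr (k + 6) (u t))"
      using Hsob_SV_second[of "u t" "Suc k" \<nu> dt] reg_solD(1)[OF S t0] \<nu> dt0
      by (simp add: T2_def[abs_def] V_def s_def n3_def numeral_eq_Suc)
    also have "\<dots> \<le> n3 * (4 * \<nu>\<^sup>2 * dt\<^sup>2 * R)"
      using reg_solD(2)[OF S t0] pos by (intro mult_left_mono) (auto simp: R_def)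
    finally have T2: "nr s T2 \<le> n3 * (4 * \<nu>\<^sup>2 * R) * dt\<^sup>2" by (simp add: algebra_simps)
    have dV4: "deriv V \<in> Hsob s" unfolding dV s_def by (rule Hsob_SV(1)) (use DH(1)[OF t0] in \<open>simp add: s_def\<close>)
    have T3H: "T3 \<in> Hsob s" unfolding T3_def[abs_def]
      by (intro Hsob_add Hsob_diff Hsob_cmult prod CX[OF adm] V5 al dV4)
    have "nr s T3 \<le> CT * dt\<^sup>2 * nr (k + 5) V" unfolding T3_def[abs_def] by (rule CT(2)[OF adm V5(1)])
    also have "\<dots> \<le> CT * dt\<^sup>2 * R" using Vn CT(1) by (intro mult_left_mono) auto
    finally have T3: "nr s T3 \<le> CT * R * dt\<^sup>2" by (simp add: algebra_simps)
    have eH: "(\<lambda>x. deriv V x - deriv (u t) x) \<in> Hsob s" by (intro Hsob_diff dV4 DH t0)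
    have "nr s (\<lambda>x. deriv V x - deriv (u t) x) \<le> n3 * (2 * \<nu> * dt * nr (k + 4) (deriv (u t)))"
      using Hsob_SV_first[of "deriv (u t)" "Suc k" \<nu> dt] Hsob_mono[OF reg_solD(3)[OF S t0], of "k + 4"] \<nu> dt0
      by (simp add: dV s_def n3_def numeral_eq_Suc)
    also have "\<dots> \<le> n3 * (2 * \<nu> * dt * R)"
      using reg_solD(4)[OF S t0] nr_mono[of "k + 4" "k + 5" "deriv (u t)"] pos \<nu> dt0 by (intro mult_left_mono) (auto simp: R_def)
    finally have en: "nr s (\<lambda>x. deriv V x - deriv (u t) x) \<le> n3 * (2 * \<nu> * dt * R)" .
    note aeH = prod(1)[OF al(1) eH]
    have T4H: "T4 \<in> Hsob s" unfolding T4_def[abs_def] by (rule Hsob_cmult[OF aeH])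
    have "nr s T4 \<le> dt * nr s (\<lambda>x. al x * (deriv V x - deriv (u t) x))"
      unfolding T4_def[abs_def] using nr_cmult[OF aeH, of dt] dt0 by simp
    also have "\<dots> \<le> dt * (A * nr s al * nr s (\<lambda>x. deriv V x - deriv (u t) x))" using prod(2)[OF al(1) eH] dt0 by (intro mult_left_mono) auto
    also have "\<dots> \<le> dt * (A * C0 * (n3 * (2 * \<nu> * dt * R)))"
      using en al(2) A C0(1) dt0 by (intro mult_left_mono mult_mono mult_nonneg_nonneg) auto
    finally have T4: "nr s T4 \<le> A * C0 * (n3 * (2 * \<nu> * R)) * dt\<^sup>2" by (simp add: power2_eq_square algebra_simps)
    \<comment> \<open>The terms of order \<open>dt\<close> cancel by the choice of \<open>Q\<close>.\<close>
    have eq: "\<tau> = (\<lambda>x. (T1 x - T2 x) - (T3 x - T4 x))"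
      by (auto simp: \<tau>_def T1_def T2_def T3_def T4_def G_def Q_def algebra_simps)
    have \<tau>H: "\<tau> \<in> Hsob s" unfolding eq by (intro Hsob_diff T1 T2H T3H T4H)
    have "nr s \<tau> \<le> (nr s T1 + nr s T2) + (nr s T3 + nr s T4)"
      unfolding eq using nr_diff[OF Hsob_diff[OF T1(1) T2H] Hsob_diff[OF T3H T4H]] nr_diff[OF T1(1) T2H] nr_diff[OF T3H T4H] by linarith
    also have "\<dots> \<le> C * dt\<^sup>2" using T1(2) T2 T3 T4 by (simp add: C_def algebra_simps)
    finally show ?thesis using \<tau>H by (simp add: \<tau>_def[abs_def] al_def[abs_def] V_def)
  qed
  show ?thesis using C d main unfolding s_def by blast
qed

section \<open>One step of the scheme\<close>

text \<open>The weight keeps the factor of the first square at \<open>1 + dt\<close>; the factor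
  \<open>2 / dt\<close> falls on quantities of higher order.\<close>

lemma Young_dt:
  assumes "0 < dt" "dt \<le> (1::real)" shows "(a + b)\<^sup>2 \<le> (1 + dt) * a\<^sup>2 + (2 / dt) * b\<^sup>2"
proof -
  have "0 \<le> (dt * a - b)\<^sup>2 / dt" using assms by simp
  also have "\<dots> = dt * a\<^sup>2 - 2 * a * b + b\<^sup>2 / dt" using assms by (simp add: power2_eq_square field_simps)
  finally have 1: "2 * a * b \<le> dt * a\<^sup>2 + b\<^sup>2 / dt" by simp
  have 2: "b\<^sup>2 \<le> b\<^sup>2 / dt" using assms mult_right_mono[of dt 1 "b\<^sup>2"] by (simp add: field_simps)
  have "(a + b)\<^sup>2 = a\<^sup>2 + 2 * a * b + b\<^sup>2" by (simp add: power2_sum)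
  also have "\<dots> \<le> a\<^sup>2 + (dt * a\<^sup>2 + b\<^sup>2 / dt) + b\<^sup>2 / dt" using 1 2 by linarith
  also have "\<dots> = (1 + dt) * a\<^sup>2 + (2 / dt) * b\<^sup>2" by (simp add: algebra_simps)
  finally show ?thesis .
qed

text \<open>The new error is \<open>P + (\<tau> + Sd)\<close>: the averaged old error transported by the numerical
  velocity, the truncation error, and the difference of the averaged exact solution transported by the two
  velocities. The last one contains the new error itself with a factor \<open>\<kappa> dt \<le> 1/2\<close> and is
  absorbed. Only \<open>P\<close> carries no power of \<open>dt\<close>, and its estimates have leading constant one.\<close>

lemma scheme_step:
  assumes F: "Ck (k + 3) f" and \<nu>: "0 \<le> \<nu>" and Rb: "0 \<le> Rb"
  shows "\<exists>C\<ge>0. \<exists>d>0. \<forall>T u t dt uh. reg_sol k f \<nu> T Ra Rb u \<longrightarrow> 0 \<le> t \<longrightarrow> t + dt \<le> T \<longrightarrow> 0 < dt \<longrightarrow> dt \<le> d \<longrightarrow>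
    uh \<in> Hsob (Suc (Suc k)) \<longrightarrow> nr (Suc (Suc k)) uh \<le> R \<longrightarrow>
    (\<exists>!w. is_SA (Suc (Suc k)) f dt (SV \<nu> dt uh) w) \<and>
    SA (Suc (Suc k)) f dt (SV \<nu> dt uh) \<in> Hsob (Suc (Suc k)) \<and>
    (\<forall>j\<in>{0, Suc (Suc k)}. (Hsemi j (\<lambda>x. u (t + dt) x - SA (Suc (Suc k)) f dt (SV \<nu> dt uh) x))\<^sup>2 \<le>
       (Hsemi j (\<lambda>x. u t x - uh x))\<^sup>2 + C * dt * (nr (Suc (Suc k)) (\<lambda>x. u t x - uh x))\<^sup>2 + C * dt ^ 3)"
proof -
  define s where "s = Suc (Suc k)"
  have F': "Ck (Suc (Suc (Suc k))) f" using F by (simp add: numeral_eq_Suc)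
  obtain R1 d1 where R1: "R1 \<ge> 0" "d1 > 0" "\<And>b dt. b \<in> Hsob s \<Longrightarrow> nr s b \<le> R \<Longrightarrow> 0 \<le> dt \<Longrightarrow> dt \<le> d1 \<Longrightarrow>
     (\<exists>!w. is_SA s f dt b w) \<and> is_SA s f dt b (SA s f dt b) \<and> nr s (SA s f dt b) \<le> R1"
    using SA_wellposed[OF F, of R] unfolding s_def by blast
  obtain Ct d2 where Ct: "Ct \<ge> 0" "d2 > 0" "\<And>T u t dt. reg_sol k f \<nu> T Ra Rb u \<Longrightarrow> 0 \<le> t \<Longrightarrow> t + dt \<le> T \<Longrightarrow> 0 < dt \<Longrightarrow> dt \<le> d2 \<Longrightarrow>
    (\<lambda>x. u (t + dt) x - SV \<nu> dt (u t) (X1 dt (\<lambda>x. f (u (t + dt) x)) x)) \<in> Hsob s \<and>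
    nr s (\<lambda>x. u (t + dt) x - SV \<nu> dt (u t) (X1 dt (\<lambda>x. f (u (t + dt) x)) x)) \<le> Ct * dt\<^sup>2"
    using truncation_error[OF F \<nu>, of Ra Rb] unfolding s_def by blast
  define R2 where "R2 = max R1 Rb"
  have R2: "R1 \<le> R2" "Rb \<le> R2" by (auto simp: R2_def)
  obtain C0 where C00: "C0 \<ge> 0"
    and C01: "\<forall>v\<in>Hsob s. nr s v \<le> R2 \<longrightarrow> (\<lambda>x. f (v x)) \<in> Hsob s \<and> nr s (\<lambda>x. f (v x)) \<le> C0"
    and C02: "\<forall>v\<in>Hsob s. \<forall>w\<in>Hsob s. nr s v \<le> R2 \<longrightarrow> nr s w \<le> R2 \<longrightarrow> nr s (\<lambda>x. f (v x) - f (w x)) \<le> C0 * nr s (\<lambda>x. v x - w x)"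
    using Hsob_compose[OF F', of R2, folded s_def] by (elim exE conjE) (rule that)
  note C0 = C00 C01[rule_format] C02[rule_format]
  obtain C3 where C3: "C3 \<ge> 0" "\<And>a dt e. admS k C0 dt a \<Longrightarrow> e \<in> Hsob s \<Longrightarrow>
     (\<lambda>x. e (X1 dt a x)) \<in> Hsob s \<and> nr s (\<lambda>x. e (X1 dt a x)) \<le> C3 * nr s e \<and>
     (L2norm (\<lambda>x. e (X1 dt a x)))\<^sup>2 \<le> (1 + C3 * dt) * (L2norm e)\<^sup>2 \<and>
     (Hsemi s (\<lambda>x. e (X1 dt a x)))\<^sup>2 \<le> (Hsemi s e)\<^sup>2 + C3 * dt * (nr s e)\<^sup>2"
    using Hsob_X1[of k C0] unfolding s_def by blast
  obtain C4 where C4: "C4 \<ge> 0" "\<And>a b dt e. admS k C0 dt a \<Longrightarrow> admS k C0 dt b \<Longrightarrow> e \<in> Hsob (k + 4) \<Longrightarrow>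
     nr s (\<lambda>x. e (X1 dt a x) - e (X1 dt b x)) \<le> C4 * dt * nr s (\<lambda>x. a x - b x) * nr (k + 4) e"
    using Hsob_X1_diff[of k C0] unfolding s_def by blast
  define \<kappa> where "\<kappa> = C4 * C0 * Rb"
  have \<kappa>: "\<kappa> \<ge> 0" using C4(1) C0(1) Rb by (simp add: \<kappa>_def)
  define K where "K = Ct + 2 * \<kappa> * Ct + 2 * \<kappa> * C3"
  have K: "K \<ge> 0" using \<kappa> Ct(1) C3(1) by (simp add: K_def)
  define C where "C = 1 + 2 * C3 + 4 * K\<^sup>2"
  have C: "C \<ge> 0" using C3(1) by (simp add: C_def)
  define d where "d = min (min 1 d1) (min d2 (min (1 / (2 * (C0 + 1))) (1 / (2 * (\<kappa> + 1)))))"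
  have d: "d > 0" using R1(2) Ct(2) C0(1) \<kappa> by (simp add: d_def)
  have main: "(\<exists>!w. is_SA s f dt (SV \<nu> dt uh) w) \<and> SA s f dt (SV \<nu> dt uh) \<in> Hsob s \<and>
    (\<forall>j\<in>{0, s}. (Hsemi j (\<lambda>x. u (t + dt) x - SA s f dt (SV \<nu> dt uh) x))\<^sup>2 \<le>
       (Hsemi j (\<lambda>x. u t x - uh x))\<^sup>2 + C * dt * (nr s (\<lambda>x. u t x - uh x))\<^sup>2 + C * dt ^ 3)"
    if S: "reg_sol k f \<nu> T Ra Rb u" and t: "0 \<le> t" "t + dt \<le> T" and dt: "0 < dt" "dt \<le> d"
      and uh: "uh \<in> Hsob s" "nr s uh \<le> R" for T u t dt uh
  proof -
    have dts: "dt \<le> 1" "dt \<le> d1" "dt \<le> d2" "dt \<le> 1 / (2 * (C0 + 1))" "dt \<le> 1 / (2 * (\<kappa> + 1))" "0 \<le> dt"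
      using dt by (auto simp: d_def)
    have t0: "t \<in> {0..T}" and t1: "t + dt \<in> {0..T}" using t dt by auto
    have uH: "u r \<in> Hsob s" "nr s (u r) \<le> R2" if "r \<in> {0..T}" for r
      using Hsob_mono[OF reg_solD(1)[OF S that], of s] nr_mono[of s "k + 6" "u r"] reg_solD(2)[OF S that] R2 by (auto simp: s_def)
    define b where "b = SV \<nu> dt uh"
    have b: "b \<in> Hsob s" "nr s b \<le> R" using Hsob_SV(1)[of uh "Suc k" \<nu> dt] nr_SV[of uh "Suc k" \<nu> dt] uh by (auto simp: b_def s_def)
    define w where "w = SA s f dt b"
    note W = R1(3)[OF b dts(6,2), folded w_def]
    have w: "w \<in> Hsob s" "nr s w \<le> R2" "\<And>x. w x = b (X1 dt (\<lambda>x. f (w x)) x)"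
    proof -
      show "w \<in> Hsob s" using W by (simp add: is_SA_def)
      show "nr s w \<le> R2" using W R2 by linarith
      have "w = b \<circ> X1 dt (f \<circ> w)" using W by (simp add: is_SA_def)
      from fun_cong[OF this, unfolded comp_def] show "w x = b (X1 dt (\<lambda>x. f (w x)) x)" for x .
    qed
    define al where "al x = f (u (t + dt) x)" for x
    define be where "be x = f (w x)" for x
    have al: "al \<in> Hsob s" "nr s al \<le> C0" using C0(2)[OF uH[OF t1]] by (auto simp: al_def[abs_def])
    have be: "be \<in> Hsob s" "nr s be \<le> C0" using C0(2)[OF w(1,2)] by (auto simp: be_def[abs_def])
    have "dt * C0 \<le> 1/2" by (rule small_product[OF C0(1) dts(4)])
    then have adm: "admS k C0 dt al" "admS k C0 dt be" using al be dts by (auto simp: admS_def s_def)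
    have kd: "\<kappa> * dt \<le> 1/2" using small_product[OF \<kappa> dts(5)] by (simp add: mult.commute)
    define E where "E x = u t x - uh x" for x
    have E: "E \<in> Hsob s" unfolding E_def[abs_def] by (intro Hsob_diff uH t0 uh)
    define V where "V = SV \<nu> dt (u t)"
    have u4: "u t \<in> Hsob (Suc (k + 3))" by (rule Hsob_mono[OF reg_solD(1)[OF S t0]]) simp
    have V4: "V \<in> Hsob (k + 4)" using Hsob_SV(1)[OF u4, of \<nu> dt] by (simp add: V_def numeral_eq_Suc)
    have Vs: "V \<in> Hsob s" by (rule Hsob_mono[OF V4]) (simp add: s_def)
    have Vn: "nr (k + 4) V \<le> Rb"
      using nr_SV[OF u4, of \<nu> dt] nr_mono[of "k + 4" "k + 6" "u t"] reg_solD(2)[OF S t0] by (simp add: V_def numeral_eq_Suc)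
    define \<tau> where "\<tau> x = u (t + dt) x - V (X1 dt al x)" for x
    have \<tau>: "\<tau> \<in> Hsob s" "nr s \<tau> \<le> Ct * dt\<^sup>2"
      using Ct(3)[OF S t dt(1) dts(3)] by (auto simp: \<tau>_def[abs_def] V_def al_def[abs_def])
    define e where "e = SV \<nu> dt E"
    have e: "e \<in> Hsob s" "nr s e \<le> nr s E" "L2norm e \<le> L2norm E" "Hsemi s e \<le> Hsemi s E"
      using Hsob_SV[of E "Suc k"] nr_SV[of E "Suc k" \<nu> dt] L2norm_SV_le[of E "Suc k" \<nu> dt] E by (auto simp: e_def s_def)
    define P where "P x = e (X1 dt be x)" for x
    define Sd where "Sd x = V (X1 dt al x) - V (X1 dt be x)" for x
    define z where "z x = u (t + dt) x - w x" for x
    have P: "P \<in> Hsob s" "nr s P \<le> C3 * nr s e" "(L2norm P)\<^sup>2 \<le> (1 + C3 * dt) * (L2norm e)\<^sup>2" "(Hsemi s P)\<^sup>2 \<le> (Hsemi s e)\<^sup>2 + C3 * dt * (nr s e)\<^sup>2"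
      using C3(2)[OF adm(2) e(1)] by (auto simp: P_def[abs_def])
    have Sd: "Sd \<in> Hsob s" unfolding Sd_def[abs_def] using C3(2)[OF adm(1) Vs] C3(2)[OF adm(2) Vs] by (intro Hsob_diff) auto
    have z: "z \<in> Hsob s" unfolding z_def[abs_def] by (intro Hsob_diff uH t1 w)
    \<comment> \<open>The numerical velocity \<open>be\<close> transports the old error; the mismatch \<open>al - be\<close> acts on the smooth \<open>V\<close> only.\<close>
    have zeq: "z = (\<lambda>x. P x + (\<tau> x + Sd x))"
    proof
      fix x
      have "e y = V y - b y" for y unfolding e_def V_def b_def E_def[abs_def] by (simp add: SV_diff)
      then show "z x = P x + (\<tau> x + Sd x)"
        unfolding z_def P_def \<tau>_def Sd_def using w(3)[of x] by (simp add: be_def[abs_def])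
    qed
    have albe: "nr s (\<lambda>x. al x - be x) \<le> C0 * nr s z"
      using C0(3)[OF uH(1)[OF t1] w(1) uH(2)[OF t1] w(2)] by (simp add: al_def be_def z_def[abs_def])
    have "nr s Sd \<le> C4 * dt * nr s (\<lambda>x. al x - be x) * nr (k + 4) V" unfolding Sd_def[abs_def] by (rule C4(2)[OF adm V4])
    also have "\<dots> \<le> C4 * dt * (C0 * nr s z) * Rb" using albe Vn C4(1) C0(1) dts(6) by (intro mult_mono mult_nonneg_nonneg) auto
    finally have Sdn: "nr s Sd \<le> \<kappa> * dt * nr s z" by (simp add: \<kappa>_def algebra_simps)
    have rH: "(\<lambda>x. \<tau> x + Sd x) \<in> Hsob s" by (rule Hsob_add[OF \<tau>(1) Sd])
    have rn0: "nr s (\<lambda>x. \<tau> x + Sd x) \<le> Ct * dt\<^sup>2 + \<kappa> * dt * nr s z" using nr_add[OF \<tau>(1) Sd] \<tau>(2) Sdn by linarith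
    have Pn: "nr s P \<le> C3 * nr s E" using P(2) mult_left_mono[OF e(2) C3(1)] by linarith
    have "nr s z \<le> C3 * nr s E + (Ct * dt\<^sup>2 + \<kappa> * dt * nr s z)" unfolding zeq using nr_add[OF P(1) rH] Pn rn0 unfolding zeq by linarith
    also have "\<kappa> * dt * nr s z \<le> (1/2) * nr s z" using kd by (intro mult_right_mono) auto
    \<comment> \<open>A crude bound for the new error suffices in the coefficient of \<open>dt\<close>.\<close>
    finally have zn: "nr s z \<le> 2 * C3 * nr s E + 2 * Ct * dt\<^sup>2" by simp
    have d2: "dt\<^sup>2 \<le> 1" "dt * dt\<^sup>2 \<le> dt\<^sup>2" using dts by (auto simp: power_le_one mult_left_le_one_le)
    have "nr s (\<lambda>x. \<tau> x + Sd x) \<le> Ct * dt\<^sup>2 + \<kappa> * dt * (2 * C3 * nr s E + 2 * Ct * dt\<^sup>2)"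
      using rn0 mult_left_mono[OF zn, of "\<kappa> * dt"] \<kappa> dts(6) by simp
    also have "\<dots> = Ct * dt\<^sup>2 + 2 * \<kappa> * C3 * (dt * nr s E) + 2 * \<kappa> * Ct * (dt * dt\<^sup>2)" by (simp add: algebra_simps)
    also have "\<dots> \<le> Ct * dt\<^sup>2 + 2 * \<kappa> * C3 * (dt * nr s E) + 2 * \<kappa> * Ct * dt\<^sup>2"
      using d2 \<kappa> Ct(1) by (intro add_left_mono mult_left_mono) auto
    also have "\<dots> \<le> K * (dt\<^sup>2 + dt * nr s E)"
    proof -
      have "Ct * (dt * nr s E) \<ge> 0" "2 * \<kappa> * Ct * (dt * nr s E) \<ge> 0" "2 * \<kappa> * C3 * dt\<^sup>2 \<ge> 0" using Ct(1) C3(1) \<kappa> dts(6) by auto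
      then show ?thesis by (simp add: K_def algebra_simps)
    qed
    finally have rn: "nr s (\<lambda>x. \<tau> x + Sd x) \<le> K * (dt\<^sup>2 + dt * nr s E)" .
    have rsq: "(2 / dt) * (nr s (\<lambda>x. \<tau> x + Sd x))\<^sup>2 \<le> 4 * K\<^sup>2 * (dt ^ 3 + dt * (nr s E)\<^sup>2)"
    proof -
      have "(nr s (\<lambda>x. \<tau> x + Sd x))\<^sup>2 \<le> (K * (dt\<^sup>2 + dt * nr s E))\<^sup>2" using rn by (intro power_mono) auto
      also have "\<dots> = K\<^sup>2 * (dt\<^sup>2 + dt * nr s E)\<^sup>2" by (simp add: power_mult_distrib)
      also have "(dt\<^sup>2 + dt * nr s E)\<^sup>2 \<le> 2 * ((dt\<^sup>2)\<^sup>2 + (dt * nr s E)\<^sup>2)" 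
        using sum_squares_bound[of "dt\<^sup>2" "dt * nr s E"] by (simp add: power2_sum)
      finally have "(nr s (\<lambda>x. \<tau> x + Sd x))\<^sup>2 \<le> K\<^sup>2 * (2 * ((dt\<^sup>2)\<^sup>2 + (dt * nr s E)\<^sup>2))" by (simp add: mult_left_mono)
      then have "(2 / dt) * (nr s (\<lambda>x. \<tau> x + Sd x))\<^sup>2 \<le> (2 / dt) * (K\<^sup>2 * (2 * ((dt\<^sup>2)\<^sup>2 + (dt * nr s E)\<^sup>2)))"
        using dts(6) by (intro mult_left_mono) auto
      also have "\<dots> = 4 * K\<^sup>2 * (dt ^ 3 + dt * (nr s E)\<^sup>2)"
        using dt(1) by (simp add: field_simps power2_eq_square power3_eq_cube)
      finally show ?thesis .
    qed
    have "(Hsemi j z)\<^sup>2 \<le> (Hsemi j E)\<^sup>2 + C * dt * (nr s E)\<^sup>2 + C * dt ^ 3" if j: "j \<in> {0, s}" for j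
    proof -
      have js: "j \<le> s" using j by auto
      define a where "a = (nr s E)\<^sup>2"
      have Ej: "(Hsemi j E)\<^sup>2 \<le> a" unfolding a_def using Hsemi_le_nr[OF js, of E] by (intro power_mono) auto
      have Pj: "(Hsemi j P)\<^sup>2 \<le> (Hsemi j E)\<^sup>2 + C3 * dt * a"
      proof (cases "j = 0")
        case True
        have "(Hsemi j P)\<^sup>2 \<le> (1 + C3 * dt) * (L2norm e)\<^sup>2" using P(3) True Hsemi_0[OF HsobD(1)[OF P(1)]] by simp
        also have "\<dots> \<le> (1 + C3 * dt) * (L2norm E)\<^sup>2" using e(3) C3(1) dts(6) by (intro mult_left_mono power_mono) auto
        also have "\<dots> = (Hsemi j E)\<^sup>2 + C3 * dt * (Hsemi j E)\<^sup>2" using True Hsemi_0[OF HsobD(1)[OF E]] by (simp add: algebra_simps)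
        also have "\<dots> \<le> (Hsemi j E)\<^sup>2 + C3 * dt * a" using Ej C3(1) dts(6) by (intro add_left_mono mult_left_mono) auto
        finally show ?thesis .
      next
        case False
        then have js: "j = s" using j by simp
        have "(Hsemi s e)\<^sup>2 + C3 * dt * (nr s e)\<^sup>2 \<le> (Hsemi s E)\<^sup>2 + C3 * dt * a"
          unfolding a_def using e C3(1) dts(6) by (intro add_mono mult_left_mono power_mono) auto
        then show ?thesis using P(4) js by simp
      qed
      have "Hsemi j z \<le> Hsemi j P + nr s (\<lambda>x. \<tau> x + Sd x)"
        unfolding zeq using Hsemi_add[OF P(1) rH js] Hsemi_le_nr[OF js, of "\<lambda>x. \<tau> x + Sd x"] by linarith
      then have "(Hsemi j z)\<^sup>2 \<le> (Hsemi j P + nr s (\<lambda>x. \<tau> x + Sd x))\<^sup>2" by (intro power_mono) auto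
      also have "\<dots> \<le> (1 + dt) * (Hsemi j P)\<^sup>2 + (2 / dt) * (nr s (\<lambda>x. \<tau> x + Sd x))\<^sup>2" by (rule Young_dt[OF dt(1) dts(1)])
      also have "\<dots> \<le> (1 + dt) * ((Hsemi j E)\<^sup>2 + C3 * dt * a) + 4 * K\<^sup>2 * (dt ^ 3 + dt * a)"
        using Pj rsq dts(6) unfolding a_def by (intro add_mono mult_left_mono) auto
      also have "\<dots> \<le> (Hsemi j E)\<^sup>2 + dt * a + 2 * (C3 * dt * a) + 4 * K\<^sup>2 * (dt ^ 3 + dt * a)"
      proof -
        have x1: "dt * (Hsemi j E)\<^sup>2 \<le> dt * a" using Ej dts(6) by (rule mult_left_mono)
        have a0: "a \<ge> 0" by (simp add: a_def)
        have x2: "dt * (C3 * dt * a) \<le> 1 * (C3 * dt * a)" using dts C3(1) a0 by (intro mult_right_mono) auto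
        have "(1 + dt) * ((Hsemi j E)\<^sup>2 + C3 * dt * a) = (Hsemi j E)\<^sup>2 + dt * (Hsemi j E)\<^sup>2 + C3 * dt * a + dt * (C3 * dt * a)" by (simp add: algebra_simps)
        then show ?thesis using x1 x2 by linarith
      qed
      also have "\<dots> \<le> (Hsemi j E)\<^sup>2 + C * dt * a + C * dt ^ 3"
      proof -
        have "0 \<le> (1 + 2 * C3) * dt ^ 3" using C3(1) dts(6) by simp
        then show ?thesis by (simp add: C_def algebra_simps)
      qed
      finally show ?thesis by (simp add: a_def)
    qed
    then show ?thesis using W w(1) unfolding w_def b_def z_def[abs_def] E_def[abs_def] by blast
  qed
  show ?thesis using C d main unfolding s_def by blast
qed

section \<open>Convergence of the scheme\<close>

text \<open>(P1) with \<open>w = - z\<close>: the function on its left-hand side is then \<open>z\<close> itself.\<close>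

lemma interpolation_Pythagoras:
  assumes I: "interpolation_operator s xs I" and P: "P1 s I" and z: "z \<in> Hsob s"
  shows "(Hsemi s z)\<^sup>2 = (Hsemi s (\<lambda>x. z x - I z x))\<^sup>2 + (Hsemi s (I z))\<^sup>2"
proof -
  have mz: "(\<lambda>x. - z x) \<in> Hsob s" using Hsob_cmult[OF z, of "-1"] by simp
  have "I (\<lambda>x. (- 1) * z x) = (\<lambda>x. (- 1) * I z x)" using I z unfolding interpolation_operator_def by blast
  then have Im: "I (\<lambda>x. - z x) = (\<lambda>x. - I z x)" by simp
  have "(Hsemi s (\<lambda>x. (z x - I z x) - I (\<lambda>x. - z x) x))\<^sup>2 = (Hsemi s (\<lambda>x. z x - I z x))\<^sup>2 + (Hsemi s (I (\<lambda>x. - z x)))\<^sup>2"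
    using P z mz unfolding P1_def by blast
  moreover have "I z \<in> Hsob s" using I z unfolding interpolation_operator_def by blast
  ultimately show ?thesis unfolding Im using Hsemi_uminus[of "I z" s s] by simp
qed

lemma interpolation_diff:
  assumes I: "interpolation_operator s xs I" and v: "v \<in> Hsob s" and w: "w \<in> Hsob s"
  shows "I (\<lambda>x. v x - w x) = (\<lambda>x. I v x - I w x)"
proof -
  have mw: "(\<lambda>x. (- 1) * w x) \<in> Hsob s" by (rule Hsob_cmult[OF w])
  have "I (\<lambda>x. v x + (- 1) * w x) = (\<lambda>x. I v x + I (\<lambda>x. (- 1) * w x) x)"
    using I[unfolded interpolation_operator_def, THEN conjunct2, THEN conjunct1, rule_format, OF v mw] .
  moreover have "I (\<lambda>x. (- 1) * w x) = (\<lambda>x. (- 1) * I w x)" using I w unfolding interpolation_operator_def by blast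
  ultimately show ?thesis by simp
qed

lemma interpolationD:
  assumes "interpolation_operator s xs I" "v \<in> Hsob s"
  shows "I v \<in> Hsob s" "I (I v) = I v"
  using assms unfolding interpolation_operator_def by blast+

text \<open>(P2) for \<open>z - I z\<close>, which \<open>I\<close> annihilates.\<close>

lemma interpolation_L2_error:
  assumes I: "interpolation_operator s xs I" and P: "P2 s Cs h I" and z: "z \<in> Hsob s"
  shows "L2norm (\<lambda>x. z x - I z x) \<le> Cs * h ^ s * Hsemi s (\<lambda>x. z x - I z x)"
proof -
  note Iz = interpolationD[OF I z]
  define y where "y x = z x - I z x" for x
  have y: "y \<in> Hsob s" unfolding y_def[abs_def] by (rule Hsob_diff[OF z Iz(1)])
  have "I y = (\<lambda>x. 0)" unfolding y_def[abs_def] interpolation_diff[OF I z Iz(1)] Iz(2) by simp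
  then show ?thesis using P y unfolding P2_def y_def[abs_def] by fastforce
qed

text \<open>The weight \<open>\<mu>\<close> is chosen so large that the seminorm, which interpolation decreases,
  compensates the growth of the \<open>L\<^sup>2\<close> norm.\<close>

definition energy :: "real \<Rightarrow> nat \<Rightarrow> (real \<Rightarrow> real) \<Rightarrow> real" where
  "energy \<mu> s v = (L2norm v)\<^sup>2 + \<mu> * (Hsemi s v)\<^sup>2"

lemma energy_nonneg: "0 \<le> \<mu> \<Longrightarrow> 0 \<le> energy \<mu> s v"
  by (simp add: energy_def)

lemma energy_interpolation:
  assumes I: "interpolation_operator s xs I" and P1: "P1 s I" and P2: "P2 s Cs h I" and z: "z \<in> Hsob s"
    and dt: "0 < dt" "dt \<le> 1" and h: "0 \<le> h" "0 \<le> Cs" and C: "h ^ (2 * s) / dt \<le> CD" and lam: "2 * Cs\<^sup>2 * CD \<le> \<mu>"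
  shows "energy \<mu> s (I z) \<le> (1 + dt) * energy \<mu> s z"
proof -
  note Iz = interpolationD[OF I z]
  define y where "y x = z x - I z x" for x
  have y: "y \<in> Hsob s" unfolding y_def[abs_def] by (rule Hsob_diff[OF z Iz(1)])
  define H where "H = Hsemi s y"
  have Ly: "L2norm y \<le> Cs * h ^ s * H" using interpolation_L2_error[OF I P2 z] by (simp add: y_def[abs_def] H_def)
  have CD: "0 \<le> CD" using C h dt by (smt (verit) divide_nonneg_pos zero_le_power)
  have lam0: "0 \<le> \<mu>" using lam CD by (smt (verit) mult_nonneg_nonneg zero_le_power2)
  have "(2 / dt) * (L2norm y)\<^sup>2 \<le> (2 / dt) * (Cs * h ^ s * H)\<^sup>2"
    using Ly dt by (intro mult_left_mono power_mono) auto
  also have "\<dots> = 2 * Cs\<^sup>2 * (h ^ (2 * s) / dt) * H\<^sup>2"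
    by (simp add: power_mult_distrib power_mult[symmetric] mult.commute)
  also have "\<dots> \<le> 2 * Cs\<^sup>2 * CD * H\<^sup>2" using C by (intro mult_right_mono mult_left_mono) auto
  also have "\<dots> \<le> \<mu> * H\<^sup>2" using lam by (intro mult_right_mono) auto
  finally have 1: "(2 / dt) * (L2norm y)\<^sup>2 \<le> \<mu> * H\<^sup>2" .
  have "I z = (\<lambda>x. z x - y x)" by (simp add: y_def)
  then have "L2norm (I z) \<le> L2norm z + L2norm y" using L2norm_triangle_diff[OF HsobD(1)[OF z] HsobD(1)[OF y]] by simp
  then have "(L2norm (I z))\<^sup>2 \<le> (L2norm z + L2norm y)\<^sup>2" by (intro power_mono) auto
  also have "\<dots> \<le> (1 + dt) * (L2norm z)\<^sup>2 + (2 / dt) * (L2norm y)\<^sup>2" by (rule Young_dt[OF dt])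
  finally have 2: "(L2norm (I z))\<^sup>2 \<le> (1 + dt) * (L2norm z)\<^sup>2 + \<mu> * H\<^sup>2" using 1 by linarith
  have "(Hsemi s z)\<^sup>2 = H\<^sup>2 + (Hsemi s (I z))\<^sup>2"
    using interpolation_Pythagoras[OF I P1 z] by (simp add: H_def y_def[abs_def])
  then have 3: "\<mu> * (Hsemi s (I z))\<^sup>2 = \<mu> * (Hsemi s z)\<^sup>2 - \<mu> * H\<^sup>2" by (simp add: algebra_simps)
  have "0 \<le> dt * (\<mu> * (Hsemi s z)\<^sup>2)" using dt lam0 by simp
  then show ?thesis unfolding energy_def using 2 3 by (simp add: algebra_simps)
qed

lemma discrete_Gronwall:
  fixes y :: "nat \<Rightarrow> real"
  assumes "y 0 = 0" "0 \<le> a" "0 \<le> H" "\<And>m. m < n \<Longrightarrow> y (Suc m) \<le> (1 + a) * y m + H"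
  shows "y n \<le> real n * H * exp (real n * a)"
proof -
  have "y m \<le> real m * H * (1 + a) ^ m" if "m \<le> n" for m
    using that
  proof (induction m)
    case (Suc m)
    have "y (Suc m) \<le> (1 + a) * y m + H" using assms(4) Suc.prems by simp
    also have "\<dots> \<le> (1 + a) * (real m * H * (1 + a) ^ m) + H * (1 + a) ^ Suc m"
    proof (intro add_mono mult_left_mono)
      show "y m \<le> real m * H * (1 + a) ^ m" using Suc by simp
      have "1 \<le> (1 + a) ^ Suc m" using assms(2) by (intro one_le_power) auto
      then have "H * 1 \<le> H * (1 + a) ^ Suc m" using assms(3) by (rule mult_left_mono)
      then show "H \<le> H * (1 + a) ^ Suc m" by simp
    qed (use assms in auto)
    also have "\<dots> = real (Suc m) * H * (1 + a) ^ Suc m" by (simp add: algebra_simps)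
    finally show ?case .
  qed (use assms in simp)
  then have "y n \<le> real n * H * (1 + a) ^ n" by simp
  also have "\<dots> \<le> real n * H * exp (real n * a)"
  proof (rule mult_left_mono)
    have "(1 + a) ^ n \<le> (exp a) ^ n" using assms(2) by (intro power_mono) auto
    then show "(1 + a) ^ n \<le> exp (real n * a)" by (simp add: exp_of_nat_mult)
  qed (use assms in auto)
  finally show ?thesis .
qed

lemma sq_sum_le: "(x::real) \<ge> 0 \<Longrightarrow> y \<ge> 0 \<Longrightarrow> z \<ge> 0 \<Longrightarrow> x\<^sup>2 + y\<^sup>2 + z\<^sup>2 \<le> (x + y + z)\<^sup>2"
  by (simp add: power2_eq_square algebra_simps)

text \<open>With \<open>r = dt^(\<epsilon>/2)\<close> the second mesh condition reads
  \<open>h^(q-s) / dt^(1/2) \<le> CD^(1/2) r\<close>; multiplied with the first one it bounds \<open>h^q / dt\<close>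
  by \<open>CD r\<close>. This is where a positive \<open>\<epsilon>\<close> is essential.\<close>

lemma error_small:
  assumes "C > 0" "\<epsilon> > (0::real)" "0 \<le> CD" "s < (q::nat)"
  shows "\<exists>d\<in>{0<..<1}. \<forall>h dt. 0 \<le> h \<longrightarrow> 0 < dt \<longrightarrow> dt < d \<longrightarrow> h ^ (2 * s) / dt \<le> CD \<longrightarrow> h ^ (2 * (q - s)) / dt powr (1 + \<epsilon>) \<le> CD \<longrightarrow>
     C * (dt + h ^ (q - s) / dt powr (1 / 2) + h ^ q / dt) \<le> 1"
proof -
  define g where "g dt = C * (dt + (sqrt CD + CD) * dt powr (\<epsilon> / 2))" for dt
  have "((\<lambda>dt. dt powr (\<epsilon> / 2)) \<longlongrightarrow> 0 powr (\<epsilon> / 2)) (at_right 0)"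
    by (rule tendsto_powr2) (use assms in \<open>auto simp: eventually_at_filter\<close>)
  then have "(g \<longlongrightarrow> C * (0 + (sqrt CD + CD) * 0)) (at_right 0)"
    unfolding g_def[abs_def] by (intro tendsto_intros) auto
  then have "\<forall>\<^sub>F dt in at_right 0. g dt < 1" by (intro order_tendstoD) auto
  then obtain b where b: "b > 0" "\<And>y. 0 < y \<Longrightarrow> y < b \<Longrightarrow> g y < 1" unfolding eventually_at_right_field by blast
  show ?thesis
  proof (intro bexI[of _ "min b (1/2)"] allI impI)
    show "min b (1 / 2) \<in> {0<..<1}" using b(1) by auto
    fix h dt :: real assume h: "0 \<le> h" and dt: "0 < dt" "dt < min b (1 / 2)"
      and a1: "h ^ (2 * s) / dt \<le> CD" and a2: "h ^ (2 * (q - s)) / dt powr (1 + \<epsilon>) \<le> CD"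
    define p where "p = dt powr (1/2)"
    define X where "X = h ^ (q - s)"
    define r where "r = dt powr (\<epsilon> / 2)"
    have p: "p > 0" "p\<^sup>2 = dt" using dt by (auto simp: p_def powr_half_sqrt)
    have r: "r > 0" "r\<^sup>2 = dt powr \<epsilon>" using dt by (auto simp: r_def power2_eq_square powr_add[symmetric])
    have X: "X \<ge> 0" "h ^ (2 * (q - s)) = X\<^sup>2" using h by (auto simp: X_def power_mult[symmetric] mult.commute)
    have "X\<^sup>2 \<le> CD * (dt powr (1 + \<epsilon>))" using a2 dt unfolding X(2) by (simp add: divide_le_eq)
    also have "dt powr (1 + \<epsilon>) = p\<^sup>2 * r\<^sup>2" using dt by (simp add: p r powr_add)
    finally have "X\<^sup>2 \<le> CD * (p * r)\<^sup>2" by (simp add: power_mult_distrib)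
    then have "sqrt (X\<^sup>2) \<le> sqrt (CD * (p * r)\<^sup>2)" by (rule real_sqrt_le_mono)
    then have Xle: "X \<le> sqrt CD * (p * r)" using X p r by (simp add: real_sqrt_mult)
    then have 1: "X / p \<le> sqrt CD * r" using p by (simp add: divide_le_eq algebra_simps)
    have "(h ^ s)\<^sup>2 \<le> CD * p\<^sup>2" using a1 dt by (simp add: divide_le_eq p power_mult[symmetric] mult.commute)
    then have "sqrt ((h ^ s)\<^sup>2) \<le> sqrt (CD * p\<^sup>2)" by (rule real_sqrt_le_mono)
    then have hs: "h ^ s \<le> sqrt CD * p" using h p(1) by (simp only: real_sqrt_mult real_sqrt_abs abs_of_nonneg zero_le_power abs_of_pos)
    have "h ^ q = X * h ^ s" using assms(4) by (simp add: X_def power_add[symmetric])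
    then have "h ^ q / dt = (X / p) * (h ^ s / p)" using p by (simp add: p(2)[symmetric] power2_eq_square)
    also have "\<dots> \<le> (sqrt CD * r) * sqrt CD"
      using 1 hs p X h r assms(3) by (intro mult_mono) (auto simp: divide_le_eq)
    also have "\<dots> = CD * r" using assms(3) by (simp add: algebra_simps)
    finally have 2: "h ^ q / dt \<le> CD * r" .
    have "C * (dt + X / p + h ^ q / dt) \<le> C * (dt + (sqrt CD * r) + CD * r)"
      using 1 2 assms(1) by (intro mult_left_mono add_mono) auto
    also have "\<dots> = g dt" by (simp add: g_def r_def algebra_simps)
    also have "\<dots> < 1" using b(2) dt by simp
    finally show "C * (dt + h ^ (q - s) / dt powr (1 / 2) + h ^ q / dt) \<le> 1" by (simp add: X_def p_def)
  qed
qed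

lemma mesh_nonneg: "is_grid xs \<Longrightarrow> 0 \<le> mesh xs"
proof -
  assume g: "is_grid xs"
  have l: "length xs \<ge> 2" using g by (simp add: is_grid_def)
  have "\<bar>xs ! 1 - xs ! (1 - 1)\<bar> \<le> mesh xs" unfolding mesh_def
    by (intro Max_ge imageI finite_imageI) (use l in auto)
  then show ?thesis by (rule order_trans[rotated]) simp
qed

text \<open>The number \<open>h\<close> is tied to the grid only through (P2) and (P3), which is all the convergence
  proof knows about it.\<close>

definition convergence_rate ::
    "nat \<Rightarrow> nat \<Rightarrow> (real \<Rightarrow> real) \<Rightarrow> real \<Rightarrow> real \<Rightarrow> real \<Rightarrow> real \<Rightarrow> real \<Rightarrow> real \<Rightarrow> (real \<Rightarrow> real) \<Rightarrow> (real \<Rightarrow> real \<Rightarrow> real) \<Rightarrow> real \<Rightarrow> bool" where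
  "convergence_rate s q f \<nu> T Cs Cq CD \<epsilon> u0 u Ce \<longleftrightarrow>
     (\<exists>d\<in>{0<..<1}. \<forall>xs I Nt h dt.
        interpolation_operator s xs I \<longrightarrow> P1 s I \<longrightarrow> P2 s Cs h I \<longrightarrow> P3 s q Cq h I \<longrightarrow>
        0 \<le> h \<longrightarrow> Nt \<ge> 1 \<longrightarrow> dt = T / real Nt \<longrightarrow> dt < d \<longrightarrow>
        h ^ (2 * s) / dt \<le> CD \<longrightarrow> h ^ (2 * (q - s)) / dt powr (1 + \<epsilon>) \<le> CD \<longrightarrow>
        scheme_well_defined s f \<nu> dt I u0 Nt \<and>
        (\<forall>n\<le>Nt. Hnorm_star s (\<lambda>x. u (real n * dt) x - num_sol s f \<nu> dt I u0 n x)
           \<le> Ce * (dt + h ^ (q - s) / dt powr (1 / 2) + h ^ q / dt)))"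

text \<open>Induction over \<open>n\<close> of three statements at once: the numerical solution is defined up to step
  \<open>n\<close>, its discrete error satisfies the Gronwall bound, and hence it lies in the ball of radius
  \<open>R\<close> on which \<open>scheme_step\<close> supplies uniform constants. The norms \<open>a\<close>,
  \<open>b\<close>, \<open>c\<close> of the solution are fixed beforehand because the constant may depend on nothing
  else.\<close>

lemma scheme_convergence:
  fixes T \<nu> Cs Cq CD \<epsilon> a b c :: real
  assumes T: "T > 0" and \<nu>: "\<nu> > 0" and qk: "q > Suc (Suc k)" and F: "Ck (k + 3) f"
    and Cs: "Cs > 0" and Cq: "Cq > 0" and CD: "CD > 0" and \<epsilon>: "\<epsilon> > 0"
  shows "\<exists>Ce>0. \<forall>u0 u. smooth_solution (Suc (Suc k)) q f \<nu> T u0 u \<longrightarrow>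
      Winf_norm 1 T (k + 4) u = a \<longrightarrow> Linf_norm T (k + 6) u = b \<longrightarrow> Linf_norm T q u = c \<longrightarrow>
      convergence_rate (Suc (Suc k)) q f \<nu> T Cs Cq CD \<epsilon> u0 u Ce"
proof -
  define s where "s = Suc (Suc k)"
  define Ra where "Ra = real (k + 5) * a"
  define Rb where "Rb = real (k + 7) * \<bar>b\<bar>"
  define R where "R = Rb + 1"
  have Rb: "0 \<le> Rb" by (simp add: Rb_def)
  have \<nu>0: "0 \<le> \<nu>" using \<nu> by simp
  obtain K d1 where K: "K \<ge> 0" and d1: "d1 > 0" and
    step: "\<forall>T u t dt uh. reg_sol k f \<nu> T Ra Rb u \<longrightarrow> 0 \<le> t \<longrightarrow> t + dt \<le> T \<longrightarrow> 0 < dt \<longrightarrow> dt \<le> d1 \<longrightarrow> uh \<in> Hsob s \<longrightarrow> nr s uh \<le> R \<longrightarrow>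
    (\<exists>!w. is_SA s f dt (SV \<nu> dt uh) w) \<and> SA s f dt (SV \<nu> dt uh) \<in> Hsob s \<and>
    (\<forall>j\<in>{0, s}. (Hsemi j (\<lambda>x. u (t + dt) x - SA s f dt (SV \<nu> dt uh) x))\<^sup>2 \<le>
       (Hsemi j (\<lambda>x. u t x - uh x))\<^sup>2 + K * dt * (nr s (\<lambda>x. u t x - uh x))\<^sup>2 + K * dt ^ 3)"
    using scheme_step[OF F \<nu>0 Rb, of Ra R, folded s_def] by (elim exE conjE) (rule that)
  \<comment> \<open>The summand one makes the energy dominate the square of the seminorm.\<close>
  define \<mu> where "\<mu> = 2 * Cs\<^sup>2 * CD + 1"
  have lam: "1 \<le> \<mu>" "2 * Cs\<^sup>2 * CD \<le> \<mu>" using CD by (auto simp: \<mu>_def)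
  define S where "S = 2 * (real s + 1)\<^sup>2"
  have S: "S \<ge> 0" by (simp add: S_def)
  define K' where "K' = (1 + \<mu>) * K * (S + 1)"
  have K': "K' \<ge> 0" using lam K S by (simp add: K'_def)
  \<comment> \<open>Collects \<open>(1 + dt) (1 + K' dt) (1 + dt)\<close> for \<open>dt \<le> 1\<close>.\<close>
  define K2 where "K2 = 3 + 4 * K'"
  have K2: "K2 \<ge> 0" using K' by (simp add: K2_def)
  define g1 where "g1 = Cq * c"
  define g0 where "g0 = Cs * g1"
  define B where "B = T * (2 * (1 + K') * (2 * g0\<^sup>2 + \<mu> * g1\<^sup>2) + 2 * K') * exp (K2 * T)"
  have B: "B \<ge> 0" using T K' lam by (simp add: B_def)
  define Ce where "Ce = sqrt (2 * B + (2 * g0\<^sup>2 + \<mu> * g1\<^sup>2) + 1)"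
  have Ce1: "2 * B + (2 * g0\<^sup>2 + \<mu> * g1\<^sup>2) + 1 > 0" using B lam by (intro add_nonneg_pos add_nonneg_nonneg) auto
  have Ce: "Ce > 0" "Ce\<^sup>2 = 2 * B + (2 * g0\<^sup>2 + \<mu> * g1\<^sup>2) + 1" using Ce1 by (auto simp: Ce_def)
  define C1 where "C1 = 2 * (real s + 1) * Ce"
  have C1: "C1 > 0" using Ce by (simp add: C1_def)
  obtain d2 where d2: "d2 \<in> {0<..<1}" and small: "\<forall>h dt. 0 \<le> h \<longrightarrow> 0 < dt \<longrightarrow> dt < d2 \<longrightarrow> h ^ (2 * s) / dt \<le> CD \<longrightarrow> h ^ (2 * (q - s)) / dt powr (1 + \<epsilon>) \<le> CD \<longrightarrow>
     C1 * (dt + h ^ (q - s) / dt powr (1 / 2) + h ^ q / dt) \<le> 1"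
    using error_small[OF C1 \<epsilon> less_imp_le[OF CD] qk, folded s_def] by (elim bexE) (rule that)
  define d where "d = min d1 d2"
  have d: "d \<in> {0<..<1}" using d1 d2 by (auto simp: d_def)
  have main: "scheme_well_defined s f \<nu> dt I u0 Nt \<and>
       (\<forall>n\<le>Nt. Hnorm_star s (\<lambda>x. u (real n * dt) x - num_sol s f \<nu> dt I u0 n x) \<le> Ce * (dt + h ^ (q - s) / dt powr (1 / 2) + h ^ q / dt))"
    if sol: "smooth_solution s q f \<nu> T u0 u" and na: "Winf_norm 1 T (k + 4) u = a" and nb: "Linf_norm T (k + 6) u = b" and nc: "Linf_norm T q u = c"
      and I: "interpolation_operator s xs I" and P1: "P1 s I" and P2: "P2 s Cs h I" and P3: "P3 s q Cq h I"
      and h: "0 \<le> h" and Nt: "Nt \<ge> 1" and dtN: "dt = T / real Nt" and dtd: "dt < d"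
      and h1: "h ^ (2 * s) / dt \<le> CD" and h2: "h ^ (2 * (q - s)) / dt powr (1 + \<epsilon>) \<le> CD" for u0 u xs I Nt h dt
  proof -
    have q0: "q > 0" using qk by simp
    note sr = smooth_solution_regular[OF sol[unfolded s_def] T q0]
    have reg: "reg_sol k f \<nu> T Ra Rb u" using sr(1) sr(4) unfolding na nb Ra_def Rb_def by simp
    have c0: "c \<ge> 0" using sr(5) nc by simp
    have g1: "g1 \<ge> 0" "g0 \<ge> 0" using Cq Cs c0 by (auto simp: g1_def g0_def)
    have u0: "u 0 = u0" using sol by (simp add: smooth_solution_def solves_problem_def)
    have "0 < dt" using T Nt by (simp add: dtN)
    then have dt: "0 < dt" "dt \<le> 1" "dt \<le> d1" "dt < d2" using dtd d d2 by (simp_all add: d_def)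
    have NtT: "real Nt * dt = T" using dtN Nt by simp
    have tn: "real n * dt \<in> {0..T}" if "n \<le> Nt" for n
    proof -
      have "real n * dt \<le> real Nt * dt" using that dt by (intro mult_right_mono) auto
      then show ?thesis using NtT dt by simp
    qed
    define X where "X = h ^ (q - s)"
    define Y where "Y = h ^ q"
    \<comment> \<open>The rate of the theorem.\<close>
    define \<omega> where "\<omega> = dt + X / dt powr (1 / 2) + Y / dt"
    have XY: "X \<ge> 0" "Y \<ge> 0" using h by (auto simp: X_def Y_def)
    have om0: "0 \<le> \<omega>" using XY dt by (simp add: \<omega>_def)
    have om2: "dt\<^sup>2 + X\<^sup>2 / dt + Y\<^sup>2 / dt\<^sup>2 \<le> \<omega>\<^sup>2"
    proof -
      have "(dt powr (1/2))\<^sup>2 = dt" using dt by (simp add: powr_half_sqrt)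
      then show ?thesis using sq_sum_le[of dt "X / dt powr (1/2)" "Y / dt"] XY dt by (simp add: \<omega>_def power_divide)
    qed
    have sm: "C1 * \<omega> \<le> 1" unfolding \<omega>_def X_def Y_def using small h dt h1 h2 by blast
    define uh where "uh n = num_sol s f \<nu> dt I u0 n" for n
    define U where "U n = u (real n * dt)" for n
    define e where "e n x = I (U n) x - uh n x" for n x
    define \<eta> where "\<eta> n x = U n x - I (U n) x" for n x
    define E where "E n x = U n x - uh n x" for n x
    \<comment> \<open>The contribution of the interpolation error of the exact solution to the energy.\<close>
    define G where "G = (2 / dt) * (g0 * Y)\<^sup>2 + \<mu> * (g1 * X)\<^sup>2"
    have G0: "G \<ge> 0" using dt lam by (simp add: G_def)
    define H where "H = 2 * (1 + K') * G + 2 * K' * dt ^ 3"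
    have H0: "H \<ge> 0" using K' G0 dt by (simp add: H_def)
    have UH: "U n \<in> Hsob s" "nr s (U n) \<le> Rb" if "n \<le> Nt" for n
      using Hsob_mono[OF reg_solD(1)[OF reg tn[OF that]], of s] nr_mono[of s "k + 6" "U n"] reg_solD(2)[OF reg tn[OF that]]
      by (auto simp: s_def U_def)
    have \<eta>b: "Hsemi s (\<eta> n) \<le> g1 * X" "L2norm (\<eta> n) \<le> g0 * Y" if n: "n \<le> Nt" for n
    proof -
      have Uq: "U n \<in> Hsob q" "Hsemi q (U n) \<le> c" using sr(2)[OF tn[OF n]] nc by (auto simp: U_def)
      have "Hsemi s (\<eta> n) \<le> Cq * h ^ (q - s) * Hsemi q (U n)" using P3 Uq(1) unfolding P3_def \<eta>_def[abs_def] by blast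
      also have "\<dots> \<le> Cq * h ^ (q - s) * c" using Uq(2) Cq h by (intro mult_left_mono) auto
      finally show 1: "Hsemi s (\<eta> n) \<le> g1 * X" by (simp add: g1_def X_def algebra_simps)
      have sq: "s + (q - s) = q" using qk by (simp add: s_def)
      have "h ^ s * X = Y" unfolding X_def Y_def power_add[symmetric] sq ..
      then have hY: "Cs * h ^ s * (g1 * X) = g0 * Y" by (simp add: g0_def algebra_simps)
      have "L2norm (\<eta> n) \<le> Cs * h ^ s * Hsemi s (\<eta> n)" unfolding \<eta>_def[abs_def] by (rule interpolation_L2_error[OF I P2 UH(1)[OF n]])
      also have "\<dots> \<le> Cs * h ^ s * (g1 * X)" using 1 Cs h by (intro mult_left_mono) auto
      also note hY
      finally show "L2norm (\<eta> n) \<le> g0 * Y" .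
    qed
    \<comment> \<open>Orthogonality excludes a mixed term in the seminorm, which would cost a power of \<open>dt\<close>.\<close>
    have EE: "energy \<mu> s (E n) \<le> (1 + dt) * energy \<mu> s (e n) + G"
      if n: "n \<le> Nt" and uH: "uh n \<in> Hsob s" and Iu: "I (uh n) = uh n" for n
    proof -
      note IU = interpolationD[OF I UH(1)[OF n]]
      have eH: "e n \<in> Hsob s" unfolding e_def[abs_def] by (rule Hsob_diff[OF IU(1) uH])
      have Ie: "I (e n) = e n" unfolding e_def[abs_def] interpolation_diff[OF I IU(1) uH] IU(2) Iu ..
      have \<eta>H: "\<eta> n \<in> Hsob s" unfolding \<eta>_def[abs_def] by (rule Hsob_diff[OF UH(1)[OF n] IU(1)])
      have EH: "E n \<in> Hsob s" unfolding E_def[abs_def] by (rule Hsob_diff[OF UH(1)[OF n] uH])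
      have Ee: "E n = (\<lambda>x. \<eta> n x + e n x)" by (auto simp: E_def \<eta>_def e_def)
      have me: "(\<lambda>x. - e n x) \<in> Hsob s" using Hsob_cmult[OF eH, of "-1"] by simp
      have "I (\<lambda>x. (- 1) * e n x) = (\<lambda>x. (- 1) * I (e n) x)" using I eH unfolding interpolation_operator_def by blast
      then have Im: "I (\<lambda>x. - e n x) = (\<lambda>x. - e n x)" by (simp add: Ie)
      have "(Hsemi s (\<lambda>x. (U n x - I (U n) x) - I (\<lambda>x. - e n x) x))\<^sup>2 = (Hsemi s (\<lambda>x. U n x - I (U n) x))\<^sup>2 + (Hsemi s (I (\<lambda>x. - e n x)))\<^sup>2"
        using P1 UH(1)[OF n] me unfolding P1_def by blast
      then have Hs: "(Hsemi s (E n))\<^sup>2 = (Hsemi s (\<eta> n))\<^sup>2 + (Hsemi s (e n))\<^sup>2"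
        unfolding Im using Hsemi_uminus[OF eH order_refl] by (simp add: E_def[abs_def] e_def \<eta>_def[abs_def] Ee)
      have "(L2norm (E n))\<^sup>2 \<le> (L2norm (e n) + L2norm (\<eta> n))\<^sup>2"
        unfolding Ee using L2norm_triangle[OF HsobD(1)[OF \<eta>H] HsobD(1)[OF eH]] by (intro power_mono) auto
      also have "\<dots> \<le> (1 + dt) * (L2norm (e n))\<^sup>2 + (2 / dt) * (L2norm (\<eta> n))\<^sup>2" by (rule Young_dt[OF dt(1,2)])
      also have "(2 / dt) * (L2norm (\<eta> n))\<^sup>2 \<le> (2 / dt) * (g0 * Y)\<^sup>2" using \<eta>b(2)[OF n] dt by (intro mult_left_mono power_mono) auto
      finally have L: "(L2norm (E n))\<^sup>2 \<le> (1 + dt) * (L2norm (e n))\<^sup>2 + (2 / dt) * (g0 * Y)\<^sup>2" by simp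
      have "\<mu> * (Hsemi s (\<eta> n))\<^sup>2 \<le> \<mu> * (g1 * X)\<^sup>2" using \<eta>b(1)[OF n] lam by (intro mult_left_mono power_mono) auto
      moreover have "0 \<le> dt * (\<mu> * (Hsemi s (e n))\<^sup>2)" using dt lam by simp
      ultimately show ?thesis unfolding energy_def G_def using L Hs by (simp add: algebra_simps)
    qed
    have nrE: "nr s v \<le> (real s + 1) * (2 * m)" if v: "v \<in> Hsob s" and m: "energy \<mu> s v \<le> m\<^sup>2" "0 \<le> m" for v m
    proof -
      have "1 * (Hsemi s v)\<^sup>2 \<le> \<mu> * (Hsemi s v)\<^sup>2" using lam by (intro mult_right_mono) auto
      then have sum: "(L2norm v)\<^sup>2 + (Hsemi s v)\<^sup>2 \<le> m\<^sup>2" using m(1) by (simp add: energy_def)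
      have "L2norm v \<le> m" by (rule power2_le_imp_le[OF _ m(2)]) (use sum zero_le_power2[of "Hsemi s v"] in linarith)
      moreover have "Hsemi s v \<le> m" by (rule power2_le_imp_le[OF _ m(2)]) (use sum zero_le_power2[of "L2norm v"] in linarith)
      ultimately have "L2norm v + Hsemi s v \<le> 2 * m" by simp
      then have "(real s + 1) * (L2norm v + Hsemi s v) \<le> (real s + 1) * (2 * m)" by (rule mult_left_mono) simp
      then show ?thesis using nr_le_star[OF v] by linarith
    qed
    have GH: "real n * H * exp (real n * (K2 * dt)) \<le> B * \<omega>\<^sup>2" if n: "n \<le> Nt" for n
    proof -
      have "real n * dt \<le> T" using tn[OF n] by simp
      then have ex: "exp (real n * (K2 * dt)) \<le> exp (K2 * T)" using K2 mult_left_mono[of "real n * dt" T K2] by (simp add: algebra_simps)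
      have nH: "real n * H \<le> T * (H / dt)"
      proof -
        have "real n * H = (real n * dt) * (H / dt)" using dt by simp
        also have "\<dots> \<le> T * (H / dt)" using \<open>real n * dt \<le> T\<close> H0 dt by (intro mult_right_mono) auto
        finally show ?thesis .
      qed
      have "H / dt = 2 * (1 + K') * (2 * g0\<^sup>2 * (Y\<^sup>2 / dt\<^sup>2) + \<mu> * g1\<^sup>2 * (X\<^sup>2 / dt)) + 2 * K' * dt\<^sup>2"
        using dt by (simp add: H_def G_def field_simps power2_eq_square power3_eq_cube)
      also have "\<dots> \<le> 2 * (1 + K') * (2 * g0\<^sup>2 * \<omega>\<^sup>2 + \<mu> * g1\<^sup>2 * \<omega>\<^sup>2) + 2 * K' * \<omega>\<^sup>2"
      proof -
        have nn: "0 \<le> dt\<^sup>2" "0 \<le> X\<^sup>2 / dt" "0 \<le> Y\<^sup>2 / dt\<^sup>2" using dt by auto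
        then have "dt\<^sup>2 \<le> \<omega>\<^sup>2" "X\<^sup>2 / dt \<le> \<omega>\<^sup>2" "Y\<^sup>2 / dt\<^sup>2 \<le> \<omega>\<^sup>2" using om2 by linarith+
        then show ?thesis using K' lam by (intro add_mono mult_left_mono) auto
      qed
      also have "\<dots> = (2 * (1 + K') * (2 * g0\<^sup>2 + \<mu> * g1\<^sup>2) + 2 * K') * \<omega>\<^sup>2" by (simp add: algebra_simps)
      finally have "T * (H / dt) \<le> T * ((2 * (1 + K') * (2 * g0\<^sup>2 + \<mu> * g1\<^sup>2) + 2 * K') * \<omega>\<^sup>2)" using T by (intro mult_left_mono) auto
      then have nH2: "real n * H \<le> T * ((2 * (1 + K') * (2 * g0\<^sup>2 + \<mu> * g1\<^sup>2) + 2 * K') * \<omega>\<^sup>2)" using nH by linarith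
      have "real n * H * exp (real n * (K2 * dt)) \<le> T * ((2 * (1 + K') * (2 * g0\<^sup>2 + \<mu> * g1\<^sup>2) + 2 * K') * \<omega>\<^sup>2) * exp (K2 * T)"
        by (rule mult_mono[OF nH2 ex]) (use T K' lam in \<open>auto intro!: mult_nonneg_nonneg add_nonneg_nonneg\<close>)
      also have "\<dots> = B * \<omega>\<^sup>2" by (simp add: B_def algebra_simps)
      finally show ?thesis .
    qed
    have G\<omega>: "G \<le> (2 * g0\<^sup>2 + \<mu> * g1\<^sup>2) * \<omega>\<^sup>2"
    proof -
      have nn: "0 \<le> dt\<^sup>2" "0 \<le> X\<^sup>2 / dt" "0 \<le> Y\<^sup>2 / dt\<^sup>2" using dt by auto
      have "X\<^sup>2 \<le> X\<^sup>2 / dt" using dt mult_left_mono[OF dt(2), of "X\<^sup>2"] by (simp add: pos_le_divide_eq)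
      then have x: "X\<^sup>2 \<le> \<omega>\<^sup>2" using om2 nn by linarith
      have "Y\<^sup>2 / dt \<le> Y\<^sup>2 / dt\<^sup>2" using dt by (intro divide_left_mono) (auto simp: power2_eq_square mult_left_le)
      then have y: "Y\<^sup>2 / dt \<le> \<omega>\<^sup>2" using om2 nn by linarith
      have "G = 2 * g0\<^sup>2 * (Y\<^sup>2 / dt) + \<mu> * g1\<^sup>2 * X\<^sup>2" by (simp add: G_def power_mult_distrib)
      also have "\<dots> \<le> 2 * g0\<^sup>2 * \<omega>\<^sup>2 + \<mu> * g1\<^sup>2 * \<omega>\<^sup>2" using x y lam by (intro add_mono mult_left_mono) auto
      finally show ?thesis by (simp add: algebra_simps)
    qed
    have Ebound: "energy \<mu> s (E n) \<le> (Ce * \<omega>)\<^sup>2"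
      if n: "n \<le> Nt" and uH: "uh n \<in> Hsob s" "I (uh n) = uh n" and en: "energy \<mu> s (e n) \<le> real n * H * exp (real n * (K2 * dt))" for n
    proof -
      have "energy \<mu> s (E n) \<le> (1 + dt) * energy \<mu> s (e n) + G" by (rule EE[OF n uH])
      also have "\<dots> \<le> 2 * (B * \<omega>\<^sup>2) + (2 * g0\<^sup>2 + \<mu> * g1\<^sup>2) * \<omega>\<^sup>2"
        using en GH[OF n] dt G\<omega> energy_nonneg[of \<mu> s "e n"] lam B by (intro add_mono mult_mono) auto
      also have "\<dots> \<le> (2 * B + (2 * g0\<^sup>2 + \<mu> * g1\<^sup>2) + 1) * \<omega>\<^sup>2" by (simp add: algebra_simps)
      also have "\<dots> = (Ce * \<omega>)\<^sup>2" by (simp add: Ce(2) power_mult_distrib)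
      finally show ?thesis .
    qed
    \<comment> \<open>The error bound is at most one for small \<open>dt\<close>, which closes the a priori bound on the numerical solution.\<close>
    have uhR: "nr s (uh n) \<le> R"
      if n: "n \<le> Nt" and uH: "uh n \<in> Hsob s" "I (uh n) = uh n" and en: "energy \<mu> s (e n) \<le> real n * H * exp (real n * (K2 * dt))" for n
    proof -
      have EH: "E n \<in> Hsob s" unfolding E_def[abs_def] by (rule Hsob_diff[OF UH(1)[OF n] uH(1)])
      have "nr s (E n) \<le> (real s + 1) * (2 * (Ce * \<omega>))"
        by (rule nrE[OF EH Ebound[OF n uH en]]) (use Ce om0 in simp)
      also have "\<dots> = C1 * \<omega>" by (simp add: C1_def)
      also have "\<dots> \<le> 1" by (rule sm)
      finally have "nr s (E n) \<le> 1" .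
      moreover have "uh n = (\<lambda>x. U n x - E n x)" by (simp add: E_def)
      ultimately show ?thesis using nr_diff[OF UH(1)[OF n] EH] UH(2)[OF n] by (simp add: R_def)
    qed
    have one: "(\<exists>!w. is_SA s f dt (SV \<nu> dt (uh n)) w) \<and> uh (Suc n) \<in> Hsob s \<and> I (uh (Suc n)) = uh (Suc n) \<and>
       energy \<mu> s (e (Suc n)) \<le> (1 + K2 * dt) * energy \<mu> s (e n) + H"
      if n: "n < Nt" and uH: "uh n \<in> Hsob s" "I (uh n) = uh n" and R: "nr s (uh n) \<le> R" for n
    proof -
      have t: "0 \<le> real n * dt" "real n * dt + dt \<le> T" using tn[of "Suc n"] n dt by (auto simp: algebra_simps)
      define w where "w = SA s f dt (SV \<nu> dt (uh n))"
      have tS: "real n * dt + dt = real (Suc n) * dt" by (simp add: algebra_simps)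
      have st: "(\<exists>!w. is_SA s f dt (SV \<nu> dt (uh n)) w) \<and> w \<in> Hsob s \<and>
        (\<forall>j\<in>{0, s}. (Hsemi j (\<lambda>x. U (Suc n) x - w x))\<^sup>2 \<le> (Hsemi j (E n))\<^sup>2 + K * dt * (nr s (E n))\<^sup>2 + K * dt ^ 3)"
        using step[rule_format, OF reg t dt(1,3) uH(1) R] unfolding w_def U_def E_def[abs_def] tS by blast
      then have ex: "\<exists>!w. is_SA s f dt (SV \<nu> dt (uh n)) w" and wH: "w \<in> Hsob s" by blast+
      define z where "z x = U (Suc n) x - w x" for x
      have USH: "U (Suc n) \<in> Hsob s" using UH n by simp
      have EH: "E n \<in> Hsob s" unfolding E_def[abs_def] using UH(1)[of n] n uH(1) by (intro Hsob_diff) auto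
      have zH: "z \<in> Hsob s" unfolding z_def[abs_def] by (rule Hsob_diff[OF USH wH])
      have uS: "uh (Suc n) = I w" by (simp add: uh_def w_def)
      have Iw: "I w \<in> Hsob s" "I (I w) = I w" by (rule interpolationD[OF I wH])+
      have eS: "e (Suc n) = I z" unfolding e_def[abs_def] uS z_def[abs_def] interpolation_diff[OF I USH wH] ..
      have z0: "(L2norm z)\<^sup>2 \<le> (L2norm (E n))\<^sup>2 + K * dt * (nr s (E n))\<^sup>2 + K * dt ^ 3"
        using st Hsemi_0[OF HsobD(1)[OF zH]] Hsemi_0[OF HsobD(1)[OF EH]] by (simp add: z_def[abs_def])
      have zs: "(Hsemi s z)\<^sup>2 \<le> (Hsemi s (E n))\<^sup>2 + K * dt * (nr s (E n))\<^sup>2 + K * dt ^ 3"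
        using st by (simp add: z_def[abs_def])
      define N where "N = energy \<mu> s (E n)"
      have N0: "N \<ge> 0" unfolding N_def using lam by (intro energy_nonneg) auto
      have nrN: "(nr s (E n))\<^sup>2 \<le> S * N"
      proof -
        have "(nr s (E n))\<^sup>2 \<le> ((real s + 1) * (L2norm (E n) + Hsemi s (E n)))\<^sup>2"
          using nr_le_star[OF EH] by (intro power_mono) auto
        also have "\<dots> = (real s + 1)\<^sup>2 * (L2norm (E n) + Hsemi s (E n))\<^sup>2" by (simp add: power_mult_distrib)
        also have "\<dots> \<le> (real s + 1)\<^sup>2 * (2 * ((L2norm (E n))\<^sup>2 + (Hsemi s (E n))\<^sup>2))"
          using sum_squares_bound[of "L2norm (E n)" "Hsemi s (E n)"] by (intro mult_left_mono) (auto simp: power2_sum)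
        also have "\<dots> \<le> (real s + 1)\<^sup>2 * (2 * N)"
        proof -
          have "1 * (Hsemi s (E n))\<^sup>2 \<le> \<mu> * (Hsemi s (E n))\<^sup>2" using lam by (intro mult_right_mono) auto
          then show ?thesis unfolding N_def energy_def by (intro mult_left_mono) auto
        qed
        finally show ?thesis by (simp add: S_def)
      qed
      have "energy \<mu> s z \<le> N + (1 + \<mu>) * (K * dt * (nr s (E n))\<^sup>2 + K * dt ^ 3)"
      proof -
        have "\<mu> * (Hsemi s z)\<^sup>2 \<le> \<mu> * ((Hsemi s (E n))\<^sup>2 + K * dt * (nr s (E n))\<^sup>2 + K * dt ^ 3)"
          using zs lam by (intro mult_left_mono) auto
        then show ?thesis unfolding energy_def N_def using z0 by (simp add: algebra_simps)
      qed
      also have "\<dots> \<le> N + (1 + \<mu>) * (K * dt * (S * N) + K * dt ^ 3)"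
        using nrN K dt lam by (intro add_left_mono mult_left_mono add_right_mono) auto
      also have "\<dots> \<le> (1 + K' * dt) * N + K' * dt ^ 3"
      proof -
        have "0 \<le> (1 + \<mu>) * K * dt * N" "0 \<le> (1 + \<mu>) * K * S * dt ^ 3" using K dt lam N0 S by auto
        then show ?thesis by (simp add: K'_def algebra_simps)
      qed
      finally have ez: "energy \<mu> s z \<le> (1 + K' * dt) * N + K' * dt ^ 3" .
      define y where "y = energy \<mu> s (e n)"
      have y0: "y \<ge> 0" unfolding y_def using lam by (intro energy_nonneg) auto
      have Ny: "N \<le> (1 + dt) * y + G" unfolding N_def y_def by (rule EE) (use n uH in auto)
      have "energy \<mu> s (e (Suc n)) \<le> (1 + dt) * energy \<mu> s z"
        unfolding eS by (rule energy_interpolation[OF I P1 P2 zH dt(1,2) h _ h1 lam(2)]) (use Cs in simp)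
      also have "\<dots> \<le> (1 + dt) * ((1 + K' * dt) * ((1 + dt) * y + G) + K' * dt ^ 3)"
        using ez Ny K' dt by (intro mult_left_mono order_trans[OF ez] add_right_mono) auto
      also have "\<dots> \<le> (1 + K2 * dt) * y + H"
      proof -
        have a1: "dt * dt \<le> dt" using dt by (simp add: mult_left_le)
        have "(1 + dt) * (1 + K' * dt) * (1 + dt) \<le> 1 + K2 * dt"
        proof -
          have "(1 + dt) * (1 + dt) \<le> 1 + 3 * dt" using a1 by (simp add: algebra_simps)
          then have "(1 + dt) * (1 + dt) * (1 + K' * dt) \<le> (1 + 3 * dt) * (1 + K' * dt)" using K' dt by (intro mult_right_mono) auto
          also have "\<dots> = 1 + 3 * dt + K' * dt + 3 * (K' * (dt * dt))" by (simp add: algebra_simps)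
          also have "\<dots> \<le> 1 + 3 * dt + K' * dt + 3 * (K' * dt)" using a1 K' by (intro add_left_mono mult_left_mono) auto
          finally show ?thesis by (simp add: K2_def algebra_simps)
        qed
        then have y1: "(1 + dt) * (1 + K' * dt) * (1 + dt) * y \<le> (1 + K2 * dt) * y" using y0 by (rule mult_right_mono)
        have "(1 + dt) * (1 + K' * dt) \<le> 2 * (1 + K')" using K' dt by (intro mult_mono) (auto intro: mult_left_le)
        then have y2: "(1 + dt) * (1 + K' * dt) * G \<le> 2 * (1 + K') * G" using G0 by (rule mult_right_mono)
        have y3: "(1 + dt) * (K' * dt ^ 3) \<le> 2 * (K' * dt ^ 3)" using K' dt by (intro mult_right_mono) auto
        have "(1 + dt) * ((1 + K' * dt) * ((1 + dt) * y + G) + K' * dt ^ 3) = (1 + dt) * (1 + K' * dt) * (1 + dt) * y + (1 + dt) * (1 + K' * dt) * G + (1 + dt) * (K' * dt ^ 3)"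
          by (simp add: algebra_simps)
        then show ?thesis using y1 y2 y3 unfolding H_def by linarith
      qed
      finally show ?thesis using ex Iw unfolding uS y_def by blast
    qed
    have u0H: "u0 \<in> Hsob s" using UH(1)[of 0] by (simp add: U_def u0)
    have "e 0 = (\<lambda>x. 0)" by (simp add: e_def[abs_def] U_def u0 uh_def)
    then have e0: "energy \<mu> s (e 0) = 0"
      using Hsemi_cmult_le[OF u0H order_refl, of 0] Hsemi_nonneg[of s "\<lambda>x. 0"] by (simp add: energy_def)
    have Inv: "uh n \<in> Hsob s \<and> I (uh n) = uh n \<and> energy \<mu> s (e n) \<le> real n * H * exp (real n * (K2 * dt)) \<and>
        (\<forall>m<n. \<exists>!w. is_SA s f dt (SV \<nu> dt (uh m)) w)
        \<and> (\<forall>m<n. energy \<mu> s (e (Suc m)) \<le> (1 + K2 * dt) * energy \<mu> s (e m) + H)" if "n \<le> Nt" for n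
      using that
    proof (induction n)
      case 0
      have "uh 0 = I u0" by (simp add: uh_def)
      then show ?case using interpolationD[OF I u0H] e0 by simp
    next
      case (Suc n)
      then have n: "n \<le> Nt" "n < Nt" by auto
      have IH: "uh n \<in> Hsob s" "I (uh n) = uh n" "energy \<mu> s (e n) \<le> real n * H * exp (real n * (K2 * dt))"
        "\<forall>m<n. \<exists>!w. is_SA s f dt (SV \<nu> dt (uh m)) w" "\<forall>m<n. energy \<mu> s (e (Suc m)) \<le> (1 + K2 * dt) * energy \<mu> s (e m) + H"
        using Suc.IH[OF n(1)] by auto
      note on = one[OF n(2) IH(1,2) uhR[OF n(1) IH(1-3)]]
      have all: "\<forall>m<Suc n. energy \<mu> s (e (Suc m)) \<le> (1 + K2 * dt) * energy \<mu> s (e m) + H"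
        using IH(5) on by (auto simp: less_Suc_eq)
      have "energy \<mu> s (e (Suc n)) \<le> real (Suc n) * H * exp (real (Suc n) * (K2 * dt))"
        by (rule discrete_Gronwall[of "\<lambda>n. energy \<mu> s (e n)"]) (use e0 K2 dt H0 all in auto)
      moreover have "\<forall>m<Suc n. \<exists>!w. is_SA s f dt (SV \<nu> dt (uh m)) w"
        using IH(4) on by (auto simp: less_Suc_eq)
      ultimately show ?case using on all by blast
    qed
    have "scheme_well_defined s f \<nu> dt I u0 Nt"
      using Inv[OF order_refl] unfolding scheme_well_defined_def uh_def by blast
    moreover have "Hnorm_star s (\<lambda>x. u (real n * dt) x - num_sol s f \<nu> dt I u0 n x) \<le> Ce * \<omega>" if n: "n \<le> Nt" for n
    proof -
      have "(L2norm (E n))\<^sup>2 + 1 * (Hsemi s (E n))\<^sup>2 \<le> energy \<mu> s (E n)"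
        unfolding energy_def using lam by (intro add_left_mono mult_right_mono) auto
      also have "\<dots> \<le> (Ce * \<omega>)\<^sup>2" using Ebound[OF n] Inv[OF n] by blast
      finally have "sqrt ((L2norm (E n))\<^sup>2 + (Hsemi s (E n))\<^sup>2) \<le> sqrt ((Ce * \<omega>)\<^sup>2)" by (intro real_sqrt_le_mono) simp
      then show ?thesis using Ce om0 by (simp add: Hnorm_star_def E_def[abs_def] U_def uh_def)
    qed
    ultimately show ?thesis unfolding \<omega>_def X_def Y_def by blast
  qed
  show ?thesis
  proof (intro exI[of _ Ce] conjI allI impI)
    show "Ce > 0" by (rule Ce)
    fix u0 u assume "smooth_solution (Suc (Suc k)) q f \<nu> T u0 u" "Winf_norm 1 T (k + 4) u = a" "Linf_norm T (k + 6) u = b" "Linf_norm T q u = c"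
    note m = main[unfolded s_def, OF this]
    show "convergence_rate (Suc (Suc k)) q f \<nu> T Cs Cq CD \<epsilon> u0 u Ce"
      unfolding convergence_rate_def by (intro bexI[OF _ d] allI impI) (rule m)
  qed
qed

theorem theorem3p2:
  fixes T \<nu> cf Cf Cs Cq C\<Delta>2 \<epsilon> :: real
    and s q :: nat
    and f :: "real \<Rightarrow> real"
    and Ih :: "real list \<Rightarrow> (real \<Rightarrow> real) \<Rightarrow> real \<Rightarrow> real"
  assumes "T > 0" and "\<nu> > 0"
    and "s \<ge> 2" and "q > s"
    and "Ck (s + 1) f"
    and "cf > 0" and "Cf > 0" and "\<forall>y. cf \<le> \<bar>deriv f y\<bar> \<and> \<bar>deriv f y\<bar> \<le> Cf"
    and "Cs > 0" and "Cq > 0"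
    and "\<forall>xs. is_grid xs \<longrightarrow>
           interpolation_operator s xs (Ih xs) \<and>
           P1 s (Ih xs) \<and> P2 s Cs (mesh xs) (Ih xs) \<and> P3 s q Cq (mesh xs) (Ih xs)"
    and "C\<Delta>2 > 0" and "\<epsilon> > 0"
  shows "\<exists>Ce :: real \<Rightarrow> real \<Rightarrow> real \<Rightarrow> real.
    (\<forall>a b c. Ce a b c > 0) \<and>
    (\<forall>u0 u. unique_smooth_solution s q f \<nu> T u0 u \<longrightarrow>
      (\<exists>h0\<in>{0<..<1}. \<exists>dt0\<in>{0<..<1}.
        \<forall>xs Nt h dt.
          is_grid xs \<and> h = mesh xs \<and> Nt \<ge> 1 \<and> dt = T / real Nt \<and>
          h < h0 \<and> dt < dt0 \<and>
          h ^ (2 * s) / dt \<le> C\<Delta>2 \<and>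
          h ^ (2 * (q - s)) / dt powr (1 + \<epsilon>) \<le> C\<Delta>2 \<longrightarrow>
          scheme_well_defined s f \<nu> dt (Ih xs) u0 Nt \<and>
          (\<forall>n\<le>Nt.
             Hnorm_star s (\<lambda>x. u (real n * dt) x - num_sol s f \<nu> dt (Ih xs) u0 n x)
               \<le> Ce (Winf_norm 1 T (s + 2) u) (Linf_norm T (s + 4) u) (Linf_norm T q u)
                   * (dt + h ^ (q - s) / dt powr (1 / 2) + h ^ q / dt))))"
proof -
  define k where "k = s - 2"
  have s: "s = Suc (Suc k)" and s2: "s + 2 = k + 4" "s + 4 = k + 6" "s + 1 = k + 3"
    using assms(3) by (auto simp: k_def)
  have F: "Ck (k + 3) f" using assms(5) unfolding s2 .
  have "\<exists>Ce>0. \<forall>u0 u. smooth_solution s q f \<nu> T u0 u \<longrightarrow>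
      Winf_norm 1 T (s + 2) u = a \<longrightarrow> Linf_norm T (s + 4) u = b \<longrightarrow> Linf_norm T q u = c \<longrightarrow>
      convergence_rate s q f \<nu> T Cs Cq C\<Delta>2 \<epsilon> u0 u Ce" for a b c
  proof -
    have "q > Suc (Suc k)" using assms(4) s by simp
    from scheme_convergence[OF assms(1,2) this F assms(9,10,12,13), of a b c]
    show ?thesis unfolding s2 unfolding s .
  qed
  then obtain Ce where Ce: "\<And>a b c. Ce a b c > 0" and rate: "\<And>a b c u0 u. smooth_solution s q f \<nu> T u0 u \<Longrightarrow>
      Winf_norm 1 T (s + 2) u = a \<Longrightarrow> Linf_norm T (s + 4) u = b \<Longrightarrow> Linf_norm T q u = c \<Longrightarrow>
      convergence_rate s q f \<nu> T Cs Cq C\<Delta>2 \<epsilon> u0 u (Ce a b c)" by metis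
  show ?thesis
  proof (intro exI[of _ Ce] conjI allI impI Ce)
    fix u0 u assume "unique_smooth_solution s q f \<nu> T u0 u"
    then have sol: "smooth_solution s q f \<nu> T u0 u" by (simp add: unique_smooth_solution_def)
    obtain d where d: "d \<in> {0<..<1}" and D: "\<forall>xs I Nt h dt.
        interpolation_operator s xs I \<longrightarrow> P1 s I \<longrightarrow> P2 s Cs h I \<longrightarrow> P3 s q Cq h I \<longrightarrow>
        0 \<le> h \<longrightarrow> Nt \<ge> 1 \<longrightarrow> dt = T / real Nt \<longrightarrow> dt < d \<longrightarrow>
        h ^ (2 * s) / dt \<le> C\<Delta>2 \<longrightarrow> h ^ (2 * (q - s)) / dt powr (1 + \<epsilon>) \<le> C\<Delta>2 \<longrightarrow>
        scheme_well_defined s f \<nu> dt I u0 Nt \<and>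
        (\<forall>n\<le>Nt. Hnorm_star s (\<lambda>x. u (real n * dt) x - num_sol s f \<nu> dt I u0 n x)
           \<le> Ce (Winf_norm 1 T (s + 2) u) (Linf_norm T (s + 4) u) (Linf_norm T q u) * (dt + h ^ (q - s) / dt powr (1 / 2) + h ^ q / dt))"
      using rate[OF sol refl refl refl] unfolding convergence_rate_def by (elim bexE) (rule that)
    show "\<exists>h0\<in>{0<..<1}. \<exists>dt0\<in>{0<..<1}.
        \<forall>xs Nt h dt.
          is_grid xs \<and> h = mesh xs \<and> Nt \<ge> 1 \<and> dt = T / real Nt \<and>
          h < h0 \<and> dt < dt0 \<and>
          h ^ (2 * s) / dt \<le> C\<Delta>2 \<and>
          h ^ (2 * (q - s)) / dt powr (1 + \<epsilon>) \<le> C\<Delta>2 \<longrightarrow>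
          scheme_well_defined s f \<nu> dt (Ih xs) u0 Nt \<and>
          (\<forall>n\<le>Nt.
             Hnorm_star s (\<lambda>x. u (real n * dt) x - num_sol s f \<nu> dt (Ih xs) u0 n x)
               \<le> Ce (Winf_norm 1 T (s + 2) u) (Linf_norm T (s + 4) u) (Linf_norm T q u)
                   * (dt + h ^ (q - s) / dt powr (1 / 2) + h ^ q / dt))"
    \<comment> \<open>The mesh conditions already bound \<open>h\<close> in terms of \<open>dt\<close>, so any bound on \<open>h\<close> will do.\<close>
    proof (rule bexI[of _ "1/2"], rule bexI[OF _ d], intro allI impI, elim conjE)
      fix xs Nt h dt
      assume xs: "is_grid xs" and h: "h = mesh xs"
        and A: "Nt \<ge> 1" "dt = T / real Nt" "dt < d" "h ^ (2 * s) / dt \<le> C\<Delta>2" "h ^ (2 * (q - s)) / dt powr (1 + \<epsilon>) \<le> C\<Delta>2"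
      have I: "interpolation_operator s xs (Ih xs)" "P1 s (Ih xs)" "P2 s Cs h (Ih xs)" "P3 s q Cq h (Ih xs)"
        using assms(11) xs unfolding h by blast+
      have h0: "0 \<le> h" unfolding h by (rule mesh_nonneg[OF xs])
      show "scheme_well_defined s f \<nu> dt (Ih xs) u0 Nt \<and>
          (\<forall>n\<le>Nt.
             Hnorm_star s (\<lambda>x. u (real n * dt) x - num_sol s f \<nu> dt (Ih xs) u0 n x)
               \<le> Ce (Winf_norm 1 T (s + 2) u) (Linf_norm T (s + 4) u) (Linf_norm T q u)
                   * (dt + h ^ (q - s) / dt powr (1 / 2) + h ^ q / dt))"
        by (rule D[rule_format, OF I h0 A])
    qed auto
  qed
qed

end
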